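(* Let $\Gamma=\{a_1,\dots,a_\tau\}$ be a finite collection of translations, regarded as a variable $\mathbf a=(a_1,\dots,a_\tau)\in\mathbb R^{\tau d}$. Let $E^{\mathbf a}$ be the nonautonomous affine set in $\mathbb R^d$ whose translations are elements of $\Gamma$ (see context), with $\Xi_k=\Xi=\{T_1,\dots,T_{n_0}\}$ for all $k>0$, where $n_0\ge2$ and the $T_j$ are nonsingular $d\times d$ matrices. Let $\mu^{\mathbf a}$ be the nonautonomous affine measure with $\mathbf p_k=\mathbf p=(p_1,\dots,p_{n_0})$ for all $k>0$. Suppose that $$\sup\{\|T_j\|:0<j\le n_0\}<\tfrac12.$$ Then for all $q>0$, $d_q^-=d_q^+=d_q$, where $d_q^\pm$ are the critical values defined in the context and $d_q$ is as follows. For $q>1$, $d_q$ is the unique solution to $$\lim_{k\to\infty}\Big(\sum_{\mathbf u\in\Sigma^k}\psi^{d_q}(T_{\mathbf u})^{1-q}p_{\mathbf u}^q\Big)^{1/k}=1;$$ for $q=1$, $d_1$ is the unique solution to $$\lim_{k\to\infty}\frac1k\int\log\big(\psi^{d_1}(T_{\mathbf u|k})^{-1}p_{\mathbf u|k}\big)\,d\mu(\mathbf u)=0;$$ and for $0<q<1$, $d_q$ denotes the common value of $d_q^-$ and $d_q^+$. For $1\le q\le2$, the generalized $q$-dimension $D_q(\mu^{\mathbf a})$ exists and $$D_q(\mu^{\mathbf a})=\min\{d_q,d\}$$ for (Lebesgue) almost all $\mathbf a\in\mathbb R^{\tau d}$.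
   Context: **Words.** Here $n_k=n_0$ for all $k$: $\Sigma^k=\{1,\dots,n_0\}^k$, $\Sigma^0=\{\emptyset\}$, $\Sigma^*=\bigcup_{k\ge0}\Sigma^k$, $\Sigma^\infty=\{1,\dots,n_0\}^{\mathbb N}$. For $\mathbf u=u_1\cdots u_k$ write $\mathbf u^-=u_1\cdots u_{k-1}$; for an infinite word $\mathbf u$, $\mathbf u|k=u_1\cdots u_k$. $\mathcal C_{\mathbf u}\subset\Sigma^\infty$ is the cylinder of infinite words with prefix $\mathbf u$. **Nonautonomous affine set with translations in $\Gamma$.** To each nonempty word $\mathbf u\in\Sigma^*$ is assigned a translation $\omega_{\mathbf u}\in\Gamma$ (one of the variables $a_1,\dots,a_\tau$). For $\mathbf u=u_1\cdots u_k$ put $\Psi_{u_j}(x)=T_{u_j}x+\omega_{u_1\cdots u_j}$ and $J_{\mathbf u}=\Psi_{u_1}\circ\cdots\circ\Psi_{u_k}(J)$, $J_\emptyset=J$, where $J\subset\mathbb R^d$ is a compact set with non-empty interior such that $J_{\mathbf ui}\subset J_{\mathbf u}$ for all $\mathbf u$ and $i$, and $\max_{\mathbf u\in\Sigma^k}|J_{\mathbf u}|\to0$ as $k\to\infty$ ($|\cdot|$ of a set denoting diameter). Then $E^{\mathbf a}=\bigcap_{k\ge1}\bigcup_{\mathbf u\in\Sigma^k}J_{\mathbf u}$, and $\Pi^{\mathbf a}:\Sigma^\infty\to E^{\mathbf a}$ sends $\mathbf u=u_1u_2\cdots$ to the unique point of $\bigcap_kJ_{u_1\cdots u_k}$; equivalently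 $\Pi^{\mathbf a}(\mathbf u)=\omega_{u_1}+T_{u_1}\omega_{u_1u_2}+T_{u_1}T_{u_2}\omega_{u_1u_2u_3}+\cdots$. **Nonautonomous affine measure.** $\mathbf p$ is a probability vector, $\mu$ is the Bernoulli measure on $\Sigma^\infty$ with $\mu(\mathcal C_{\mathbf u})=p_{\mathbf u}=p_{u_1}\cdots p_{u_k}$, and $\mu^{\mathbf a}(A)=\mu\{\mathbf u:\Pi^{\mathbf a}(\mathbf u)\in A\}$. **Generalized $q$-dimensions.** Let $\mathcal M_r$ be the family of $r$-mesh cubes $[j_1r,(j_1+1)r)\times\cdots\times[j_dr,(j_d+1)r)$, $j_i\in\mathbb Z$. For a finite Borel measure $\nu$ on $\mathbb R^d$ and $q\ne1$, $\underline D_q(\nu)$ and $\overline D_q(\nu)$ are the $\liminf$ and $\limsup$ as $r\to0$ of $\frac{\log\sum_{Q\in\mathcal M_r}\nu(Q)^q}{(q-1)\log r}$; $\underline D_1(\nu)$ and $\overline D_1(\nu)$ are the $\liminf$ and $\limsup$ as $r\to0$ of $\frac{\sum_{Q\in\mathcal M_r}\nu(Q)\log\nu(Q)}{\log r}$. If $\underline D_q(\nu)=\overline D_q(\nu)$, $D_q(\nu)$ exists and is the common value. **Singular value function.** For a contracting nonsingular linear $T$ with singular values $1>\alpha_1(T)\ge\cdots\ge\alpha_d(T)>0$: $\psi^s(T)=\alpha_1(T)\cdots\alpha_{m-1}(T)\alpha_m(T)^{s-m+1}$ for $0<s\le d$, where $m$ is the integer with $m-1<s\le m$; $\psi^0(T)=1$;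 and $\psi^s(T)=(\alpha_1(T)\cdots\alpha_d(T))^{s/d}$ for $s>d$. For $\mathbf u=u_1\cdots u_k$, $T_{\mathbf u}=T_{u_1}\cdots T_{u_k}$, with $T_\emptyset=I$. **Critical values.** For $s>0$, $0<r<1$, with $m$ the integer such that $m-1<s\le m$ (and $m=d$ if $s>d$), let $\Sigma^*(s,r)=\{\mathbf u\in\Sigma^*:\alpha_m(T_{\mathbf u})\le r<\alpha_m(T_{\mathbf u^-})\}$. Let $F_q(s,r)=\sum_{\mathbf u\in\Sigma^*(s,r)}\psi^s(T_{\mathbf u})^{1-q}\mu(\mathcal C_{\mathbf u})^q$ for $q\ne1$ and $F_1(s,r)=\sum_{\mathbf u\in\Sigma^*(s,r)}\mu(\mathcal C_{\mathbf u})\log\big(\psi^s(T_{\mathbf u})^{-1}\mu(\mathcal C_{\mathbf u})\big)$. Then - for $q\ge1$: $d_q^-=\sup\{s:\limsup_{r\to0}F_q(s,r)<\infty\}$, $d_q^+=\sup\{s:\liminf_{r\to0}F_q(s,r)<\infty\}$; - for $0<q<1$: $d_q^-=\inf\{s:\liminf_{r\to0}F_q(s,r)<\infty\}$, $d_q^+=\inf\{s:\limsup_{r\to0}F_q(s,r)<\infty\}$. Here $s$ ranges over $s>0$, with $\sup\emptyset=0$, $\inf\emptyset=+\infty$, $0\log0=0$.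
   Formalization: For each word u, the translations ω_{u1},…,ω_{un_0} are required to be distinct variables of Γ; without this the almost-sure formula can fail, e.g. one common translation and T_j multiples of the identity in the plane put E^a in a line while d_2 > 1. *)

theory Defs
  imports "HOL-Probability.Probability"
begin

section \<open>Words\<close>

text \<open>
  The alphabet \<open>{1,\<dots>,n\<^sub>0}\<close> is a finite type \<open>'n\<close>; finite words are lists and infinite words are
  functions \<open>nat \<Rightarrow> 'n\<close>.  Letters of infinite words are numbered from 0, so the prefix \<open>u|k\<close> is
  \<open>u 0 \<dots> u (k - 1)\<close>; \<open>u\<^sup>-\<close> is \<open>butlast u\<close>.
\<close>

definition prefix_word :: "(nat \<Rightarrow> 'n) \<Rightarrow> nat \<Rightarrow> 'n list" where
  "prefix_word u k = map u [0..<k]"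

definition cylinder :: "'n list \<Rightarrow> (nat \<Rightarrow> 'n) set" where
  "cylinder v = {u. prefix_word u (length v) = v}"

definition bernoulli_measure :: "'n pmf \<Rightarrow> (nat \<Rightarrow> 'n) measure" where
  "bernoulli_measure p = (\<Pi>\<^sub>M i\<in>UNIV. measure_pmf p)"

definition word_prob :: "'n pmf \<Rightarrow> 'n list \<Rightarrow> real" where
  "word_prob p u = (\<Prod>i\<leftarrow>u. pmf p i)"

section \<open>Nonautonomous affine sets and measures\<close>

text \<open>
  \<open>w u\<close> is the translation assigned to the nonempty word \<open>u\<close>; the value \<open>w []\<close> is never used.
  The argument of \<open>Psi\<close> is the whole prefix \<open>u\<^sub>1 \<dots> u\<^sub>j\<close>, because the map applied at level \<open>j\<close>
  depends on it through the translation.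
\<close>

definition Psi ::
  "('n \<Rightarrow> real^'d^'d) \<Rightarrow> ('n list \<Rightarrow> real^'d) \<Rightarrow> 'n list \<Rightarrow> real^'d \<Rightarrow> real^'d" where
  "Psi T w u x = T (last u) *v x + w u"

definition word_map ::
  "('n \<Rightarrow> real^'d^'d) \<Rightarrow> ('n list \<Rightarrow> real^'d) \<Rightarrow> 'n list \<Rightarrow> real^'d \<Rightarrow> real^'d" where
  "word_map T w u = foldr (\<lambda>j f. Psi T w (take (Suc j) u) \<circ> f) [0..<length u] id"

definition word_set ::
  "('n \<Rightarrow> real^'d^'d) \<Rightarrow> ('n list \<Rightarrow> real^'d) \<Rightarrow> (real^'d) set \<Rightarrow> 'n list \<Rightarrow> (real^'d) set" where
  "word_set T w J u = word_map T w u ` J"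

definition admissible_seed ::
  "('n::finite \<Rightarrow> real^'d^'d) \<Rightarrow> ('n list \<Rightarrow> real^'d) \<Rightarrow> (real^'d) set \<Rightarrow> bool" where
  "admissible_seed T w J \<longleftrightarrow>
     compact J \<and> interior J \<noteq> {} \<and>
     (\<forall>u i. word_set T w J (u @ [i]) \<subseteq> word_set T w J u) \<and>
     (\<lambda>k. Max ((\<lambda>u. diameter (word_set T w J u)) ` {u. length u = k})) \<longlonglongrightarrow> 0"

definition affine_set ::
  "('n \<Rightarrow> real^'d^'d) \<Rightarrow> ('n list \<Rightarrow> real^'d) \<Rightarrow> (real^'d) set \<Rightarrow> (real^'d) set" where
  "affine_set T w J = (\<Inter>k\<in>{1..}. \<Union>u\<in>{u. length u = k}. word_set T w J u)"

definition coding_map ::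
  "('n \<Rightarrow> real^'d^'d) \<Rightarrow> ('n list \<Rightarrow> real^'d) \<Rightarrow> (real^'d) set \<Rightarrow> (nat \<Rightarrow> 'n) \<Rightarrow> real^'d" where
  "coding_map T w J u = (THE x. x \<in> (\<Inter>k. word_set T w J (prefix_word u k)))"

definition affine_measure ::
  "('n \<Rightarrow> real^'d^'d) \<Rightarrow> 'n pmf \<Rightarrow> ('n list \<Rightarrow> real^'d) \<Rightarrow> (real^'d) set \<Rightarrow> (real^'d) measure" where
  "affine_measure T p w J = distr (bernoulli_measure p) borel (coding_map T w J)"

text \<open>
  The variable assigned to the word \<open>u\<close> is \<open>a $ \<omega> u\<close>.  The maps \<open>x \<mapsto> T i *v x + a $ \<omega> (u @ [i])\<close>
  following a given word \<open>u\<close> are required to carry different variables.  Without this the almost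
  sure dimension formula fails: if \<open>\<omega>\<close> is constant and every \<open>T i\<close> is a multiple of the identity,
  then the affine set lies in a line, although \<open>d\<^sub>q\<close> can exceed 1 (three maps with ratio near 1/2, \<open>d \<ge> 2\<close>).
\<close>

definition distinct_siblings :: "('n list \<Rightarrow> 't) \<Rightarrow> bool" where
  "distinct_siblings \<omega> \<longleftrightarrow> (\<forall>u i j. i \<noteq> j \<longrightarrow> \<omega> (u @ [i]) \<noteq> \<omega> (u @ [j]))"

lemma word_map_Nil [simp]: "word_map T w [] = id"
  by (simp add: word_map_def)

lemma word_map_snoc: "word_map T w (u @ [i]) = word_map T w u \<circ> Psi T w (u @ [i])"
proof -
  have *: "foldr (\<lambda>j f. G j \<circ> f) js h = foldr (\<lambda>j f. G j \<circ> f) js id \<circ> h"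
    for G :: "nat \<Rightarrow> real^'d \<Rightarrow> real^'d" and js h
    by (induction js) (auto simp: comp_assoc)
  have "foldr (\<lambda>j f. Psi T w (take (Suc j) (u @ [i])) \<circ> f) [0..<length u] id
      = foldr (\<lambda>j f. Psi T w (take (Suc j) u) \<circ> f) [0..<length u] id"
    by (rule foldr_cong) auto
  then show ?thesis
    unfolding word_map_def by (simp add: *[of _ _ "Psi T w (u @ [i])"])
qed

lemma continuous_word_map: "continuous_on A (word_map T w u)"
proof (induction u arbitrary: A rule: rev_induct)
  case Nil
  then show ?case by (simp add: id_def continuous_on_id)
next
  case (snoc i u)
  have "continuous_on A (Psi T w (u @ [i]))"
    unfolding Psi_def by (intro continuous_intros)
  then show ?case
    unfolding word_map_snoc by (intro continuous_on_compose snoc.IH)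
qed

lemma finite_words: "finite {u :: 'n::finite list. length u = k}"
  using finite_lists_length_eq[of "UNIV :: 'n set" k] by simp

text \<open>An admissible \<open>J\<close> always exists: a sufficiently large closed ball.\<close>

lemma admissible_seed_exists:
  fixes T :: "'n::finite \<Rightarrow> real^'d^'d"
  assumes "(SUP j. onorm ((*v) (T j))) < 1" and "finite (range w)"
  shows "\<exists>J. admissible_seed T w J"
proof -
  define c where "c = max 0 (SUP j. onorm ((*v) (T j)))"
  have c: "0 \<le> c" "c < 1" using assms(1) by (auto simp: c_def)
  have onle: "onorm ((*v) (T j)) \<le> c" for j
    unfolding c_def by (rule max.coboundedI2) (intro cSUP_upper bdd_above_finite; simp)
  have nT: "norm (T j *v x) \<le> c * norm x" for j x
    by (rule order_trans[OF onorm[OF matrix_vector_mul_bounded_linear]])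
       (intro mult_right_mono onle norm_ge_zero)
  define M where "M = Max (norm ` range w)"
  have M: "norm (w u) \<le> M" for u
    unfolding M_def using assms(2) by (intro Max_ge) auto
  have M0: "0 \<le> M" using M[of "[]"] norm_ge_zero[of "w []"] by linarith
  define R where "R = M / (1 - c) + 1"
  have R: "0 < R" using M0 c by (simp add: R_def add_nonneg_pos)
  have MR: "c * R + M \<le> R"
  proof -
    have "(1 - c) * R = M + (1 - c)" using c by (simp add: R_def field_simps)
    then show ?thesis using c by (simp add: algebra_simps)
  qed
  define J where "J = cball (0 :: real^'d) R"
  have PsiJ: "Psi T w u ` J \<subseteq> J" for u
  proof
    fix y assume "y \<in> Psi T w u ` J"
    then obtain x where x: "norm x \<le> R" "y = T (last u) *v x + w u"
      by (auto simp: J_def Psi_def)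
    have "norm y \<le> c * norm x + M"
      unfolding x(2) using norm_triangle_ineq[of "T (last u) *v x" "w u"] nT[of "last u" x] M[of u]
      by linarith
    also have "\<dots> \<le> c * R + M" using x(1) c by (simp add: mult_left_mono)
    finally show "y \<in> J" using MR by (simp add: J_def)
  qed
  have nest: "word_set T w J (u @ [i]) \<subseteq> word_set T w J u" for u i
    unfolding word_set_def word_map_snoc image_comp[symmetric] by (intro image_mono PsiJ)
  have lip: "dist (word_map T w u x) (word_map T w u y) \<le> c ^ length u * dist x y" for u x y
  proof (induction u arbitrary: x y rule: rev_induct)
    case Nil
    then show ?case by simp
  next
    case (snoc i u)
    have "dist (Psi T w (u @ [i]) x) (Psi T w (u @ [i]) y) \<le> c * dist x y"
      using nT[of i "x - y"] by (simp add: Psi_def dist_norm matrix_vector_mult_diff_distrib)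
    then have "c ^ length u * dist (Psi T w (u @ [i]) x) (Psi T w (u @ [i]) y)
        \<le> c ^ length u * (c * dist x y)"
      using c by (intro mult_left_mono) auto
    with snoc.IH[of "Psi T w (u @ [i]) x" "Psi T w (u @ [i]) y"] show ?case
      by (simp add: word_map_snoc mult_ac)
  qed
  have diam: "diameter (word_set T w J u) \<le> c ^ length u * (2 * R)" for u
  proof (rule diameter_le)
    show "word_set T w J u \<noteq> {} \<or> 0 \<le> c ^ length u * (2 * R)" using c R by auto
    fix x y assume "x \<in> word_set T w J u" "y \<in> word_set T w J u"
    then obtain a b where ab: "norm a \<le> R" "norm b \<le> R"
      "x = word_map T w u a" "y = word_map T w u b"
      by (auto simp: word_set_def J_def)
    have "dist a b \<le> 2 * R" using ab norm_triangle_ineq4[of a b] by (simp add: dist_norm)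
    then have "c ^ length u * dist a b \<le> c ^ length u * (2 * R)"
      using c by (intro mult_left_mono) auto
    then show "norm (x - y) \<le> c ^ length u * (2 * R)"
      using lip[of u a b] by (simp add: ab dist_norm)
  qed
  let ?m = "\<lambda>k. Max ((\<lambda>u. diameter (word_set T w J u)) ` {u. length u = k})"
  have ne: "{u :: 'n list. length u = k} \<noteq> {}" for k
    by (auto intro: exI[of _ "replicate k undefined"])
  have "?m \<longlonglongrightarrow> 0"
  proof (rule tendsto_sandwich[where f = "\<lambda>_. 0" and h = "\<lambda>k. c ^ k * (2 * R)"])
    have "0 \<le> ?m k" for k
    proof -
      have "0 \<le> diameter (word_set T w J (replicate k undefined))"
        by (intro diameter_ge_0 compact_imp_bounded)
           (auto simp: word_set_def J_def intro!: compact_continuous_image continuous_word_map)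
      also have "\<dots> \<le> ?m k" by (intro Max_ge finite_imageI finite_words) auto
      finally show ?thesis .
    qed
    then show "\<forall>\<^sub>F k in sequentially. 0 \<le> ?m k" by simp
    have "?m k \<le> c ^ k * (2 * R)" for k
    proof (rule Max.boundedI)
      fix x assume "x \<in> (\<lambda>u. diameter (word_set T w J u)) ` {u. length u = k}"
      then show "x \<le> c ^ k * (2 * R)" using diam by blast
    qed (use ne[of k] in \<open>auto simp: finite_words\<close>)
    then show "\<forall>\<^sub>F k in sequentially. ?m k \<le> c ^ k * (2 * R)" by simp
    show "(\<lambda>k. c ^ k * (2 * R)) \<longlonglongrightarrow> 0"
      using tendsto_mult_right[OF LIMSEQ_realpow_zero[OF c], of "2 * R"] by simp
  qed simp
  then have "admissible_seed T w J"
    unfolding admissible_seed_def using nest R by (auto simp: J_def)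
  then show ?thesis ..
qed

lemma coding_map_unique:
  fixes T :: "'n::finite \<Rightarrow> real^'d^'d"
  assumes J: "admissible_seed T w J"
  shows "\<exists>!x. x \<in> (\<Inter>k. word_set T w J (prefix_word u k))"
proof -
  let ?S = "\<lambda>k. word_set T w J (prefix_word u k)"
  have comp: "compact (word_set T w J v)" for v
    using J unfolding word_set_def admissible_seed_def
    by (intro compact_continuous_image continuous_word_map) auto
  have ne: "?S k \<noteq> {}" for k
    using J interior_subset[of J] by (auto simp: word_set_def admissible_seed_def)
  have "?S (Suc k) \<subseteq> ?S k" for k
    using J by (simp add: admissible_seed_def prefix_word_def)
  then have dec: "?S n \<subseteq> ?S m" if "m \<le> n" for m n
    using that by (rule lift_Suc_antimono_le)
  have ex: "(\<Inter>k. ?S k) \<noteq> {}"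
    using compact_nest[of ?S] comp ne dec by blast
  have "x = y" if "x \<in> (\<Inter>k. ?S k)" "y \<in> (\<Inter>k. ?S k)" for x y
  proof -
    let ?m = "\<lambda>k. Max ((\<lambda>v. diameter (word_set T w J v)) ` {v. length v = k})"
    have "dist x y \<le> ?m k" for k
    proof -
      have "dist x y \<le> diameter (?S k)"
        using that by (intro diameter_bounded_bound compact_imp_bounded comp) auto
      also have "\<dots> \<le> ?m k"
        by (intro Max_ge finite_imageI finite_words) (auto simp: prefix_word_def)
      finally show ?thesis .
    qed
    moreover have "?m \<longlonglongrightarrow> 0" using J by (simp add: admissible_seed_def)
    ultimately have "dist x y \<le> 0" by (intro LIMSEQ_le_const) auto
    then show ?thesis by simp
  qed
  with ex show ?thesis by blast
qed

lemma coding_map_in_affine_set: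
  fixes T :: "'n::finite \<Rightarrow> real^'d^'d"
  assumes J: "admissible_seed T w J"
  shows "coding_map T w J u \<in> affine_set T w J"
proof -
  have "coding_map T w J u \<in> (\<Inter>k. word_set T w J (prefix_word u k))"
    unfolding coding_map_def by (rule theI'[OF coding_map_unique[OF J]])
  moreover have "length (prefix_word u k) = k" for k by (simp add: prefix_word_def)
  ultimately show ?thesis unfolding affine_set_def by blast
qed

section \<open>Generalized \<open>q\<close>-dimensions\<close>

definition mesh_cubes :: "real \<Rightarrow> (real^'d) set set" where
  "mesh_cubes r = range (\<lambda>j :: int^'d. {x. \<forall>i. of_int (j $ i) * r \<le> x $ i \<and>
                                            x $ i < (of_int (j $ i) + 1) * r})"

definition ln_ereal :: "ereal \<Rightarrow> ereal" where
  "ln_ereal x = (if x = \<infinity> then \<infinity> else if x \<le> 0 then -\<infinity> else ereal (ln (real_of_ereal x)))"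

text \<open>
  The sums over the mesh are taken in \<open>ereal\<close>, so that they have the intended (possibly infinite)
  value for every finite Borel measure: each term is finite, and for \<open>q = 1\<close> only finitely many
  terms are positive.  The convention \<open>0 log 0 = 0\<close> holds in the form \<open>0 * ln 0 = 0\<close>.
\<close>

definition dimension_quotient :: "real \<Rightarrow> (real^'d) measure \<Rightarrow> real \<Rightarrow> ereal" where
  "dimension_quotient q \<nu> r =
     (if q = 1
      then (\<Sum>\<^sub>\<infinity>Q\<in>mesh_cubes r. ereal (measure \<nu> Q * ln (measure \<nu> Q))) / ereal (ln r)
      else ln_ereal (\<Sum>\<^sub>\<infinity>Q\<in>mesh_cubes r. ereal (measure \<nu> Q powr q)) / ereal ((q - 1) * ln r))"

definition lower_gen_dim :: "real \<Rightarrow> (real^'d) measure \<Rightarrow> ereal" where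
  "lower_gen_dim q \<nu> = Liminf (at_right 0) (dimension_quotient q \<nu>)"

definition upper_gen_dim :: "real \<Rightarrow> (real^'d) measure \<Rightarrow> ereal" where
  "upper_gen_dim q \<nu> = Limsup (at_right 0) (dimension_quotient q \<nu>)"

definition gen_dim_exists :: "real \<Rightarrow> (real^'d) measure \<Rightarrow> bool" where
  "gen_dim_exists q \<nu> \<longleftrightarrow> lower_gen_dim q \<nu> = upper_gen_dim q \<nu>"

text \<open>Meaningful only when \<open>gen_dim_exists q \<nu>\<close>.\<close>

definition gen_dim :: "real \<Rightarrow> (real^'d) measure \<Rightarrow> ereal" where
  "gen_dim q \<nu> = lower_gen_dim q \<nu>"

section \<open>Singular values\<close>

text \<open>
  The singular values of \<open>A\<close> are the nonnegative square roots of the eigenvalues of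
  \<open>transpose A ** A\<close>, with multiplicity, in decreasing order; the last clause says that the
  characteristic polynomial of \<open>transpose A ** A\<close> has precisely the roots \<open>x\<^sup>2\<close>.
\<close>

definition singular_values :: "real^'d^'d \<Rightarrow> real list" where
  "singular_values A = (THE xs. length xs = CARD('d) \<and> sorted_wrt (\<ge>) xs \<and> (\<forall>x\<in>set xs. 0 \<le> x) \<and>
     (\<forall>t. det (mat t - transpose A ** A) = (\<Prod>x\<leftarrow>xs. t - x\<^sup>2)))"

text \<open>Indexed from 1: \<open>sing_val A 1 \<ge> \<dots> \<ge> sing_val A CARD('d)\<close>.\<close>

definition sing_val :: "real^'d^'d \<Rightarrow> nat \<Rightarrow> real" where
  "sing_val A i = singular_values A ! (i - 1)"

text \<open>For \<open>0 < s \<le> d\<close> the integer \<open>m\<close> with \<open>m - 1 < s \<le> m\<close> is \<open>\<lceil>s\<rceil>\<close>.\<close>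

definition sv_fun :: "real \<Rightarrow> real^'d^'d \<Rightarrow> real" where
  "sv_fun s A =
     (if s = 0 then 1
      else if s \<le> CARD('d)
      then let m = nat \<lceil>s\<rceil> in (\<Prod>i\<in>{1..<m}. sing_val A i) * sing_val A m powr (s - real m + 1)
      else (\<Prod>i\<in>{1..CARD('d)}. sing_val A i) powr (s / CARD('d)))"

section \<open>Critical values\<close>

definition word_matrix :: "('n \<Rightarrow> real^'d^'d) \<Rightarrow> 'n list \<Rightarrow> real^'d^'d" where
  "word_matrix T u = foldr (\<lambda>i A. T i ** A) u (mat 1)"

definition cut_set :: "('n \<Rightarrow> real^'d^'d) \<Rightarrow> real \<Rightarrow> real \<Rightarrow> 'n list set" where
  "cut_set T s r =
     (let m = (if s > CARD('d) then CARD('d) else nat \<lceil>s\<rceil>)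
      in {u. u \<noteq> [] \<and> sing_val (word_matrix T u) m \<le> r \<and> r < sing_val (word_matrix T (butlast u)) m})"

text \<open>The set \<open>cut_set T s r\<close> is finite when the \<open>T j\<close> are contractions and \<open>s, r > 0\<close>.\<close>

definition F_sum :: "('n::finite \<Rightarrow> real^'d^'d) \<Rightarrow> 'n pmf \<Rightarrow> real \<Rightarrow> real \<Rightarrow> real \<Rightarrow> real" where
  "F_sum T p q s r =
     (let \<mu> = (\<lambda>u. measure (bernoulli_measure p) (cylinder u)); \<psi> = (\<lambda>u. sv_fun s (word_matrix T u))
      in if q = 1
         then (\<Sum>u\<in>cut_set T s r. \<mu> u * ln (inverse (\<psi> u) * \<mu> u))
         else (\<Sum>u\<in>cut_set T s r. \<psi> u powr (1 - q) * \<mu> u powr q))"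

text \<open>
  The element 0 inserted below implements \<open>sup {} = 0\<close>; in \<open>ereal\<close> one has \<open>Inf {} = \<infinity>\<close>.
\<close>

definition crit_lower :: "('n::finite \<Rightarrow> real^'d^'d) \<Rightarrow> 'n pmf \<Rightarrow> real \<Rightarrow> ereal" where
  "crit_lower T p q =
     (if q \<ge> 1
      then Sup (insert 0 (ereal ` {s. 0 < s \<and> Limsup (at_right 0) (\<lambda>r. ereal (F_sum T p q s r)) < \<infinity>}))
      else Inf (ereal ` {s. 0 < s \<and> Liminf (at_right 0) (\<lambda>r. ereal (F_sum T p q s r)) < \<infinity>}))"

definition crit_upper :: "('n::finite \<Rightarrow> real^'d^'d) \<Rightarrow> 'n pmf \<Rightarrow> real \<Rightarrow> ereal" where
  "crit_upper T p q =
     (if q \<ge> 1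
      then Sup (insert 0 (ereal ` {s. 0 < s \<and> Liminf (at_right 0) (\<lambda>r. ereal (F_sum T p q s r)) < \<infinity>}))
      else Inf (ereal ` {s. 0 < s \<and> Limsup (at_right 0) (\<lambda>r. ereal (F_sum T p q s r)) < \<infinity>}))"

text \<open>
  The equation whose unique solution is \<open>d\<^sub>q\<close>, for \<open>q \<ge> 1\<close>.  The unknown ranges over the domain
  \<open>s \<ge> 0\<close> of the singular value function; \<open>s = 0\<close> occurs as the solution if \<open>p\<close> is a point mass.
\<close>

definition crit_equation :: "('n::finite \<Rightarrow> real^'d^'d) \<Rightarrow> 'n pmf \<Rightarrow> real \<Rightarrow> real \<Rightarrow> bool" where
  "crit_equation T p q s \<longleftrightarrow> 0 \<le> s \<and>
     (if q = 1
      then (\<lambda>k. 1 / real k * (\<integral>u. ln (inverse (sv_fun s (word_matrix T (prefix_word u k)))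
                * word_prob p (prefix_word u k)) \<partial>bernoulli_measure p)) \<longlonglongrightarrow> 0
      else (\<lambda>k. (\<Sum>u\<in>{u. length u = k}. sv_fun s (word_matrix T u) powr (1 - q) * word_prob p u powr q)
                powr (1 / real k)) \<longlonglongrightarrow> 1)"

text \<open>
  For \<open>0 < q < 1\<close>, \<open>d\<^sub>q\<close> denotes the common value of the two critical values, so it is taken to be
  the lower one; it is meaningful only together with the equality of the two.
\<close>

definition crit_dim :: "('n::finite \<Rightarrow> real^'d^'d) \<Rightarrow> 'n pmf \<Rightarrow> real \<Rightarrow> ereal" where
  "crit_dim T p q = (if q \<ge> 1 then ereal (THE s. crit_equation T p q s) else crit_lower T p q)"

end

theory Submission imports Defs begin

text \<open>
  The sums of \<open>\<psi>\<^sup>s(T\<^sub>u)\<^sup>1\<^sup>-\<^sup>q p\<^sub>u\<^sup>q\<close> over the words \<open>u\<close> of length \<open>k\<close> are super- or submultiplicative in \<open>k\<close> up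
  to a constant factor, so they grow at an exponential rate; divided by \<open>q - 1\<close>, the rate is a continuous,
  strictly increasing function \<open>\<gamma> q\<close> of \<open>s\<close>. Its zero is \<open>d\<^sub>q\<close>: on the two sides of it the sums over
  \<open>\<Sigma>\<^sup>*(s, r)\<close> stay bounded, respectively diverge, as \<open>r\<close> tends to 0.

  Upper bound: for \<open>u \<in> \<Sigma>\<^sup>*(s, r)\<close> the set \<open>J\<^sub>u\<close> meets at most a constant times \<open>\<psi>\<^sup>s(T\<^sub>u) r\<^sup>-\<^sup>s\<close> cubes of the
  \<open>r\<close>-mesh, and by convexity its contribution to the mesh sum is smallest if its mass is spread evenly over them.

  Lower bound: as the norms are below 1/2, two words that separate after the prefix \<open>u\<close> code points at distance
  at most \<open>r\<close> only for a bounded set of parameters of measure at most a constant times \<open>r\<^sup>s / \<psi>\<^sup>s(T\<^sub>u)\<close>.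
  Integrating the \<open>(q - 1)\<close>-th power of the measure of a ball of radius \<open>r\<close> over its center and over the
  parameters therefore bounds the mesh sums by sums over words; \<open>q \<le> 2\<close> makes this power subadditive.
  For \<open>q = 1\<close> the centers are first restricted to a set of words with typical growth, of measure close to 1.
  Borel-Cantelli along \<open>r = 2\<^sup>-\<^sup>n\<close> gives the estimates for almost every parameter.
\<close>

text \<open>Only exponential rates matter, so psi^s need be submultiplicative only up to a constant;
  this comes from comparing volumes of thickened ellipsoids, without exterior powers. With
  \<open>X s u\<close> the logarithm of p_u / psi^s(T_u), the means \<open>gmean\<close>
  (logarithmic exponential moments, plain means at q = 1) are monotone and additive over independent
  blocks for every q; this makes one rate function serve q > 1, q = 1 and q < 1. At q = 1 the terms
  have both signs, so cut sums cannot be dominated by the sum over all words; long words are split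
  at the cut instead. Typical growth is obtained from exponential moments for q slightly below 1, in
  place of a subadditive ergodic theorem. The coding map equals a series linear in the parameters
  and independent of \<open>J\<close>, so differences of coded points are linear images of the
  parameters, and transversality becomes a volume estimate for linear preimages of balls. The
  estimates are made at an s strictly on one side of d_q; the gap pays for constants, polynomial
  factors and Borel-Cantelli.\<close>

section \<open>Spectral theorem and singular value decomposition\<close>

lemma quadratic_nonpos_linear_coeff:
  fixes b c :: real
  assumes "\<And>t. 2 * t * b + t\<^sup>2 * c \<le> 0"
  shows "b = 0"
proof (rule ccontr)
  assume "b \<noteq> 0"
  \<comment> \<open>This t has the sign of b and is so small that the linear term outweighs the
    quadratic one.\<close>
  define t where "t = b / (\<bar>c\<bar> + 1)"
  have "t * (\<bar>c\<bar> + 1) = b" by (simp add: t_def)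
  have "t \<noteq> 0" using \<open>b \<noteq> 0\<close> by (simp add: t_def)
  have "2 * t * b + t\<^sup>2 * c = t\<^sup>2 * (2 * (\<bar>c\<bar> + 1) + c)"
    using \<open>t * (\<bar>c\<bar> + 1) = b\<close> by (auto simp: power2_eq_square algebra_simps)
  moreover have "t\<^sup>2 * (2 * (\<bar>c\<bar> + 1) + c) > 0"
    using \<open>t \<noteq> 0\<close> by (intro mult_pos_pos) auto
  ultimately show False using assms[of t] by simp
qed

text \<open>A maximizer v of the Rayleigh quotient on the unit sphere of S is an eigenvector: along
  v + t w with w in S the defect of the maximality inequality is a nonpositive quadratic in t
  without constant term, so its linear coefficient, the inner product of f v - l v with w, vanishes.
  As f v - l v lies in S itself, it is 0.\<close>

lemma selfadjoint_max_eigenvector: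
  fixes f :: "'a::euclidean_space \<Rightarrow> 'a"
  assumes lin: "linear f" and sym: "\<And>x y. f x \<bullet> y = x \<bullet> f y"
    and S: "subspace S" "S \<noteq> {0}" and inv: "f ` S \<subseteq> S"
  obtains v l where "v \<in> S" "norm v = 1" "f v = l *\<^sub>R v" "\<And>x. x \<in> S \<Longrightarrow> f x \<bullet> x \<le> l * (norm x)\<^sup>2"
proof -
  have "compact (S \<inter> sphere 0 1)"
    by (intro closed_Int_compact closed_subspace S compact_sphere)
  moreover obtain w where w: "w \<in> S" "w \<noteq> 0" using S subspace_0[OF S(1)] by blast
  then have "w /\<^sub>R norm w \<in> S \<inter> sphere 0 1" using S by (simp add: subspace_scale)
  then have "S \<inter> sphere 0 1 \<noteq> {}" by blast
  moreover have "continuous_on (S \<inter> sphere 0 1) (\<lambda>x. f x \<bullet> x)"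
    by (intro continuous_intros linear_continuous_on linear_conv_bounded_linear[THEN iffD1] lin)
  ultimately have "\<exists>v\<in>S \<inter> sphere 0 1. \<forall>x\<in>S \<inter> sphere 0 1. f x \<bullet> x \<le> f v \<bullet> v"
    by (rule continuous_attains_sup)
  then obtain v where v: "v \<in> S \<inter> sphere 0 1" and
    vmax: "\<And>x. x \<in> S \<inter> sphere 0 1 \<Longrightarrow> f x \<bullet> x \<le> f v \<bullet> v" by auto
  define l where "l = f v \<bullet> v"
  have le: "f x \<bullet> x \<le> l * (norm x)\<^sup>2" if "x \<in> S" for x
  proof (cases "x = 0")
    case True
    then show ?thesis by (simp add: linear_0[OF lin])
  next
    case False
    have "x /\<^sub>R norm x \<in> S \<inter> sphere 0 1" using that S False by (simp add: subspace_scale)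
    from vmax[OF this] have "(f x \<bullet> x) / (norm x)\<^sup>2 \<le> l"
      by (simp add: linear_cmul[OF lin] l_def power2_eq_square divide_inverse mult_ac)
    then show ?thesis using False by (simp add: field_simps)
  qed
  have vn: "v \<bullet> v = 1" "norm v = 1" using v by (auto simp: norm_eq_1)
  have "(f v - l *\<^sub>R v) \<bullet> w = 0" if w: "w \<in> S" for w
  proof (rule quadratic_nonpos_linear_coeff)
    fix t :: real
    have "v + t *\<^sub>R w \<in> S" using v w S by (simp add: subspace_add subspace_scale)
    from le[OF this] have A: "f (v + t *\<^sub>R w) \<bullet> (v + t *\<^sub>R w) \<le> l * ((v + t *\<^sub>R w) \<bullet> (v + t *\<^sub>R w))"
      by (simp add: power2_norm_eq_inner)
    have B: "f (v + t *\<^sub>R w) \<bullet> (v + t *\<^sub>R w)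
        = l + 2 * t * (f v \<bullet> w) + t\<^sup>2 * (f w \<bullet> w)"
      using sym[of w v] by (simp add: linear_add[OF lin] linear_cmul[OF lin] inner_add_left
        inner_add_right l_def power2_eq_square inner_commute algebra_simps)
    have C: "(v + t *\<^sub>R w) \<bullet> (v + t *\<^sub>R w) = 1 + 2 * t * (v \<bullet> w) + t\<^sup>2 * (w \<bullet> w)"
      using vn by (simp add: inner_add_left inner_add_right power2_eq_square inner_commute algebra_simps)
    from A[unfolded B C] show "2 * t * ((f v - l *\<^sub>R v) \<bullet> w) + t\<^sup>2 * (f w \<bullet> w - l * (w \<bullet> w)) \<le> 0"
      by (simp add: algebra_simps inner_diff_left)
  qed
  moreover have "f v - l *\<^sub>R v \<in> S" using v inv S by (auto simp: subspace_diff subspace_scale)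
  ultimately have "f v = l *\<^sub>R v" by (metis inner_eq_zero_iff eq_iff_diff_eq_0)
  then show thesis using that[of v l] v vn le by auto
qed

text \<open>Induction on the dimension: split off a maximal eigenvector and pass to its orthogonal
  complement in S, which f leaves invariant by self-adjointness. The maximality on S puts the
  eigenvalues in decreasing order.\<close>

lemma selfadjoint_eigenbasis:
  fixes f :: "'a::euclidean_space \<Rightarrow> 'a"
  assumes lin: "linear f" and sym: "\<And>x y. f x \<bullet> y = x \<bullet> f y"
  shows "subspace S \<Longrightarrow> f ` S \<subseteq> S \<Longrightarrow> dim S = n \<Longrightarrow>
    \<exists>v l. (\<forall>i<n. v i \<in> S \<and> f (v i) = l i *\<^sub>R v i) \<and>
      (\<forall>i<n. \<forall>j<n. v i \<bullet> v j = (if i = j then 1 else 0)) \<and>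
      (\<forall>i<n. \<forall>j<n. i \<le> j \<longrightarrow> l j \<le> (l i :: real))"
proof (induction n arbitrary: S)
  case 0
  then show ?case by auto
next
  case (Suc n)
  then have "S \<noteq> {0}" by auto
  then obtain v l where v: "v \<in> S" "norm v = 1" "f v = l *\<^sub>R v"
    and le: "\<And>x. x \<in> S \<Longrightarrow> f x \<bullet> x \<le> l * (norm x)\<^sup>2"
    using selfadjoint_max_eigenvector[OF lin sym Suc.prems(1) _ Suc.prems(2)] by metis
  define S' where "S' = {x \<in> S. orthogonal v x}"
  have S'_eq: "S' = {x. orthogonal v x} \<inter> S" by (auto simp: S'_def)
  have sub: "subspace S'" unfolding S'_eq
    by (intro subspace_inter Suc.prems subspace_orthogonal_to_vector)
  have inv: "f ` S' \<subseteq> S'"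
  proof
    fix y assume "y \<in> f ` S'"
    then obtain x where x: "x \<in> S" "v \<bullet> x = 0" "y = f x" by (auto simp: S'_def orthogonal_def)
    then have "v \<bullet> y = 0" using sym[of v x] v by simp
    then show "y \<in> S'" using x Suc.prems by (auto simp: S'_def orthogonal_def)
  qed
  have "dim {y \<in> S. \<forall>x \<in> span {v}. orthogonal x y} + dim (span {v}) = dim S"
    using Suc.prems(1) v by (intro dim_subspace_orthogonal_to_vectors span_minimal) auto
  moreover have "v \<noteq> 0" using v by auto
  moreover have "{y \<in> S. \<forall>x \<in> span {v}. orthogonal x y} = S'"
    by (auto simp: S'_def span_singleton orthogonal_def)
  ultimately have "dim S' = n" using Suc.prems(3) by simp
  from Suc.IH[OF sub inv this] obtain w k where
    w1: "\<forall>i<n. w i \<in> S' \<and> f (w i) = k i *\<^sub>R w i" and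
    w2: "\<forall>i<n. \<forall>j<n. w i \<bullet> w j = (if i = j then 1 else 0)" and
    w3: "\<forall>i<n. \<forall>j<n. i \<le> j \<longrightarrow> k j \<le> (k i :: real)" by (elim exE conjE)
  have kl: "k i \<le> l" if "i < n" for i
    using le[of "w i"] w1[rule_format, OF that] w2[rule_format, OF that that] by (simp add: S'_def power2_norm_eq_inner)
  have vw: "v \<bullet> w i = 0" "w i \<bullet> v = 0" if "i < n" for i
    using w1[rule_format, OF that] by (auto simp: S'_def orthogonal_def inner_commute)
  have vv: "v \<bullet> v = 1" using v by (simp add: norm_eq_1)
  show ?case
    by (rule exI[of _ "case_nat v w"], rule exI[of _ "case_nat l k"])
      (use v w1 w2 w3 kl vw vv in \<open>auto simp: S'_def split: nat.split\<close>)
qed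

text \<open>This makes the definite description in \<open>singular_values\<close> well defined. The
  heads of two sorted lists with the same roots agree; cancel their common factor and recurse on the
  tails.\<close>

lemma prod_list_roots_unique:
  fixes xs ys :: "real list"
  assumes "length xs = length ys" "sorted_wrt (\<ge>) xs" "sorted_wrt (\<ge>) ys"
    "\<forall>x\<in>set xs. 0 \<le> x" "\<forall>x\<in>set ys. 0 \<le> x"
    "\<And>t. (\<Prod>x\<leftarrow>xs. t - x\<^sup>2) = (\<Prod>x\<leftarrow>ys. t - x\<^sup>2)"
  shows "xs = ys"
  using assms
proof (induction xs arbitrary: ys)
  case Nil
  then show ?case by simp
next
  case (Cons x xs zs)
  then obtain y ys where zs: "zs = y # ys" by (cases zs) auto
  have root: "(\<Prod>z\<leftarrow>as. t - z\<^sup>2) = 0 \<longleftrightarrow> (\<exists>z\<in>set as. t = z\<^sup>2)" for t :: real and as :: "real list"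
    by (induction as) auto
  have "\<exists>z\<in>set zs. x\<^sup>2 = z\<^sup>2"
    using root[where as = "x # xs" and t = "x\<^sup>2"] root[where as = zs and t = "x\<^sup>2"] Cons.prems(6)[of "x\<^sup>2"] by auto
  then have "x \<le> y" using Cons.prems zs by (auto simp: power2_eq_iff_nonneg)
  moreover have "\<exists>z\<in>set (x # xs). y\<^sup>2 = z\<^sup>2"
    using root[where as = "x # xs" and t = "y\<^sup>2"] root[where as = zs and t = "y\<^sup>2"] Cons.prems(6)[of "y\<^sup>2"] zs by auto
  then have "y \<le> x" using Cons.prems zs by (auto simp: power2_eq_iff_nonneg)
  ultimately have xy: "x = y" by simp
  \<comment> \<open>Cancellation is possible only away from the root; continuity in t recovers the
    equality at the root itself.\<close>
  have eq: "(\<Prod>z\<leftarrow>xs. t - z\<^sup>2) = (\<Prod>z\<leftarrow>ys. t - z\<^sup>2)" if "t \<noteq> x\<^sup>2" for t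
    using Cons.prems(6)[of t] that by (simp add: zs xy)
  have cont: "isCont (\<lambda>t. \<Prod>z\<leftarrow>as. t - z\<^sup>2) t" for as :: "real list" and t
    by (induction as) auto
  have "(\<Prod>z\<leftarrow>xs. x\<^sup>2 - z\<^sup>2) = (\<Prod>z\<leftarrow>ys. x\<^sup>2 - z\<^sup>2)"
  proof (rule tendsto_unique[of "at (x\<^sup>2)"])
    show "(\<lambda>t. \<Prod>z\<leftarrow>xs. t - z\<^sup>2) \<midarrow>x\<^sup>2\<rightarrow> (\<Prod>z\<leftarrow>xs. x\<^sup>2 - z\<^sup>2)" using cont isContD by blast
    show "(\<lambda>t. \<Prod>z\<leftarrow>xs. t - z\<^sup>2) \<midarrow>x\<^sup>2\<rightarrow> (\<Prod>z\<leftarrow>ys. x\<^sup>2 - z\<^sup>2)"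
      by (rule Lim_transform_eventually[OF isContD[OF cont[where as = ys]]])
        (use eq in \<open>auto simp: eventually_at intro!: exI[of _ 1]\<close>)
  qed simp
  then have "(\<Prod>z\<leftarrow>xs. t - z\<^sup>2) = (\<Prod>z\<leftarrow>ys. t - z\<^sup>2)" for t using eq by (cases "t = x\<^sup>2") auto
  then have "xs = ys" using Cons zs by auto
  then show ?case using xy zs by simp
qed

lemma det_eigenbasis:
  fixes M :: "real^'d^'d" and v :: "nat \<Rightarrow> real^'d"
  assumes on: "\<And>i j. i < CARD('d) \<Longrightarrow> j < CARD('d) \<Longrightarrow> v i \<bullet> v j = (if i = j then 1 else 0)"
    and ev: "\<And>i. i < CARD('d) \<Longrightarrow> M *v v i = l i *\<^sub>R v i"
  shows "det M = (\<Prod>i<CARD('d). l i)"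
proof -
  \<comment> \<open>The basis is indexed by numbers and matrices by the type \<open>'d\<close>;
    \<open>g\<close> translates, so that the basis vectors become the columns of an orthogonal
    matrix that diagonalizes M.\<close>
  obtain g :: "'d \<Rightarrow> nat" where g: "bij_betw g UNIV {..<CARD('d)}"
    using ex_bij_betw_finite_nat[of "UNIV :: 'd set"] by (auto simp: atLeast0LessThan)
  have gl: "g i < CARD('d)" for i using g by (auto simp: bij_betw_def)
  have gi: "g i = g j \<longleftrightarrow> i = j" for i j using g by (auto simp: bij_betw_def inj_on_def)
  define Q :: "real^'d^'d" where "Q = (\<chi> i j. v (g j) $ i)"
  have colQ: "column j Q = v (g j)" for j by (simp add: Q_def column_def vec_eq_iff)
  have QQ: "transpose Q ** Q = mat 1"
    by (simp add: vec_eq_iff matrix_mult_transpose_dot_column colQ on gl gi mat_def)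
  have MQ: "column j (M ** Q) = l (g j) *\<^sub>R v (g j)" for j
    using ev[OF gl[of j]] by (simp add: column_def matrix_matrix_mult_def matrix_vector_mult_def
      vec_eq_iff Q_def)
  have entry: "(transpose Q ** B) $ i $ j = column i Q \<bullet> column j B" for B :: "real^'d^'d" and i j
    by (simp add: matrix_matrix_mult_def transpose_def column_def inner_vec_def)
  have "det (transpose Q ** (M ** Q)) = (\<Prod>i\<in>UNIV. (transpose Q ** (M ** Q)) $ i $ i)"
    by (rule det_diagonal) (simp add: entry colQ MQ on gl gi)
  also have "\<dots> = (\<Prod>i\<in>UNIV. l (g i))" by (simp add: entry colQ MQ on gl gi)
  also have "\<dots> = (\<Prod>i<CARD('d). l i)" by (rule prod.reindex_bij_betw[OF g])
  also have "det (transpose Q ** (M ** Q)) = det (transpose Q ** Q) * det M"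
    by (simp add: det_mul)
  finally show ?thesis by (simp add: QQ)
qed

text \<open>The only place where the description in \<open>singular_values\<close> is unfolded: an
  orthonormal eigenbasis of \<open>transpose A ** A\<close> yields the characteristic polynomial,
  and the square roots of the eigenvalues are the singular values. Everything later about them is
  derived from this basis.\<close>

lemma singular_value_basis:
  fixes A :: "real^'d^'d"
  obtains v where
    "\<And>i j. i \<in> {1..CARD('d)} \<Longrightarrow> j \<in> {1..CARD('d)} \<Longrightarrow> v i \<bullet> v j = (if i = j then 1 else 0)"
    "\<And>i j. i \<in> {1..CARD('d)} \<Longrightarrow> j \<in> {1..CARD('d)} \<Longrightarrow>
       (A *v v i) \<bullet> (A *v v j) = (if i = j then (sing_val A i)\<^sup>2 else 0)"
    "\<And>i j. 1 \<le> i \<Longrightarrow> i \<le> j \<Longrightarrow> j \<le> CARD('d) \<Longrightarrow> sing_val A j \<le> sing_val A i"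
    "\<And>i. 1 \<le> i \<Longrightarrow> i \<le> CARD('d) \<Longrightarrow> 0 \<le> sing_val A i"
proof -
  define n where "n = CARD('d)"
  define S where "S = transpose A ** A"
  have Sx: "(S *v x) \<bullet> y = (A *v x) \<bullet> (A *v y)" for x y
    by (metis S_def dot_lmul_matrix inner_commute matrix_vector_mul_assoc transpose_matrix_vector)
  obtain v l where v1: "\<And>i. i < n \<Longrightarrow> S *v (v i) = l i *\<^sub>R v i"
    and v2: "\<And>i j. i < n \<Longrightarrow> j < n \<Longrightarrow> v i \<bullet> v j = (if i = j then 1 else 0)"
    and v3: "\<And>i j. i < n \<Longrightarrow> j < n \<Longrightarrow> i \<le> j \<Longrightarrow> l j \<le> (l i :: real)"
  proof -
    have "\<exists>v l. (\<forall>i<n. v i \<in> UNIV \<and> S *v v i = l i *\<^sub>R v i) \<and>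
      (\<forall>i<n. \<forall>j<n. v i \<bullet> v j = (if i = j then 1 else 0)) \<and>
      (\<forall>i<n. \<forall>j<n. i \<le> j \<longrightarrow> l j \<le> (l i :: real))"
    proof (rule selfadjoint_eigenbasis)
      show "(S *v x) \<bullet> y = x \<bullet> (S *v y)" for x y
        using Sx[of x y] Sx[of y x] by (simp add: inner_commute)
    qed (auto simp: n_def)
    then obtain v l where *: "\<forall>i<n. v i \<in> UNIV \<and> S *v v i = l i *\<^sub>R v i"
      "\<forall>i<n. \<forall>j<n. v i \<bullet> v j = (if i = j then 1 else 0)"
      "\<forall>i<n. \<forall>j<n. i \<le> j \<longrightarrow> l j \<le> (l i :: real)" by (elim exE conjE)
    show thesis by (rule that[of v l]) (use * in simp_all)
  qed
  have Avv: "(A *v v i) \<bullet> (A *v v j) = (if i = j then l i else 0)" if "i < n" "j < n" for i j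
    using Sx[of "v i" "v j"] v1[OF that(1)] v2[OF that] by (cases "i = j") auto
  have l0: "0 \<le> l i" if "i < n" for i
    using Avv[OF that that] inner_ge_zero[of "A *v v i"] by simp
  define xs where "xs = map (\<lambda>i. sqrt (l i)) [0..<n]"
  have "det (mat t - S) = (\<Prod>x\<leftarrow>xs. t - x\<^sup>2)" for t
  proof -
    have "det (mat t - S) = (\<Prod>i<n. t - l i)"
      unfolding n_def
    proof (rule det_eigenbasis)
      fix i assume "i < CARD('d)"
      moreover have "mat t *v x = t *\<^sub>R x" for x :: "real^'d"
        by (simp add: matrix_vector_mult_def mat_def vec_eq_iff if_distrib if_distribR cong: if_cong)
      ultimately show "(mat t - S) *v v i = (t - l i) *\<^sub>R v i"
        using v1[of i] by (simp add: matrix_vector_mult_diff_rdistrib n_def scaleR_diff_left)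
    qed (use v2 n_def in auto)
    also have "\<dots> = (\<Prod>x\<leftarrow>xs. t - x\<^sup>2)"
      unfolding xs_def using l0
      by (auto simp: prod.list_conv_set_nth atLeast0LessThan intro!: prod.cong)
    finally show ?thesis .
  qed
  moreover have "length xs = n" "sorted_wrt (\<ge>) xs" "\<forall>x\<in>set xs. 0 \<le> x"
    using v3 l0 by (auto simp: xs_def sorted_wrt_iff_nth_less)
  ultimately have sv: "singular_values A = xs"
    unfolding singular_values_def S_def[symmetric] n_def[symmetric]
    by (intro the_equality) (auto intro!: prod_list_roots_unique)
  then have sq: "sing_val A i = sqrt (l (i - 1))" if "i \<in> {1..n}" for i
    using that by (auto simp: sing_val_def xs_def)
  show thesis
  proof (rule that[of "\<lambda>i. v (i - 1)"])
    show "v (i - 1) \<bullet> v (j - 1) = (if i = j then 1 else 0)"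
      if "i \<in> {1..CARD('d)}" "j \<in> {1..CARD('d)}" for i j
      using v2[of "i - 1" "j - 1"] that by (auto simp: n_def)
    show "(A *v v (i - 1)) \<bullet> (A *v v (j - 1)) = (if i = j then (sing_val A i)\<^sup>2 else 0)"
      if "i \<in> {1..CARD('d)}" "j \<in> {1..CARD('d)}" for i j
      using Avv[of "i - 1" "j - 1"] that l0[of "i - 1"] by (auto simp: n_def sq)
    show "sing_val A j \<le> sing_val A i" if "1 \<le> i" "i \<le> j" "j \<le> CARD('d)" for i j
      using that v3[of "i - 1" "j - 1"] by (auto simp: n_def sq)
    show "0 \<le> sing_val A i" if "1 \<le> i" "i \<le> CARD('d)" for i
      using that l0[of "i - 1"] by (auto simp: n_def sq)
  qed
qed

text \<open>An orthonormal basis of right singular vectors. Like \<open>sing_val\<close> it is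
  numbered from 1; other indices are unconstrained.\<close>

definition sv_basis :: "real^'d^'d \<Rightarrow> (nat \<Rightarrow> real^'d) \<Rightarrow> bool" where
  "sv_basis A v \<longleftrightarrow> (\<forall>i\<in>{1..CARD('d)}. \<forall>j\<in>{1..CARD('d)}.
     v i \<bullet> v j = (if i = j then 1 else 0) \<and>
     (A *v v i) \<bullet> (A *v v j) = (if i = j then (sing_val A i)\<^sup>2 else 0))"

lemma sv_basis_exists: "\<exists>v. sv_basis A v"
proof (rule singular_value_basis[of A])
  fix v
  assume "\<And>i j. i \<in> {1..CARD('a)} \<Longrightarrow> j \<in> {1..CARD('a)} \<Longrightarrow> v i \<bullet> v j = (if i = j then 1 else 0)"
    "\<And>i j. i \<in> {1..CARD('a)} \<Longrightarrow> j \<in> {1..CARD('a)} \<Longrightarrow>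
       (A *v v i) \<bullet> (A *v v j) = (if i = j then (sing_val A i)\<^sup>2 else 0)"
  then have "sv_basis A v" unfolding sv_basis_def by blast
  then show ?thesis by blast
qed

lemma sing_val_antimono: "1 \<le> i \<Longrightarrow> i \<le> j \<Longrightarrow> j \<le> CARD('d) \<Longrightarrow> sing_val A j \<le> sing_val A i"
  for A :: "real^'d^'d"
  by (rule singular_value_basis[of A]) auto

lemma sing_val_nonneg: "1 \<le> i \<Longrightarrow> i \<le> CARD('d) \<Longrightarrow> 0 \<le> sing_val A i"
  for A :: "real^'d^'d"
  by (rule singular_value_basis[of A]) auto

context
  fixes A :: "real^'d^'d" and v
  assumes v: "sv_basis A v"
begin

lemma sv_basis_inner: "i \<in> {1..CARD('d)} \<Longrightarrow> j \<in> {1..CARD('d)} \<Longrightarrow> v i \<bullet> v j = (if i = j then 1 else 0)"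
  using v by (simp add: sv_basis_def)

lemma sv_basis_dim_span: "I \<subseteq> {1..CARD('d)} \<Longrightarrow> dim (span (v ` I)) = card I"
proof -
  assume I: "I \<subseteq> {1..CARD('d)}"
  have "inj_on v I"
  proof (rule inj_onI)
    fix i j assume "i \<in> I" "j \<in> I" "v i = v j"
    then show "i = j" using sv_basis_inner[of i j] sv_basis_inner[of j j] I
      by (cases "i = j") (auto simp: subset_eq)
  qed
  moreover have "independent (v ` I)"
  proof (rule pairwise_orthogonal_independent)
    show "pairwise orthogonal (v ` I)"
      unfolding pairwise_def orthogonal_def
    proof (intro ballI impI)
      fix x y assume "x \<in> v ` I" "y \<in> v ` I" "x \<noteq> y"
      then obtain i j where "i \<in> I" "j \<in> I" "x = v i" "y = v j" "i \<noteq> j" by blast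
      then show "x \<bullet> y = 0" using sv_basis_inner[of i j] I by (auto simp: subset_eq)
    qed
    show "0 \<notin> v ` I"
    proof
      assume "0 \<in> v ` I"
      then obtain i where "i \<in> I" "v i = 0" by force
      then show False using sv_basis_inner[of i i] I by auto
    qed
  qed
  ultimately show ?thesis by (simp add: dim_eq_card_independent card_image)
qed

lemma sv_basis_span: "span (v ` {1..CARD('d)}) = UNIV"
  using sv_basis_dim_span[of "{1..CARD('d)}"]
  by (metis DIM_cart DIM_real card_atLeastAtMost diff_Suc_1 dim_eq_full mult.right_neutral order_refl span_span)

lemma sv_basis_expand: "x = (\<Sum>i=1..CARD('d). (x \<bullet> v i) *\<^sub>R v i)"
proof -
  let ?y = "x - (\<Sum>i=1..CARD('d). (x \<bullet> v i) *\<^sub>R v i)"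
  have "orthogonal ?y w" if w: "w \<in> v ` {1..CARD('d)}" for w
  proof -
    obtain j where j: "j \<in> {1..CARD('d)}" "w = v j" using w by blast
    have "(\<Sum>i=1..CARD('d). (x \<bullet> v i) *\<^sub>R v i) \<bullet> v j = (\<Sum>i=1..CARD('d). if i = j then x \<bullet> v j else 0)"
      unfolding inner_sum_left by (rule sum.cong) (use j sv_basis_inner in auto)
    also have "\<dots> = x \<bullet> v j" using j by simp
    finally show ?thesis by (simp add: orthogonal_def inner_diff_left j)
  qed
  then have "orthogonal ?y ?y" using orthogonal_to_span[of ?y] sv_basis_span by blast
  then show ?thesis by (simp add: orthogonal_self)
qed

lemma sv_basis_norm: "(norm x)\<^sup>2 = (\<Sum>i=1..CARD('d). (x \<bullet> v i)\<^sup>2)"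
proof -
  have "x \<bullet> x = x \<bullet> (\<Sum>i=1..CARD('d). (x \<bullet> v i) *\<^sub>R v i)" using sv_basis_expand[of x] by simp
  also have "\<dots> = (\<Sum>i=1..CARD('d). (x \<bullet> v i)\<^sup>2)"
    by (simp add: inner_sum_right power2_eq_square)
  finally show ?thesis by (simp add: power2_norm_eq_inner)
qed

lemma sv_basis_image_norm: "(norm (A *v x))\<^sup>2 = (\<Sum>i=1..CARD('d). (sing_val A i)\<^sup>2 * (x \<bullet> v i)\<^sup>2)"
proof -
  have "A *v x = A *v (\<Sum>i=1..CARD('d). (x \<bullet> v i) *\<^sub>R v i)" using sv_basis_expand[of x] by simp
  also have "\<dots> = (\<Sum>i=1..CARD('d). (x \<bullet> v i) *\<^sub>R (A *v v i))"
    by (simp add: linear_sum[OF matrix_vector_mul_linear] matrix_vector_mult_scaleR)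
  finally have e: "A *v x = (\<Sum>i=1..CARD('d). (x \<bullet> v i) *\<^sub>R (A *v v i))" .
  have "(A *v x) \<bullet> (A *v x) = (\<Sum>i=1..CARD('d). \<Sum>j=1..CARD('d).
      (x \<bullet> v i) * ((x \<bullet> v j) * ((A *v v i) \<bullet> (A *v v j))))"
    unfolding e inner_sum_left inner_sum_right inner_scaleR_left inner_scaleR_right sum_distrib_left
    by (subst sum.swap) (simp add: mult_ac)
  also have "\<dots> = (\<Sum>i=1..CARD('d). \<Sum>j=1..CARD('d).
      (if j = i then (x \<bullet> v i)\<^sup>2 * (sing_val A i)\<^sup>2 else 0))"
    using v by (intro sum.cong) (auto simp: sv_basis_def power2_eq_square)
  also have "\<dots> = (\<Sum>i=1..CARD('d). (sing_val A i)\<^sup>2 * (x \<bullet> v i)\<^sup>2)"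
    by (intro sum.cong) auto
  finally show ?thesis by (simp add: power2_norm_eq_inner)
qed

lemma sv_basis_span_coord:
  assumes "I \<subseteq> {1..CARD('d)}" "x \<in> span (v ` I)" "j \<in> {1..CARD('d)}" "j \<notin> I"
  shows "x \<bullet> v j = 0"
proof -
  have "orthogonal (v j) x"
  proof (rule orthogonal_to_span[OF assms(2)])
    fix y assume "y \<in> v ` I"
    then obtain i where "i \<in> I" "y = v i" by blast
    then show "orthogonal (v j) y"
      using assms sv_basis_inner[of j i] by (auto simp: orthogonal_def)
  qed
  then show ?thesis by (simp add: orthogonal_def inner_commute)
qed

text \<open>In the singular basis the squared norm of A x is the sum of the squared coordinates of x
  weighted by squared singular values. On the span of the last vectors every weight that occurs is
  at most that of index m; \<open>sv_basis_high\<close> is the counterpart for the first m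
  vectors.\<close>

lemma sv_basis_low:
  assumes m: "1 \<le> m" "m \<le> CARD('d)" and x: "x \<in> span (v ` {m..CARD('d)})"
  shows "norm (A *v x) \<le> sing_val A m * norm x"
proof (rule power2_le_imp_le)
  have "(norm (A *v x))\<^sup>2 = (\<Sum>i=1..CARD('d). (sing_val A i)\<^sup>2 * (x \<bullet> v i)\<^sup>2)" by (rule sv_basis_image_norm)
  also have "\<dots> \<le> (\<Sum>i=1..CARD('d). (sing_val A m)\<^sup>2 * (x \<bullet> v i)\<^sup>2)"
  proof (rule sum_mono)
    fix i assume i: "i \<in> {1..CARD('d)}"
    show "(sing_val A i)\<^sup>2 * (x \<bullet> v i)\<^sup>2 \<le> (sing_val A m)\<^sup>2 * (x \<bullet> v i)\<^sup>2"
    proof (cases "m \<le> i")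
      case True
      then show ?thesis using i m
        by (intro mult_right_mono power_mono sing_val_antimono sing_val_nonneg) auto
    next
      case False
      then have "x \<bullet> v i = 0" using sv_basis_span_coord[OF _ x] i m by auto
      then show ?thesis by simp
    qed
  qed
  also have "\<dots> = (sing_val A m * norm x)\<^sup>2"
    by (simp add: sv_basis_norm power_mult_distrib sum_distrib_left)
  finally show "(norm (A *v x))\<^sup>2 \<le> (sing_val A m * norm x)\<^sup>2" .
qed (use m in \<open>auto intro!: mult_nonneg_nonneg sing_val_nonneg\<close>)

lemma sv_basis_high:
  assumes m: "1 \<le> m" "m \<le> CARD('d)" and x: "x \<in> span (v ` {1..m})"
  shows "sing_val A m * norm x \<le> norm (A *v x)"
proof (rule power2_le_imp_le)
  have "(sing_val A m * norm x)\<^sup>2 = (\<Sum>i=1..CARD('d). (sing_val A m)\<^sup>2 * (x \<bullet> v i)\<^sup>2)"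
    by (simp add: sv_basis_norm power_mult_distrib sum_distrib_left)
  also have "\<dots> \<le> (\<Sum>i=1..CARD('d). (sing_val A i)\<^sup>2 * (x \<bullet> v i)\<^sup>2)"
  proof (rule sum_mono)
    fix i assume i: "i \<in> {1..CARD('d)}"
    show "(sing_val A m)\<^sup>2 * (x \<bullet> v i)\<^sup>2 \<le> (sing_val A i)\<^sup>2 * (x \<bullet> v i)\<^sup>2"
    proof (cases "i \<le> m")
      case True
      then show ?thesis using i m
        by (intro mult_right_mono power_mono sing_val_antimono sing_val_nonneg) auto
    next
      case False
      then have "x \<bullet> v i = 0" using sv_basis_span_coord[OF _ x] i m by auto
      then show ?thesis by simp
    qed
  qed
  also have "\<dots> = (norm (A *v x))\<^sup>2" by (simp add: sv_basis_image_norm)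
  finally show "(sing_val A m * norm x)\<^sup>2 \<le> (norm (A *v x))\<^sup>2" .
qed simp

end

section \<open>Courant-Fischer bounds for singular values\<close>

lemma subspaces_intersect_nontrivially:
  fixes U V :: "'a::euclidean_space set"
  assumes "subspace U" "subspace V" "dim U + dim V > DIM('a)"
  obtains x where "x \<in> U" "x \<in> V" "x \<noteq> 0"
proof -
  have "dim {x + y |x y. x \<in> U \<and> y \<in> V} + dim (U \<inter> V) = dim U + dim V"
    by (rule dim_sums_Int[OF assms(1,2)])
  moreover have "dim {x + y |x y. x \<in> U \<and> y \<in> V} \<le> DIM('a)" by (rule dim_subset_UNIV)
  ultimately have "dim (U \<inter> V) \<noteq> 0" using assms(3) by linarith
  then have "\<not> U \<inter> V \<subseteq> {0}" by (simp add: dim_eq_0)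
  then show thesis using that by blast
qed

text \<open>U is too large to avoid the span of the singular vectors with index at least m, of
  dimension d + 1 - m. On a common nonzero vector both stretching bounds apply. The upper estimate
  \<open>sing_val_leI\<close> intersects with the first m vectors instead.\<close>

lemma sing_val_geI:
  fixes A :: "real^'d^'d"
  assumes m: "1 \<le> m" "m \<le> CARD('d)" and U: "subspace U" "dim U \<ge> m"
    and le: "\<And>x. x \<in> U \<Longrightarrow> c * norm x \<le> norm (A *v x)"
  shows "c \<le> sing_val A m"
proof -
  obtain v where v: "sv_basis A v" using sv_basis_exists by blast
  have "dim (span (v ` {m..CARD('d)})) = CARD('d) + 1 - m"
    using sv_basis_dim_span[OF v, of "{m..CARD('d)}"] m by simp
  then have "dim U + dim (span (v ` {m..CARD('d)})) > DIM(real^'d)" using U m by simp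
  then obtain x where "x \<in> U" "x \<in> span (v ` {m..CARD('d)})" "x \<noteq> 0"
    using subspaces_intersect_nontrivially[OF U(1) subspace_span] by blast
  then have "c * norm x \<le> sing_val A m * norm x" "norm x > 0"
    using le sv_basis_low[OF v m] order_trans by (blast, simp)
  then show ?thesis by simp
qed

lemma sing_val_leI:
  fixes A :: "real^'d^'d"
  assumes m: "1 \<le> m" "m \<le> CARD('d)" and U: "subspace U" "dim U + m > CARD('d)"
    and le: "\<And>x. x \<in> U \<Longrightarrow> norm (A *v x) \<le> c * norm x"
  shows "sing_val A m \<le> c"
proof -
  obtain v where v: "sv_basis A v" using sv_basis_exists by blast
  have "dim (span (v ` {1..m})) = m"
    using sv_basis_dim_span[OF v, of "{1..m}"] m by simp
  then have "dim U + dim (span (v ` {1..m})) > DIM(real^'d)" using U m by simp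
  then obtain x where "x \<in> U" "x \<in> span (v ` {1..m})" "x \<noteq> 0"
    using subspaces_intersect_nontrivially[OF U(1) subspace_span] by blast
  then have "sing_val A m * norm x \<le> c * norm x" "norm x > 0"
    using le sv_basis_high[OF v m] order_trans by (blast, simp)
  then show ?thesis by simp
qed

lemma sing_val_le:
  fixes A :: "real^'d^'d"
  assumes "1 \<le> m" "m \<le> CARD('d)" "\<And>x. norm (A *v x) \<le> c * norm x"
  shows "sing_val A m \<le> c"
  using assms by (intro sing_val_leI[of m UNIV]) auto

lemma sing_val_ge:
  fixes A :: "real^'d^'d"
  assumes "1 \<le> m" "m \<le> CARD('d)" "\<And>x. c * norm x \<le> norm (A *v x)"
  shows "c \<le> sing_val A m"
  using assms by (intro sing_val_geI[of m UNIV]) auto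

text \<open>Carries an extremal subspace for A back to one of the same dimension for
  \<open>A ** B\<close>, where the Courant-Fischer bounds can be applied.\<close>

lemma dim_preimage_matrix:
  fixes B :: "real^'d^'d"
  assumes "invertible B"
  obtains U' where "subspace U'" "dim U' = dim U" "\<And>x. x \<in> U' \<Longrightarrow> B *v x \<in> span U"
proof -
  obtain B' where B': "B ** B' = mat 1" "B' ** B = mat 1" using assms by (auto simp: invertible_def)
  have "inj ((*v) B')" using B' by (metis inj_matrix_vector_mult invertible_def)
  then have "dim ((*v) B' ` span U) = dim U"
    by (subst dim_image_eq) (auto intro: inj_on_subset)
  moreover have "B *v x \<in> span U" if "x \<in> (*v) B' ` span U" for x
    using that B'(1) by (auto simp: matrix_vector_mul_assoc)
  moreover have "subspace ((*v) B' ` span U)"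
    by (rule linear_subspace_image) auto
  ultimately show thesis using that by blast
qed

lemma sing_val_mult_le:
  fixes A B :: "real^'d^'d"
  assumes m: "1 \<le> m" "m \<le> CARD('d)" and B: "invertible B" "\<And>x. norm (B *v x) \<le> c * norm x"
  shows "sing_val (A ** B) m \<le> sing_val A m * c"
proof -
  obtain v where v: "sv_basis A v" using sv_basis_exists by blast
  obtain U where U: "subspace U" "dim U = dim (v ` {m..CARD('d)})"
    "\<And>x. x \<in> U \<Longrightarrow> B *v x \<in> span (v ` {m..CARD('d)})"
    using dim_preimage_matrix[OF B(1)] by metis
  show ?thesis
  proof (rule sing_val_leI[OF m U(1)])
    show "dim U + m > CARD('d)"
      using U(2) sv_basis_dim_span[OF v, of "{m..CARD('d)}"] m by simp
    fix x assume "x \<in> U"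
    then have "norm (A *v (B *v x)) \<le> sing_val A m * norm (B *v x)"
      by (intro sv_basis_low[OF v m] U(3))
    also have "\<dots> \<le> sing_val A m * (c * norm x)"
      using m by (intro mult_left_mono B sing_val_nonneg)
    finally show "norm (A ** B *v x) \<le> sing_val A m * c * norm x"
      by (simp add: matrix_vector_mul_assoc mult_ac)
  qed
qed

lemma sing_val_mult_ge:
  fixes A B :: "real^'d^'d"
  assumes m: "1 \<le> m" "m \<le> CARD('d)" and B: "invertible B" "\<And>x. c * norm x \<le> norm (B *v x)"
  shows "sing_val A m * c \<le> sing_val (A ** B) m"
proof -
  obtain v where v: "sv_basis A v" using sv_basis_exists by blast
  obtain U where U: "subspace U" "dim U = dim (v ` {1..m})"
    "\<And>x. x \<in> U \<Longrightarrow> B *v x \<in> span (v ` {1..m})"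
    using dim_preimage_matrix[OF B(1)] by metis
  show ?thesis
  proof (rule sing_val_geI[OF m U(1)])
    show "dim U \<ge> m"
      using U(2) sv_basis_dim_span[OF v, of "{1..m}"] m by simp
    fix x assume x: "x \<in> U"
    have "sing_val A m * (c * norm x) \<le> sing_val A m * norm (B *v x)"
      using m by (intro mult_left_mono B sing_val_nonneg)
    also have "\<dots> \<le> norm (A *v (B *v x))"
      using x by (intro sv_basis_high[OF v m] U(3))
    finally show "sing_val A m * c * norm x \<le> norm (A ** B *v x)"
      by (simp add: matrix_vector_mul_assoc mult_ac)
  qed
qed

lemma invertible_lower_bound:
  fixes A :: "real^'d^'d"
  assumes "invertible A"
  obtains c where "c > 0" "\<And>x. c * norm x \<le> norm (A *v x)"
proof -
  obtain B where B: "B ** A = mat 1" using assms by (auto simp: invertible_def)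
  obtain K where K: "K > 0" "\<And>x. norm (B *v x) \<le> norm x * K"
    using bounded_linear.pos_bounded[OF matrix_vector_mul_bounded_linear[of B]] by blast
  have "inverse K * norm x \<le> norm (A *v x)" for x
    using K(2)[of "A *v x"] K(1) B by (simp add: matrix_vector_mul_assoc field_simps)
  then show thesis using that[of "inverse K"] K by simp
qed

lemma sing_val_pos:
  fixes A :: "real^'d^'d"
  assumes "invertible A" "1 \<le> m" "m \<le> CARD('d)"
  shows "0 < sing_val A m"
  using invertible_lower_bound[OF assms(1)] sing_val_ge[OF assms(2,3)] by (metis less_le_trans)

text \<open>Needed for s > d, where psi^s is a power of the determinant and hence exactly
  multiplicative.\<close>

lemma prod_sing_val:
  fixes A :: "real^'d^'d"
  shows "(\<Prod>i=1..CARD('d). sing_val A i) = \<bar>det A\<bar>"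
proof -
  obtain v where v: "sv_basis A v" using sv_basis_exists by blast
  have "det (transpose A ** A) = (\<Prod>i<CARD('d). (sing_val A (Suc i))\<^sup>2)"
  proof (rule det_eigenbasis)
    fix i assume i: "i < CARD('d)"
    show "transpose A ** A *v v (Suc i) = (sing_val A (Suc i))\<^sup>2 *\<^sub>R v (Suc i)" (is "?a = ?b")
    proof -
      have "?a \<bullet> v j = ?b \<bullet> v j" if "j \<in> {1..CARD('d)}" for j
      proof -
        have "?a \<bullet> v j = (A *v v (Suc i)) \<bullet> (A *v v j)"
          by (metis dot_lmul_matrix inner_commute matrix_vector_mul_assoc transpose_matrix_vector)
        also have "\<dots> = ?b \<bullet> v j" using v that i by (auto simp: sv_basis_def)
        finally show ?thesis .
      qed
      then have "(\<Sum>j=1..CARD('d). (?a \<bullet> v j) *\<^sub>R v j) = (\<Sum>j=1..CARD('d). (?b \<bullet> v j) *\<^sub>R v j)"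
        by (intro sum.cong) auto
      then show ?thesis using sv_basis_expand[OF v] by metis
    qed
  qed (use sv_basis_inner[OF v] in auto)
  also have "\<dots> = (\<Prod>i=1..CARD('d). sing_val A i)\<^sup>2"
    by (simp add: prod_power_distrib[symmetric] prod.atLeast1_atMost_eq)
  finally have "\<bar>det A\<bar>\<^sup>2 = (\<Prod>i=1..CARD('d). sing_val A i)\<^sup>2"
    by (simp add: det_mul power2_eq_square)
  moreover have "0 \<le> (\<Prod>i=1..CARD('d). sing_val A i)"
    using sing_val_nonneg by (intro prod_nonneg) auto
  ultimately show ?thesis using power2_eq_iff_nonneg[of "\<bar>det A\<bar>"] by simp
qed

text \<open>The normalized images of the right singular vectors are the left singular vectors. Along
  the i-th one, the coordinate of M x is the i-th coordinate of x times the i-th singular value, so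
  the image of a ball lies in a box with sides proportional to the singular values.\<close>

lemma sv_basis_image_coord:
  fixes M :: "real^'d^'d"
  assumes "sv_basis M w" "invertible M" "i \<in> {1..CARD('d)}"
  shows "\<bar>(M *v x) \<bullet> ((M *v w i) /\<^sub>R sing_val M i)\<bar> \<le> sing_val M i * norm x"
proof -
  have a: "0 < sing_val M i" using sing_val_pos[OF assms(2)] assms(3) by auto
  have "M *v x = M *v (\<Sum>j=1..CARD('d). (x \<bullet> w j) *\<^sub>R w j)" using sv_basis_expand[OF assms(1), of x] by simp
  also have "\<dots> = (\<Sum>j=1..CARD('d). (x \<bullet> w j) *\<^sub>R (M *v w j))"
    by (simp add: linear_sum[OF matrix_vector_mul_linear] matrix_vector_mult_scaleR)
  also have "\<dots> \<bullet> (M *v w i) = (\<Sum>j=1..CARD('d). if j = i then (x \<bullet> w i) * (sing_val M i)\<^sup>2 else 0)"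
    unfolding inner_sum_left using assms(1,3) by (intro sum.cong) (auto simp: sv_basis_def)
  also have "\<dots> = (x \<bullet> w i) * (sing_val M i)\<^sup>2" using assms(3) by simp
  finally have "(M *v x) \<bullet> ((M *v w i) /\<^sub>R sing_val M i) = (x \<bullet> w i) * sing_val M i"
    using a by (simp add: power2_eq_square)
  moreover have "norm (w i) = 1" using sv_basis_inner[OF assms(1), of i i] assms(3) by (simp add: norm_eq_1)
  then have "\<bar>x \<bullet> w i\<bar> \<le> norm x" using Cauchy_Schwarz_ineq2[of x "w i"] by simp
  ultimately show ?thesis using a by (simp add: abs_mult mult.commute)
qed

section \<open>The singular value function\<close>

text \<open>Turns the three cases of \<open>sv_fun\<close> into one formula: psi^s is the product of
  the singular values raised to these exponents, which are nonnegative and increase with s, also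
  across s = d.\<close>

definition sv_exp :: "nat \<Rightarrow> real \<Rightarrow> nat \<Rightarrow> real" where
  "sv_exp d s i = (if s \<le> d then min 1 (max 0 (s - real i + 1)) else s / d)"

lemma sv_exp_nonneg: "0 \<le> s \<Longrightarrow> 0 \<le> sv_exp d s i"
  by (simp add: sv_exp_def)

lemma sv_exp_le_1: "s \<le> real d \<Longrightarrow> sv_exp d s i \<le> 1"
  by (simp add: sv_exp_def)

lemma sv_exp_mono: "s \<le> t \<Longrightarrow> 0 < d \<Longrightarrow> sv_exp d s i \<le> sv_exp d t i"
  by (auto simp: sv_exp_def min_le_iff_disj intro: divide_right_mono)

lemma sum_sv_exp:
  assumes "0 \<le> s" "0 < d"
  shows "(\<Sum>i=1..d. sv_exp d s i) = s"
proof (cases "s \<le> d")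
  case True
  have "(\<Sum>i=1..n. min 1 (max 0 (s - real i + 1))) = min s n" for n
    using assms(1) by (induction n) (auto simp: min_def max_def)
  from this[of d] True show ?thesis by (simp add: sv_exp_def)
next
  case False
  then show ?thesis using assms by (simp add: sv_exp_def)
qed

lemma sv_fun_eq:
  fixes A :: "real^'d^'d"
  assumes A: "invertible A" and s: "0 \<le> s"
  shows "sv_fun s A = (\<Prod>i=1..CARD('d). sing_val A i powr sv_exp (CARD('d)) s i)"
proof -
  have pos: "0 < sing_val A i" if "i \<in> {1..CARD('d)}" for i
    using sing_val_pos[OF A] that by auto
  consider "s = 0" | "0 < s" "s \<le> CARD('d)" | "s > CARD('d)" using s by linarith
  then show ?thesis
  proof cases
    case 1
    have "(\<Prod>i=1..CARD('d). sing_val A i powr sv_exp (CARD('d)) s i) = (\<Prod>i=1..CARD('d). 1)"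
      using pos less_numeral_extra(3) by (intro prod.cong) (force simp: 1 sv_exp_def)+
    then show ?thesis by (simp add: sv_fun_def 1)
  next
    case 2
    define m where "m = nat \<lceil>s\<rceil>"
    have m: "real m - 1 < s" "s \<le> real m" "1 \<le> m" "m \<le> CARD('d)"
      using 2 by (auto simp: m_def) linarith+
    have split: "{1..CARD('d)} = {1..<m} \<union> {m} \<union> {m<..CARD('d)}" using m by auto
    have "(\<Prod>i=1..CARD('d). sing_val A i powr sv_exp (CARD('d)) s i)
      = (\<Prod>i\<in>{1..<m}. sing_val A i powr sv_exp (CARD('d)) s i) * sing_val A m powr sv_exp (CARD('d)) s m *
        (\<Prod>i\<in>{m<..CARD('d)}. sing_val A i powr sv_exp (CARD('d)) s i)"
      unfolding split by (subst prod.union_disjoint; force)+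
    also have "(\<Prod>i\<in>{1..<m}. sing_val A i powr sv_exp (CARD('d)) s i) = (\<Prod>i\<in>{1..<m}. sing_val A i)"
    proof (rule prod.cong)
      fix i assume i: "i \<in> {1..<m}"
      then have "sv_exp (CARD('d)) s i = 1" using m 2 by (auto simp: sv_exp_def)
      then show "sing_val A i powr sv_exp (CARD('d)) s i = sing_val A i"
        using pos[of i] i m by auto
    qed simp
    also have "(\<Prod>i\<in>{m<..CARD('d)}. sing_val A i powr sv_exp (CARD('d)) s i) = (\<Prod>i\<in>{m<..CARD('d)}. 1)"
    proof (rule prod.cong)
      fix i assume i: "i \<in> {m<..CARD('d)}"
      then have "sv_exp (CARD('d)) s i = 0" using m 2 by (auto simp: sv_exp_def max_def)
      then show "sing_val A i powr sv_exp (CARD('d)) s i = 1"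
        using pos[of i] i m by auto
    qed simp
    also have "sv_exp (CARD('d)) s m = s - real m + 1" using m 2 by (auto simp: sv_exp_def)
    finally show ?thesis using 2 by (simp add: sv_fun_def m_def Let_def)
  next
    case 3
    have "(\<Prod>i=1..CARD('d). sing_val A i powr sv_exp (CARD('d)) s i)
        = (\<Prod>i=1..CARD('d). sing_val A i) powr (s / CARD('d))"
      using 3 pos by (subst prod_powr_distrib) (auto simp: sv_exp_def less_imp_le)
    then show ?thesis using 3 by (simp add: sv_fun_def)
  qed
qed

lemma sv_fun_pos:
  fixes A :: "real^'d^'d"
  assumes "invertible A" "0 \<le> s"
  shows "0 < sv_fun s A"
  unfolding sv_fun_eq[OF assms] using sing_val_pos[OF assms(1)] by (intro prod_pos) force

lemma sv_fun_zero [simp]: "sv_fun 0 A = 1"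
  by (simp add: sv_fun_def)

text \<open>All comparisons of singular value functions below are instances of this one: the exponents
  of \<open>sv_fun s\<close> add up to \<open>s\<close>.\<close>

lemma prod_powr_sv_exp_scale:
  assumes "0 \<le> s" "0 < d" "0 < k" "\<And>i. i \<in> {1..d} \<Longrightarrow> 0 < a i"
  shows "(\<Prod>i=1..d. (a i * k) powr sv_exp d s i) = (\<Prod>i=1..d. a i powr sv_exp d s i) * k powr s"
proof -
  have "(\<Prod>i=1..d. (a i * k) powr sv_exp d s i) = (\<Prod>i=1..d. a i powr sv_exp d s i * k powr sv_exp d s i)"
    using assms by (intro prod.cong) (auto simp: powr_mult)
  also have "\<dots> = (\<Prod>i=1..d. a i powr sv_exp d s i) * (\<Prod>i=1..d. k powr sv_exp d s i)"
    by (rule prod.distrib)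
  also have "(\<Prod>i=1..d. k powr sv_exp d s i) = k powr s"
    using sum_sv_exp[OF assms(1,2)] assms(3) by (simp add: powr_sum[symmetric])
  finally show ?thesis .
qed

lemma sv_fun_mult_ge:
  fixes A B :: "real^'d^'d"
  assumes A: "invertible A" and B: "invertible B" "\<And>x. c * norm x \<le> norm (B *v x)"
    and s: "0 \<le> s" and c: "0 < c"
  shows "sv_fun s A * c powr s \<le> sv_fun s (A ** B)"
proof -
  have AB: "invertible (A ** B)" using A B by (simp add: invertible_mult)
  have "sv_fun s A * c powr s = (\<Prod>i=1..CARD('d). (sing_val A i * c) powr sv_exp (CARD('d)) s i)"
    unfolding sv_fun_eq[OF A s] using sing_val_pos[OF A] s c
    by (intro prod_powr_sv_exp_scale[symmetric]) auto
  also have "\<dots> \<le> sv_fun s (A ** B)"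
    unfolding sv_fun_eq[OF AB s]
    using sing_val_mult_ge[OF _ _ B, of _ A] sing_val_nonneg[of _ A] s c
    by (intro prod_mono) (auto intro!: powr_mono2 sv_exp_nonneg)
  finally show ?thesis .
qed

lemma sv_fun_add:
  fixes A :: "real^'d^'d"
  assumes A: "invertible A" and s: "0 \<le> s" "0 \<le> t"
  shows "sv_fun (s + t) A = sv_fun s A * (\<Prod>i=1..CARD('d).
    sing_val A i powr (sv_exp (CARD('d)) (s + t) i - sv_exp (CARD('d)) s i))"
proof -
  have st: "0 \<le> s + t" using s by simp
  show ?thesis
    unfolding sv_fun_eq[OF A st] sv_fun_eq[OF A s(1)] prod.distrib[symmetric]
    using sing_val_pos[OF A] by (intro prod.cong) (auto simp: powr_add[symmetric])
qed

text \<open>By \<open>sv_fun_add\<close> the quotient of psi^(s+t) and psi^s is a product of powers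
  of singular values whose exponents are nonnegative and add up to t. Bounding each singular value
  by c gives c^t; bounding below gives \<open>sv_fun_add_ge\<close>.\<close>

lemma sv_fun_add_le:
  fixes A :: "real^'d^'d"
  assumes A: "invertible A" "\<And>x. norm (A *v x) \<le> c * norm x" and s: "0 \<le> s" "0 \<le> t" and c: "0 < c"
  shows "sv_fun (s + t) A \<le> sv_fun s A * c powr t"
proof -
  let ?e = "\<lambda>i. sv_exp (CARD('d)) (s + t) i - sv_exp (CARD('d)) s i"
  have "(\<Prod>i=1..CARD('d). sing_val A i powr ?e i) \<le> (\<Prod>i=1..CARD('d). c powr ?e i)"
    using sing_val_le[OF _ _ A(2)] sing_val_nonneg s
    by (intro prod_mono) (auto intro!: powr_mono2 sv_exp_mono)
  also have "\<dots> = c powr (\<Sum>i=1..CARD('d). ?e i)" using c by (simp add: powr_sum)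
  also have "\<dots> = c powr t"
    using sum_sv_exp[of s "CARD('d)"] sum_sv_exp[of "s + t" "CARD('d)"] s by (simp add: sum_subtractf)
  finally show ?thesis
    using sv_fun_pos[OF A(1) s(1)] unfolding sv_fun_add[OF A(1) s] by simp
qed

lemma sv_fun_add_ge:
  fixes A :: "real^'d^'d"
  assumes A: "invertible A" "\<And>x. c * norm x \<le> norm (A *v x)" and s: "0 \<le> s" "0 \<le> t" and c: "0 < c"
  shows "sv_fun s A * c powr t \<le> sv_fun (s + t) A"
proof -
  let ?e = "\<lambda>i. sv_exp (CARD('d)) (s + t) i - sv_exp (CARD('d)) s i"
  have "c powr t = c powr (\<Sum>i=1..CARD('d). ?e i)"
    using sum_sv_exp[of s "CARD('d)"] sum_sv_exp[of "s + t" "CARD('d)"] s by (simp add: sum_subtractf)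
  also have "\<dots> = (\<Prod>i=1..CARD('d). c powr ?e i)" using c by (simp add: powr_sum)
  also have "\<dots> \<le> (\<Prod>i=1..CARD('d). sing_val A i powr ?e i)"
    using sing_val_ge[OF _ _ A(2)] c s
    by (intro prod_mono) (auto intro!: powr_mono2 sv_exp_mono)
  finally show ?thesis
    using sv_fun_pos[OF A(1) s(1)] unfolding sv_fun_add[OF A(1) s] by simp
qed

section \<open>Volumes of thickened ellipsoids as a description of psi^s\<close>

text \<open>Up to constants, the volume of the r-neighbourhood of the image of the unit ball under
  A. For 0 < s \<le> d, psi^s(A) is the minimum over r > 0 of this number times r^(s-d), by the next
  two lemmas on \<open>sv_fun\<close>; so volume inequalities turn into inequalities for
  psi^s.\<close>

definition sv_max_prod :: "real^'d^'d \<Rightarrow> real \<Rightarrow> real" where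
  "sv_max_prod A r = (\<Prod>i=1..CARD('d). max (sing_val A i) r)"

lemma sv_max_prod_pos: "0 < r \<Longrightarrow> 0 < sv_max_prod A r"
  by (auto simp: sv_max_prod_def intro!: prod_pos)

lemma prod_powr_complement:
  assumes "0 \<le> s" "0 < d" "0 < r"
  shows "(\<Prod>i=1..d. r powr (1 - sv_exp d s i)) = r powr (real d - s)"
  using assms sum_sv_exp[of s d] by (simp add: powr_sum[symmetric] sum_subtractf)

text \<open>Factor by factor: a weighted geometric mean of a singular value and r is at most their
  maximum. The exponents left over for r add up to d - s.\<close>

lemma sv_fun_le_max_prod:
  fixes A :: "real^'d^'d" and s :: real
  assumes A: "invertible A" and s: "0 \<le> s" "s \<le> CARD('d)" and r: "0 < r"
  shows "sv_fun s A * r powr (real CARD('d) - s) \<le> sv_max_prod A r"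
proof -
  let ?e = "sv_exp (CARD('d)) s"
  have "sv_fun s A * r powr (real CARD('d) - s) = (\<Prod>i=1..CARD('d). sing_val A i powr ?e i * r powr (1 - ?e i))"
    unfolding sv_fun_eq[OF A s(1)] prod.distrib using prod_powr_complement[of s "CARD('d)" r] s r by simp
  also have "\<dots> \<le> sv_max_prod A r"
    unfolding sv_max_prod_def
  proof (rule prod_mono, intro conjI)
    fix i assume i: "i \<in> {1..CARD('d)}"
    let ?m = "max (sing_val A i) r"
    have "sing_val A i powr ?e i * r powr (1 - ?e i) \<le> ?m powr ?e i * ?m powr (1 - ?e i)"
      using sing_val_pos[OF A, of i] i s r sv_exp_nonneg[OF s(1), of "CARD('d)" i] sv_exp_le_1[OF s(2), of i]
      by (intro mult_mono powr_mono2) auto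
    also have "\<dots> = ?m" using r by (simp add: powr_add[symmetric])
    finally show "sing_val A i powr ?e i * r powr (1 - ?e i) \<le> ?m" .
  qed auto
  finally show ?thesis .
qed

text \<open>At r equal to the m-th singular value the means in \<open>sv_fun_le_max_prod\<close>
  degenerate: below m the exponent is 1 and the singular value is the maximum, above m the exponent
  is 0 and r is the maximum, and at m both agree.\<close>

lemma sv_max_prod_at_sing_val:
  fixes A :: "real^'d^'d" and s :: real
  assumes A: "invertible A" and s: "0 < s" "s \<le> CARD('d)" and m: "m = nat \<lceil>s\<rceil>"
  shows "sv_max_prod A (sing_val A m) = sv_fun s A * sing_val A m powr (real CARD('d) - s)"
proof -
  let ?e = "sv_exp (CARD('d)) s"
  have m': "real m - 1 < s" "s \<le> real m" "1 \<le> m" "m \<le> CARD('d)"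
    using s by (auto simp: m) linarith+
  let ?r = "sing_val A m"
  have r: "0 < ?r" using sing_val_pos[OF A] m' by auto
  have "sv_fun s A * ?r powr (real CARD('d) - s) = (\<Prod>i=1..CARD('d). sing_val A i powr ?e i * ?r powr (1 - ?e i))"
    unfolding sv_fun_eq[OF A less_imp_le[OF s(1)]] prod.distrib
    using prod_powr_complement[of s "CARD('d)" ?r] s r by simp
  also have "\<dots> = sv_max_prod A ?r"
    unfolding sv_max_prod_def
  proof (rule prod.cong)
    fix i assume i: "i \<in> {1..CARD('d)}"
    have pi: "0 < sing_val A i" using sing_val_pos[OF A] i by auto
    consider "i < m" | "i = m" | "i > m" by linarith
    then show "sing_val A i powr ?e i * ?r powr (1 - ?e i) = max (sing_val A i) ?r"
    proof cases
      case 1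
      then have "?e i = 1" using m' s by (auto simp: sv_exp_def)
      then show ?thesis using sing_val_antimono[of i m A] 1 i m' pi r by simp
    next
      case 2
      then show ?thesis using r by (simp add: powr_add[symmetric])
    next
      case 3
      then have "?e i = 0" using m' s by (auto simp: sv_exp_def max_def)
      then show ?thesis using sing_val_antimono[of m i A] 3 i m' pi r by (simp add: max_def)
    qed
  qed simp
  finally show ?thesis by simp
qed

section \<open>Volumes\<close>

definition orthonormal_family :: "(nat \<Rightarrow> real^'d) \<Rightarrow> bool" where
  "orthonormal_family e \<longleftrightarrow>
     (\<forall>i\<in>{1..CARD('d)}. \<forall>j\<in>{1..CARD('d)}. e i \<bullet> e j = (if i = j then 1 else 0))"

definition obox :: "(nat \<Rightarrow> real^'d) \<Rightarrow> (nat \<Rightarrow> real) \<Rightarrow> (real^'d) set" where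
  "obox e l = {x. \<forall>i\<in>{1..CARD('d)}. \<bar>x \<bullet> e i\<bar> \<le> l i}"

lemma sing_val_mat_1: "i \<in> {1..CARD('d)} \<Longrightarrow> sing_val (mat 1 :: real^'d^'d) i = 1"
  using sing_val_le[of i "mat 1 :: real^'d^'d" 1] sing_val_ge[of i 1 "mat 1 :: real^'d^'d"] by auto

text \<open>All singular values of the identity are 1, so expansions proved for singular bases hold
  for any orthonormal family.\<close>

lemma orthonormal_family_sv_basis:
  fixes e :: "nat \<Rightarrow> real^'d"
  shows "orthonormal_family e \<longleftrightarrow> sv_basis (mat 1) e"
  unfolding orthonormal_family_def sv_basis_def using sing_val_mat_1[where 'd = 'd] by (intro ball_cong) auto

lemma sv_basis_orthonormal: "sv_basis A v \<Longrightarrow> orthonormal_family v"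
  by (simp add: orthonormal_family_def sv_basis_def)

lemma sv_basis_image_orthonormal:
  fixes A :: "real^'d^'d"
  assumes "sv_basis A v" "invertible A"
  shows "orthonormal_family (\<lambda>i. (A *v v i) /\<^sub>R sing_val A i)"
proof -
  have "sing_val A i \<noteq> 0" if "i \<in> {1..CARD('d)}" for i
    using sing_val_pos[OF assms(2), of i] that by auto
  then show ?thesis using assms(1)
    unfolding orthonormal_family_def sv_basis_def
    by (intro ballI) (simp add: power2_eq_square divide_inverse[symmetric] mult_ac)
qed

lemma closed_obox: "closed (obox e l)"
proof -
  have "obox e l = (\<Inter>i\<in>{1..CARD('a)}. {x. \<bar>x \<bullet> e i\<bar> \<le> l i})" by (auto simp: obox_def)
  also have "closed \<dots>" by (intro closed_INT ballI closed_Collect_le continuous_intros)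
  finally show ?thesis .
qed

lemma obox_borel [measurable]: "obox e l \<in> sets borel"
  by (rule borel_closed[OF closed_obox])

text \<open>The box is the image of the cube [-1,1]^d under the matrix with columns l_i e_i. Its
  Gram matrix is diagonal, which gives the absolute value of the determinant.\<close>

lemma emeasure_obox_wellorder:
  fixes e :: "nat \<Rightarrow> (real, 'd::{finite,wellorder}) vec"
  assumes e: "orthonormal_family e" and l: "\<And>i. i \<in> {1..CARD('d)} \<Longrightarrow> 0 < l i"
  shows "emeasure lborel (obox e l) = ennreal (\<Prod>i=1..CARD('d). 2 * l i)"
proof -
  have sv: "sv_basis (mat 1) e" using e by (simp add: orthonormal_family_sv_basis)
  obtain g :: "'d \<Rightarrow> nat" where g: "bij_betw g UNIV {1..CARD('d)}"
  proof -
    obtain h :: "nat \<Rightarrow> 'd" where h: "bij_betw h {1..CARD('d)} UNIV"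
      using ex_bij_betw_nat_finite_1[of "UNIV :: 'd set"] by auto
    show thesis by (rule that[OF bij_betw_inv_into[OF h]])
  qed
  have gm: "g i \<in> {1..CARD('d)}" for i using g by (auto simp: bij_betw_def)
  have gi: "g i = g j \<longleftrightarrow> i = j" for i j using g by (auto simp: bij_betw_def inj_on_def)
  have ee: "e (g i) \<bullet> e (g j) = (if i = j then 1 else 0)" for i j
    using e gm[of i] gm[of j] gi by (auto simp: orthonormal_family_def)
  have lp: "0 < l (g i)" for i using l gm by blast
  define M :: "((real, 'd) vec, 'd) vec" where "M = (\<chi> i j. l (g j) * e (g j) $ i)"
  have colM: "column j M = l (g j) *\<^sub>R e (g j)" for j by (simp add: M_def column_def vec_eq_iff)
  have "transpose M ** M = (\<chi> i j. if i = j then (l (g i))\<^sup>2 else 0)"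
    by (simp add: vec_eq_iff matrix_mult_transpose_dot_column colM ee power2_eq_square)
  then have "det (transpose M ** M) = (\<Prod>i\<in>UNIV. (l (g i))\<^sup>2)" by (simp add: det_diagonal)
  then have "\<bar>det M\<bar>\<^sup>2 = (\<Prod>i\<in>UNIV. l (g i))\<^sup>2"
    by (simp add: det_mul power2_eq_square prod.distrib)
  then have detM: "\<bar>det M\<bar> = (\<Prod>i\<in>UNIV. l (g i))"
    using lp by (subst (asm) power2_eq_iff_nonneg) (auto intro: prod_nonneg less_imp_le)
  have Mv: "M *v y = (\<Sum>j\<in>UNIV. (l (g j) * y $ j) *\<^sub>R e (g j))" for y
    by (simp add: vec_eq_iff M_def matrix_vector_mult_def mult_ac)
  have Mve: "(M *v y) \<bullet> e (g j) = l (g j) * y $ j" for y j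
  proof -
    have "(M *v y) \<bullet> e (g j) = (\<Sum>i\<in>UNIV. if i = j then l (g j) * y $ j else 0)"
      unfolding Mv inner_sum_left by (rule sum.cong) (auto simp: ee)
    then show ?thesis by simp
  qed
  have "obox e l = (*v) M ` cbox (- 1) 1"
  proof (intro equalityI subsetI)
    fix x assume x: "x \<in> obox e l"
    define y :: "(real, 'd) vec" where "y = (\<chi> j. (x \<bullet> e (g j)) / l (g j))"
    have "M *v y = (\<Sum>j\<in>UNIV. (x \<bullet> e (g j)) *\<^sub>R e (g j))"
      unfolding Mv by (intro sum.cong) (use lp in \<open>auto simp: y_def less_imp_neq[symmetric]\<close>)
    also have "\<dots> = (\<Sum>i=1..CARD('d). (x \<bullet> e i) *\<^sub>R e i)" by (rule sum.reindex_bij_betw[OF g])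
    also have "\<dots> = x" by (rule sv_basis_expand[OF sv, symmetric])
    finally have "x = M *v y" by simp
    moreover have "y \<in> cbox (- 1) 1"
    proof -
      have "\<bar>x \<bullet> e (g j)\<bar> \<le> l (g j)" for j using x gm[of j] by (auto simp: obox_def)
      then show ?thesis using lp by (auto simp: mem_box_cart y_def divide_simps abs_le_iff) (smt (verit))+
    qed
    ultimately show "x \<in> (*v) M ` cbox (- 1) 1" by blast
  next
    fix x assume "x \<in> (*v) M ` cbox (- 1) 1"
    then obtain y where y: "y \<in> cbox (- 1) 1" "x = M *v y" by blast
    show "x \<in> obox e l"
      unfolding obox_def
    proof (intro CollectI ballI)
      fix i assume "i \<in> {1..CARD('d)}"
      then have "i \<in> range g" using g by (simp add: bij_betw_def)
      then obtain j where j: "i = g j" by blast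
      have "\<bar>y $ j\<bar> \<le> 1" using y(1) by (auto simp: mem_box_cart abs_le_iff minus_le_iff)
      then have "l i * \<bar>y $ j\<bar> \<le> l i * 1" using lp[of j] j by (intro mult_left_mono) auto
      then show "\<bar>x \<bullet> e i\<bar> \<le> l i" using lp[of j] by (simp add: y(2) j Mve abs_mult)
    qed
  qed
  moreover have cube: "measure lebesgue (cbox (- 1) (1 :: (real, 'd) vec)) = 2 ^ CARD('d)"
  proof -
    have "measure lebesgue (cbox (- 1) (1 :: (real, 'd) vec)) = (\<Prod>b\<in>Basis. (1 :: (real, 'd) vec) \<bullet> b - (- 1) \<bullet> b)"
      unfolding measure_completion[OF borel_closed[OF closed_cbox, folded sets_lborel]] 
      by (rule content_cbox) (auto simp: Basis_vec_def inner_axis)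
    also have "\<dots> = (\<Prod>b\<in>(Basis :: ((real, 'd) vec) set). 2)"
      by (intro prod.cong) (auto simp: Basis_vec_def inner_axis)
    also have "\<dots> = 2 ^ CARD('d)" by simp
    finally show ?thesis .
  qed
  moreover have "measure lebesgue ((*v) M ` cbox (- 1) 1)
      = \<bar>det (matrix ((*v) M))\<bar> * measure lebesgue (cbox (- 1) (1 :: (real, 'd) vec))"
    by (rule measure_linear_image) auto
  ultimately have m: "measure lebesgue (obox e l) = \<bar>det M\<bar> * 2 ^ CARD('d)"
    by (simp only: cube matrix_of_matrix_vector_mul)
  have "obox e l \<in> lmeasurable"
    unfolding \<open>obox e l = (*v) M ` cbox (- 1) 1\<close> by (intro measurable_linear_image) auto
  then have "emeasure lebesgue (obox e l) \<noteq> top" by (rule fmeasurableD2)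
  then have "emeasure lebesgue (obox e l) = ennreal (\<bar>det M\<bar> * 2 ^ CARD('d))"
    unfolding m[symmetric] by (rule emeasure_eq_ennreal_measure)
  also have "\<bar>det M\<bar> * 2 ^ CARD('d) = (\<Prod>i\<in>UNIV. 2 * l (g i))"
    by (simp add: detM prod.distrib)
  also have "\<dots> = (\<Prod>i=1..CARD('d). 2 * l i)" by (rule prod.reindex_bij_betw[OF g])
  finally show ?thesis by simp
qed

text \<open>The library computes the volume of a linear image only for well-ordered index types; a copy of
  the index type with a well-order transfers the result to an arbitrary one.\<close>

typedef 'a windex = "UNIV :: 'a set" ..

instance windex :: (finite) finite
proof
  have "(UNIV :: 'a windex set) = range Abs_windex" by (metis Abs_windex_cases surjI)
  then show "finite (UNIV :: 'a windex set)" by (metis finite finite_imageI)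
qed

definition windex_rank :: "'a::finite windex \<Rightarrow> nat" where
  "windex_rank = (SOME f. inj f)"

lemma inj_windex_rank: "inj windex_rank"
proof -
  have "\<exists>f :: 'a windex \<Rightarrow> nat. inj f" using finite_imp_inj_to_nat_seg[of "UNIV :: 'a windex set"] by auto
  then show ?thesis unfolding windex_rank_def by (rule someI_ex)
qed

instantiation windex :: (finite) wellorder
begin

definition less_eq_windex :: "'a windex \<Rightarrow> 'a windex \<Rightarrow> bool" where
  "less_eq_windex x y \<longleftrightarrow> windex_rank x \<le> windex_rank y"

definition less_windex :: "'a windex \<Rightarrow> 'a windex \<Rightarrow> bool" where
  "less_windex x y \<longleftrightarrow> windex_rank x < windex_rank y"

instance
proof
  fix P :: "'a windex \<Rightarrow> bool" and a :: "'a windex"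
  assume step: "\<And>x. (\<And>y. y < x \<Longrightarrow> P y) \<Longrightarrow> P x"
  show "P a"
  proof (induction "windex_rank a" arbitrary: a rule: less_induct)
    case less
    show ?case by (rule step) (simp add: less less_windex_def)
  qed
qed (use inj_windex_rank in \<open>auto simp: less_eq_windex_def less_windex_def inj_def\<close>)

end

lemma emeasure_obox:
  fixes e :: "nat \<Rightarrow> real^'d"
  assumes e: "orthonormal_family e" and l: "\<And>i. i \<in> {1..CARD('d)} \<Longrightarrow> 0 < l i"
  shows "emeasure lborel (obox e l) = ennreal (\<Prod>i=1..CARD('d). 2 * l i)"
proof -
  \<comment> \<open>Relabelling the coordinates is an isometry onto the space over the ordered index
    type; comparing boxes shows that it preserves Lebesgue measure.\<close>
  define h :: "real^'d \<Rightarrow> real^'d windex" where "h x = (\<chi> i. x $ Rep_windex i)" for x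
  have bij: "bij (Rep_windex :: 'd windex \<Rightarrow> 'd)"
    by (metis Abs_windex_inverse Rep_windex_inverse UNIV_I bijI')
  have card: "CARD('d windex) = CARD('d)" using bij bij_betw_same_card by blast
  have inner_h: "h x \<bullet> h y = x \<bullet> y" for x y
    unfolding inner_vec_def h_def
    using sum.reindex_bij_betw[OF bij, of "\<lambda>i. x $ i \<bullet> y $ i"] by simp
  have "continuous_on UNIV h" unfolding h_def by (intro continuous_intros)
  then have [measurable]: "h \<in> borel_measurable borel" by (rule borel_measurable_continuous_onI)
  have prod_Basis: "(\<Prod>b\<in>Basis. (u - l) \<bullet> b) = (\<Prod>i\<in>UNIV. (u - l) $ i)" for u l :: "real^'k"
  proof -
    have B: "(Basis :: (real^'k) set) = range (\<lambda>i. axis i 1)" by (auto simp: Basis_vec_def)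
    have "inj (\<lambda>i. axis i (1 :: real) :: real^'k)" by (auto simp: inj_def axis_eq_axis)
    then show ?thesis unfolding B by (subst prod.reindex) (auto simp: inner_axis)
  qed
  have "lborel = distr lborel borel h"
  proof (rule lborel_eqI)
    fix l u :: "real^'d windex"
    assume lu: "\<And>b. b \<in> Basis \<Longrightarrow> l \<bullet> b \<le> u \<bullet> b"
    define k :: "real^'d windex \<Rightarrow> real^'d" where "k x = (\<chi> i. x $ Abs_windex i)" for x
    have lu': "l $ i \<le> u $ i" for i using lu[of "axis i 1"] by (simp add: inner_axis)
    have "h -` box l u = box (k l) (k u)"
      unfolding h_def k_def box_def
      by (auto simp: Basis_vec_def inner_axis) (metis Abs_windex_inverse Rep_windex_inverse UNIV_I)+
    then have "emeasure (distr lborel borel h) (box l u) = emeasure lborel (box (k l) (k u))"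
      by (simp add: emeasure_distr)
    also have "\<dots> = (\<Prod>b\<in>Basis. (k u - k l) \<bullet> b)"
      using lu' by (intro emeasure_lborel_box) (auto simp: Basis_vec_def inner_axis k_def)
    also have "(\<Prod>b\<in>Basis. (k u - k l) \<bullet> b) = (\<Prod>b\<in>Basis. (u - l) \<bullet> b)"
      unfolding prod_Basis k_def
      using prod.reindex_bij_betw[OF bij, of "\<lambda>i. (u - l) $ Abs_windex i"] by (simp add: Rep_windex_inverse)
    finally show "emeasure (distr lborel borel h) (box l u) = ennreal (\<Prod>b\<in>Basis. (u - l) \<bullet> b)" .
  qed simp
  then have "emeasure lborel (obox (h \<circ> e) l) = emeasure (distr lborel borel h) (obox (h \<circ> e) l)" by simp
  also have "\<dots> = emeasure lborel (h -` obox (h \<circ> e) l)" by (simp add: emeasure_distr)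
  also have "h -` obox (h \<circ> e) l = obox e l" by (simp add: obox_def inner_h card)
  finally have "emeasure lborel (obox e l) = emeasure lborel (obox (h \<circ> e) l)" by (rule sym)
  also have "\<dots> = ennreal (\<Prod>i=1..CARD('d). 2 * l i)"
    using e l by (subst emeasure_obox_wellorder) (auto simp: card orthonormal_family_def inner_h)
  finally show ?thesis .
qed

text \<open>Along the i-th right singular vector such a y is bounded both by R and by r over the
  i-th singular value. The resulting box has volume of order r^d over
  \<open>sv_max_prod A r\<close>, and \<open>sv_fun_le_max_prod\<close> converts this into r^s /
  psi^s(A).\<close>

lemma emeasure_linear_preimage_ball:
  fixes A :: "real^'d^'d" and s :: real
  assumes A: "invertible A" and s: "0 \<le> s" "s \<le> CARD('d)" and r: "0 < r" and R: "1 \<le> R"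
  shows "emeasure lborel {y. norm y \<le> R \<and> norm (A *v y) \<le> r} \<le>
    ennreal ((2 * R) ^ CARD('d) * (r powr s / sv_fun s A))"
proof -
  obtain v where v: "sv_basis A v" using sv_basis_exists by blast
  have on: "orthonormal_family v" by (rule sv_basis_orthonormal[OF v])
  \<comment> \<open>One expression covers both bounds up to the factor R; the hypothesis R \<ge> 1
    is what allows this.\<close>
  define l where "l i = R * (r / max (sing_val A i) r)" for i
  have l0: "0 < l i" for i using r R by (auto simp: l_def)
  have "{y. norm y \<le> R \<and> norm (A *v y) \<le> r} \<subseteq> obox v l"
  proof (clarsimp simp: obox_def)
    fix y i assume y: "norm y \<le> R" "norm (A *v y) \<le> r" and i: "Suc 0 \<le> i" "i \<le> CARD('d)"
    have a: "0 < sing_val A i" using sing_val_pos[OF A] i by auto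
    have "(sing_val A i * (y \<bullet> v i))\<^sup>2 \<le> (\<Sum>i=1..CARD('d). (sing_val A i)\<^sup>2 * (y \<bullet> v i)\<^sup>2)"
      using i by (subst power_mult_distrib, intro member_le_sum[of i _ "\<lambda>i. (sing_val A i)\<^sup>2 * (y \<bullet> v i)\<^sup>2"]) auto
    then have "(sing_val A i * (y \<bullet> v i))\<^sup>2 \<le> (norm (A *v y))\<^sup>2" using sv_basis_image_norm[OF v, of y] by simp
    then have "\<bar>sing_val A i * (y \<bullet> v i)\<bar> \<le> \<bar>norm (A *v y)\<bar>" by (simp only: abs_le_square_iff)
    then have 1: "sing_val A i * \<bar>y \<bullet> v i\<bar> \<le> r" using y a by (simp add: abs_mult)
    have "norm (v i) = 1" using sv_basis_inner[OF v, of i i] i by (simp add: norm_eq_1)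
    then have 2: "\<bar>y \<bullet> v i\<bar> \<le> R" using Cauchy_Schwarz_ineq2[of y "v i"] y by simp
    show "\<bar>y \<bullet> v i\<bar> \<le> l i"
    proof (cases "sing_val A i \<le> r")
      case True
      then show ?thesis using 2 r by (simp add: l_def max_def)
    next
      case False
      have "\<bar>y \<bullet> v i\<bar> \<le> 1 * (r / sing_val A i)" using 1 a by (simp add: field_simps)
      also have "\<dots> \<le> R * (r / sing_val A i)" using R r a by (intro mult_right_mono) auto
      finally show ?thesis using False by (simp add: l_def max_def)
    qed
  qed
  then have "emeasure lborel {y. norm y \<le> R \<and> norm (A *v y) \<le> r} \<le> emeasure lborel (obox v l)"
    by (intro emeasure_mono) auto
  also have "\<dots> = ennreal (\<Prod>i=1..CARD('d). 2 * l i)" using l0 by (intro emeasure_obox on)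
  also have "(\<Prod>i=1..CARD('d). 2 * l i) = (2 * R) ^ CARD('d) * (r ^ CARD('d) / sv_max_prod A r)"
    by (simp add: l_def prod.distrib prod_dividef sv_max_prod_def power_mult_distrib)
  also have "r ^ CARD('d) / sv_max_prod A r \<le> r powr s / sv_fun s A"
  proof -
    have "sv_fun s A * r ^ CARD('d) = (sv_fun s A * r powr (real CARD('d) - s)) * r powr s"
      using r by (simp add: powr_add[symmetric] powr_realpow mult.assoc)
    also have "\<dots> \<le> sv_max_prod A r * r powr s"
      by (intro mult_right_mono sv_fun_le_max_prod A s r) auto
    finally show ?thesis
      using sv_fun_pos[OF A s(1)] sv_max_prod_pos[OF r, of A] by (simp add: field_simps)
  qed
  then have "(2 * R) ^ CARD('d) * (r ^ CARD('d) / sv_max_prod A r) \<le> (2 * R) ^ CARD('d) * (r powr s / sv_fun s A)"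
    using R by (intro mult_left_mono) auto
  finally show ?thesis by (simp add: ennreal_leI)
qed

text \<open>A point of the thickened ellipsoid of \<open>A ** B\<close> has the form A (B k) plus a
  vector of norm at most \<rho> r. Moving B k by at most \<rho> keeps y in the thickened ellipsoid
  of B and x - A y in that of A scaled by \<rho>. Integrating over x bounds the product of the
  volume of L and that of a \<rho>-ball by the product of the volumes of U and U'.\<close>

lemma sv_max_prod_mult_le:
  fixes A B :: "real^'d^'d"
  assumes A: "invertible A" and B: "invertible B" and r: "0 < r" "0 < \<rho>"
  shows "sv_max_prod (A ** B) (\<rho> * r) \<le>
    (8 * (real CARD('d))\<^sup>2) ^ CARD('d) * sv_max_prod A r * sv_max_prod B \<rho>"
proof -
  let ?d = "CARD('d)"
  define D where "D = real ?d"
  have D: "1 \<le> D" by (simp add: D_def Suc_leI)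
  have AB: "invertible (A ** B)" using A B by (simp add: invertible_mult)
  obtain v where v: "sv_basis (A ** B) v" using sv_basis_exists by blast
  obtain va where va: "sv_basis A va" using sv_basis_exists by blast
  obtain vb where vb: "sv_basis B vb" using sv_basis_exists by blast
  define e where "e i = (A ** B *v v i) /\<^sub>R sing_val (A ** B) i" for i
  define ea where "ea i = (A *v va i) /\<^sub>R sing_val A i" for i
  define eb where "eb i = (B *v vb i) /\<^sub>R sing_val B i" for i
  have on: "orthonormal_family e" "orthonormal_family ea" "orthonormal_family eb"
    unfolding e_def ea_def eb_def by (intro sv_basis_image_orthonormal v va vb A B AB)+
  \<comment> \<open>The division by the dimension makes the vectors k and k' below, sums of at most
    d orthogonal pieces, have norm at most 1 and \<rho> r.\<close>
  define L where "L = obox e (\<lambda>i. max (sing_val (A ** B) i) (\<rho> * r) / D)"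
  define U where "U = obox eb (\<lambda>i. 2 * max (sing_val B i) \<rho>)"
  define U' where "U' = obox ea (\<lambda>i. 2 * \<rho> * max (sing_val A i) r)"
  define c where "c = emeasure lborel (cball (0 :: real^'d) \<rho>)"
  have [measurable]: "L \<in> sets borel" "U \<in> sets borel" "U' \<in> sets borel"
    unfolding L_def U_def U'_def by measurable
  have image_coord: "\<bar>(M *v x) \<bullet> ((M *v w i) /\<^sub>R sing_val M i)\<bar> \<le> sing_val M i"
    if "sv_basis M w" "invertible M" "norm x \<le> 1" "i \<in> {1..?d}" for M :: "real^'d^'d" and w x i
  proof -
    have "sing_val M i * norm x \<le> sing_val M i * 1"
      using that sing_val_pos[OF that(2)] by (intro mult_left_mono) (auto intro: less_imp_le)
    with sv_basis_image_coord[OF that(1,2,4), of x] show ?thesis by linarith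
  qed
  have unit_coord: "\<bar>y \<bullet> f i\<bar> \<le> norm y" if "orthonormal_family f" "i \<in> {1..?d}" for f :: "nat \<Rightarrow> real^'d" and y i
    using Cauchy_Schwarz_ineq2[of y "f i"] that by (auto simp: orthonormal_family_def norm_eq_sqrt_inner)
  have key: "indicator L x * c \<le> (\<integral>\<^sup>+y. indicator U y * indicator U' (x - A *v y) \<partial>lborel)" for x
  proof (cases "x \<in> L")
    case True
    \<comment> \<open>On axes longer than \<rho> r the point is reached by k in the unit ball; the
      coordinates on the short axes go into the error k'.\<close>
    define I where "I = {i\<in>{1..?d}. sing_val (A ** B) i \<ge> \<rho> * r}"
    define k where "k = (\<Sum>i\<in>I. ((x \<bullet> e i) / sing_val (A ** B) i) *\<^sub>R v i)"
    define k' where "k' = (\<Sum>i\<in>{1..?d} - I. (x \<bullet> e i) *\<^sub>R e i)"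
    have xi: "\<bar>x \<bullet> e i\<bar> \<le> max (sing_val (A ** B) i) (\<rho> * r) / D" if "i \<in> {1..?d}" for i
      using True that by (auto simp: L_def obox_def)
    have pos: "0 < sing_val (A ** B) i" if "i \<in> {1..?d}" for i using sing_val_pos[OF AB] that by auto
    have "norm k \<le> (\<Sum>i\<in>I. 1 / D)"
      unfolding k_def
    proof (rule sum_norm_le)
      fix i assume i: "i \<in> I"
      have "norm (v i) = 1" using sv_basis_inner[OF v, of i i] i by (simp add: norm_eq_1 I_def)
      then show "norm (((x \<bullet> e i) / sing_val (A ** B) i) *\<^sub>R v i) \<le> 1 / D"
        using xi[of i] i pos[of i] D by (simp add: I_def max.absorb1 field_simps)
    qed
    also have "\<dots> \<le> (\<Sum>i\<in>{1..?d}. 1 / D)" using D by (intro sum_mono2) (auto simp: I_def)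
    finally have k: "norm k \<le> 1" using D by (simp add: D_def)
    have "norm k' \<le> (\<Sum>i\<in>{1..?d} - I. \<rho> * r / D)"
      unfolding k'_def
    proof (rule sum_norm_le)
      fix i assume i: "i \<in> {1..?d} - I"
      have "norm (e i) = 1" using on(1) i by (simp add: norm_eq_1 orthonormal_family_def)
      then show "norm ((x \<bullet> e i) *\<^sub>R e i) \<le> \<rho> * r / D"
        using xi[of i] i by (simp add: I_def max_def split: if_splits)
    qed
    also have "\<dots> \<le> (\<Sum>i\<in>{1..?d}. \<rho> * r / D)" using D r by (intro sum_mono2) auto
    finally have k': "norm k' \<le> \<rho> * r" using D by (simp add: D_def)
    have "A ** B *v k = (\<Sum>i\<in>I. (x \<bullet> e i) *\<^sub>R e i)"
      unfolding k_def linear_sum[OF matrix_vector_mul_linear]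
      by (intro sum.cong) (auto simp: matrix_vector_mult_scaleR e_def divide_inverse)
    then have "A ** B *v k + k' = (\<Sum>i\<in>{1..?d}. (x \<bullet> e i) *\<^sub>R e i)"
      unfolding k'_def by (subst (2) sum.subset_diff[of I]) (auto simp: I_def)
    also have "\<dots> = x"
      using sv_basis_expand[of "mat 1" e x] on(1) by (simp add: orthonormal_family_sv_basis)
    finally have x: "x = A *v (B *v k) + k'" by (simp add: matrix_vector_mul_assoc)
    have "cball (B *v k) \<rho> \<subseteq> {y. y \<in> U \<and> x - A *v y \<in> U'}"
    proof (intro subsetI CollectI conjI)
      fix y assume "y \<in> cball (B *v k) \<rho>"
      then have t: "norm (y - B *v k) \<le> \<rho>" by (simp add: dist_norm norm_minus_commute)
      show "y \<in> U"
        unfolding U_def obox_def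
      proof (intro CollectI ballI)
        fix i assume i: "i \<in> {1..?d}"
        have "\<bar>(B *v k) \<bullet> eb i\<bar> \<le> sing_val B i" unfolding eb_def by (rule image_coord[OF vb B k i])
        moreover have "\<bar>(y - B *v k) \<bullet> eb i\<bar> \<le> \<rho>" using unit_coord[OF on(3) i] t order_trans by blast
        ultimately show "\<bar>y \<bullet> eb i\<bar> \<le> 2 * max (sing_val B i) \<rho>" by (simp add: inner_diff_left)
      qed
      show "x - A *v y \<in> U'"
        unfolding U'_def obox_def
      proof (intro CollectI ballI)
        fix i assume i: "i \<in> {1..?d}"
        define t where "t = (y - B *v k) /\<^sub>R \<rho>"
        have "norm t = norm (y - B *v k) / \<rho>" using r by (simp add: t_def divide_inverse mult.commute)
        then have "norm t \<le> 1" using t r by simp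
        then have "\<bar>(A *v t) \<bullet> ea i\<bar> \<le> sing_val A i" unfolding ea_def by (rule image_coord[OF va A _ i])
        then have 1: "\<rho> * \<bar>(A *v t) \<bullet> ea i\<bar> \<le> \<rho> * sing_val A i" using r by simp
        have "x - A *v y = k' - \<rho> *\<^sub>R (A *v t)"
          using r by (simp add: x t_def matrix_vector_mult_scaleR matrix_vector_mult_diff_distrib)
        then have 2: "(x - A *v y) \<bullet> ea i = k' \<bullet> ea i - \<rho> * ((A *v t) \<bullet> ea i)"
          by (simp add: inner_diff_left)
        have 3: "\<bar>\<rho> * ((A *v t) \<bullet> ea i)\<bar> = \<rho> * \<bar>(A *v t) \<bullet> ea i\<bar>" using r by (simp add: abs_mult)
        have 4: "\<bar>k' \<bullet> ea i\<bar> \<le> \<rho> * r" using unit_coord[OF on(2) i, of k'] k' by linarith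
        have "\<bar>(x - A *v y) \<bullet> ea i\<bar> \<le> \<rho> * r + \<rho> * sing_val A i"
          using abs_triangle_ineq4[of "k' \<bullet> ea i" "\<rho> * ((A *v t) \<bullet> ea i)"]
          unfolding 2 using 1 3 4 by linarith
        also have "\<dots> \<le> \<rho> * max (sing_val A i) r + \<rho> * max (sing_val A i) r"
          using r by (intro add_mono mult_left_mono) auto
        finally show "\<bar>(x - A *v y) \<bullet> ea i\<bar> \<le> 2 * \<rho> * max (sing_val A i) r" by simp
      qed
    qed
    then have sub: "indicator (cball (B *v k) \<rho>) y \<le> (indicator U y * indicator U' (x - A *v y) :: ennreal)" for y
      by (auto simp: indicator_def)
    have "c = emeasure lborel (cball (B *v k) \<rho>)"
      unfolding c_def using r by (simp add: emeasure_cball)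
    also have "\<dots> = (\<integral>\<^sup>+y. indicator (cball (B *v k) \<rho>) y \<partial>lborel)" by simp
    also have "\<dots> \<le> (\<integral>\<^sup>+y. indicator U y * indicator U' (x - A *v y) \<partial>lborel)"
      by (intro nn_integral_mono sub)
    finally show ?thesis using True by simp
  qed simp
  have cont: "continuous_on UNIV (\<lambda>p. fst p - A *v snd p)"
    by (intro continuous_intros continuous_on_compose2[OF matrix_vector_mult_linear_continuous_on]) auto
  then have [measurable]: "(\<lambda>p. fst p - A *v snd p) \<in> borel_measurable borel"
    by (rule borel_measurable_continuous_onI)
  have [measurable]: "(\<lambda>(x, y). x - A *v y) \<in> borel_measurable (lborel \<Otimes>\<^sub>M lborel)"
  proof -
    have "(\<lambda>(x, y). x - A *v y) = (\<lambda>p. fst p - A *v snd p)" by auto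
    then show ?thesis by (simp add: lborel_prod)
  qed
  have "emeasure lborel L * c = (\<integral>\<^sup>+x. indicator L x * c \<partial>lborel)"
    by (simp add: nn_integral_multc)
  also have "\<dots> \<le> (\<integral>\<^sup>+x. \<integral>\<^sup>+y. indicator U y * indicator U' (x - A *v y) \<partial>lborel \<partial>lborel)"
    by (intro nn_integral_mono key)
  \<comment> \<open>After the exchange the inner integral over x is a translate of U', so the double
    integral factors.\<close>
  also have "\<dots> = (\<integral>\<^sup>+y. \<integral>\<^sup>+x. indicator U y * indicator U' (x - A *v y) \<partial>lborel \<partial>lborel)"
    by (rule lborel_pair.Fubini'[symmetric]) measurable
  also have "\<dots> = (\<integral>\<^sup>+y. indicator U y * emeasure lborel U' \<partial>lborel)"
  proof (rule nn_integral_cong)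
    fix y
    have "(\<integral>\<^sup>+x. indicator U' (x - A *v y) \<partial>lborel) = (\<integral>\<^sup>+x. indicator U' x \<partial>distr lborel borel ((+) (- (A *v y))))"
      by (subst nn_integral_distr) auto
    also have "\<dots> = emeasure lborel U'" by (simp add: lborel_distr_plus)
    finally have "(\<integral>\<^sup>+x. indicator U' (x - A *v y) \<partial>lborel) = emeasure lborel U'" .
    then show "(\<integral>\<^sup>+x. indicator U y * indicator U' (x - A *v y) \<partial>lborel) = indicator U y * emeasure lborel U'"
      by (subst nn_integral_cmult) auto
  qed
  also have "\<dots> = emeasure lborel U * emeasure lborel U'" by (simp add: nn_integral_multc)
  finally have main: "emeasure lborel L * c \<le> emeasure lborel U * emeasure lborel U'" .
  \<comment> \<open>A box inscribed in the \<rho>-ball bounds its volume from below by an explicit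
    number, so that all four volumes are products of side lengths.\<close>
  have "obox e (\<lambda>i. \<rho> / D) \<subseteq> cball 0 \<rho>"
  proof
    fix x assume x: "x \<in> obox e (\<lambda>i. \<rho> / D)"
    have "norm x = norm (\<Sum>i=1..?d. (x \<bullet> e i) *\<^sub>R e i)"
      using sv_basis_expand[of "mat 1" e x] on(1) by (simp add: orthonormal_family_sv_basis)
    also have "\<dots> \<le> (\<Sum>i=1..?d. \<rho> / D)"
    proof (rule sum_norm_le)
      fix i assume i: "i \<in> {1..?d}"
      have "norm (e i) = 1" using on(1) i by (simp add: norm_eq_1 orthonormal_family_def)
      then show "norm ((x \<bullet> e i) *\<^sub>R e i) \<le> \<rho> / D" using x i by (simp add: obox_def)
    qed
    also have "\<dots> = \<rho>" using D by (simp add: D_def)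
    finally show "x \<in> cball 0 \<rho>" by simp
  qed
  then have "emeasure lborel (obox e (\<lambda>i. \<rho> / D)) \<le> c" unfolding c_def by (intro emeasure_mono) auto
  then have "ennreal ((2 * (\<rho> / D)) ^ ?d) \<le> c"
    using emeasure_obox[OF on(1), of "\<lambda>i. \<rho> / D"] r D by simp
  then have "emeasure lborel L * ennreal ((2 * (\<rho> / D)) ^ ?d) \<le> emeasure lborel U * emeasure lborel U'"
    using main by (meson mult_left_mono order_trans zero_le)
  also have "emeasure lborel L = ennreal ((2 / D) ^ ?d * sv_max_prod (A ** B) (\<rho> * r))"
    unfolding L_def using r D
    by (subst emeasure_obox[OF on(1)])
      (auto simp: sv_max_prod_def power_divide prod.distrib prod_dividef less_max_iff_disj)
  also have "emeasure lborel U = ennreal (4 ^ ?d * sv_max_prod B \<rho>)"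
    unfolding U_def using r by (subst emeasure_obox[OF on(3)]) (auto simp: sv_max_prod_def prod.distrib less_max_iff_disj)
  also have "emeasure lborel U' = ennreal ((4 * \<rho>) ^ ?d * sv_max_prod A r)"
    unfolding U'_def using r
    by (subst emeasure_obox[OF on(2)]) (auto simp: sv_max_prod_def prod.distrib less_max_iff_disj power_mult_distrib mult.assoc)
  finally have "ennreal ((2 / D) ^ ?d * sv_max_prod (A ** B) (\<rho> * r) * (2 * (\<rho> / D)) ^ ?d) \<le>
      ennreal (4 ^ ?d * sv_max_prod B \<rho> * ((4 * \<rho>) ^ ?d * sv_max_prod A r))"
    using r D sv_max_prod_pos[of "\<rho> * r" "A ** B"] sv_max_prod_pos[of \<rho> B] sv_max_prod_pos[of r A]
    by (subst (asm) (1 2) ennreal_mult[symmetric]) auto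
  then have le: "(2 / D) ^ ?d * sv_max_prod (A ** B) (\<rho> * r) * (2 * (\<rho> / D)) ^ ?d \<le>
      4 ^ ?d * sv_max_prod B \<rho> * ((4 * \<rho>) ^ ?d * sv_max_prod A r)"
    using r D sv_max_prod_pos[of \<rho> B] sv_max_prod_pos[of r A] by (subst (asm) ennreal_le_iff) auto
  \<comment> \<open>Multiplying by this factor clears the coefficient on the left and leaves (4
    D^2)^d on the right, which is rounded up.\<close>
  let ?k = "(D\<^sup>2 / (4 * \<rho>)) ^ ?d"
  have "?k * ((2 / D) ^ ?d * sv_max_prod (A ** B) (\<rho> * r) * (2 * (\<rho> / D)) ^ ?d) =
      sv_max_prod (A ** B) (\<rho> * r) * (D\<^sup>2 / (4 * \<rho>) * (2 / D) * (2 * (\<rho> / D))) ^ ?d"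
    by (simp only: power_mult_distrib mult_ac)
  also have "D\<^sup>2 / (4 * \<rho>) * (2 / D) * (2 * (\<rho> / D)) = 1"
    using D r by (simp add: power2_eq_square field_simps)
  finally have "sv_max_prod (A ** B) (\<rho> * r) \<le> ?k * (4 ^ ?d * sv_max_prod B \<rho> * ((4 * \<rho>) ^ ?d * sv_max_prod A r))"
    using mult_left_mono[OF le, of ?k] r
    by (simp only: power_one mult_1_right) (simp only: zero_le_power zero_le_divide_iff zero_le_power2 mult_nonneg_nonneg less_imp_le zero_le_numeral simp_thms)
  also have "\<dots> = (D\<^sup>2 / (4 * \<rho>) * 4 * (4 * \<rho>)) ^ ?d * sv_max_prod A r * sv_max_prod B \<rho>"
    by (simp only: power_mult_distrib mult_ac)
  also have "D\<^sup>2 / (4 * \<rho>) * 4 * (4 * \<rho>) = 4 * D\<^sup>2" using r by simp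
  also have "(4 * D\<^sup>2) ^ ?d * sv_max_prod A r * sv_max_prod B \<rho> \<le>
      (8 * D\<^sup>2) ^ ?d * sv_max_prod A r * sv_max_prod B \<rho>"
    using r by (intro mult_right_mono power_mono less_imp_le[OF sv_max_prod_pos]) auto
  finally show ?thesis by (simp add: D_def)
qed

section \<open>Sums over words\<close>

abbreviation words :: "nat \<Rightarrow> 'n list set" where
  "words k \<equiv> {u. length u = k}"

lemma sum_words_append:
  fixes f :: "'n::finite list \<Rightarrow> 'a::comm_monoid_add"
  shows "(\<Sum>u\<in>words (j + k). f u) = (\<Sum>u\<in>words j. \<Sum>v\<in>words k. f (u @ v))"
proof -
  have "(\<Sum>u\<in>words j. \<Sum>v\<in>words k. f (u @ v)) = (\<Sum>(u, v)\<in>words j \<times> words k. f (u @ v))"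
    by (rule sum.cartesian_product)
  also have "\<dots> = (\<Sum>u\<in>words (j + k). f u)"
    by (rule sum.reindex_bij_witness[of _ "\<lambda>u. (take j u, drop j u)" "\<lambda>(u, v). u @ v"]) auto
  finally show ?thesis by simp
qed

lemma sum_words_1: "(\<Sum>u\<in>words 1. f u) = (\<Sum>i\<in>UNIV. f [i])"
  by (rule sum.reindex_bij_witness[of _ "\<lambda>i. [i]" hd]) (auto simp: length_Suc_conv)

lemma sum_words_Suc: "(\<Sum>u\<in>words (Suc k). f u) = (\<Sum>i\<in>UNIV. \<Sum>v\<in>words k. f (i # v))"
  for f :: "'n::finite list \<Rightarrow> 'a::comm_monoid_add"
  using sum_words_append[of f 1 k] sum_words_1[of "\<lambda>u. \<Sum>v\<in>words k. f (u @ v)"] by simp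

lemma word_prob_append [simp]: "word_prob p (u @ v) = word_prob p u * word_prob p v"
  by (simp add: word_prob_def)

lemma word_prob_Nil [simp]: "word_prob p [] = 1"
  by (simp add: word_prob_def)

lemma word_prob_nonneg [simp]: "0 \<le> word_prob p u"
  by (auto simp: word_prob_def intro!: prod_list_nonneg)

lemma sum_word_prob: "(\<Sum>u\<in>words k. word_prob p u) = 1"
  for p :: "'n::finite pmf"
proof (induction k)
  case (Suc k)
  have "(\<Sum>u\<in>words (Suc k). word_prob p u) = (\<Sum>i\<in>UNIV. pmf p i * (\<Sum>v\<in>words k. word_prob p v))"
    unfolding sum_words_Suc by (simp add: word_prob_def sum_distrib_left)
  also have "\<dots> = 1" using sum_pmf_eq_1[of UNIV p] by (simp add: Suc)
  finally show ?case .
qed simp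

lemma word_prob_le_1: "word_prob p u \<le> 1"
  for p :: "'n::finite pmf"
  unfolding word_prob_def by (induction u) (auto intro!: mult_le_one prod_list_nonneg pmf_le_1)

text \<open>A finite cross-section of the word tree. Besides the sets \<open>cut_set T s r\<close>
  this covers the trivial cut \<open>{[]}\<close>, which is used for the bound by the dimension of
  the space.\<close>

definition is_cut :: "'n list set \<Rightarrow> bool" where
  "is_cut S \<longleftrightarrow> finite S \<and> (\<forall>x. \<exists>!k. prefix_word x k \<in> S)"

text \<open>Padding to an infinite word makes the condition on infinite words in
  \<open>is_cut\<close> applicable to finite words; the letters after the end are arbitrary.\<close>

definition word_extend :: "'n list \<Rightarrow> nat \<Rightarrow> 'n" where
  "word_extend u i = (if i < length u then u ! i else undefined)"

lemma prefix_word_extend: "k \<le> length u \<Longrightarrow> prefix_word (word_extend u) k = take k u"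
  by (auto simp: prefix_word_def word_extend_def intro!: nth_equalityI)

lemma length_prefix_word [simp]: "length (prefix_word x k) = k"
  by (simp add: prefix_word_def)

lemma take_prefix_word: "j \<le> k \<Longrightarrow> take j (prefix_word x k) = prefix_word x j"
  by (simp add: prefix_word_def take_map)

lemma cut_prefix_free:
  assumes "is_cut S" "u \<in> S" "k < length u"
  shows "take k u \<notin> S"
proof
  assume "take k u \<in> S"
  then have "prefix_word (word_extend u) k \<in> S" "prefix_word (word_extend u) (length u) \<in> S"
    using assms by (simp_all add: prefix_word_extend)
  then show False using assms(1,3) unfolding is_cut_def by (metis nat_neq_iff)
qed

lemma cut_prefix_exists:
  assumes "is_cut S" "\<And>v. v \<in> S \<Longrightarrow> length v \<le> L" "L \<le> length u"
  obtains k where "k \<le> L" "take k u \<in> S"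
proof -
  obtain k where k: "prefix_word (word_extend u) k \<in> S" using assms(1) unfolding is_cut_def by metis
  then have "k \<le> L" using assms(2) by fastforce
  then show thesis using that[of k] k assms(3) by (simp add: prefix_word_extend)
qed

text \<open>A submartingale argument. The frontier moves down the tree one level at a time: words of
  S already met stay, every other frontier word is replaced by its children, which does not lower
  the sum. At level L nothing but S is left.\<close>

lemma cut_sum_le:
  fixes g :: "'n::finite list \<Rightarrow> real"
  assumes S: "is_cut S" "\<And>v. v \<in> S \<Longrightarrow> length v \<le> L"
    and g: "\<And>u. length u < L \<Longrightarrow> g u \<le> (\<Sum>i\<in>UNIV. g (u @ [i]))"
  shows "g [] \<le> sum g S"
proof -
  \<comment> \<open>The part of the frontier at level n that has not yet reached S.\<close>
  define P where "P n = {u :: 'n list. length u = n \<and> (\<forall>k\<le>n. take k u \<notin> S)}" for n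
  have fin: "finite (P n)" for n by (rule finite_subset[OF _ finite_words[of n]]) (auto simp: P_def)
  have finS: "finite S" using S by (simp add: is_cut_def)
  have "n \<le> L \<Longrightarrow> g [] \<le> sum g {u\<in>S. length u \<le> n} + sum g (P n)" for n
  proof (induction n)
    case 0
    have eq: "{u\<in>S. length u \<le> 0} \<union> P 0 = {[]}" and disj: "{u\<in>S. length u \<le> 0} \<inter> P 0 = {}"
      by (auto simp: P_def)
    have "sum g ({u\<in>S. length u \<le> 0} \<union> P 0) = sum g {u\<in>S. length u \<le> 0} + sum g (P 0)"
      by (rule sum.union_disjoint[OF _ fin disj]) (rule finite_subset[OF _ finS], blast)
    moreover have "sum g ({u\<in>S. length u \<le> 0} \<union> P 0) = g []" unfolding eq by simp
    ultimately show ?case by linarith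
  next
    case (Suc n)
    have eq: "{u\<in>S. length u = Suc n} \<union> P (Suc n) = (\<lambda>(u, i). u @ [i]) ` (P n \<times> UNIV)"
    proof (intro equalityI subsetI)
      fix u assume u: "u \<in> {u\<in>S. length u = Suc n} \<union> P (Suc n)"
      then have "length u = Suc n" unfolding P_def by blast
      define v where "v = butlast u"
      define i where "i = last u"
      have vi: "u = v @ [i]" "length v = n"
        using \<open>length u = Suc n\<close> unfolding v_def i_def by (cases u rule: rev_cases; simp)+
      have "take k v \<notin> S" if "k \<le> n" for k
      proof -
        have "take k v = take k u" using that vi by simp
        moreover have "take k u \<notin> S" using u cut_prefix_free[OF S(1), of u k] that by (auto simp: P_def)
        ultimately show ?thesis by simp
      qed
      then have "v \<in> P n" using vi by (simp add: P_def)
      then show "u \<in> (\<lambda>(u, i). u @ [i]) ` (P n \<times> UNIV)" using vi by force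
    next
      fix u assume "u \<in> (\<lambda>(u, i). u @ [i]) ` (P n \<times> UNIV)"
      then obtain v i where vi: "u = v @ [i]" "v \<in> P n" by auto
      have "take k u \<notin> S" if "k \<le> n" for k using vi that by (auto simp: P_def)
      then show "u \<in> {u\<in>S. length u = Suc n} \<union> P (Suc n)"
        using vi by (auto simp: P_def le_Suc_eq)
    qed
    have "sum g (P n) \<le> (\<Sum>u\<in>P n. \<Sum>i\<in>UNIV. g (u @ [i]))"
      using g Suc.prems by (intro sum_mono) (auto simp: P_def)
    also have "\<dots> = sum g ((\<lambda>(u, i). u @ [i]) ` (P n \<times> UNIV))"
      by (subst sum.reindex) (auto simp: inj_on_def sum.cartesian_product intro!: sum.cong)
    also have "\<dots> = sum g {u\<in>S. length u = Suc n} + sum g (P (Suc n))"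
      unfolding eq[symmetric] by (rule sum.union_disjoint) (use fin finS in \<open>auto simp: P_def\<close>)
    finally have 1: "sum g (P n) \<le> sum g {u\<in>S. length u = Suc n} + sum g (P (Suc n))" .
    have "{u\<in>S. length u \<le> Suc n} = {u\<in>S. length u \<le> n} \<union> {u\<in>S. length u = Suc n}" by auto
    then have "sum g {u\<in>S. length u \<le> Suc n} = sum g {u\<in>S. length u \<le> n} + sum g {u\<in>S. length u = Suc n}"
      using finS by (simp, intro sum.union_disjoint) auto
    then show ?case using 1 Suc by simp
  qed
  from this[of L] have "g [] \<le> sum g {u\<in>S. length u \<le> L} + sum g (P L)" by simp
  moreover have "P L = {}" unfolding P_def using cut_prefix_exists[OF S] by (metis (mono_tags, lifting) Collect_empty_eq order_refl)
  moreover have "{u\<in>S. length u \<le> L} = S" using S(2) by auto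
  ultimately show ?thesis by simp
qed

lemma cut_length_bound:
  assumes "is_cut S"
  obtains L where "\<And>v. v \<in> S \<Longrightarrow> length v \<le> L"
proof -
  have "finite (length ` S)" using assms by (simp add: is_cut_def)
  then show thesis using that[of "Max (length ` S)"] by simp
qed

lemma cut_sum_eq:
  fixes g :: "'n::finite list \<Rightarrow> real"
  assumes S: "is_cut S" "\<And>v. v \<in> S \<Longrightarrow> length v \<le> L"
    and g: "\<And>u. length u < L \<Longrightarrow> g u = (\<Sum>i\<in>UNIV. g (u @ [i]))"
  shows "g [] = sum g S"
  using cut_sum_le[OF S, of g] cut_sum_le[OF S, of "\<lambda>u. - g u"] g by (simp add: sum_negf)

lemma cut_sum_word_prob:
  fixes p :: "'n::finite pmf"
  assumes S: "is_cut S"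
  shows "(\<Sum>u\<in>S. word_prob p u) = 1"
proof -
  obtain L where L: "\<And>v. v \<in> S \<Longrightarrow> length v \<le> L" using cut_length_bound[OF S] by blast
  have "word_prob p [] = (\<Sum>u\<in>S. word_prob p u)"
    by (rule cut_sum_eq[OF S L])
      (use sum_pmf_eq_1[of UNIV p] in \<open>auto simp: word_prob_def sum_distrib_left[symmetric]\<close>)
  then show ?thesis by simp
qed

text \<open>Take for g u the sum of f over all extensions of u to length n; it is additive over
  children, so \<open>cut_sum_eq\<close> applies.\<close>

lemma cut_sum_words:
  fixes f :: "'n::finite list \<Rightarrow> real"
  assumes S: "is_cut S" "\<And>v. v \<in> S \<Longrightarrow> length v \<le> L" and n: "L \<le> n"
  shows "(\<Sum>u\<in>words n. f u) = (\<Sum>w\<in>S. \<Sum>v\<in>words (n - length w). f (w @ v))"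
proof -
  let ?g = "\<lambda>u. \<Sum>v\<in>words (n - length u). f (u @ v)"
  have "?g [] = sum ?g S"
  proof (rule cut_sum_eq[OF S])
    fix u :: "'n list" assume "length u < L"
    then have "n - length u = Suc (n - length (u @ [undefined]))" using n by simp
    then show "?g u = (\<Sum>i\<in>UNIV. ?g (u @ [i]))" by (simp add: sum_words_Suc)
  qed auto
  then show ?thesis by simp
qed

text \<open>f grows only over whole blocks of length k. Summing f over all completions of u to the
  next multiple of k gives a function that obeys the one-letter inequality: it is an equality inside
  a block, and the hypothesis at its start.\<close>

lemma cut_sum_blocks:
  fixes f :: "'n::finite list \<Rightarrow> real"
  assumes S: "is_cut S" and k: "0 < k"
    and f: "\<And>u. k dvd length u \<Longrightarrow> f u \<le> (\<Sum>v\<in>words k. f (u @ v))"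
  shows "f [] \<le> (\<Sum>u\<in>S. \<Sum>v\<in>words ((k - length u mod k) mod k). f (u @ v))"
proof -
  let ?m = "\<lambda>n. (k - n mod k) mod k"
  let ?g = "\<lambda>u. \<Sum>v\<in>words (?m (length u)). f (u @ v)"
  obtain L where L: "\<And>v. v \<in> S \<Longrightarrow> length v \<le> L" using cut_length_bound[OF S] by blast
  have "?g [] \<le> sum ?g S"
  proof (rule cut_sum_le[OF S L])
    fix u :: "'n list"
    have m_Suc: "?m n = Suc (?m (Suc n))" if "\<not> k dvd n" for n
    proof -
      have "0 < n mod k" "n mod k < k" using that k by (auto simp: dvd_eq_mod_eq_0)
      then show ?thesis by (auto simp: mod_Suc)
    qed
    show "?g u \<le> (\<Sum>i\<in>UNIV. ?g (u @ [i]))"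
    proof (cases "k dvd length u")
      case True
      then have "?m (length u) = 0" "k = Suc (?m (Suc (length u)))" using k by (auto simp: mod_Suc)
      then have "(\<Sum>v\<in>words k. f (u @ v)) = (\<Sum>i\<in>UNIV. ?g (u @ [i]))"
        using sum_words_Suc[of "\<lambda>v. f (u @ v)" "?m (Suc (length u))"] by simp
      then show ?thesis using f[OF True] \<open>?m (length u) = 0\<close> by simp
    next
      case False
      show ?thesis unfolding m_Suc[OF False] by (simp add: sum_words_Suc)
    qed
  qed
  then show ?thesis by simp
qed

text \<open>Fekete's lemma for positive indices; the linear bound keeps the supremum of the
  quotients finite.\<close>

lemma superadditive_limit:
  fixes f :: "nat \<Rightarrow> real" and M :: real
  assumes super: "\<And>j k. 0 < j \<Longrightarrow> 0 < k \<Longrightarrow> f (j + k) \<ge> f j + f k" and bound: "\<And>k. f k \<le> M * k"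
  obtains l where "(\<lambda>k. f k / k) \<longlonglongrightarrow> l" "\<And>k. 0 < k \<Longrightarrow> f k \<le> l * k"
proof -
  define l where "l = (SUP k\<in>{0<..}. f k / real k)"
  have bdd: "bdd_above ((\<lambda>k. f k / real k) ` {0<..})"
    using bound by (intro bdd_aboveI2[of _ _ M]) (auto simp: divide_le_eq)
  have le: "f k / k \<le> l" if "0 < k" for k unfolding l_def using that bdd by (intro cSUP_upper) auto
  have block: "real n * f k \<le> f (n * k)" if "0 < k" "0 < n" for n k
    using that(2)
  proof (induction n rule: nat_induct_non_zero)
    case (Suc n)
    have "f k + f (n * k) \<le> f (k + n * k)" using that Suc by (intro super) auto
    then show ?case using Suc by (simp add: algebra_simps)
  qed simp
  have "(\<lambda>k. f k / k) \<longlonglongrightarrow> l"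
  proof (rule order_tendstoI)
    fix y assume y: "y < l"
    then obtain k where k: "0 < k" "y < f k / k"
      unfolding l_def using less_cSUP_iff[OF _ bdd] by auto
    define m where "m = (MIN r\<in>{..<k}. min 0 (f r))"
    have m: "m \<le> min 0 (f r)" if "r < k" for r unfolding m_def using that by (intro Min_le) auto
    have fn: "f n \<ge> real (n div k) * f k + m" if n: "n \<ge> k" for n
    proof -
      have d: "0 < n div k" using n k by (simp add: div_greater_zero_iff)
      have nk: "n div k * k + n mod k = n" by simp
      show ?thesis
      proof (cases "n mod k = 0")
        case True
        then have "n = n div k * k" using nk by simp
        then have "real (n div k) * f k \<le> f n" using block[OF k(1) d] by metis
        then show ?thesis using m[of 0] k by linarith
      next
        case False
        have "f (n div k * k) + f (n mod k) \<le> f n"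
          using super[of "n div k * k" "n mod k"] False d k by simp
        then show ?thesis using block[OF k(1) d] m[of "n mod k"] k mod_less_divisor[of k n] by linarith
      qed
    qed
    have "(\<lambda>n. real (n div k) / n) \<longlonglongrightarrow> 1 / k"
    proof (rule tendsto_sandwich[where f = "\<lambda>n :: nat. 1 / real k - 1 / real n" and h = "\<lambda>n. 1 / real k"])
      show "\<forall>\<^sub>F n in sequentially. 1 / real k - 1 / real n \<le> real (n div k) / n"
        using eventually_gt_at_top[of 0]
      proof eventually_elim
        case (elim n)
        have "n < (n div k + 1) * k" using k by (metis dividend_less_div_times mult.commute Suc_eq_plus1 mult_Suc)
        then have "real n < (real (n div k) + 1) * k" by (metis of_nat_1 of_nat_add of_nat_less_iff of_nat_mult)
        then have "real n / k - 1 \<le> real (n div k)" using k by (simp add: field_simps)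
        then have "(real n / k - 1) / n \<le> real (n div k) / n" by (rule divide_right_mono) simp
        then show ?case using elim by (simp add: diff_divide_distrib)
      qed
      show "\<forall>\<^sub>F n in sequentially. real (n div k) / n \<le> 1 / real k"
        using eventually_gt_at_top[of 0]
      proof eventually_elim
        case (elim n)
        have "real (n div k) * k \<le> n" by (metis div_times_less_eq_dividend of_nat_le_iff of_nat_mult)
        then show ?case using elim k by (simp add: field_simps)
      qed
    qed (auto intro!: tendsto_eq_intros lim_1_over_n)
    then have "(\<lambda>n. real (n div k) / n * f k + m * (1 / n)) \<longlonglongrightarrow> 1 / k * f k + m * 0"
      by (intro tendsto_add tendsto_mult tendsto_const lim_1_over_n)
    then have "\<forall>\<^sub>F n in sequentially. y < real (n div k) / n * f k + m * (1 / n)"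
      using k by (intro order_tendstoD(1)) auto
    with eventually_ge_at_top[of "max k 1"] show "\<forall>\<^sub>F n in sequentially. y < f n / n"
    proof eventually_elim
      case (elim n)
      have "(real (n div k) * f k + m) / n \<le> f n / n" using fn[of n] elim by (intro divide_right_mono) auto
      then show ?case using elim by (simp add: add_divide_distrib)
    qed
  next
    fix y assume y: "l < y"
    show "\<forall>\<^sub>F n in sequentially. f n / n < y"
      using eventually_gt_at_top[of "0 :: nat"]
    proof eventually_elim
      case (elim n)
      then show ?case using le[of n] y by linarith
    qed
  qed
  moreover have "f k \<le> l * k" if "0 < k" for k using le[OF that] that by (simp add: divide_le_eq)
  ultimately show thesis using that by blast
qed

section \<open>Growth rates of sums over words\<close>

lemma exp_scaled_at_top:
  assumes "0 < z" "0 < (y :: real)"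
  obtains l :: nat where "M \<le> z * exp (y * l)"
proof -
  obtain l :: nat where "\<bar>M\<bar> / (z * y) < l" using reals_Archimedean2 by blast
  then have "\<bar>M\<bar> \<le> z * (y * l)" using assms by (simp add: field_simps)
  also have "y * l \<le> exp (y * l)" using exp_ge_add_one_self[of "y * l"] by linarith
  then have "z * (y * l) \<le> z * exp (y * l)" using assms by (intro mult_left_mono) auto
  finally show thesis using that[of l] by linarith
qed

text \<open>What is used of psi^s(T_u): \<open>K\<close> is the quasi-submultiplicativity constant,
  and \<open>b\<close> and \<open>c\<close> bound the stretching by a single letter from below and
  above. Since c < 1, the rate of growth is strictly increasing in s.\<close>

locale word_growth =
  fixes p :: "'n::finite pmf" and \<phi> :: "real \<Rightarrow> 'n list \<Rightarrow> real" and b c :: real and K :: "real \<Rightarrow> real"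
  assumes b: "0 < b" and c: "0 < c" "c < 1" and K: "\<And>s. 0 \<le> s \<Longrightarrow> 1 \<le> K s"
    and phi_pos: "\<And>s u. 0 \<le> s \<Longrightarrow> 0 < \<phi> s u"
    and phi_zero: "\<And>u. \<phi> 0 u = 1"
    and phi_Nil: "\<And>s. 0 \<le> s \<Longrightarrow> \<phi> s [] = 1"
    and phi_submult: "\<And>s u v. 0 \<le> s \<Longrightarrow> \<phi> s (u @ v) \<le> K s * \<phi> s u * \<phi> s v"
    and phi_append_ge: "\<And>(s :: real) u v. 0 \<le> s \<Longrightarrow> \<phi> s u * b powr (s * length v) \<le> \<phi> s (u @ v)"
    and phi_add_le: "\<And>(s :: real) (t :: real) u. 0 \<le> s \<Longrightarrow> 0 \<le> t \<Longrightarrow> \<phi> (s + t) u \<le> \<phi> s u * c powr (t * length u)"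
    and phi_add_ge: "\<And>(s :: real) (t :: real) u. 0 \<le> s \<Longrightarrow> 0 \<le> t \<Longrightarrow> \<phi> s u * b powr (t * length u) \<le> \<phi> (s + t) u"
begin

text \<open>The exponential of (q - 1) \<open>X s u\<close>, weighted by p_u, is the summand for q
  \<noteq> 1, and \<open>X s u\<close> so weighted is the summand for q = 1. On words of probability
  0 its value carries no meaning, hence the positivity hypotheses below.\<close>

definition X :: "real \<Rightarrow> 'n list \<Rightarrow> real" where
  "X s u = ln (inverse (\<phi> s u) * word_prob p u)"

definition term_sum :: "real \<Rightarrow> real \<Rightarrow> 'n list \<Rightarrow> real" where
  "term_sum q s u = (if q = 1 then word_prob p u * X s u
     else \<phi> s u powr (1 - q) * word_prob p u powr q)"

text \<open>The logarithmic exponential mean of Y under the word probabilities, with the plain mean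
  as its limit case q = 1. Dividing by q - 1 makes it increasing in Y for every q, so the sign of q
  - 1 needs no further attention.\<close>

definition gmean :: "real \<Rightarrow> nat \<Rightarrow> ('n list \<Rightarrow> real) \<Rightarrow> real" where
  "gmean q k Y = (if q = 1 then (\<Sum>u\<in>words k. word_prob p u * Y u)
     else ln (\<Sum>u\<in>words k. word_prob p u * exp ((q - 1) * Y u)) / (q - 1))"

lemma word_prob_pos_iff: "0 < word_prob p u \<longleftrightarrow> word_prob p u \<noteq> 0"
  using word_prob_nonneg[of p u] by linarith

lemma word_prob_append_pos: "0 < word_prob p (u @ v) \<longleftrightarrow> 0 < word_prob p u \<and> 0 < word_prob p v"
  by (simp add: zero_less_mult_iff leD)

lemma gmean_sum_pos: "0 < (\<Sum>u\<in>words k. word_prob p u * exp (Y u))"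
proof -
  have "(\<Sum>u\<in>words k. word_prob p u * exp (Y u)) \<noteq> 0"
  proof
    assume "(\<Sum>u\<in>words k. word_prob p u * exp (Y u)) = 0"
    then have "\<forall>u\<in>words k. word_prob p u = 0" by (subst (asm) sum_nonneg_eq_0_iff) (auto simp: finite_words)
    then have "(\<Sum>u\<in>words k. word_prob p u) = 0" by simp
    then show False using sum_word_prob[of p k] by simp
  qed
  moreover have "0 \<le> (\<Sum>u\<in>words k. word_prob p u * exp (Y u))" by (intro sum_nonneg) auto
  ultimately show ?thesis by linarith
qed

lemma gmean_mono:
  assumes "\<And>u. length u = k \<Longrightarrow> 0 < word_prob p u \<Longrightarrow> Y u \<le> Z u"
  shows "gmean q k Y \<le> gmean q k Z"
proof -
  consider "q = 1" | "q > 1" | "q < 1" by linarith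
  then show ?thesis
  proof cases
    case 1
    have "word_prob p u * Y u \<le> word_prob p u * Z u" if "length u = k" for u
      using assms[OF that] word_prob_pos_iff[of u] by (cases "word_prob p u = 0") auto
    then show ?thesis unfolding gmean_def using 1 by (auto intro!: sum_mono)
  next
    case 2
    have "word_prob p u * exp ((q - 1) * Y u) \<le> word_prob p u * exp ((q - 1) * Z u)" if "length u = k" for u
      using assms[OF that] word_prob_pos_iff[of u] 2 by (cases "word_prob p u = 0") auto
    then have "(\<Sum>u\<in>words k. word_prob p u * exp ((q - 1) * Y u)) \<le> (\<Sum>u\<in>words k. word_prob p u * exp ((q - 1) * Z u))"
      by (intro sum_mono) auto
    then show ?thesis unfolding gmean_def using 2 gmean_sum_pos[of "\<lambda>u. (q - 1) * Y u" k]
      by (auto intro!: divide_right_mono)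
  next
    case 3
    have "word_prob p u * exp ((q - 1) * Z u) \<le> word_prob p u * exp ((q - 1) * Y u)" if "length u = k" for u
      using assms[OF that] word_prob_pos_iff[of u] 3 by (cases "word_prob p u = 0") auto
    then have "(\<Sum>u\<in>words k. word_prob p u * exp ((q - 1) * Z u)) \<le> (\<Sum>u\<in>words k. word_prob p u * exp ((q - 1) * Y u))"
      by (intro sum_mono) auto
    then show ?thesis unfolding gmean_def using 3 gmean_sum_pos[of "\<lambda>u. (q - 1) * Z u" k]
      by (auto intro!: divide_right_mono_neg)
  qed
qed

lemma gmean_add_const: "gmean q k (\<lambda>u. Y u + z) = gmean q k Y + z"
proof (cases "q = 1")
  case True
  then show ?thesis
    using sum_word_prob[of p k] by (simp add: gmean_def distrib_left sum.distrib sum_distrib_right[symmetric])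
next
  case False
  have "(\<Sum>u\<in>words k. word_prob p u * exp ((q - 1) * (Y u + z)))
      = exp ((q - 1) * z) * (\<Sum>u\<in>words k. word_prob p u * exp ((q - 1) * Y u))"
    by (simp add: distrib_left exp_add sum_distrib_left mult_ac)
  then show ?thesis using False gmean_sum_pos[of "\<lambda>u. (q - 1) * Y u" k]
    by (simp add: gmean_def ln_mult add_divide_distrib)
qed

lemma gmean_const: "gmean q k (\<lambda>_. z) = z"
  using gmean_add_const[of q k "\<lambda>_. 0" z] sum_word_prob[of p k] by (simp add: gmean_def)

text \<open>The first j and the last k letters are independent, so the exponential moments
  multiply.\<close>

lemma gmean_append:
  "gmean q (j + k) (\<lambda>u. Y (take j u) + Z (drop j u)) = gmean q j Y + gmean q k Z"
proof (cases "q = 1")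
  case True
  have "gmean q (j + k) (\<lambda>u. Y (take j u) + Z (drop j u))
      = (\<Sum>u\<in>words j. \<Sum>v\<in>words k. word_prob p u * word_prob p v * (Y u + Z v))"
    unfolding gmean_def sum_words_append using True by simp
  also have "\<dots> = (\<Sum>u\<in>words j. word_prob p u * Y u * (\<Sum>v\<in>words k. word_prob p v)
      + word_prob p u * (\<Sum>v\<in>words k. word_prob p v * Z v))"
    by (simp add: sum_distrib_left distrib_left sum.distrib mult_ac)
  also have "\<dots> = (\<Sum>u\<in>words j. word_prob p u * Y u) + (\<Sum>u\<in>words j. word_prob p u) * (\<Sum>v\<in>words k. word_prob p v * Z v)"
    by (simp add: sum_word_prob sum.distrib flip: sum_distrib_right)
  finally show ?thesis using True by (simp add: sum_word_prob gmean_def)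
next
  case False
  have "(\<Sum>u\<in>words (j + k). word_prob p u * exp ((q - 1) * (Y (take j u) + Z (drop j u))))
      = (\<Sum>u\<in>words j. \<Sum>v\<in>words k. word_prob p u * exp ((q - 1) * Y u) * (word_prob p v * exp ((q - 1) * Z v)))"
    unfolding sum_words_append by (intro sum.cong) (auto simp: distrib_left exp_add)
  also have "\<dots> = (\<Sum>u\<in>words j. word_prob p u * exp ((q - 1) * Y u)) * (\<Sum>v\<in>words k. word_prob p v * exp ((q - 1) * Z v))"
    by (simp add: sum_product)
  finally show ?thesis
    using False gmean_sum_pos[of "\<lambda>u. (q - 1) * Y u" j] gmean_sum_pos[of "\<lambda>u. (q - 1) * Z u" k]
    by (simp add: gmean_def ln_mult add_divide_distrib)
qed

lemma X_eq: "0 \<le> s \<Longrightarrow> 0 < word_prob p u \<Longrightarrow> X s u = ln (word_prob p u) - ln (\<phi> s u)"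
  using phi_pos[of s u] by (simp add: X_def ln_mult ln_inverse)

lemma term_sum_eq:
  assumes "0 \<le> s" "q \<noteq> 1"
  shows "term_sum q s u = word_prob p u * exp ((q - 1) * X s u)"
proof (cases "word_prob p u = 0")
  case False
  then have p: "0 < word_prob p u" by (simp add: word_prob_pos_iff)
  have "term_sum q s u = exp ((1 - q) * ln (\<phi> s u)) * exp (q * ln (word_prob p u))"
    using assms p phi_pos[OF assms(1), of u] by (simp add: term_sum_def powr_def)
  also have "\<dots> = exp (ln (word_prob p u)) * exp ((q - 1) * X s u)"
    unfolding exp_add[symmetric] by (simp add: X_eq[OF assms(1) p] algebra_simps)
  finally show ?thesis using p by simp
qed (use assms in \<open>simp add: term_sum_def\<close>)

lemma term_sum_nonneg: "q \<noteq> 1 \<Longrightarrow> 0 \<le> term_sum q s u"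
  by (simp add: term_sum_def)

lemma gmean_term_sum: "0 \<le> s \<Longrightarrow> gmean q k (X s) =
   (if q = 1 then (\<Sum>u\<in>words k. term_sum 1 s u) else ln (\<Sum>u\<in>words k. term_sum q s u) / (q - 1))"
  by (cases "q = 1") (simp_all add: gmean_def term_sum_eq term_sum_def[of 1])

lemma sum_term_sum_eq:
  assumes "0 \<le> s" "q \<noteq> 1"
  shows "(\<Sum>u\<in>words k. term_sum q s u) = exp ((q - 1) * gmean q k (X s))"
  using assms gmean_sum_pos[of "\<lambda>u. (q - 1) * X s u" k] by (simp add: gmean_def term_sum_eq)

lemma X_superadditive:
  assumes "0 \<le> s" "0 < word_prob p (u @ v)"
  shows "X s u + X s v - ln (K s) \<le> X s (u @ v)"
proof -
  have p: "0 < word_prob p u" "0 < word_prob p v" using assms(2) by (simp_all only: word_prob_append_pos)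
  have "ln (\<phi> s (u @ v)) \<le> ln (K s * \<phi> s u * \<phi> s v)"
    using phi_submult[OF assms(1), of u v] phi_pos[OF assms(1)] by (intro ln_mono) auto
  also have "\<dots> = ln (K s) + ln (\<phi> s u) + ln (\<phi> s v)"
    using K[OF assms(1)] phi_pos[OF assms(1), of u] phi_pos[OF assms(1), of v] by (simp add: ln_mult)
  finally show ?thesis using p assms by (simp add: X_eq ln_mult)
qed

lemma X_append_le:
  assumes "0 \<le> s" "0 < word_prob p (u @ v)"
  shows "X s (u @ v) \<le> X s u + s * length v * ln (1 / b)"
proof -
  have p: "0 < word_prob p u" "0 < word_prob p v" using assms(2) by (simp_all only: word_prob_append_pos)
  have "ln (\<phi> s u * b powr (s * length v)) \<le> ln (\<phi> s (u @ v))"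
    using phi_append_ge[OF assms(1)] phi_pos[OF assms(1)] b by simp
  then have "ln (\<phi> s u) - s * length v * ln (1 / b) \<le> ln (\<phi> s (u @ v))"
    using phi_pos[OF assms(1), of u] b by (simp add: ln_mult ln_powr ln_div)
  moreover have "ln (word_prob p v) \<le> 0" using word_prob_le_1[of p v] p by simp
  moreover have "X s (u @ v) = ln (word_prob p u) + ln (word_prob p v) - ln (\<phi> s (u @ v))"
    using p assms by (simp add: X_eq ln_mult)
  ultimately show ?thesis using X_eq[OF assms(1) p(1)] by linarith
qed

lemma X_zero: "0 < word_prob p u \<Longrightarrow> X 0 u = ln (word_prob p u)"
  by (simp add: X_eq phi_zero)

lemma X_add:
  fixes s t :: real
  assumes "0 \<le> s" "0 \<le> t" "0 < word_prob p u"
  shows "X s u + t * length u * ln (1 / c) \<le> X (s + t) u" "X (s + t) u \<le> X s u + t * length u * ln (1 / b)"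
proof -
  have st: "0 \<le> s + t" using assms by simp
  have "ln (\<phi> (s + t) u) \<le> ln (\<phi> s u * c powr (t * length u))"
    using phi_add_le[OF assms(1,2)] phi_pos[OF st] phi_pos[OF assms(1)] c by simp
  then show "X s u + t * length u * ln (1 / c) \<le> X (s + t) u"
    using phi_pos[OF assms(1), of u] c assms by (simp add: X_eq ln_mult ln_powr ln_div)
  have "ln (\<phi> s u * b powr (t * length u)) \<le> ln (\<phi> (s + t) u)"
    using phi_add_ge[OF assms(1,2)] phi_pos[OF st] phi_pos[OF assms(1)] b by simp
  then show "X (s + t) u \<le> X s u + t * length u * ln (1 / b)"
    using phi_pos[OF assms(1), of u] b assms by (simp add: X_eq ln_mult ln_powr ln_div)
qed

lemma X_Nil: "0 \<le> s \<Longrightarrow> X s [] = 0"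
  by (simp add: X_def phi_Nil)

definition G :: "real \<Rightarrow> real \<Rightarrow> nat \<Rightarrow> real" where
  "G q s k = gmean q k (X s)"

lemma G_superadditive:
  assumes "0 \<le> s"
  shows "G q s j + G q s k - ln (K s) \<le> G q s (j + k)"
proof -
  have "gmean q (j + k) (\<lambda>u. (X s (take j u) + X s (drop j u)) + - ln (K s)) \<le> G q s (j + k)"
    unfolding G_def
  proof (rule gmean_mono)
    fix u assume "0 < word_prob p u"
    then show "X s (take j u) + X s (drop j u) + - ln (K s) \<le> X s u"
      using X_superadditive[OF assms, of "take j u" "drop j u"] by simp
  qed
  then show ?thesis unfolding gmean_add_const gmean_append G_def by linarith
qed

lemma G_add:
  fixes s t :: real
  assumes "0 \<le> s" "0 \<le> t"
  shows "G q s k + t * k * ln (1 / c) \<le> G q (s + t) k" "G q (s + t) k \<le> G q s k + t * k * ln (1 / b)"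
  unfolding G_def gmean_add_const[symmetric]
  by (intro gmean_mono; use X_add[OF assms] in auto)+

definition H0 :: "real \<Rightarrow> real" where "H0 q = G q 0 1"

text \<open>At s = 0 only the logarithm of the word probability remains, which is exactly additive.
  This anchors the rate: \<open>H0\<close> is its value at s = 0, and it is never positive.\<close>

lemma G_zero: "G q 0 k = k * H0 q"
proof (induction k)
  case 0
  show ?case by (simp add: G_def gmean_def X_Nil)
next
  case (Suc k)
  let ?Y = "\<lambda>u. X 0 (take 1 u) + X 0 (drop 1 u)"
  have eq: "X 0 u = ?Y u" if "0 < word_prob p u" for u
  proof -
    have "word_prob p u = word_prob p (take 1 u) * word_prob p (drop 1 u)"
      by (metis append_take_drop_id word_prob_append)
    then have "0 < word_prob p (take 1 u)" "0 < word_prob p (drop 1 u)"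
      using that word_prob_append_pos[of "take 1 u" "drop 1 u"] by simp_all
    then show ?thesis using that \<open>word_prob p u = _\<close> by (simp add: X_zero ln_mult)
  qed
  have "gmean q (1 + k) (X 0) = gmean q (1 + k) ?Y"
    using eq by (intro antisym gmean_mono) (simp_all only: order_refl)
  also have "\<dots> = gmean q 1 (X 0) + gmean q k (X 0)" by (rule gmean_append)
  finally show ?case using Suc by (simp add: G_def H0_def algebra_simps)
qed

lemma H0_nonpos: "H0 q \<le> 0"
proof -
  have "G q 0 1 \<le> gmean q 1 (\<lambda>_. 0)"
    unfolding G_def using word_prob_le_1 by (intro gmean_mono) (auto simp: X_zero ln_le_zero_iff)
  then show ?thesis by (simp add: gmean_const H0_def)
qed

text \<open>Subtracting the constant ln K makes G superadditive; comparison with s = 0 provides the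
  linear upper bound for Fekete's lemma. The inequality for finite k is kept because it bounds means
  by the rate without passing to the limit.\<close>

lemma G_limit_exists:
  assumes "0 \<le> s"
  shows "\<exists>l. (\<lambda>k. G q s k / k) \<longlonglongrightarrow> l \<and> (\<forall>k>0. G q s k \<le> l * k + ln (K s))"
proof -
  have K1: "0 \<le> ln (K s)" using K[OF assms] by simp
  have "G q s k - ln (K s) \<le> max 0 (s * ln (1 / b)) * k" for k
  proof -
    have "G q s k \<le> k * H0 q + s * k * ln (1 / b)" using G_add(2)[of 0 s q k] assms by (simp add: G_zero)
    also have "\<dots> = k * H0 q + (s * ln (1 / b)) * k" by simp
    also have "\<dots> \<le> 0 + max 0 (s * ln (1 / b)) * k"
      using H0_nonpos[of q] by (intro add_mono mult_nonneg_nonpos mult_right_mono) auto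
    finally show ?thesis using K1 by simp
  qed
  then obtain l where l: "(\<lambda>k. (G q s k - ln (K s)) / k) \<longlonglongrightarrow> l" "\<And>k. 0 < k \<Longrightarrow> G q s k - ln (K s) \<le> l * k"
    using superadditive_limit[of "\<lambda>k. G q s k - ln (K s)"] G_superadditive[OF assms, of q] 
    by (metis (no_types, lifting) add_diff_eq diff_add_eq diff_right_mono)
  have "(\<lambda>k. (G q s k - ln (K s)) / k + ln (K s) * (1 / real k)) \<longlonglongrightarrow> l + ln (K s) * 0"
    by (intro tendsto_add l(1) tendsto_mult tendsto_const lim_1_over_n)
  then have "(\<lambda>k. G q s k / k) \<longlonglongrightarrow> l" by (simp add: diff_divide_distrib)
  then show ?thesis using l(2) by (intro exI[of _ l]) (auto simp: algebra_simps)
qed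

definition \<gamma> :: "real \<Rightarrow> real \<Rightarrow> real" where
  "\<gamma> q s = lim (\<lambda>k. G q s k / k)"

lemma G_limit: "0 \<le> s \<Longrightarrow> (\<lambda>k. G q s k / k) \<longlonglongrightarrow> \<gamma> q s"
  unfolding \<gamma>_def using G_limit_exists[of s q] limI by blast

lemma G_upper: "0 \<le> s \<Longrightarrow> 0 < k \<Longrightarrow> G q s k \<le> \<gamma> q s * k + ln (K s)"
  unfolding \<gamma>_def using G_limit_exists[of s q] limI by blast

lemma gamma_zero: "\<gamma> q 0 = H0 q"
proof -
  have "(\<lambda>k. G q 0 k / k) \<longlonglongrightarrow> H0 q"
    by (rule tendsto_eventually) (use eventually_gt_at_top[of 0] in eventually_elim, simp add: G_zero)
  then show ?thesis using G_limit[of 0 q] LIMSEQ_unique by blast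
qed

lemma gamma_add:
  fixes s t :: real
  assumes "0 \<le> s" "0 \<le> t"
  shows "\<gamma> q s + t * ln (1 / c) \<le> \<gamma> q (s + t)" "\<gamma> q (s + t) \<le> \<gamma> q s + t * ln (1 / b)"
proof -
  have st: "0 \<le> s + t" using assms by simp
  have "(\<lambda>k. G q s k / k + t * ln (1 / c)) \<longlonglongrightarrow> \<gamma> q s + t * ln (1 / c)"
    by (intro tendsto_intros G_limit assms)
  moreover have "\<forall>\<^sub>F k in sequentially. G q s k / k + t * ln (1 / c) \<le> G q (s + t) k / k"
    using eventually_gt_at_top[of 0]
  proof eventually_elim
    case (elim k)
    have "(G q s k + t * k * ln (1 / c)) / k \<le> G q (s + t) k / k"
      using G_add(1)[OF assms, of q k] by (intro divide_right_mono) auto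
    then show ?case using elim by (simp add: add_divide_distrib)
  qed
  ultimately show "\<gamma> q s + t * ln (1 / c) \<le> \<gamma> q (s + t)"
    using tendsto_le[OF _ G_limit[OF st]] by (metis trivial_limit_sequentially)
  have "(\<lambda>k. G q s k / k + t * ln (1 / b)) \<longlonglongrightarrow> \<gamma> q s + t * ln (1 / b)"
    by (intro tendsto_intros G_limit assms)
  moreover have "\<forall>\<^sub>F k in sequentially. G q (s + t) k / k \<le> G q s k / k + t * ln (1 / b)"
    using eventually_gt_at_top[of 0]
  proof eventually_elim
    case (elim k)
    have "G q (s + t) k / k \<le> (G q s k + t * k * ln (1 / b)) / k"
      using G_add(2)[OF assms, of q k] by (intro divide_right_mono) auto
    then show ?case using elim by (simp add: add_divide_distrib)
  qed
  ultimately show "\<gamma> q (s + t) \<le> \<gamma> q s + t * ln (1 / b)"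
    using tendsto_le[OF _ _ G_limit[OF st]] by (metis trivial_limit_sequentially)
qed

lemma ln_inverse_c_pos: "0 < ln (1 / c)" and ln_inverse_b_pos: "0 < ln (1 / b)"
proof -
  show *: "0 < ln (1 / c)" using c by simp
  show "0 < ln (1 / b)" using gamma_add[of 0 1 0] * by simp
qed

lemma gamma_strict_mono:
  assumes "0 \<le> s" "s < t"
  shows "\<gamma> q s < \<gamma> q t"
proof -
  have "0 < (t - s) * ln (1 / c)" using ln_inverse_c_pos assms by simp
  then show ?thesis using gamma_add(1)[of s "t - s" q] assms by simp
qed

lemma gamma_continuous: "continuous_on {0..} (\<gamma> q)"
proof (rule lipschitz_on_continuous_on)
  show "(ln (1 / b))-lipschitz_on {0..} (\<gamma> q)"
  proof (rule lipschitz_onI)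
    have *: "\<bar>\<gamma> q x - \<gamma> q y\<bar> \<le> ln (1 / b) * (y - x)" if "0 \<le> x" "x \<le> y" for x y
    proof (cases "x = y")
      case False
      then show ?thesis using gamma_add(2)[of x "y - x" q] gamma_strict_mono[of x y q] that by (simp add: mult.commute)
    qed simp
    fix x y :: real assume "x \<in> {0..}" "y \<in> {0..}"
    then show "dist (\<gamma> q x) (\<gamma> q y) \<le> ln (1 / b) * dist x y"
      using *[of x y] *[of y x] by (cases "x \<le> y") (auto simp: dist_real_def abs_minus_commute)
  qed (use ln_inverse_b_pos in simp)
qed

lemma gamma_root: "\<exists>!s. 0 \<le> s \<and> \<gamma> q s = 0"
proof (rule ex_ex1I)
  \<comment> \<open>The rate increases with slope at least ln (1 / c), so from \<open>H0\<close> it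
    has reached 0 by this t.\<close>
  define t where "t = - H0 q / ln (1 / c)"
  have t: "0 \<le> t" unfolding t_def using H0_nonpos[of q] ln_inverse_c_pos by (intro divide_nonneg_pos) auto
  have "\<gamma> q 0 \<le> 0" using H0_nonpos by (simp add: gamma_zero)
  moreover have "t * ln (1 / c) = - H0 q" using ln_inverse_c_pos by (simp add: t_def)
  then have "0 \<le> \<gamma> q t" using gamma_add(1)[of 0 t q] t by (simp add: gamma_zero)
  moreover have "continuous_on {0..t} (\<gamma> q)" by (rule continuous_on_subset[OF gamma_continuous]) auto
  ultimately show "\<exists>s. 0 \<le> s \<and> \<gamma> q s = 0" using IVT'[of "\<gamma> q" 0 0 t] t by blast
  show "s = t" if "0 \<le> s \<and> \<gamma> q s = 0" "0 \<le> t \<and> \<gamma> q t = 0" for s t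
    using gamma_strict_mono[of s t q] gamma_strict_mono[of t s q] that by (cases s t rule: linorder_cases) auto
qed

end

section \<open>Cut sums and the sign of the rate\<close>

context word_growth
begin

lemma term_sum_summable:
  assumes s: "0 \<le> s" and q: "q \<noteq> 1" "(q - 1) * \<gamma> q s < 0"
  shows "summable (\<lambda>k. \<Sum>u\<in>words k. term_sum q s u)"
proof -
  define \<delta> where "\<delta> = (q - 1) * \<gamma> q s / 2"
  have \<delta>: "\<delta> < 0" "(q - 1) * \<gamma> q s < \<delta>" using q by (auto simp: \<delta>_def)
  have "(\<lambda>k. (q - 1) * (G q s k / k)) \<longlonglongrightarrow> (q - 1) * \<gamma> q s"
    by (intro tendsto_intros G_limit s)
  then have "\<forall>\<^sub>F k in sequentially. (q - 1) * (G q s k / k) < \<delta>"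
    using \<delta>(2) by (rule order_tendstoD)
  with eventually_gt_at_top[of 0] have "\<forall>\<^sub>F k in sequentially. norm (\<Sum>u\<in>words k. term_sum q s u) \<le> exp \<delta> ^ k"
  proof eventually_elim
    case (elim k)
    then have "(q - 1) * G q s k \<le> k * \<delta>" by (simp add: field_simps)
    then show ?case by (simp add: sum_term_sum_eq[OF s q(1)] G_def exp_of_nat_mult[symmetric])
  qed
  moreover have "summable (\<lambda>k. exp \<delta> ^ k)" using \<delta>(1) by (intro summable_geometric) simp
  ultimately show ?thesis by (rule summable_comparison_test_ev)
qed

text \<open>The summands are nonnegative and the sum over all words converges, so any cut sum is
  dominated by it. The sign condition is a negative rate for q > 1 and a positive one for q <
  1.\<close>

lemma cut_sum_bounded:
  assumes s: "0 \<le> s" and q: "q \<noteq> 1" "(q - 1) * \<gamma> q s < 0"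
  shows "\<exists>B. \<forall>S. is_cut S \<longrightarrow> (\<Sum>u\<in>S. term_sum q s u) \<le> B"
proof (intro exI allI impI)
  fix S :: "'n list set" assume S: "is_cut S"
  obtain L where L: "\<And>v. v \<in> S \<Longrightarrow> length v \<le> L" using cut_length_bound[OF S] by blast
  have fin: "finite (\<Union>k\<in>{..L}. words k :: 'n list set)" by (auto simp: finite_words)
  have "(\<Sum>u\<in>S. term_sum q s u) \<le> (\<Sum>u\<in>(\<Union>k\<in>{..L}. words k). term_sum q s u)"
    using L term_sum_nonneg[OF q(1)] by (intro sum_mono2 fin) auto
  also have "\<dots> = (\<Sum>k\<le>L. \<Sum>u\<in>words k. term_sum q s u)"
    by (rule sum.UNION_disjoint) (auto simp: finite_words)
  also have "\<dots> \<le> (\<Sum>k. \<Sum>u\<in>words k. term_sum q s u)"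
    by (rule sum_le_suminf[OF term_sum_summable[OF s q]]) (auto intro!: sum_nonneg term_sum_nonneg q)
  finally show "(\<Sum>u\<in>S. term_sum q s u) \<le> (\<Sum>k. \<Sum>u\<in>words k. term_sum q s u)" .
qed

lemma G_bounded_below:
  assumes "0 \<le> s" "\<And>n. m \<le> G q s n"
  shows "0 \<le> \<gamma> q s"
proof (rule tendsto_le[OF _ G_limit[OF assms(1)]])
  show "(\<lambda>n. m * (1 / real n)) \<longlonglongrightarrow> 0" using tendsto_mult[OF tendsto_const lim_1_over_n] by fastforce
  show "\<forall>\<^sub>F n in sequentially. m * (1 / real n) \<le> G q s n / real n"
    using assms(2) by (auto intro!: always_eventually divide_right_mono)
qed simp

text \<open>Signed terms exclude domination by the sum over all words. If some cut sum exceeded ln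
  K, splitting long words at this cut would show by induction that \<open>G 1 s n\<close> is bounded
  below, contradicting its negative rate.\<close>

lemma cut_sum_bounded_1:
  assumes s: "0 \<le> s" and neg: "\<gamma> 1 s < 0" and S: "is_cut S" "[] \<notin> S"
  shows "(\<Sum>u\<in>S. term_sum 1 s u) \<le> ln (K s)"
proof (rule ccontr)
  assume "\<not> (\<Sum>u\<in>S. term_sum 1 s u) \<le> ln (K s)"
  then have gt: "ln (K s) < (\<Sum>u\<in>S. term_sum 1 s u)" by simp
  obtain L where L: "\<And>v. v \<in> S \<Longrightarrow> length v \<le> L" using cut_length_bound[OF S(1)] by blast
  \<comment> \<open>The minimum over the initial lengths. Splitting a longer word at the cut returns
    at least m plus the excess of the cut sum over ln K, so the bound persists.\<close>
  define m where "m = Min (G 1 s ` {..L})"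
  have "m \<le> G 1 s n" for n
  proof (induction n rule: less_induct)
    case (less n)
    show ?case
    proof (cases "n \<le> L")
      case True
      then show ?thesis by (auto simp: m_def)
    next
      case False
      have rec: "term_sum 1 s (w @ v) \<ge> word_prob p w * word_prob p v * (X s w + X s v - ln (K s))" for w v
      proof (cases "word_prob p (w @ v) = 0")
        case nz: False
        then have "0 < word_prob p (w @ v)" using word_prob_pos_iff by blast
        then have "word_prob p (w @ v) * (X s w + X s v - ln (K s)) \<le> word_prob p (w @ v) * X s (w @ v)"
          by (intro mult_left_mono X_superadditive s) auto
        then show ?thesis by (simp add: term_sum_def)
      qed (auto simp: term_sum_def)
      have eq: "(\<Sum>v\<in>words k. word_prob p w * word_prob p v * (X s w + X s v - ln (K s)))
          = term_sum 1 s w + word_prob p w * G 1 s k - word_prob p w * ln (K s)" for w k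
      proof -
        have "(\<Sum>v\<in>words k. word_prob p w * word_prob p v * (X s w + X s v - ln (K s)))
          = (\<Sum>v\<in>words k. (word_prob p w * X s w - word_prob p w * ln (K s)) * word_prob p v
              + word_prob p w * (word_prob p v * X s v))"
          by (intro sum.cong) (auto simp: algebra_simps)
        then show ?thesis
          by (simp add: sum.distrib sum_distrib_left[symmetric] sum_word_prob term_sum_def G_def gmean_def)
      qed
      have "(\<Sum>v\<in>words k. word_prob p w * word_prob p v * (X s w + X s v - ln (K s)))
          \<le> (\<Sum>v\<in>words k. term_sum 1 s (w @ v))" for w k
        by (intro sum_mono rec)
      then have e3: "term_sum 1 s w + word_prob p w * G 1 s (n - length w) - word_prob p w * ln (K s)
          \<le> (\<Sum>v\<in>words (n - length w). term_sum 1 s (w @ v))" for w unfolding eq .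
      have e4: "word_prob p w * m \<le> word_prob p w * G 1 s (n - length w)" if "w \<in> S" for w
      proof -
        have "0 < length w" using that S(2) by auto
        then have "n - length w < n" using False by (intro diff_less) auto
        then show ?thesis by (intro mult_left_mono less) auto
      qed
      have "term_sum 1 s w + word_prob p w * (m - ln (K s))
          \<le> (\<Sum>v\<in>words (n - length w). term_sum 1 s (w @ v))" if "w \<in> S" for w
        using e3[of w] e4[OF that] unfolding right_diff_distrib by linarith
      then have "(\<Sum>w\<in>S. term_sum 1 s w + word_prob p w * (m - ln (K s)))
          \<le> (\<Sum>w\<in>S. \<Sum>v\<in>words (n - length w). term_sum 1 s (w @ v))"
        by (rule sum_mono)
      also have "\<dots> = (\<Sum>u\<in>words n. term_sum 1 s u)"
        using cut_sum_words[OF S(1) L, of n "term_sum 1 s"] False by simp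
      also have "\<dots> = G 1 s n" by (simp add: G_def gmean_term_sum[OF s])
      also have "(\<Sum>w\<in>S. term_sum 1 s w + word_prob p w * (m - ln (K s)))
          = (\<Sum>w\<in>S. term_sum 1 s w) + (m - ln (K s))"
        by (simp add: sum.distrib sum_distrib_right[symmetric] cut_sum_word_prob[OF S(1)])
      finally show ?thesis using gt by linarith
    qed
  qed
  from G_bounded_below[OF s this] show False using neg by simp
qed

lemma term_sum_append_lt1:
  assumes s: "0 \<le> s" and q: "q < 1"
  shows "term_sum q s (u @ v) \<le> K s powr (1 - q) * term_sum q s u * term_sum q s v"
proof -
  have "\<phi> s (u @ v) powr (1 - q) \<le> (K s * \<phi> s u * \<phi> s v) powr (1 - q)"
    using phi_submult[OF s] phi_pos[OF s] q by (intro powr_mono2) (auto intro: less_imp_le)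
  also have "\<dots> = K s powr (1 - q) * \<phi> s u powr (1 - q) * \<phi> s v powr (1 - q)"
    using K[OF s] phi_pos[OF s, of u] phi_pos[OF s, of v] by (simp add: powr_mult)
  finally have "\<phi> s (u @ v) powr (1 - q) * (word_prob p u powr q * word_prob p v powr q) \<le>
      K s powr (1 - q) * \<phi> s u powr (1 - q) * \<phi> s v powr (1 - q) * (word_prob p u powr q * word_prob p v powr q)"
    by (rule mult_right_mono) auto
  then show ?thesis using q by (simp add: term_sum_def powr_mult mult_ac)
qed

text \<open>If the cut sum were smaller, each split at the cut would multiply the sum over longer
  words by a factor at most 1. The sums would stay bounded, and division by the negative q - 1 would
  force the rate to be nonnegative.\<close>

lemma cut_sum_lower_lt1:
  assumes s: "0 \<le> s" and q: "q < 1" and neg: "\<gamma> q s < 0" and S: "is_cut S" "[] \<notin> S"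
  shows "K s powr (q - 1) \<le> (\<Sum>u\<in>S. term_sum q s u)"
proof (rule ccontr)
  let ?K = "K s powr (1 - q)"
  have K0: "0 < ?K" using K[OF s] by simp
  assume "\<not> K s powr (q - 1) \<le> (\<Sum>u\<in>S. term_sum q s u)"
  then have "?K * (\<Sum>u\<in>S. term_sum q s u) \<le> ?K * K s powr (q - 1)"
    using K0 by (intro mult_left_mono) auto
  also have "\<dots> = 1" using K[OF s] by (simp add: powr_add[symmetric])
  finally have le1: "?K * (\<Sum>u\<in>S. term_sum q s u) \<le> 1" .
  obtain L where L: "\<And>v. v \<in> S \<Longrightarrow> length v \<le> L" using cut_length_bound[OF S(1)] by blast
  define a where "a n = (\<Sum>u\<in>words n. term_sum q s u)" for n
  define M where "M = Max (a ` {..L})"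
  have a_pos: "0 < a n" for n unfolding a_def using q by (simp add: sum_term_sum_eq[OF s])
  have M0: "0 < M"
  proof -
    have "a 0 \<le> M" unfolding M_def by (rule Max_ge) auto
    then show ?thesis using a_pos[of 0] by linarith
  qed
  have "a n \<le> M" for n
  proof (induction n rule: less_induct)
    case (less n)
    show ?case
    proof (cases "n \<le> L")
      case True
      then show ?thesis by (auto simp: M_def)
    next
      case False
      have "a n = (\<Sum>w\<in>S. \<Sum>v\<in>words (n - length w). term_sum q s (w @ v))"
        unfolding a_def using cut_sum_words[OF S(1) L, of n] False by simp
      also have "\<dots> \<le> (\<Sum>w\<in>S. ?K * term_sum q s w * M)"
      proof (rule sum_mono)
        fix w assume w: "w \<in> S"
        then have "0 < length w" using S(2) by auto
        then have "n - length w < n" using False by (intro diff_less) auto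
        have "(\<Sum>v\<in>words (n - length w). term_sum q s (w @ v))
            \<le> (\<Sum>v\<in>words (n - length w). ?K * term_sum q s w * term_sum q s v)"
          by (intro sum_mono term_sum_append_lt1 s q)
        also have "\<dots> = ?K * term_sum q s w * a (n - length w)" by (simp add: a_def sum_distrib_left)
        also have "\<dots> \<le> ?K * term_sum q s w * M"
          using \<open>n - length w < n\<close> K0 q term_sum_nonneg[of q s w] by (intro mult_left_mono less) auto
        finally show "(\<Sum>v\<in>words (n - length w). term_sum q s (w @ v)) \<le> ?K * term_sum q s w * M" .
      qed
      also have "\<dots> = (?K * (\<Sum>w\<in>S. term_sum q s w)) * M" by (simp add: sum_distrib_left sum_distrib_right)
      also have "\<dots> \<le> 1 * M" using le1 M0 by (intro mult_right_mono) auto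
      finally show ?thesis by simp
    qed
  qed
  then have "ln (a n) \<le> ln M" for n using a_pos by (intro ln_mono) auto
  then have "ln M / (q - 1) \<le> ln (a n) / (q - 1)" for n using q by (intro divide_right_mono_neg) auto
  moreover have "G q s n = ln (a n) / (q - 1)" for n using q by (simp add: G_def gmean_term_sum[OF s] a_def)
  ultimately have "ln M / (q - 1) \<le> G q s n" for n by simp
  from G_bounded_below[OF s this] show False using neg by simp
qed

lemma G_at_top:
  assumes s: "0 \<le> s" and pos: "0 < \<gamma> q s"
  obtains k where "0 < k" "z \<le> G q s k"
proof -
  have "\<forall>\<^sub>F k in sequentially. \<gamma> q s / 2 < G q s k / k"
    using pos by (intro order_tendstoD(1)[OF G_limit[OF s]]) auto
  moreover have "\<forall>\<^sub>F k in sequentially. z / (\<gamma> q s / 2) \<le> real k"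
    using filterlim_real_sequentially unfolding filterlim_at_top by blast
  ultimately have "\<forall>\<^sub>F k in sequentially. 0 < k \<and> z \<le> G q s k"
    using eventually_gt_at_top[of 0]
  proof eventually_elim
    case (elim k)
    then have "z \<le> \<gamma> q s / 2 * k" using pos by (simp add: field_simps)
    also have "\<dots> \<le> G q s k" using elim by (simp add: field_simps)
    finally show ?case using elim by simp
  qed
  from eventually_happens[OF this] obtain k where "0 < k \<and> z \<le> G q s k" by auto
  then show thesis using that[of k] by simp
qed

text \<open>A positive rate supplies a block length k whose gain absorbs the constant K, so the sum
  never falls when every word is extended by a block. Starting from the empty word,
  \<open>cut_sum_blocks\<close> carries the value 1 to the cut, up to incomplete blocks.\<close>

lemma cut_sum_lower_gt1:
  assumes s: "0 \<le> s" and q: "1 < q" and pos: "0 < \<gamma> q s"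
  shows "\<exists>z>0. \<forall>S. is_cut S \<longrightarrow> z \<le> (\<Sum>u\<in>S. term_sum q s u)"
proof -
  obtain k where k: "0 < k" "ln (K s) \<le> G q s k" using G_at_top[OF s pos] by metis
  \<comment> \<open>The possible gain when a word of the cut is completed to a multiple of k, at
    most k further letters.\<close>
  define M where "M = exp ((q - 1) * (s * k * ln (1 / b)))"
  have step: "term_sum q s u \<le> (\<Sum>v\<in>words k. term_sum q s (u @ v))" for u
  proof -
    have ge: "term_sum q s u * exp (- (q - 1) * ln (K s)) * term_sum q s v \<le> term_sum q s (u @ v)" for v
    proof (cases "word_prob p (u @ v) = 0")
      case True
      then show ?thesis using q s by (auto simp: term_sum_eq)
    next
      case False
      then have "0 < word_prob p (u @ v)" using word_prob_pos_iff by blast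
      then have "(q - 1) * (X s u + X s v - ln (K s)) \<le> (q - 1) * X s (u @ v)"
        using q by (intro mult_left_mono X_superadditive s) auto
      then have "word_prob p (u @ v) * exp ((q - 1) * (X s u + X s v - ln (K s))) \<le> term_sum q s (u @ v)"
        using q s by (auto simp: term_sum_eq intro!: mult_left_mono)
      moreover have "exp ((q - 1) * (X s u + X s v - ln (K s))) =
          exp ((q - 1) * X s u) * exp ((q - 1) * X s v) * exp (- (q - 1) * ln (K s))"
        by (simp add: exp_add[symmetric] algebra_simps)
      ultimately show ?thesis using q s by (simp add: term_sum_eq mult_ac)
    qed
    have "(q - 1) * ln (K s) \<le> (q - 1) * G q s k" using k q by (intro mult_left_mono) auto
    then have "0 \<le> - (q - 1) * ln (K s) + (q - 1) * G q s k" by linarith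
    then have "1 \<le> exp (- (q - 1) * ln (K s)) * exp ((q - 1) * G q s k)"
      unfolding exp_add[symmetric] by simp
    then have "term_sum q s u * 1 \<le> term_sum q s u * (exp (- (q - 1) * ln (K s)) * exp ((q - 1) * G q s k))"
      using q by (intro mult_left_mono term_sum_nonneg) auto
    also have "\<dots> = (\<Sum>v\<in>words k. term_sum q s u * exp (- (q - 1) * ln (K s)) * term_sum q s v)"
      using q sum_term_sum_eq[OF s, of q k] by (simp add: G_def sum_distrib_left[symmetric])
    also have "\<dots> \<le> (\<Sum>v\<in>words k. term_sum q s (u @ v))" by (intro sum_mono ge)
    finally show ?thesis by simp
  qed
  have upper: "(\<Sum>v\<in>words m. term_sum q s (u @ v)) \<le> M * term_sum q s u" if "m \<le> k" for m u
  proof -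
    have "term_sum q s (u @ v) \<le> M * term_sum q s u * word_prob p v" if v: "v \<in> words m" for v
    proof (cases "word_prob p (u @ v) = 0")
      case True
      then show ?thesis using q s by (auto simp: term_sum_eq M_def)
    next
      case False
      then have "0 < word_prob p (u @ v)" using word_prob_pos_iff by blast
      then have "X s (u @ v) \<le> X s u + s * length v * ln (1 / b)" by (rule X_append_le[OF s])
      also have "\<dots> \<le> X s u + s * k * ln (1 / b)"
        using v \<open>m \<le> k\<close> s ln_inverse_b_pos by (intro add_left_mono mult_right_mono mult_left_mono) auto
      finally have "(q - 1) * X s (u @ v) \<le> (q - 1) * (X s u + s * k * ln (1 / b))"
        using q by (intro mult_left_mono) auto
      then have "term_sum q s (u @ v) \<le> word_prob p (u @ v) * exp ((q - 1) * (X s u + s * k * ln (1 / b)))"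
        using q s by (auto simp: term_sum_eq intro!: mult_left_mono)
      also have "\<dots> = M * term_sum q s u * word_prob p v"
        using q s by (simp add: term_sum_eq M_def exp_add distrib_left mult_ac)
      finally show ?thesis .
    qed
    then have "(\<Sum>v\<in>words m. term_sum q s (u @ v)) \<le> (\<Sum>v\<in>words m. M * term_sum q s u * word_prob p v)"
      by (rule sum_mono)
    then show ?thesis by (simp add: sum_distrib_left[symmetric] sum_word_prob)
  qed
  have "1 / M \<le> (\<Sum>u\<in>S. term_sum q s u)" if S: "is_cut S" for S
  proof -
    have "term_sum q s [] \<le> (\<Sum>u\<in>S. \<Sum>v\<in>words ((k - length u mod k) mod k). term_sum q s (u @ v))"
      by (rule cut_sum_blocks[OF S k(1) step])
    also have "\<dots> \<le> (\<Sum>u\<in>S. M * term_sum q s u)"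
      using k(1) by (intro sum_mono upper) (simp add: less_imp_le)
    also have "\<dots> = M * (\<Sum>u\<in>S. term_sum q s u)" by (simp add: sum_distrib_left)
    also have "term_sum q s [] = 1" using q s by (simp add: term_sum_def phi_Nil)
    finally show ?thesis by (simp add: M_def field_simps)
  qed
  then show ?thesis by (intro exI[of _ "1 / M"]) (auto simp: M_def)
qed

text \<open>The additive form of \<open>cut_sum_lower_gt1\<close>: the cost of completing blocks is
  M times the total probability of the cut, which is 1.\<close>

lemma cut_sum_lower_1:
  assumes s: "0 \<le> s" and pos: "0 < \<gamma> 1 s"
  shows "\<exists>z. \<forall>S. is_cut S \<longrightarrow> z \<le> (\<Sum>u\<in>S. term_sum 1 s u)"
proof -
  obtain k where k: "0 < k" "ln (K s) \<le> G 1 s k" using G_at_top[OF s pos] by metis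
  define M where "M = s * k * ln (1 / b)"
  have step: "term_sum 1 s u \<le> (\<Sum>v\<in>words k. term_sum 1 s (u @ v))" for u
  proof -
    have ge: "word_prob p u * (X s u - ln (K s)) * word_prob p v + word_prob p u * (word_prob p v * X s v)
        \<le> term_sum 1 s (u @ v)" for v
    proof (cases "word_prob p (u @ v) = 0")
      case False
      then have "0 < word_prob p (u @ v)" using word_prob_pos_iff by blast
      then have "word_prob p (u @ v) * (X s u + X s v - ln (K s)) \<le> word_prob p (u @ v) * X s (u @ v)"
        by (intro mult_left_mono X_superadditive s) auto
      then show ?thesis by (simp add: term_sum_def algebra_simps)
    qed (auto simp: term_sum_def)
    have "word_prob p u * X s u \<le> word_prob p u * (X s u - ln (K s) + G 1 s k)"
      using k(2) by (intro mult_left_mono) auto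
    also have "\<dots> = word_prob p u * (X s u - ln (K s)) * (\<Sum>v\<in>words k. word_prob p v)
        + word_prob p u * (\<Sum>v\<in>words k. word_prob p v * X s v)"
      by (simp add: sum_word_prob G_def gmean_def algebra_simps)
    also have "\<dots> = (\<Sum>v\<in>words k. word_prob p u * (X s u - ln (K s)) * word_prob p v + word_prob p u * (word_prob p v * X s v))"
      by (simp only: sum.distrib sum_distrib_left)
    also have "\<dots> \<le> (\<Sum>v\<in>words k. term_sum 1 s (u @ v))" by (intro sum_mono ge)
    finally show ?thesis by (simp add: term_sum_def)
  qed
  have upper: "(\<Sum>v\<in>words m. term_sum 1 s (u @ v)) \<le> term_sum 1 s u + word_prob p u * M" if "m \<le> k" for m u
  proof -
    have "term_sum 1 s (u @ v) \<le> (term_sum 1 s u + word_prob p u * M) * word_prob p v" if v: "v \<in> words m" for v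
    proof (cases "word_prob p (u @ v) = 0")
      case False
      then have "0 < word_prob p (u @ v)" using word_prob_pos_iff by blast
      then have "X s (u @ v) \<le> X s u + s * length v * ln (1 / b)" by (rule X_append_le[OF s])
      also have "\<dots> \<le> X s u + M" unfolding M_def
        using v \<open>m \<le> k\<close> s ln_inverse_b_pos by (intro add_left_mono mult_right_mono mult_left_mono) auto
      finally have "word_prob p (u @ v) * X s (u @ v) \<le> word_prob p (u @ v) * (X s u + M)"
        by (intro mult_left_mono) auto
      then show ?thesis by (simp add: term_sum_def algebra_simps)
    qed (auto simp: term_sum_def)
    then have "(\<Sum>v\<in>words m. term_sum 1 s (u @ v)) \<le> (\<Sum>v\<in>words m. (term_sum 1 s u + word_prob p u * M) * word_prob p v)"
      by (rule sum_mono)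
    then show ?thesis by (simp add: sum_distrib_left[symmetric] sum_word_prob)
  qed
  have "- M \<le> (\<Sum>u\<in>S. term_sum 1 s u)" if S: "is_cut S" for S
  proof -
    have "term_sum 1 s [] \<le> (\<Sum>u\<in>S. \<Sum>v\<in>words ((k - length u mod k) mod k). term_sum 1 s (u @ v))"
      by (rule cut_sum_blocks[OF S k(1) step])
    also have "\<dots> \<le> (\<Sum>u\<in>S. term_sum 1 s u + word_prob p u * M)"
      using k(1) by (intro sum_mono upper) (simp add: less_imp_le)
    also have "\<dots> = (\<Sum>u\<in>S. term_sum 1 s u) + M"
      by (simp add: sum.distrib sum_distrib_right[symmetric] cut_sum_word_prob[OF S])
    finally show ?thesis using s by (simp add: term_sum_def X_Nil)
  qed
  then show ?thesis by blast
qed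

text \<open>On words with at least l letters, raising s by t divides psi^s by at least c^(-t l). The
  sign of q - 1 decides in which direction this moves the summand.\<close>

lemma term_sum_shift:
  assumes s: "0 \<le> s" "0 \<le> t" and q: "q \<noteq> 1" and l: "real l \<le> length u"
  shows "1 < q \<Longrightarrow> term_sum q s u * exp ((q - 1) * (t * l * ln (1 / c))) \<le> term_sum q (s + t) u"
    and "q < 1 \<Longrightarrow> term_sum q (s + t) u * exp ((1 - q) * (t * l * ln (1 / c))) \<le> term_sum q s u"
proof -
  have st: "0 \<le> s + t" using s by simp
  have X: "X s u + t * l * ln (1 / c) \<le> X (s + t) u" if "0 < word_prob p u"
  proof -
    have "X s u + t * l * ln (1 / c) \<le> X s u + t * length u * ln (1 / c)"
      using l s ln_inverse_c_pos by (intro add_left_mono mult_right_mono mult_left_mono) auto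
    then show ?thesis using X_add(1)[OF s that] by linarith
  qed
  show "term_sum q s u * exp ((q - 1) * (t * l * ln (1 / c))) \<le> term_sum q (s + t) u" if "1 < q"
  proof (cases "word_prob p u = 0")
    case False
    then have "0 < word_prob p u" using word_prob_pos_iff by blast
    from X[OF this] that have "(q - 1) * (X s u + t * l * ln (1 / c)) \<le> (q - 1) * X (s + t) u"
      by (intro mult_left_mono) auto
    then have "word_prob p u * exp ((q - 1) * (X s u + t * l * ln (1 / c))) \<le> word_prob p u * exp ((q - 1) * X (s + t) u)"
      by (intro mult_left_mono) auto
    then show ?thesis by (simp add: term_sum_eq[OF s(1) q] term_sum_eq[OF st q] exp_add distrib_left mult_ac)
  qed (simp add: term_sum_eq[OF s(1) q] term_sum_eq[OF st q])
  show "term_sum q (s + t) u * exp ((1 - q) * (t * l * ln (1 / c))) \<le> term_sum q s u" if "q < 1"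
  proof (cases "word_prob p u = 0")
    case False
    then have "0 < word_prob p u" using word_prob_pos_iff by blast
    from X[OF this] that have "(1 - q) * (X s u + t * l * ln (1 / c)) \<le> (1 - q) * X (s + t) u"
      by (intro mult_left_mono) auto
    then have "(q - 1) * X (s + t) u + (1 - q) * (t * l * ln (1 / c)) \<le> (q - 1) * X s u"
      by (simp add: algebra_simps)
    then have "word_prob p u * exp ((q - 1) * X (s + t) u + (1 - q) * (t * l * ln (1 / c))) \<le> word_prob p u * exp ((q - 1) * X s u)"
      by (intro mult_left_mono) auto
    then show ?thesis by (simp add: term_sum_eq[OF s(1) q] term_sum_eq[OF st q] exp_add mult_ac)
  qed (simp add: term_sum_eq[OF s(1) q] term_sum_eq[OF st q])
qed

lemma term_sum_shift_1:
  assumes s: "0 \<le> s" "0 \<le> t" and l: "real l \<le> length u"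
  shows "term_sum 1 s u + word_prob p u * (t * l * ln (1 / c)) \<le> term_sum 1 (s + t) u"
proof (cases "word_prob p u = 0")
  case False
  then have p: "0 < word_prob p u" using word_prob_pos_iff by blast
  have "X s u + t * l * ln (1 / c) \<le> X s u + t * length u * ln (1 / c)"
    using l s ln_inverse_c_pos by (intro add_left_mono mult_right_mono mult_left_mono) auto
  then have "X s u + t * l * ln (1 / c) \<le> X (s + t) u" using X_add(1)[OF s p] by linarith
  then have "word_prob p u * (X s u + t * l * ln (1 / c)) \<le> word_prob p u * X (s + t) u"
    by (intro mult_left_mono) auto
  then show ?thesis by (simp add: term_sum_def distrib_left)
qed (simp add: term_sum_def)

context
  fixes S :: "real \<Rightarrow> 'n list set" and F :: "real filter"
  assumes cut: "\<forall>\<^sub>F r in F. is_cut (S r)"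
    and long: "\<And>l. \<forall>\<^sub>F r in F. \<forall>u\<in>S r. real l \<le> length u"
begin

lemma cut_nonempty_words: "\<forall>\<^sub>F r in F. [] \<notin> S r"
  using long[of 1]
proof eventually_elim
  case (elim r)
  have "real 1 \<le> real (length u)" if "u \<in> S r" for u using elim that by blast
  from this[of "[]"] show ?case by fastforce
qed

lemma cut_sums_bounded:
  assumes s: "0 \<le> s" and q: "1 \<le> q \<and> \<gamma> q s < 0 \<or> q < 1 \<and> 0 < \<gamma> q s"
  shows "\<exists>B. \<forall>\<^sub>F r in F. (\<Sum>u\<in>S r. term_sum q s u) \<le> B"
proof (cases "q = 1")
  case True
  have "\<forall>\<^sub>F r in F. (\<Sum>u\<in>S r. term_sum q s u) \<le> ln (K s)"
    using cut cut_nonempty_words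
  proof eventually_elim
    case (elim r)
    have "\<gamma> 1 s < 0" using q True by simp
    from cut_sum_bounded_1[OF s this elim] show ?case by (simp add: True)
  qed
  then show ?thesis by blast
next
  case False
  then have "(q - 1) * \<gamma> q s < 0" using q by (auto simp: mult_less_0_iff)
  then obtain B where B: "\<And>S. is_cut S \<Longrightarrow> (\<Sum>u\<in>S. term_sum q s u) \<le> B"
    using cut_sum_bounded[OF s False] by blast
  have "\<forall>\<^sub>F r in F. (\<Sum>u\<in>S r. term_sum q s u) \<le> B" using cut by eventually_elim (rule B)
  then show ?thesis by blast
qed

text \<open>The rate keeps its sign at a nearby parameter, where the cut sums are bounded below. As
  the words of the cuts become arbitrarily long, returning to s adds an unbounded amount for q = 1
  and an unbounded factor otherwise.\<close>

lemma cut_sums_at_top: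
  assumes s: "0 < s" and q: "1 \<le> q \<and> 0 < \<gamma> q s \<or> q < 1 \<and> \<gamma> q s < 0"
  shows "filterlim (\<lambda>r. \<Sum>u\<in>S r. term_sum q s u) at_top F"
proof -
  consider "q = 1" "0 < \<gamma> 1 s" | "q > 1" "0 < \<gamma> q s" | "q < 1" "\<gamma> q s < 0" using q by fastforce
  then show ?thesis
  proof cases
    case 1
    \<comment> \<open>By the Lipschitz bound the rate falls by at most half over this distance; the
      minimum with s keeps s - t nonnegative.\<close>
    define t where "t = min s (\<gamma> 1 s / (2 * ln (1 / b)))"
    have t: "0 < t" "0 \<le> s - t" "t * ln (1 / b) \<le> \<gamma> 1 s / 2"
      using s 1 ln_inverse_b_pos mult_right_mono[of t "\<gamma> 1 s / (2 * ln (1 / b))" "ln (1 / b)"]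
      by (auto simp: t_def)
    then have "0 < \<gamma> 1 (s - t)" using gamma_add(2)[of "s - t" t 1] 1 by simp
    then obtain z where z: "\<And>S. is_cut S \<Longrightarrow> z \<le> (\<Sum>u\<in>S. term_sum 1 (s - t) u)"
      using cut_sum_lower_1[OF t(2)] by blast
    show ?thesis
      unfolding filterlim_at_top
    proof
      fix M
      obtain l :: nat where l: "M \<le> z + t * l * ln (1 / c)"
      proof -
        obtain l :: nat where "(M - z) / (t * ln (1 / c)) < l" using reals_Archimedean2 by blast
        then show thesis using that[of l] t(1) ln_inverse_c_pos by (simp add: field_simps)
      qed
      show "\<forall>\<^sub>F r in F. M \<le> (\<Sum>u\<in>S r. term_sum q s u)"
        using cut long[of l]
      proof eventually_elim
        case (elim r)
        have "M \<le> (\<Sum>u\<in>S r. term_sum 1 (s - t) u) + t * l * ln (1 / c)" using l z[OF elim(1)] by linarith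
        also have "\<dots> = (\<Sum>u\<in>S r. term_sum 1 (s - t) u + word_prob p u * (t * l * ln (1 / c)))"
          by (simp only: sum.distrib sum_distrib_right[symmetric] cut_sum_word_prob[OF elim(1)] mult_1_left)
        also have "\<dots> \<le> (\<Sum>u\<in>S r. term_sum 1 (s - t + t) u)"
          using elim(2) t by (intro sum_mono term_sum_shift_1) auto
        finally show ?case using 1 by simp
      qed
    qed
  next
    case 2
    define t where "t = min s (\<gamma> q s / (2 * ln (1 / b)))"
    have t: "0 < t" "0 \<le> s - t" "t * ln (1 / b) \<le> \<gamma> q s / 2"
      using s 2 ln_inverse_b_pos mult_right_mono[of t "\<gamma> q s / (2 * ln (1 / b))" "ln (1 / b)"]
      by (auto simp: t_def)
    then have "0 < \<gamma> q (s - t)" using gamma_add(2)[of "s - t" t q] 2 by simp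
    then obtain z where z: "0 < z" "\<And>S. is_cut S \<Longrightarrow> z \<le> (\<Sum>u\<in>S. term_sum q (s - t) u)"
      using cut_sum_lower_gt1[OF t(2) 2(1)] by blast
    show ?thesis
      unfolding filterlim_at_top
    proof
      fix M
      have "0 < (q - 1) * (t * ln (1 / c))" using 2 t ln_inverse_c_pos by simp
      then obtain l :: nat where l: "M \<le> z * exp ((q - 1) * (t * ln (1 / c)) * l)"
        using exp_scaled_at_top[OF z(1)] by blast
      show "\<forall>\<^sub>F r in F. M \<le> (\<Sum>u\<in>S r. term_sum q s u)"
        using cut long[of l]
      proof eventually_elim
        case (elim r)
        have "M \<le> (\<Sum>u\<in>S r. term_sum q (s - t) u) * exp ((q - 1) * (t * ln (1 / c)) * l)"
          by (rule order_trans[OF l mult_right_mono[OF z(2)[OF elim(1)]]]) simp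
        also have "\<dots> = (\<Sum>u\<in>S r. term_sum q (s - t) u * exp ((q - 1) * (t * l * ln (1 / c))))"
          by (simp add: sum_distrib_right mult_ac)
        also have "\<dots> \<le> (\<Sum>u\<in>S r. term_sum q (s - t + t) u)"
          using elim(2) t 2 by (intro sum_mono term_sum_shift) auto
        finally show ?case by simp
      qed
    qed
  next
    case 3
    \<comment> \<open>For q < 1 the auxiliary parameter lies above s: lower values of s make the
      summands larger.\<close>
    define t where "t = - \<gamma> q s / (2 * ln (1 / b))"
    have t: "0 < t" "t * ln (1 / b) = - \<gamma> q s / 2"
      using 3 ln_inverse_b_pos by (auto simp: t_def divide_less_0_iff)
    then have neg: "\<gamma> q (s + t) < 0" using gamma_add(2)[of s t q] 3 s by simp
    have st: "0 \<le> s + t" using s t by simp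
    define z where "z = K (s + t) powr (q - 1)"
    have z: "0 < z" using K[OF st] by (simp add: z_def)
    show ?thesis
      unfolding filterlim_at_top
    proof
      fix M
      have "0 < (1 - q) * (t * ln (1 / c))" using 3 t ln_inverse_c_pos by simp
      then obtain l :: nat where l: "M \<le> z * exp ((1 - q) * (t * ln (1 / c)) * l)"
        using exp_scaled_at_top[OF z(1)] by blast
      show "\<forall>\<^sub>F r in F. M \<le> (\<Sum>u\<in>S r. term_sum q s u)"
        using cut long[of l] cut_nonempty_words
      proof eventually_elim
        case (elim r)
        have "M \<le> (\<Sum>u\<in>S r. term_sum q (s + t) u) * exp ((1 - q) * (t * ln (1 / c)) * l)"
          by (rule order_trans[OF l[unfolded z_def] mult_right_mono[OF cut_sum_lower_lt1[OF st 3(1) neg elim(1,3)]]]) simp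
        also have "\<dots> = (\<Sum>u\<in>S r. term_sum q (s + t) u * exp ((1 - q) * (t * l * ln (1 / c))))"
          by (simp add: sum_distrib_right mult_ac)
        also have "\<dots> \<le> (\<Sum>u\<in>S r. term_sum q s u)"
          using elim(2) t s 3 by (intro sum_mono term_sum_shift) auto
        finally show ?case .
      qed
    qed
  qed
qed

end

end

lemma eventually_at_right_0_less: "0 < (z :: real) \<Longrightarrow> \<forall>\<^sub>F r in at_right 0. 0 < r \<and> r < z"
  by (auto simp: eventually_at_right_field)

lemma Sup_ereal_image_eq:
  assumes "0 \<le> z" "\<And>s. 0 < s \<Longrightarrow> s < z \<Longrightarrow> s \<in> A" "\<And>s. s \<in> A \<Longrightarrow> s \<le> z"
  shows "Sup (insert 0 (ereal ` A)) = ereal z"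
proof (rule antisym)
  show "Sup (insert 0 (ereal ` A)) \<le> ereal z" using assms by (auto intro!: Sup_least)
  show "ereal z \<le> Sup (insert 0 (ereal ` A))"
  proof (cases "z = 0")
    case False
    show ?thesis
    proof (rule dense_le)
      fix y assume "y < ereal z"
      then have "max y 0 < ereal z" using False assms(1) by auto
      then obtain t where t: "max y 0 < ereal t" "ereal t < ereal z" using ereal_dense2 by blast
      then have "ereal t \<in> ereal ` A" using assms(2)[of t] by auto
      then have "ereal t \<le> Sup (insert 0 (ereal ` A))" by (intro Sup_upper) simp
      then show "y \<le> Sup (insert 0 (ereal ` A))" using t by auto
    qed
  qed (auto intro!: Sup_upper simp: zero_ereal_def)
qed

lemma Inf_ereal_image_eq:
  assumes "\<And>s. z < s \<Longrightarrow> s \<in> A" "\<And>s. s \<in> A \<Longrightarrow> z \<le> s"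
  shows "Inf (ereal ` A) = ereal z"
proof (rule antisym)
  show "ereal z \<le> Inf (ereal ` A)" using assms by (auto intro!: Inf_greatest)
  show "Inf (ereal ` A) \<le> ereal z"
  proof (rule dense_ge)
    fix y assume "ereal z < y"
    then obtain t where t: "ereal z < ereal t" "ereal t < y" using ereal_dense2 by blast
    then have "Inf (ereal ` A) \<le> ereal t" using assms(1)[of t] by (intro Inf_lower) auto
    then show "Inf (ereal ` A) \<le> y" using t by auto
  qed
qed

section \<open>The Bernoulli measure\<close>

lemma prefix_word_eq_iff: "prefix_word x k = v \<longleftrightarrow> length v = k \<and> (\<forall>i<k. x i = v ! i)"
  by (auto simp: prefix_word_def list_eq_iff_nth_eq)

lemma prob_space_bernoulli: "prob_space (bernoulli_measure p)"
  unfolding bernoulli_measure_def by (intro prob_space_PiM prob_space_measure_pmf)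

lemma space_bernoulli [simp]: "space (bernoulli_measure p) = UNIV"
  by (simp add: bernoulli_measure_def space_PiM)

lemma measurable_coordinate [measurable]: "(\<lambda>x. x i) \<in> bernoulli_measure p \<rightarrow>\<^sub>M count_space UNIV"
proof -
  have "(\<lambda>x. x i) \<in> bernoulli_measure p \<rightarrow>\<^sub>M measure_pmf p"
    unfolding bernoulli_measure_def by (rule measurable_component_singleton) simp
  then show ?thesis by (simp add: measurable_def)
qed

lemma sets_cylinder [measurable]:
  fixes v :: "'n::finite list"
  shows "cylinder v \<in> sets (bernoulli_measure p)"
proof -
  have "cylinder v = {x \<in> space (bernoulli_measure p). \<forall>i<length v. x i = v ! i}"
    by (auto simp: cylinder_def prefix_word_eq_iff)
  also have "\<dots> \<in> sets (bernoulli_measure p)" by measurable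
  finally show ?thesis .
qed

lemma measurable_prefix_word [measurable]:
  "(\<lambda>x. prefix_word x k) \<in> bernoulli_measure p \<rightarrow>\<^sub>M count_space (UNIV :: 'n::finite list set)"
proof (rule measurable_count_space_eq_countable[THEN iffD2, OF countable_subset[OF subset_UNIV]])
  show "countable (UNIV :: 'n list set)" by simp
  show "(\<lambda>x. prefix_word x k) \<in> space (bernoulli_measure p) \<rightarrow> UNIV \<and>
    (\<forall>v\<in>UNIV. (\<lambda>x. prefix_word x k) -` {v} \<inter> space (bernoulli_measure p) \<in> sets (bernoulli_measure p))"
  proof (intro conjI ballI)
    fix v :: "'n list"
    have "(\<lambda>x. prefix_word x k) -` {v} = (if length v = k then cylinder v else {})"
      by (auto simp: cylinder_def)
    then show "(\<lambda>x. prefix_word x k) -` {v} \<inter> space (bernoulli_measure p) \<in> sets (bernoulli_measure p)" by simp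
  qed auto
qed

lemma measure_cylinder:
  fixes v :: "'n::finite list"
  shows "measure (bernoulli_measure p) (cylinder v) = word_prob p v"
proof -
  interpret product_prob_space "\<lambda>_. measure_pmf p" "UNIV :: nat set"
    by (rule product_prob_spaceI) (rule prob_space_measure_pmf)
  have "cylinder v = prod_emb UNIV (\<lambda>_. measure_pmf p) {..<length v} (Pi\<^sub>E {..<length v} (\<lambda>i. {v ! i}))"
    by (subst prod_emb_PiE) (auto simp: cylinder_def prefix_word_eq_iff PiE_iff split: if_splits)
  then have "measure (bernoulli_measure p) (cylinder v) = (\<Prod>i<length v. measure (measure_pmf p) {v ! i})"
    unfolding bernoulli_measure_def by (simp add: measure_PiM_emb)
  also have "\<dots> = word_prob p v"
    by (simp add: word_prob_def prod.list_conv_set_nth atLeast0LessThan measure_pmf_single)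
  finally show ?thesis .
qed

lemma emeasure_cylinder:
  fixes v :: "'n::finite list"
  shows "emeasure (bernoulli_measure p) (cylinder v) = ennreal (word_prob p v)"
proof -
  interpret prob_space "bernoulli_measure p" by (rule prob_space_bernoulli)
  show ?thesis by (simp add: emeasure_eq_measure measure_cylinder)
qed

lemma prefix_function_sum:
  fixes f :: "'n::finite list \<Rightarrow> real"
  shows "f (prefix_word x k) = (\<Sum>w\<in>words k. f w * indicator (cylinder w) x)"
proof -
  have "(\<Sum>w\<in>words k. f w * indicator (cylinder w) x) = (\<Sum>w\<in>words k. if w = prefix_word x k then f w else 0)"
    by (intro sum.cong) (auto simp: cylinder_def indicator_def)
  also have "\<dots> = f (prefix_word x k)" by (simp add: finite_words)
  finally show ?thesis by simp
qed

lemma integral_prefix_word: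
  fixes f :: "'n::finite list \<Rightarrow> real"
  shows "(\<integral>x. f (prefix_word x k) \<partial>bernoulli_measure p) = (\<Sum>w\<in>words k. word_prob p w * f w)"
proof -
  interpret prob_space "bernoulli_measure p" by (rule prob_space_bernoulli)
  have "(\<integral>x. f (prefix_word x k) \<partial>bernoulli_measure p) = (\<integral>x. (\<Sum>w\<in>words k. f w * indicator (cylinder w) x) \<partial>bernoulli_measure p)"
    by (simp only: prefix_function_sum)
  also have "\<dots> = (\<Sum>w\<in>words k. \<integral>x. f w * indicator (cylinder w) x \<partial>bernoulli_measure p)"
    by (intro Bochner_Integration.integral_sum integrable_mult_right integrable_real_indicator)
      (auto simp: emeasure_eq_measure)
  also have "\<dots> = (\<Sum>w\<in>words k. word_prob p w * f w)"
    by (simp add: measure_cylinder mult.commute)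
  finally show ?thesis .
qed

section \<open>Products of contractions\<close>

lemma word_matrix_append: "word_matrix T (u @ v) = word_matrix T u ** word_matrix T v"
  by (induction u) (simp_all add: word_matrix_def matrix_mul_assoc)

lemma word_matrix_Nil [simp]: "word_matrix T [] = mat 1"
  by (simp add: word_matrix_def)

lemma word_matrix_single [simp]: "word_matrix T [i] = T i"
  by (simp add: word_matrix_def)

lemma invertible_mat_1: "invertible (mat 1 :: real^'d^'d)"
  unfolding invertible_def by (intro exI[of _ "mat 1"]) simp

lemma sv_fun_mat_1: "0 \<le> s \<Longrightarrow> sv_fun s (mat 1 :: real^'d^'d) = 1"
  by (subst sv_fun_eq) (auto simp: sing_val_mat_1[where 'd = 'd, simplified] intro!: prod.neutral invertible_mat_1)

text \<open>For s \<le> d choose as radii the m-th singular values of A and B. There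
  \<open>sv_max_prod\<close> equals psi^s up to powers of the radii, and for \<open>A ** B\<close>
  the inequality \<open>sv_fun_le_max_prod\<close> suffices; the powers cancel. For s > d the
  determinant is multiplicative.\<close>

lemma sv_fun_submult:
  fixes A B :: "real^'d^'d"
  assumes A: "invertible A" and B: "invertible B" and s: "0 \<le> s"
  shows "sv_fun s (A ** B) \<le> (8 * (real CARD('d))\<^sup>2) ^ CARD('d) * sv_fun s A * sv_fun s B"
proof -
  let ?d = "real CARD('d)" and ?K = "(8 * (real CARD('d))\<^sup>2) ^ CARD('d)"
  have AB: "invertible (A ** B)" using A B by (simp add: invertible_mult)
  have d1: "1 \<le> ?d" by (simp add: Suc_leI)
  then have "1 \<le> ?d\<^sup>2" by simp
  then have K: "1 \<le> ?K" by (intro one_le_power) linarith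
  consider "s = 0" | "0 < s" "s \<le> ?d" | "s > ?d" using s by linarith
  then show ?thesis
  proof cases
    case 1
    then show ?thesis using K by simp
  next
    case 2
    define m where "m = nat \<lceil>s\<rceil>"
    have m: "1 \<le> m" "m \<le> CARD('d)" using 2 by (auto simp: m_def) linarith+
    define r where "r = sing_val A m"
    define \<rho> where "\<rho> = sing_val B m"
    have r: "0 < r" "0 < \<rho>" using m sing_val_pos A B by (auto simp: r_def \<rho>_def)
    have "sv_fun s (A ** B) * (\<rho> * r) powr (?d - s) \<le> sv_max_prod (A ** B) (\<rho> * r)"
      using r 2 by (intro sv_fun_le_max_prod AB) auto
    also have "\<dots> \<le> ?K * sv_max_prod A r * sv_max_prod B \<rho>" by (rule sv_max_prod_mult_le[OF A B r])
    also have "\<dots> = ?K * sv_fun s A * sv_fun s B * (\<rho> * r) powr (?d - s)"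
      unfolding r_def \<rho>_def sv_max_prod_at_sing_val[OF A 2 m_def] sv_max_prod_at_sing_val[OF B 2 m_def]
      using r by (simp add: powr_mult r_def \<rho>_def)
    finally show ?thesis using r by simp
  next
    case 3
    have "sv_fun s (A ** B) = sv_fun s A * sv_fun s B"
      using 3 s by (simp add: sv_fun_def prod_sing_val[unfolded One_nat_def] det_mul abs_mult powr_mult)
    moreover have "1 * (sv_fun s A * sv_fun s B) \<le> ?K * (sv_fun s A * sv_fun s B)"
      using K sv_fun_pos[OF A s] sv_fun_pos[OF B s] by (intro mult_right_mono) auto
    ultimately show ?thesis by (simp add: mult.assoc)
  qed
qed

lemma power_powr_commute: "0 < x \<Longrightarrow> (x ^ k) powr t = x powr (t * real k)"
  for x :: real
  by (simp add: powr_realpow[symmetric] powr_powr mult.commute)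

locale affine_system =
  fixes T :: "'n::finite \<Rightarrow> real^'d^'d" and p :: "'n pmf" and b c :: real
  assumes inv_T: "\<And>j. invertible (T j)"
    and bT: "0 < b" "\<And>j x. b * norm x \<le> norm (T j *v x)"
    and cT: "c < 1 / 2" "\<And>j x. norm (T j *v x) \<le> c * norm x"
begin

lemma b_le_c: "b \<le> c"
proof -
  have "b * norm (axis undefined 1 :: real^'d) \<le> c * norm (axis undefined 1 :: real^'d)"
    using bT(2) cT(2) order_trans by blast
  then show ?thesis by simp
qed

lemma c_pos: "0 < c" using bT b_le_c by linarith

lemma b_less_1: "b < 1" using b_le_c cT by linarith

lemma invertible_word_matrix: "invertible (word_matrix T u)"
  using inv_T by (induction u) (simp_all add: word_matrix_def invertible_mult invertible_mat_1)

lemma norm_word_matrix_le: "norm (word_matrix T u *v x) \<le> c ^ length u * norm x"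
proof (induction u)
  case (Cons i u)
  have "norm (word_matrix T (i # u) *v x) = norm (T i *v (word_matrix T u *v x))"
    by (simp add: word_matrix_def matrix_vector_mul_assoc)
  also have "\<dots> \<le> c * norm (word_matrix T u *v x)" by (rule cT)
  also have "\<dots> \<le> c * (c ^ length u * norm x)" using Cons c_pos by (intro mult_left_mono) auto
  finally show ?case by simp
qed simp

lemma norm_word_matrix_ge: "b ^ length u * norm x \<le> norm (word_matrix T u *v x)"
proof (induction u)
  case (Cons i u)
  have "b * (b ^ length u * norm x) \<le> b * norm (word_matrix T u *v x)"
    using Cons bT by (intro mult_left_mono) auto
  also have "\<dots> \<le> norm (T i *v (word_matrix T u *v x))" by (rule bT)
  also have "\<dots> = norm (word_matrix T (i # u) *v x)"
    by (simp add: word_matrix_def matrix_vector_mul_assoc)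
  finally show ?case by simp
qed simp

sublocale word_growth p "\<lambda>s u. sv_fun s (word_matrix T u)" b c "\<lambda>_. (8 * (real CARD('d))\<^sup>2) ^ CARD('d)"
proof
  have d1: "1 \<le> real CARD('d)" by (simp add: Suc_leI)
  then have "1 \<le> (real CARD('d))\<^sup>2" by simp
  then show "1 \<le> (8 * (real CARD('d))\<^sup>2) ^ CARD('d)" by (intro one_le_power) linarith
  show "sv_fun s (word_matrix T u) * b powr (s * real (length v)) \<le> sv_fun s (word_matrix T (u @ v))"
    if "0 \<le> s" for s u v
    using sv_fun_mult_ge[OF invertible_word_matrix invertible_word_matrix norm_word_matrix_ge that, of v u] bT(1)
    by (simp add: word_matrix_append power_powr_commute)
  show "sv_fun (s + t) (word_matrix T u) \<le> sv_fun s (word_matrix T u) * c powr (t * real (length u))"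
    if "0 \<le> s" "0 \<le> t" for s t u
    using sv_fun_add_le[OF invertible_word_matrix norm_word_matrix_le that, of u] c_pos
    by (simp add: power_powr_commute)
  show "sv_fun s (word_matrix T u) * b powr (t * real (length u)) \<le> sv_fun (s + t) (word_matrix T u)"
    if "0 \<le> s" "0 \<le> t" for s t u
    using sv_fun_add_ge[OF invertible_word_matrix norm_word_matrix_ge that, of u] bT(1)
    by (simp add: power_powr_commute)
  show "sv_fun s (word_matrix T (u @ v)) \<le>
      (8 * (real CARD('d))\<^sup>2) ^ CARD('d) * sv_fun s (word_matrix T u) * sv_fun s (word_matrix T v)"
    if "0 \<le> s" for s u v
    unfolding word_matrix_append by (intro sv_fun_submult invertible_word_matrix that)
qed (use bT cT c_pos in \<open>auto simp: sv_fun_mat_1 intro!: sv_fun_pos invertible_word_matrix\<close>)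

section \<open>Critical values\<close>

definition cut_index :: "real \<Rightarrow> nat" where
  "cut_index s = (if s > CARD('d) then CARD('d) else nat \<lceil>s\<rceil>)"

lemma cut_index: "0 < s \<Longrightarrow> 1 \<le> cut_index s \<and> cut_index s \<le> CARD('d)"
  unfolding cut_index_def by (auto simp: Suc_leI; linarith)

definition \<alpha> :: "real \<Rightarrow> 'n list \<Rightarrow> real" where
  "\<alpha> s u = sing_val (word_matrix T u) (cut_index s)"

lemma cut_set_eq: "cut_set T s r = {u. u \<noteq> [] \<and> \<alpha> s u \<le> r \<and> r < \<alpha> s (butlast u)}"
  by (simp add: cut_set_def \<alpha>_def cut_index_def Let_def)

lemma alpha_le: "0 < s \<Longrightarrow> \<alpha> s u \<le> c ^ length u"
  unfolding \<alpha>_def using cut_index norm_word_matrix_le by (intro sing_val_le) auto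

lemma alpha_ge: "0 < s \<Longrightarrow> b ^ length u \<le> \<alpha> s u"
  unfolding \<alpha>_def using cut_index norm_word_matrix_ge by (intro sing_val_ge) auto

lemma alpha_pos: "0 < s \<Longrightarrow> 0 < \<alpha> s u"
  using alpha_ge[of s u] bT(1) by (meson less_le_trans zero_less_power)

lemma alpha_snoc_le: "0 < s \<Longrightarrow> \<alpha> s (u @ [i]) \<le> \<alpha> s u"
proof -
  assume s: "0 < s"
  have "\<alpha> s (u @ [i]) \<le> \<alpha> s u * c"
    unfolding \<alpha>_def word_matrix_append word_matrix_single
    using cut_index[OF s] inv_T cT(2) by (intro sing_val_mult_le) auto
  also have "\<dots> \<le> \<alpha> s u * 1" using alpha_pos[OF s, of u] cT(1) by (intro mult_left_mono) auto
  finally show ?thesis by simp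
qed

lemma alpha_snoc_ge: "0 < s \<Longrightarrow> \<alpha> s u * b \<le> \<alpha> s (u @ [i])"
  unfolding \<alpha>_def word_matrix_append word_matrix_single
  using cut_index[of s] inv_T bT(2) by (intro sing_val_mult_ge) auto

text \<open>Along an infinite word the m-th singular value starts at 1, never increases and is at
  most c^k after k letters. It therefore crosses r exactly once, after a number of letters bounded
  uniformly in the word.\<close>

lemma is_cut_cut_set:
  assumes s: "0 < s" and r: "0 < r" "r < 1"
  shows "is_cut (cut_set T s r)"
proof -
  have lim: "(\<lambda>k. c ^ k) \<longlonglongrightarrow> 0" using c_pos cT(1) by (intro LIMSEQ_realpow_zero) auto
  obtain N where N: "c ^ N < r" using eventually_happens[OF order_tendstoD(2)[OF lim r(1)]] by auto
  have "length u \<le> N" if u: "u \<in> cut_set T s r" for u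
  proof (rule ccontr)
    assume "\<not> length u \<le> N"
    then have "\<alpha> s (butlast u) \<le> c ^ length (butlast u)" "c ^ length (butlast u) \<le> c ^ N"
      using alpha_le[OF s, of "butlast u"] c_pos cT(1) by (auto intro!: power_decreasing)
    then show False using u N by (auto simp: cut_set_eq)
  qed
  then have "cut_set T s r \<subseteq> {u. set u \<subseteq> UNIV \<and> length u \<le> N}" by auto
  then have fin: "finite (cut_set T s r)" by (rule finite_subset) (rule finite_lists_length_le[OF finite])
  have "\<exists>!k. prefix_word x k \<in> cut_set T s r" for x
  proof -
    define f where "f k = \<alpha> s (prefix_word x k)" for k
    have prefix_Suc: "prefix_word x (Suc k) = prefix_word x k @ [x k]" for k by (simp add: prefix_word_def)
    have dec: "f (Suc k) \<le> f k" for k unfolding f_def prefix_Suc by (rule alpha_snoc_le[OF s])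
    then have anti: "f k \<le> f j" if "j \<le> k" for j k using that by (rule lift_Suc_antimono_le)
    have f0: "f 0 = 1" using cut_index[OF s] sing_val_mat_1[where 'd = 'd] by (simp add: f_def \<alpha>_def prefix_word_def)
    have "f N \<le> r" using alpha_le[OF s, of "prefix_word x N"] N by (simp add: f_def)
    then have "\<exists>k. f k \<le> r" by blast
    define k where "k = (LEAST k. f k \<le> r)"
    have k: "f k \<le> r" unfolding k_def using \<open>\<exists>k. f k \<le> r\<close> by (rule LeastI_ex)
    have kl: "r < f j" if "j < k" for j using not_less_Least[of j "\<lambda>k. f k \<le> r"] that by (simp add: k_def)
    have k0: "0 < k" using k f0 r by (cases k) auto
    have mem: "prefix_word x j \<in> cut_set T s r \<longleftrightarrow> 0 < j \<and> f j \<le> r \<and> r < f (j - 1)" for j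
    proof (cases j)
      case (Suc i)
      then show ?thesis by (simp add: cut_set_eq f_def prefix_Suc)
    qed (simp add: cut_set_eq prefix_word_def)
    show ?thesis
    proof (rule ex1I[of _ k])
      show "prefix_word x k \<in> cut_set T s r" using k k0 kl[of "k - 1"] by (simp add: mem)
      fix j assume "prefix_word x j \<in> cut_set T s r"
      then have j: "0 < j" "f j \<le> r" "r < f (j - 1)" by (auto simp: mem)
      have "\<not> j < k" using kl j by force
      moreover have "\<not> k < j"
      proof
        assume "k < j"
        then have "f (j - 1) \<le> f k" by (intro anti) simp
        then show False using j k by linarith
      qed
      ultimately show "j = k" by simp
    qed
  qed
  then show ?thesis using fin by (simp add: is_cut_def)
qed

lemma eventually_is_cut: "0 < s \<Longrightarrow> \<forall>\<^sub>F r in at_right 0. is_cut (cut_set T s r)"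
  using eventually_at_right_0_less[OF zero_less_one] by (rule eventually_mono) (simp add: is_cut_cut_set)

lemma eventually_cut_long: "0 < s \<Longrightarrow> \<forall>\<^sub>F r in at_right 0. \<forall>u\<in>cut_set T s r. real l \<le> length u"
proof -
  assume s: "0 < s"
  have "\<forall>\<^sub>F r in at_right 0. 0 < r \<and> r < b ^ l" using bT(1) by (intro eventually_at_right_0_less) simp
  then show ?thesis
  proof eventually_elim
    case (elim r)
    show ?case
    proof
      fix u assume u: "u \<in> cut_set T s r"
      show "real l \<le> length u"
      proof (rule ccontr)
        assume "\<not> real l \<le> length u"
        then have "b ^ l \<le> b ^ length u" using bT(1) b_less_1 by (intro power_decreasing) auto
        also have "\<dots> \<le> r" using alpha_ge[OF s, of u] u by (simp add: cut_set_eq)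
        finally show False using elim by simp
      qed
    qed
  qed
qed

lemma F_sum_eq: "F_sum T p q s r = (\<Sum>u\<in>cut_set T s r. term_sum q s u)"
  by (auto simp: F_sum_def term_sum_def X_def measure_cylinder Let_def)

lemma F_sum_bounded:
  assumes "0 < s" "1 \<le> q \<and> \<gamma> q s < 0 \<or> q < 1 \<and> 0 < \<gamma> q s"
  shows "\<exists>B. \<forall>\<^sub>F r in at_right 0. F_sum T p q s r \<le> B"
  unfolding F_sum_eq
  using cut_sums_bounded[OF eventually_is_cut[OF assms(1)] eventually_cut_long[OF assms(1)]] assms by simp

lemma F_sum_at_top:
  assumes "0 < s" "1 \<le> q \<and> 0 < \<gamma> q s \<or> q < 1 \<and> \<gamma> q s < 0"
  shows "filterlim (F_sum T p q s) at_top (at_right 0)"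
  using cut_sums_at_top[OF eventually_is_cut[OF assms(1)] eventually_cut_long[OF assms(1)] assms]
  by (simp add: F_sum_eq[abs_def])

lemma Limsup_F_sum_finite:
  assumes "0 < s" "1 \<le> q \<and> \<gamma> q s < 0 \<or> q < 1 \<and> 0 < \<gamma> q s"
  shows "Limsup (at_right 0) (\<lambda>r. ereal (F_sum T p q s r)) < \<infinity>"
    and "Liminf (at_right 0) (\<lambda>r. ereal (F_sum T p q s r)) < \<infinity>"
proof -
  obtain B where "\<forall>\<^sub>F r in at_right 0. F_sum T p q s r \<le> B" using F_sum_bounded[OF assms] by blast
  then have "Limsup (at_right 0) (\<lambda>r. ereal (F_sum T p q s r)) \<le> ereal B"
    by (intro Limsup_bounded) auto
  then show *: "Limsup (at_right 0) (\<lambda>r. ereal (F_sum T p q s r)) < \<infinity>" by (rule le_less_trans) simp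
  show "Liminf (at_right 0) (\<lambda>r. ereal (F_sum T p q s r)) < \<infinity>"
    by (rule le_less_trans[OF Liminf_le_Limsup *]) simp
qed

lemma Liminf_F_sum_infinite:
  assumes "0 < s" "1 \<le> q \<and> 0 < \<gamma> q s \<or> q < 1 \<and> \<gamma> q s < 0"
  shows "Limsup (at_right 0) (\<lambda>r. ereal (F_sum T p q s r)) = \<infinity>"
    and "Liminf (at_right 0) (\<lambda>r. ereal (F_sum T p q s r)) = \<infinity>"
proof -
  have "((\<lambda>r. ereal (F_sum T p q s r)) \<longlongrightarrow> \<infinity>) (at_right 0)"
    using F_sum_at_top[OF assms] unfolding tendsto_PInfty filterlim_at_top_dense by simp
  then show "Limsup (at_right 0) (\<lambda>r. ereal (F_sum T p q s r)) = \<infinity>"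
    and "Liminf (at_right 0) (\<lambda>r. ereal (F_sum T p q s r)) = \<infinity>"
    by (auto intro!: lim_imp_Limsup lim_imp_Liminf)
qed

definition crit_root :: "real \<Rightarrow> real" where
  "crit_root q = (THE s. 0 \<le> s \<and> \<gamma> q s = 0)"

lemma crit_root: "0 \<le> crit_root q" "\<gamma> q (crit_root q) = 0"
proof -
  have "0 \<le> crit_root q \<and> \<gamma> q (crit_root q) = 0"
    unfolding crit_root_def by (rule theI'[OF gamma_root[of q]])
  then show "0 \<le> crit_root q" "\<gamma> q (crit_root q) = 0" by simp_all
qed

lemma
  assumes s: "0 \<le> s"
  shows gamma_neg_iff: "\<gamma> q s < 0 \<longleftrightarrow> s < crit_root q"
    and gamma_pos_iff: "0 < \<gamma> q s \<longleftrightarrow> crit_root q < s"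
proof -
  have "\<gamma> q s < 0" if "s < crit_root q" using gamma_strict_mono[OF s that, of q] crit_root(2)[of q] by simp
  moreover have "0 < \<gamma> q s" if "crit_root q < s"
    using gamma_strict_mono[OF crit_root(1) that, of q] crit_root(2)[of q] by simp
  moreover have "\<gamma> q s = 0" if "s = crit_root q" using that crit_root(2)[of q] by simp
  ultimately show "\<gamma> q s < 0 \<longleftrightarrow> s < crit_root q" "0 < \<gamma> q s \<longleftrightarrow> crit_root q < s"
    by (cases s "crit_root q" rule: linorder_cases; fastforce)+
qed

text \<open>The k-th roots in the equation are the exponentials of (q - 1) G / k, so the limit is 1
  exactly when the rate is 0; for q = 1 the integral is G by definition.\<close>

lemma crit_equation_iff:
  assumes "1 \<le> q"
  shows "crit_equation T p q s \<longleftrightarrow> s = crit_root q"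
proof -
  have "crit_equation T p q s \<longleftrightarrow> 0 \<le> s \<and> \<gamma> q s = 0"
  proof (cases "0 \<le> s")
    case s: True
    have lim: "(\<lambda>k. G q s k / k) \<longlonglongrightarrow> 0 \<longleftrightarrow> \<gamma> q s = 0"
    proof
      assume "(\<lambda>k. G q s k / k) \<longlonglongrightarrow> 0"
      from LIMSEQ_unique[OF G_limit[OF s, of q] this] show "\<gamma> q s = 0" .
    qed (use G_limit[OF s, of q] in simp)
    show ?thesis
    proof (cases "q = 1")
      case True
      have eq: "1 / real k * (\<integral>u. ln (inverse (sv_fun s (word_matrix T (prefix_word u k)))
                * word_prob p (prefix_word u k)) \<partial>bernoulli_measure p) = G q s k / k" for k
        unfolding integral_prefix_word[where f = "\<lambda>v. ln (inverse (sv_fun s (word_matrix T v)) * word_prob p v)"]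
        using True by (simp add: G_def gmean_def X_def)
      show ?thesis unfolding crit_equation_def if_P[OF True] eq lim ..
    next
      case False
      define a where "a k = (\<Sum>u\<in>words k. sv_fun s (word_matrix T u) powr (1 - q) * word_prob p u powr q)" for k
      have a: "a k = exp ((q - 1) * G q s k)" for k
        using sum_term_sum_eq[OF s False, of k] False by (simp add: a_def term_sum_def G_def)
      have ap: "a k powr (1 / real k) = exp ((q - 1) * (G q s k / k))" for k
        by (simp add: a powr_def)
      have "(\<lambda>k. a k powr (1 / real k)) \<longlonglongrightarrow> 1 \<longleftrightarrow> (\<lambda>k. G q s k / k) \<longlonglongrightarrow> 0"
      proof
        assume "(\<lambda>k. a k powr (1 / real k)) \<longlonglongrightarrow> 1"
        from tendsto_ln[OF this] have "(\<lambda>k. (q - 1) * (G q s k / k)) \<longlonglongrightarrow> 0" by (simp add: ap)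
        from tendsto_mult_left[OF this, of "1 / (q - 1)"] show "(\<lambda>k. G q s k / k) \<longlonglongrightarrow> 0"
          using False by simp
      next
        assume "(\<lambda>k. G q s k / k) \<longlonglongrightarrow> 0"
        from tendsto_exp[OF tendsto_mult_left[OF this, of "q - 1"]]
        show "(\<lambda>k. a k powr (1 / real k)) \<longlonglongrightarrow> 1" by (simp add: ap)
      qed
      then show ?thesis using lim s False by (simp add: crit_equation_def a_def)
    qed
  qed (simp add: crit_equation_def)
  then show ?thesis using crit_root[of q] gamma_root[of q] by blast
qed

lemma crit_dim_ge_1: "1 \<le> q \<Longrightarrow> crit_dim T p q = ereal (crit_root q)"
  unfolding crit_dim_def by (simp, rule the_equality) (simp_all add: crit_equation_iff)

text \<open>On one side of the root \<open>F_sum\<close> stays bounded, on the other it tends to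
  infinity, with the sides exchanged for q < 1. Hence upper and lower limit are finite for the same
  s, the root possibly excepted, and a single point does not change the supremum or infimum.\<close>

lemma crit_values_eq: "crit_lower T p q = ereal (crit_root q)" "crit_upper T p q = ereal (crit_root q)"
proof -
  have less: "0 < s \<Longrightarrow> Limsup (at_right 0) (\<lambda>r. ereal (F_sum T p q s r)) < \<infinity>"
    "0 < s \<Longrightarrow> Liminf (at_right 0) (\<lambda>r. ereal (F_sum T p q s r)) < \<infinity>"
    if "1 \<le> q \<and> s < crit_root q \<or> q < 1 \<and> crit_root q < s" for s
    using Limsup_F_sum_finite[of s q] gamma_neg_iff[of s q] gamma_pos_iff[of s q] that by auto
  have gt: "0 < s \<Longrightarrow> Limsup (at_right 0) (\<lambda>r. ereal (F_sum T p q s r)) = \<infinity>"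
    "0 < s \<Longrightarrow> Liminf (at_right 0) (\<lambda>r. ereal (F_sum T p q s r)) = \<infinity>"
    if "1 \<le> q \<and> crit_root q < s \<or> q < 1 \<and> s < crit_root q" for s
    using Liminf_F_sum_infinite[of s q] gamma_neg_iff[of s q] gamma_pos_iff[of s q] that by auto
  have "crit_lower T p q = ereal (crit_root q) \<and> crit_upper T p q = ereal (crit_root q)"
  proof (cases "1 \<le> q")
    case True
    have "Sup (insert 0 (ereal ` {s. 0 < s \<and> L s < \<infinity>})) = ereal (crit_root q)"
      if "\<And>s. s < crit_root q \<Longrightarrow> 0 < s \<Longrightarrow> L s < \<infinity>" "\<And>s. crit_root q < s \<Longrightarrow> 0 < s \<Longrightarrow> L s = \<infinity>"
      for L :: "real \<Rightarrow> ereal"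
      using that crit_root(1)[of q] by (intro Sup_ereal_image_eq) (auto intro: leI)
    then show ?thesis
      unfolding crit_lower_def crit_upper_def using less gt True by simp
  next
    case False
    then have "0 < s" if "crit_root q < s" for s using crit_root[of q] that by linarith
    then have "Inf (ereal ` {s. 0 < s \<and> L s < \<infinity>}) = ereal (crit_root q)"
      if "\<And>s. crit_root q < s \<Longrightarrow> 0 < s \<Longrightarrow> L s < \<infinity>" "\<And>s. s < crit_root q \<Longrightarrow> 0 < s \<Longrightarrow> L s = \<infinity>"
      for L :: "real \<Rightarrow> ereal"
      using that by (intro Inf_ereal_image_eq) (auto intro: leI)
    then show ?thesis
      unfolding crit_lower_def crit_upper_def using less gt False by simp
  qed
  then show "crit_lower T p q = ereal (crit_root q)" "crit_upper T p q = ereal (crit_root q)" by auto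
qed

lemma crit_dim_eq: "crit_dim T p q = ereal (crit_root q)"
proof (cases "1 \<le> q")
  case True
  then show ?thesis by (rule crit_dim_ge_1)
next
  case False
  then show ?thesis using crit_values_eq(1)[of q] unfolding crit_dim_def by simp
qed

end

section \<open>The coding map\<close>

lemma nn_integral_indicator_translate:
  fixes S :: "'a::euclidean_space set"
  assumes [measurable]: "S \<in> sets borel"
  shows "(\<integral>\<^sup>+h. indicator S (t + h) \<partial>lborel) = emeasure lborel S"
proof -
  have "(\<integral>\<^sup>+h. indicator S (t + h) \<partial>lborel) = (\<integral>\<^sup>+h. indicator S h \<partial>distr lborel borel ((+) t))"
    by (subst nn_integral_distr) auto
  also have "\<dots> = (\<integral>\<^sup>+h. indicator S h \<partial>lborel)" by (simp only: lborel_distr_plus)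
  also have "\<dots> = emeasure lborel S" by (rule nn_integral_indicator) simp
  finally show ?thesis .
qed

context affine_system
begin

text \<open>\<open>tail_point \<omega> x k a\<close> is the point coded by the infinite word \<open>x\<close> with its first \<open>k\<close> maps removed.\<close>

definition tail_point :: "('n list \<Rightarrow> 't) \<Rightarrow> (nat \<Rightarrow> 'n) \<Rightarrow> nat \<Rightarrow> (real^'d)^'t \<Rightarrow> real^'d" where
  "tail_point \<omega> x k a =
     (\<Sum>l. word_matrix T (map x [k..<k + l]) *v (a $ \<omega> (prefix_word x (Suc (k + l)))))"

abbreviation code_point :: "('n list \<Rightarrow> 't) \<Rightarrow> (nat \<Rightarrow> 'n) \<Rightarrow> (real^'d)^'t \<Rightarrow> real^'d" where
  "code_point \<omega> x a \<equiv> tail_point \<omega> x 0 a"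

lemma tail_term_le:
  assumes "\<And>i. norm (a $ i) \<le> M"
  shows "norm (word_matrix T (map x [k..<k + l]) *v (a $ \<omega> (prefix_word x (Suc (k + l))))) \<le> c ^ l * M"
proof -
  have "norm (word_matrix T (map x [k..<k + l]) *v (a $ \<omega> (prefix_word x (Suc (k + l)))))
      \<le> c ^ l * norm (a $ \<omega> (prefix_word x (Suc (k + l))))"
    using norm_word_matrix_le[of "map x [k..<k + l]"] by simp
  also have "\<dots> \<le> c ^ l * M" using assms c_pos by (intro mult_left_mono) auto
  finally show ?thesis .
qed

lemma tail_summable:
  "summable (\<lambda>l. word_matrix T (map x [k..<k + l]) *v (a $ \<omega> (prefix_word x (Suc (k + l)))))"
proof (rule summable_comparison_test)
  show "\<exists>N. \<forall>n\<ge>N. norm (word_matrix T (map x [k..<k + n]) *v (a $ \<omega> (prefix_word x (Suc (k + n))))) \<le> c ^ n * norm a"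
    by (intro exI allI impI tail_term_le Finite_Cartesian_Product.norm_nth_le)
  show "summable (\<lambda>n. c ^ n * norm a)"
    using c_pos cT(1) by (intro summable_mult2 summable_geometric) auto
qed

lemma norm_tail_point_le:
  assumes "\<And>i. norm (a $ i) \<le> M"
  shows "norm (tail_point \<omega> x k a) \<le> M / (1 - c)"
proof -
  have sums: "(\<lambda>n. c ^ n * M) sums (1 / (1 - c) * M)"
    using c_pos cT(1) by (intro sums_mult2 geometric_sums) auto
  have "norm (tail_point \<omega> x k a) \<le> (\<Sum>n. c ^ n * M)"
    unfolding tail_point_def
    by (rule norm_suminf_le[OF tail_term_le[OF assms] sums_summable[OF sums]])
  then show ?thesis using sums_unique[OF sums] by simp
qed

lemma linear_tail_point: "linear (tail_point \<omega> x k)"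
proof (rule linearI)
  show "tail_point \<omega> x k (a + a') = tail_point \<omega> x k a + tail_point \<omega> x k a'" for a a'
    unfolding tail_point_def suminf_add[OF tail_summable tail_summable]
    by (simp only: vector_add_component matrix_vector_right_distrib)
  show "tail_point \<omega> x k (z *\<^sub>R a) = z *\<^sub>R tail_point \<omega> x k a" for z a
    unfolding tail_point_def vector_scaleR_component matrix_vector_mult_scaleR
    by (rule bounded_linear.suminf[OF bounded_linear_scaleR_right tail_summable, symmetric])
qed

lemma prefix_word_Suc: "prefix_word x (Suc k) = prefix_word x k @ [x k]"
  by (simp add: prefix_word_def)

lemma prefix_word_0 [simp]: "prefix_word x 0 = []"
  by (simp add: prefix_word_def)

lemma tail_point_Suc:
  "tail_point \<omega> x k a = a $ \<omega> (prefix_word x (Suc k)) + T (x k) *v tail_point \<omega> x (Suc k) a"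
proof -
  let ?f = "\<lambda>l. word_matrix T (map x [k..<k + l]) *v (a $ \<omega> (prefix_word x (Suc (k + l))))"
  let ?g = "\<lambda>l. word_matrix T (map x [Suc k..<Suc k + l]) *v (a $ \<omega> (prefix_word x (Suc (Suc k + l))))"
  have "?f (Suc l) = T (x k) *v ?g l" for l
  proof -
    have "map x [k..<k + Suc l] = [x k] @ map x [Suc k..<Suc k + l]" by (subst upt_rec) simp
    then have "word_matrix T (map x [k..<k + Suc l]) = T (x k) ** word_matrix T (map x [Suc k..<Suc k + l])"
      using word_matrix_append[of T "[x k]"] by simp
    then show ?thesis by (simp add: matrix_vector_mul_assoc del: upt_Suc)
  qed
  then have "(\<Sum>l. ?f (Suc l)) = (\<Sum>l. T (x k) *v ?g l)" by (simp only:)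
  also have "\<dots> = T (x k) *v (\<Sum>l. ?g l)"
    by (rule bounded_linear.suminf[OF matrix_vector_mul_bounded_linear tail_summable, symmetric])
  finally have "(\<Sum>l. ?f (Suc l)) = T (x k) *v tail_point \<omega> x (Suc k) a" by (simp only: tail_point_def)
  moreover have "(\<Sum>l. ?f (Suc l)) = tail_point \<omega> x k a - ?f 0"
    unfolding tail_point_def by (rule suminf_split_head[OF tail_summable])
  ultimately show ?thesis by simp
qed

lemma code_point_split:
  "code_point \<omega> x a = (\<Sum>j<k. word_matrix T (prefix_word x j) *v (a $ \<omega> (prefix_word x (Suc j))))
     + word_matrix T (prefix_word x k) *v tail_point \<omega> x k a"
proof (induction k)
  case (Suc k)
  show ?case
    using Suc by (simp add: tail_point_Suc[of \<omega> x k] matrix_vector_right_distrib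
      prefix_word_Suc[of x k] word_matrix_append matrix_vector_mul_assoc del: prefix_word_Suc)
qed simp

text \<open>The common first k terms of the series cancel. This exhibits the matrix of the common
  prefix, whose singular values govern the transversality estimate.\<close>

lemma code_point_diff:
  assumes "prefix_word x k = prefix_word y k"
  shows "code_point \<omega> x a - code_point \<omega> y a =
    word_matrix T (prefix_word x k) *v (tail_point \<omega> x k a - tail_point \<omega> y k a)"
proof -
  have "prefix_word x j = prefix_word y j" if "j \<le> k" for j
    using assms take_prefix_word[OF that] by metis
  then have "(\<Sum>j<k. word_matrix T (prefix_word x j) *v (a $ \<omega> (prefix_word x (Suc j))))
      = (\<Sum>j<k. word_matrix T (prefix_word y j) *v (a $ \<omega> (prefix_word y (Suc j))))"
    by (intro sum.cong) auto
  then show ?thesis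
    using code_point_split[of \<omega> x a k] code_point_split[of \<omega> y a k] assms
    by (simp add: matrix_vector_mult_diff_distrib)
qed

lemma word_map_affine: "word_map T w u z = word_map T w u 0 + word_matrix T u *v z"
proof (induction u arbitrary: z rule: rev_induct)
  case (snoc i u)
  show ?case
    using snoc[of "T i *v z + w (u @ [i])"] snoc[of "w (u @ [i])"]
    by (simp add: word_map_snoc Psi_def word_matrix_append matrix_vector_right_distrib matrix_vector_mul_assoc)
qed simp

lemma word_map_prefix: "word_map T (\<lambda>u. a $ \<omega> u) (prefix_word x k) z =
  (\<Sum>j<k. word_matrix T (prefix_word x j) *v (a $ \<omega> (prefix_word x (Suc j)))) + word_matrix T (prefix_word x k) *v z"
proof (induction k arbitrary: z)
  case (Suc k)
  have "word_map T (\<lambda>u. a $ \<omega> u) (prefix_word x (Suc k)) z =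
      word_map T (\<lambda>u. a $ \<omega> u) (prefix_word x k) (T (x k) *v z + a $ \<omega> (prefix_word x (Suc k)))"
    unfolding prefix_word_Suc word_map_snoc by (simp add: Psi_def)
  then show ?case
    unfolding Suc by (simp add: matrix_vector_right_distrib prefix_word_Suc[of x k] word_matrix_append matrix_vector_mul_assoc)
qed simp

text \<open>The partial sum S k is the image of the origin under the first k maps. It differs from
  the coded point by the image of a vector from the bounded set J, so by at most c^k R. The coded
  point thus depends on a linearly and not on J.\<close>

lemma coding_map_eq:
  assumes J: "admissible_seed T (\<lambda>u. a $ \<omega> u) J"
  shows "coding_map T (\<lambda>u. a $ \<omega> u) J x = code_point \<omega> x a"
proof -
  let ?z = "coding_map T (\<lambda>u. a $ \<omega> u) J x"
  have z: "?z \<in> (\<Inter>k. word_set T (\<lambda>u. a $ \<omega> u) J (prefix_word x k))"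
    unfolding coding_map_def by (rule theI'[OF coding_map_unique[OF J]])
  obtain R where R: "\<And>y. y \<in> J \<Longrightarrow> norm y \<le> R"
    using J compact_imp_bounded bounded_iff unfolding admissible_seed_def by metis
  define S where "S k = (\<Sum>j<k. word_matrix T (prefix_word x j) *v (a $ \<omega> (prefix_word x (Suc j))))" for k
  have le: "norm (S k - ?z) \<le> c ^ k * R" for k
  proof -
    obtain y where y: "y \<in> J" "?z = S k + word_matrix T (prefix_word x k) *v y"
      using z unfolding word_set_def S_def by (force simp: word_map_prefix)
    have "norm (S k - ?z) \<le> c ^ k * norm y"
      using norm_word_matrix_le[of "prefix_word x k" y] by (simp add: y(2))
    also have "\<dots> \<le> c ^ k * R" using R[OF y(1)] c_pos by (intro mult_left_mono) auto
    finally show ?thesis .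
  qed
  have "(\<lambda>k. c ^ k * R) \<longlonglongrightarrow> 0"
    using c_pos cT(1) by (intro tendsto_mult_left_zero LIMSEQ_realpow_zero) auto
  from Lim_null_comparison[OF always_eventually[OF allI[OF le]] this]
  have "(\<lambda>k. S k - ?z) \<longlonglongrightarrow> 0" .
  then have "S \<longlonglongrightarrow> ?z" by (rule LIM_zero_cancel)
  moreover have "S \<longlonglongrightarrow> code_point \<omega> x a"
    using summable_LIMSEQ[OF tail_summable[of x 0 a \<omega>]]
    unfolding S_def[abs_def] tail_point_def prefix_word_def by simp
  ultimately show ?thesis by (rule LIMSEQ_unique)
qed

lemma code_point_measurable_pair [measurable]:
  fixes \<omega> :: "'n list \<Rightarrow> 't::finite"
  shows "(\<lambda>(a, x). code_point \<omega> x a) \<in> borel_measurable (borel \<Otimes>\<^sub>M bernoulli_measure p)"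
proof -
  have "(\<lambda>z. word_matrix T (map (snd z) [0..<l]) *v (fst z $ \<omega> (prefix_word (snd z) (Suc l))))
      \<in> borel_measurable (borel \<Otimes>\<^sub>M bernoulli_measure p)" for l
  proof -
    \<comment> \<open>A term of the series sees x only through a finite prefix v, of which there are
      countably many, and is continuous in a for fixed v.\<close>
    define g where "g v a = word_matrix T (butlast v) *v (a $ \<omega> v)" for v and a :: "(real^'d)^'t"
    have "continuous_on UNIV (g v)" for v
      unfolding g_def
      by (intro continuous_on_compose2[OF matrix_vector_mult_linear_continuous_on[where S = UNIV]] continuous_intros) auto
    then have [measurable]: "g v \<in> borel_measurable borel" for v by (rule borel_measurable_continuous_onI)
    have "(\<lambda>z. g (prefix_word (snd z) (Suc l)) (fst z)) \<in> borel_measurable (borel \<Otimes>\<^sub>M bernoulli_measure p)"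
      by (rule measurable_compose_countable[where f = "\<lambda>v z. g v (fst z)"]) measurable
    then show ?thesis by (simp add: g_def prefix_word_def)
  qed
  then show ?thesis
    unfolding tail_point_def case_prod_beta by (intro borel_measurable_suminf) simp
qed

lemma code_point_measurable [measurable]:
  fixes \<omega> :: "'n list \<Rightarrow> 't::finite"
  shows "(\<lambda>x. code_point \<omega> x a) \<in> borel_measurable (bernoulli_measure p)"
  using measurable_compose[OF measurable_Pair1'[of a borel "bernoulli_measure p"] code_point_measurable_pair]
  by simp

section \<open>Transversality\<close>

definition pair_shift :: "'t \<Rightarrow> 't \<Rightarrow> real^'d \<Rightarrow> (real^'d)^'t" where
  "pair_shift i j h = axis i h - axis j h"

lemma linear_pair_shift: "linear (pair_shift i j)"
  by (rule linearI) (auto simp: pair_shift_def vec_eq_iff axis_def scaleR_diff_right)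

lemma norm_pair_shift_le:
  fixes i j :: "'t::finite"
  shows "norm (pair_shift i j h) \<le> 2 * norm h"
proof -
  have "norm (axis i h :: (real^'d)^'t) = norm h" for i :: "'t::finite"
    by (simp add: norm_eq_sqrt_inner inner_axis_axis)
  from this[of i] this[of j] show ?thesis
    unfolding pair_shift_def using norm_triangle_ineq4[of "axis i h" "axis j h"] by simp
qed

text \<open>Moving the two translations that separate \<open>x\<close> from \<open>y\<close> in opposite directions changes the difference
  of the coded points by \<open>2 h\<close> up to an error of norm at most \<open>2 c / (1 - c) < 2\<close> times \<open>norm h\<close>. Moving only
  one of them would need the bound \<open>1/3\<close> in place of \<open>1/2\<close>.\<close>

lemma pair_shift_expands:
  assumes "prefix_word x k = prefix_word y k" "x k \<noteq> y k" "distinct_siblings \<omega>"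
  defines "i \<equiv> \<omega> (prefix_word x (Suc k))" and "j \<equiv> \<omega> (prefix_word y (Suc k))"
  shows "2 * (1 - 2 * c) / (1 - c) * norm h
    \<le> norm (tail_point \<omega> x k (pair_shift i j h) - tail_point \<omega> y k (pair_shift i j h))"
proof -
  let ?a = "pair_shift i j h"
  have ij: "i \<noteq> j"
    using assms(1-3) by (simp add: i_def j_def prefix_word_Suc distinct_siblings_def)
  have a: "?a $ i = h" "?a $ j = - h" "\<And>l. norm (?a $ l) \<le> norm h"
    using ij by (auto simp: pair_shift_def axis_def)
  \<comment> \<open>All coordinates of the shifted parameter have norm at most that of h, so
    whatever the later letters are, the tails contribute no more than this.\<close>
  have small: "norm (T l *v tail_point \<omega> z (Suc k) ?a) \<le> c * (norm h / (1 - c))" for l z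
    using cT(2)[of l "tail_point \<omega> z (Suc k) ?a"] norm_tail_point_le[OF a(3), of \<omega> z "Suc k"] c_pos
    by (meson mult_left_mono order_trans less_imp_le)
  define v where "v = T (y k) *v tail_point \<omega> y (Suc k) ?a - T (x k) *v tail_point \<omega> x (Suc k) ?a"
  define n where "n = norm h / (1 - c)"
  have "norm h = n * (1 - c)" using cT(1) by (simp add: n_def)
  then have nh: "norm (2 *\<^sub>R h) = 2 * (n * (1 - c))" by simp
  have "2 * (1 - 2 * c) / (1 - c) * norm h = 2 * (1 - 2 * c) * n" by (simp add: n_def)
  also have "\<dots> = norm (2 *\<^sub>R h) - (c * n + c * n)" unfolding nh by (simp add: algebra_simps)
  also have "\<dots> \<le> norm (2 *\<^sub>R h) - norm v"
    unfolding v_def n_def by (intro diff_left_mono order_trans[OF norm_triangle_ineq4 add_mono[OF small small]])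
  also have "\<dots> \<le> norm (2 *\<^sub>R h - v)" by (rule norm_triangle_ineq2)
  also have "2 *\<^sub>R h - v = tail_point \<omega> x k ?a - tail_point \<omega> y k ?a"
    using a(1,2) tail_point_Suc[of \<omega> x k ?a] tail_point_Suc[of \<omega> y k ?a]
    by (simp add: i_def[symmetric] j_def[symmetric] scaleR_2 v_def)
  finally show ?thesis .
qed

definition expansion :: real where "expansion = 2 * (1 - 2 * c) / (1 - c)"

lemma expansion_pos: "0 < expansion"
  using cT(1) by (simp add: expansion_def)

text \<open>The set E of bad parameters has the same measure after any shift by \<eta> h. Averaging
  over h in the unit ball and exchanging integrals reduces the claim to one fibre: for fixed a, the
  h with a + \<eta> h in E lie in a translate of a linear preimage of a ball. This replaces a change
  of coordinates in parameter space.\<close>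

lemma transversality:
  fixes \<omega> :: "'n list \<Rightarrow> 't::finite"
  assumes \<omega>: "distinct_siblings \<omega>" and s: "0 \<le> s" "s \<le> real CARD('d)"
  shows "\<exists>C\<ge>0. \<forall>x y k r. prefix_word x k = prefix_word y k \<longrightarrow> x k \<noteq> y k \<longrightarrow> 0 < r \<longrightarrow>
    emeasure lborel {a \<in> cball 0 \<rho>. norm (code_point \<omega> x a - code_point \<omega> y a) \<le> r}
      \<le> ennreal (C * (r powr s / sv_fun s (word_matrix T (prefix_word x k))))"
proof -
  let ?B = "cball 0 1 :: (real^'d) set"
  let ?P = "cball 0 (\<rho> + 2) :: ((real^'d)^'t) set"
  \<comment> \<open>The factors come from differences of two points of the fibre, which have norm at
    most 2 and image of norm at most 2 r, and from passing from psi^s(A M) to psi^s(A) by the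
    expansion of M.\<close>
  define C1 where "C1 = 4 ^ CARD('d) * (2 powr s * (1 / expansion) powr s)"
  define C where "C = measure lborel ?P * C1 / measure lborel ?B"
  have C1: "0 \<le> C1" by (simp add: C1_def)
  have B_pos: "0 < measure lborel ?B"
    using content_cball_pos[of 1 "0 :: real^'d"] by simp
  have eB: "emeasure lborel ?B = ennreal (measure lborel ?B)"
    by (rule emeasure_eq_ennreal_measure) (use emeasure_lborel_cball_finite in \<open>simp add: less_top\<close>)
  have eP: "emeasure lborel ?P = ennreal (measure lborel ?P)"
    by (rule emeasure_eq_ennreal_measure) (use emeasure_lborel_cball_finite in \<open>simp add: less_top\<close>)
  have "emeasure lborel {a \<in> cball 0 \<rho>. norm (code_point \<omega> x a - code_point \<omega> y a) \<le> r}
      \<le> ennreal (C * (r powr s / sv_fun s (word_matrix T (prefix_word x k))))"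
    if xy: "prefix_word x k = prefix_word y k" "x k \<noteq> y k" and r: "0 < r" for x y k r
  proof -
    define A where "A = word_matrix T (prefix_word x k)"
    define D where "D a = tail_point \<omega> x k a - tail_point \<omega> y k a" for a
    define \<eta> where "\<eta> = (pair_shift (\<omega> (prefix_word x (Suc k))) (\<omega> (prefix_word y (Suc k))) :: real^'d \<Rightarrow> _)"
    define E where "E = {a \<in> cball 0 \<rho>. norm (code_point \<omega> x a - code_point \<omega> y a) \<le> r}"
    define z where "z = C1 * (r powr s / sv_fun s A)"
    have A: "invertible A" unfolding A_def by (rule invertible_word_matrix)
    have z0: "0 \<le> z" using C1 sv_fun_pos[OF A s(1)] by (simp add: z_def)
    have lin_D: "linear D"
      unfolding D_def[abs_def] by (intro linear_compose_sub linear_tail_point)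
    have lin_\<eta>: "linear \<eta>" unfolding \<eta>_def by (rule linear_pair_shift)
    have E_eq: "E = {a \<in> cball 0 \<rho>. norm (A *v D a) \<le> r}"
      unfolding E_def D_def A_def code_point_diff[OF xy(1)] ..
    have "continuous_on UNIV D" by (rule linear_continuous_on[OF linear_conv_bounded_linear[THEN iffD1, OF lin_D]])
    then have "continuous_on UNIV (\<lambda>a. norm (A *v D a))"
      by (intro continuous_on_norm continuous_on_compose2[OF matrix_vector_mult_linear_continuous_on[where S = UNIV]]) auto
    then have "closed {a. norm (A *v D a) \<le> r}" by (rule closed_Collect_le[OF _ continuous_on_const])
    moreover have "E = cball 0 \<rho> \<inter> {a. norm (A *v D a) \<le> r}" by (auto simp: E_eq)
    ultimately have "closed E" by (simp add: closed_Int)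
    then have [measurable]: "E \<in> sets borel" by (rule borel_closed)
    have lin_M: "linear (\<lambda>h. D (\<eta> h))" using linear_compose[OF lin_\<eta> lin_D] by (simp add: o_def)
    define M where "M = matrix (\<lambda>h. D (\<eta> h))"
    have M: "M *v h = D (\<eta> h)" for h unfolding M_def using lin_M by (simp add: matrix_works linear_matrix_vector_mul_eq)
    have M_ge: "expansion * norm h \<le> norm (M *v h)" for h
      unfolding M D_def \<eta>_def expansion_def by (rule pair_shift_expands[OF xy \<omega>])
    have "inj ((*v) M)"
    proof (rule injI)
      fix h h' assume "M *v h = M *v h'"
      then have "M *v (h - h') = 0" by (simp add: matrix_vector_mult_diff_distrib)
      then have "expansion * norm (h - h') \<le> 0" using M_ge[of "h - h'"] by simp
      then show "h = h'" using expansion_pos by (simp add: mult_le_0_iff)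
    qed
    then have inv_M: "invertible M"
      by (simp add: invertible_left_inverse matrix_left_invertible_injective)
    have inner: "(\<integral>\<^sup>+h. indicator ?B h * indicator E (a + \<eta> h) \<partial>lborel) \<le> ennreal z * indicator ?P a" for a
    proof (cases "\<exists>h\<in>?B. a + \<eta> h \<in> E")
      case False
      then have "(\<integral>\<^sup>+h. indicator ?B h * indicator E (a + \<eta> h) \<partial>lborel) = (\<integral>\<^sup>+h. 0 \<partial>(lborel :: (real^'d) measure))"
        by (intro nn_integral_cong) (auto simp: indicator_def)
      then show ?thesis by simp
    next
      case True
      \<comment> \<open>A base point in the fibre: measured from it, the affine condition on h
        becomes linear. It also shows that only a in the ball of radius \<rho> + 2
        contribute.\<close>
      then obtain h0 where h0: "h0 \<in> ?B" "a + \<eta> h0 \<in> E" by blast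
      have "norm a \<le> norm (a + \<eta> h0) + norm (\<eta> h0)" using norm_triangle_ineq4[of "a + \<eta> h0" "\<eta> h0"] by simp
      also have "\<dots> \<le> \<rho> + 2"
        using h0 norm_pair_shift_le[of "\<omega> (prefix_word x (Suc k))" "\<omega> (prefix_word y (Suc k))" h0]
        by (simp add: E_eq \<eta>_def)
      finally have aP: "a \<in> ?P" by simp
      let ?S = "{g. norm g \<le> 2 \<and> norm (A ** M *v g) \<le> 2 * r}"
      have S_closed: "closed ?S"
      proof -
        have "?S = cball 0 2 \<inter> {g. norm (A ** M *v g) \<le> 2 * r}" by auto
        also have "closed \<dots>" by (intro closed_Int closed_cball closed_Collect_le continuous_intros)
        finally show ?thesis .
      qed
      then have [measurable]: "?S \<in> sets borel" by (rule borel_closed)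
      have "indicator ?B h * indicator E (a + \<eta> h) \<le> (indicator ?S (- h0 + h) :: ennreal)" for h
      proof (cases "h \<in> ?B \<and> a + \<eta> h \<in> E")
        case True
        have "norm (- h0 + h) \<le> 2"
          using True h0 norm_triangle_ineq4[of h h0] by (simp add: norm_minus_commute)
        moreover have "A ** M *v (- h0 + h) = A *v D (a + \<eta> h) - A *v D (a + \<eta> h0)"
          by (simp add: matrix_vector_mul_assoc[symmetric] M linear_add[OF lin_D] linear_add[OF lin_\<eta>]
            linear_diff[OF lin_\<eta>] linear_diff[OF lin_D] matrix_vector_right_distrib
            matrix_vector_mult_diff_distrib[symmetric])
        then have "norm (A ** M *v (- h0 + h)) \<le> r + r"
          using True h0 norm_triangle_ineq4[of "A *v D (a + \<eta> h)" "A *v D (a + \<eta> h0)"] by (simp add: E_eq)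
        ultimately show ?thesis using True by (simp add: indicator_def)
      qed (auto simp: indicator_def)
      then have "(\<integral>\<^sup>+h. indicator ?B h * indicator E (a + \<eta> h) \<partial>lborel) \<le> (\<integral>\<^sup>+h. indicator ?S (- h0 + h) \<partial>lborel)"
        by (intro nn_integral_mono)
      also have "\<dots> = emeasure lborel ?S" by (rule nn_integral_indicator_translate) measurable
      also have "\<dots> \<le> ennreal ((2 * 2) ^ CARD('d) * ((2 * r) powr s / sv_fun s (A ** M)))"
        using r s by (intro emeasure_linear_preimage_ball invertible_mult A inv_M) auto
      also have "\<dots> \<le> ennreal z"
      proof (rule ennreal_leI)
        have *: "sv_fun s A * expansion powr s \<le> sv_fun s (A ** M)"
          using s expansion_pos by (intro sv_fun_mult_ge A inv_M M_ge)
        have "(2 * r) powr s / sv_fun s (A ** M) \<le> (2 * r) powr s / (sv_fun s A * expansion powr s)"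
          using sv_fun_pos[OF A s(1)] expansion_pos by (intro divide_left_mono * mult_pos_pos sv_fun_pos invertible_mult A inv_M s) auto
        also have "\<dots> = (2 powr s * (1 / expansion) powr s) * (r powr s / sv_fun s A)"
          using r expansion_pos by (simp add: powr_mult powr_divide)
        finally have "4 ^ CARD('d) * ((2 * r) powr s / sv_fun s (A ** M))
            \<le> 4 ^ CARD('d) * ((2 powr s * (1 / expansion) powr s) * (r powr s / sv_fun s A))"
          by (intro mult_left_mono) auto
        then show "(2 * 2) ^ CARD('d) * ((2 * r) powr s / sv_fun s (A ** M)) \<le> z"
          by (simp add: z_def C1_def mult_ac)
      qed
      finally show ?thesis using aP by simp
    qed
    have "continuous_on UNIV (\<lambda>q. fst q + \<eta> (snd q))"
      using lin_\<eta> by (intro continuous_intros linear_continuous_on_compose[OF _ lin_\<eta>])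
    then have "(\<lambda>q. fst q + \<eta> (snd q)) \<in> borel_measurable (borel :: (((real, 'd) vec, 't) vec \<times> (real, 'd) vec) measure)"
      by (rule borel_measurable_continuous_onI)
    then have [measurable]: "(\<lambda>q. fst q + \<eta> (snd q)) \<in> borel_measurable (lborel \<Otimes>\<^sub>M lborel)"
      by (simp add: lborel_prod)
    have shift: "emeasure lborel E = (\<integral>\<^sup>+a. indicator E (a + \<eta> h) \<partial>lborel)" for h
      using nn_integral_indicator_translate[of E "\<eta> h"] by (simp add: add.commute)
    have B_sets: "?B \<in> sets lborel" using borel_closed[OF closed_cball] by simp
    have "emeasure lborel ?B * emeasure lborel E = (\<integral>\<^sup>+h. indicator ?B h \<partial>lborel) * emeasure lborel E"
      unfolding nn_integral_indicator[OF B_sets] ..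
    also have "\<dots> = (\<integral>\<^sup>+h. indicator ?B h * emeasure lborel E \<partial>lborel)"
      using B_sets by (intro nn_integral_multc[symmetric] borel_measurable_indicator)
    finally have "emeasure lborel ?B * emeasure lborel E = (\<integral>\<^sup>+h. indicator ?B h * emeasure lborel E \<partial>lborel)" .
    also have "\<dots> = (\<integral>\<^sup>+h. \<integral>\<^sup>+a. indicator ?B h * indicator E (a + \<eta> h) \<partial>lborel \<partial>lborel)"
    proof (rule nn_integral_cong)
      fix h
      show "indicator ?B h * emeasure lborel E = (\<integral>\<^sup>+a. indicator ?B h * indicator E (a + \<eta> h) \<partial>lborel)"
        unfolding shift[of h] by (rule nn_integral_cmult[symmetric]) measurable
    qed
    also have "\<dots> = (\<integral>\<^sup>+a. \<integral>\<^sup>+h. indicator ?B h * indicator E (a + \<eta> h) \<partial>lborel \<partial>lborel)"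
    proof (rule lborel_pair.Fubini')
      have [measurable]: "?B \<in> sets borel" using B_sets by simp
      show "(\<lambda>(a, h). indicator ?B h * indicator E (a + \<eta> h) :: ennreal) \<in> borel_measurable (lborel \<Otimes>\<^sub>M lborel)"
        unfolding case_prod_beta by measurable
    qed
    also have "\<dots> \<le> (\<integral>\<^sup>+a. ennreal z * indicator ?P a \<partial>lborel)"
      by (intro nn_integral_mono inner)
    also have "\<dots> = ennreal z * emeasure lborel ?P"
      by (rule nn_integral_cmult_indicator) (simp add: borel_closed)
    finally have *: "ennreal (measure lborel ?B) * emeasure lborel E \<le> ennreal (z * measure lborel ?P)"
      using z0 by (simp add: eB eP ennreal_mult)
    have "emeasure lborel E \<le> emeasure lborel (cball 0 \<rho> :: ((real^'d)^'t) set)"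
      by (intro emeasure_mono) (auto simp: E_def)
    then have "emeasure lborel E < \<infinity>" using emeasure_lborel_cball_finite le_less_trans by blast
    then have eE: "emeasure lborel E = ennreal (measure lborel E)"
      by (intro emeasure_eq_ennreal_measure) auto
    have "measure lborel E * measure lborel ?B \<le> z * measure lborel ?P"
      using * z0 B_pos unfolding eE by (simp add: ennreal_mult[symmetric] mult.commute del: ennreal_mult)
    then have "measure lborel E \<le> z * measure lborel ?P / measure lborel ?B"
      by (simp only: pos_le_divide_eq[OF B_pos])
    also have "\<dots> = C * (r powr s / sv_fun s A)" by (simp add: C_def z_def mult_ac)
    finally have "measure lborel E \<le> C * (r powr s / sv_fun s A)" .
    then show ?thesis unfolding E_def[symmetric] A_def[symmetric] eE by (rule ennreal_leI)
  qed
  moreover have "0 \<le> C" using C1 B_pos by (simp add: C_def)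
  ultimately show ?thesis by blast
qed

end

section \<open>Typical growth for the Bernoulli measure\<close>

lemma sum_UN_le:
  fixes f :: "'a \<Rightarrow> real"
  assumes "finite I" "\<And>i. i \<in> I \<Longrightarrow> finite (A i)" "\<And>x. 0 \<le> f x"
  shows "sum f (\<Union>i\<in>I. A i) \<le> (\<Sum>i\<in>I. sum f (A i))"
  using assms
proof (induction I rule: finite_induct)
  case (insert i I)
  then have "sum f (A i \<union> (\<Union>i\<in>I. A i)) \<le> sum f (A i) + sum f (\<Union>i\<in>I. A i)"
    by (subst sum_Un) (auto intro!: sum_nonneg)
  then show ?case using insert by simp
qed simp

context word_growth
begin

text \<open>For one fixed large k the mean \<open>G q s k\<close> is a finite expression that
  depends continuously on q at 1, and \<open>G_upper\<close> turns a lower bound for it into one for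
  the rate, at the cost of ln K / k.\<close>

lemma gamma_left_lower_limit:
  assumes s: "0 \<le> s" and \<delta>: "0 < \<delta>"
  obtains q where "q < 1" "\<gamma> 1 s - \<delta> < \<gamma> q s"
proof -
  have "(\<lambda>k. G 1 s k / k - ln (K s) * (1 / real k)) \<longlonglongrightarrow> \<gamma> 1 s - ln (K s) * 0"
    by (intro tendsto_diff G_limit s tendsto_mult tendsto_const lim_1_over_n)
  then have "\<forall>\<^sub>F k in sequentially. \<gamma> 1 s - \<delta> / 2 < G 1 s k / k - ln (K s) * (1 / real k)"
    using \<delta> by (intro order_tendstoD(1)) auto
  from eventually_happens[OF eventually_conj[OF this eventually_gt_at_top[of 0]]]
  obtain k where k: "0 < k" "\<gamma> 1 s - \<delta> / 2 < G 1 s k / k - ln (K s) * (1 / real k)" by auto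
  \<comment> \<open>The derivative at 0 of the exponential moment is minus the mean, so g vanishes
    at 0 with positive derivative. A small t > 0 with g t > 0 gives the desired bound at q = 1 -
    t.\<close>
  define g where "g t = exp (- t * (G 1 s k - k * \<delta> / 2)) - (\<Sum>u\<in>words k. word_prob p u * exp (- t * X s u))" for t
  have "(g has_real_derivative k * \<delta> / 2) (at 0)"
    unfolding g_def
    by (auto intro!: derivative_eq_intros simp: sum_negf G_def gmean_def mult.commute)
  then obtain d where d: "0 < d" "\<And>h. 0 < h \<Longrightarrow> h < d \<Longrightarrow> g 0 < g (0 + h)"
    using DERIV_pos_inc_right[of g "k * \<delta> / 2" 0] k(1) \<delta> by auto
  define t where "t = d / 2"
  have t: "0 < t" "g 0 < g t" using d by (auto simp: t_def)
  have "g 0 = 0" by (simp add: g_def sum_word_prob)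
  then have "(\<Sum>u\<in>words k. word_prob p u * exp (- t * X s u)) < exp (- t * (G 1 s k - k * \<delta> / 2))"
    using t(2) by (simp add: g_def)
  then have "ln (\<Sum>u\<in>words k. word_prob p u * exp (- t * X s u)) < - t * (G 1 s k - k * \<delta> / 2)"
    using gmean_sum_pos[of "\<lambda>u. - t * X s u" k] by (metis exp_gt_zero ln_exp ln_less_cancel_iff)
  then have "- t * (G 1 s k - k * \<delta> / 2) / - t < ln (\<Sum>u\<in>words k. word_prob p u * exp (- t * X s u)) / - t"
    using t(1) by (intro divide_strict_right_mono_neg) auto
  then have "G 1 s k - k * \<delta> / 2 < G (1 - t) s k"
    using t(1) by (simp add: G_def[of "1 - t"] gmean_def)
  also have "\<dots> \<le> \<gamma> (1 - t) s * k + ln (K s)" by (rule G_upper[OF s k(1)])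
  finally have "(G 1 s k - k * \<delta> / 2) / k < (\<gamma> (1 - t) s * k + ln (K s)) / k"
    using k(1) by (intro divide_strict_right_mono) auto
  then have "G 1 s k / k - \<delta> / 2 - ln (K s) / k < \<gamma> (1 - t) s"
    using k(1) by (simp add: diff_divide_distrib add_divide_distrib)
  then have "\<gamma> 1 s - \<delta> < \<gamma> (1 - t) s" using k(2) by simp
  then show thesis using that[of "1 - t"] t(1) by simp
qed

text \<open>A Chernoff bound for values of X below N (\<gamma> - \<delta>), with t = 1 - q for a q <
  1 whose rate still exceeds \<gamma> - \<delta>.\<close>

lemma exponential_moment_bound:
  assumes s: "0 \<le> s" and \<delta>: "0 < \<delta>"
  obtains t where "0 < t"
    "\<forall>\<^sub>F N in sequentially. (\<Sum>u\<in>words N. word_prob p u * exp (t * (N * (\<gamma> 1 s - \<delta>) - X s u))) \<le> 1"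
proof -
  obtain q where q: "q < 1" "\<gamma> 1 s - \<delta> < \<gamma> q s" using gamma_left_lower_limit[OF s \<delta>] by blast
  define t where "t = 1 - q"
  have t: "0 < t" using q by (simp add: t_def)
  have "\<forall>\<^sub>F N in sequentially. \<gamma> 1 s - \<delta> < G q s N / N"
    by (rule order_tendstoD(1)[OF G_limit[OF s] q(2)])
  with eventually_gt_at_top[of 0]
  have "\<forall>\<^sub>F N in sequentially. (\<Sum>u\<in>words N. word_prob p u * exp (t * (N * (\<gamma> 1 s - \<delta>) - X s u))) \<le> 1"
  proof eventually_elim
    case (elim N)
    have "(\<Sum>u\<in>words N. word_prob p u * exp (t * (N * (\<gamma> 1 s - \<delta>) - X s u)))
        = exp (t * (N * (\<gamma> 1 s - \<delta>))) * (\<Sum>u\<in>words N. word_prob p u * exp ((q - 1) * X s u))"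
      unfolding sum_distrib_left by (intro sum.cong refl) (simp add: exp_add[symmetric] t_def algebra_simps)
    also have "(\<Sum>u\<in>words N. word_prob p u * exp ((q - 1) * X s u)) = exp ((q - 1) * G q s N)"
      using q sum_term_sum_eq[OF s, of q N] by (simp add: G_def term_sum_eq[OF s])
    also have "exp (t * (N * (\<gamma> 1 s - \<delta>))) * \<dots> = exp (t * (N * (\<gamma> 1 s - \<delta>) - G q s N))"
      by (simp add: exp_add[symmetric] t_def algebra_simps)
    also have "N * (\<gamma> 1 s - \<delta>) - G q s N \<le> 0" using elim by (simp add: field_simps)
    then have "exp (t * (N * (\<gamma> 1 s - \<delta>) - G q s N)) \<le> 1"
      using t by (simp add: mult_nonneg_nonpos)
    finally show ?case .
  qed
  then show thesis using that t by blast
qed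

text \<open>The lower deviations of the superadditive \<open>X\<close> are exponentially small; as the means of \<open>X\<close> do
  not exceed \<open>\<gamma>\<close> by more than a constant, upper deviations of linear size must then be rare.\<close>

lemma rare_large_values:
  assumes s: "0 \<le> s" and neg: "\<gamma> 1 s < 0" and \<tau>: "0 < \<tau>"
  shows "\<forall>\<^sub>F N in sequentially. (\<Sum>u\<in>{u\<in>words N. N * \<gamma> 1 s / 2 < X s u}. word_prob p u) \<le> \<tau>"
proof -
  define D where "D = - \<gamma> 1 s"
  have D: "0 < D" using neg by (simp add: D_def)
  \<comment> \<open>On the exceptional set X exceeds its centre by at least N D / 2. Half of the
    permitted N D \<tau> / 2 is used by the error N \<delta>, the other half by the constants, once
    N is large.\<close>
  define \<delta> where "\<delta> = \<tau> * D / 4"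
  have \<delta>: "0 < \<delta>" using D \<tau> by (simp add: \<delta>_def)
  obtain t where t: "0 < t" and
    ev: "\<forall>\<^sub>F N in sequentially. (\<Sum>u\<in>words N. word_prob p u * exp (t * (N * (\<gamma> 1 s - \<delta>) - X s u))) \<le> 1"
    using exponential_moment_bound[OF s \<delta>] by blast
  obtain N0 :: nat where N0: "(ln (K s) + 1 / t) * 4 / (\<tau> * D) < N0" using reals_Archimedean2 by blast
  from ev eventually_ge_at_top[of N0] eventually_gt_at_top[of 0] show ?thesis
  proof eventually_elim
    case (elim N)
    let ?Z = "\<lambda>u. X s u - N * (\<gamma> 1 s - \<delta>)"
    let ?B = "{u\<in>words N. N * \<gamma> 1 s / 2 < X s u}"
    have neg_part: "max 0 (- ?Z u) \<le> exp (t * (- ?Z u)) / t" for u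
    proof -
      have "t * (- ?Z u) \<le> exp (t * (- ?Z u))" using exp_ge_add_one_self[of "t * (- ?Z u)"] by linarith
      then have "- ?Z u \<le> exp (t * (- ?Z u)) / t" using t by (simp add: field_simps)
      moreover have "0 \<le> exp (t * (- ?Z u)) / t" using t by simp
      ultimately show ?thesis by simp
    qed
    have "N * (D / 2) * (\<Sum>u\<in>?B. word_prob p u) = (\<Sum>u\<in>?B. word_prob p u * (N * (D / 2)))"
      by (simp add: sum_distrib_left mult_ac)
    also have "\<dots> \<le> (\<Sum>u\<in>?B. word_prob p u * max 0 (?Z u))"
    proof (intro sum_mono mult_left_mono)
      fix u assume u: "u \<in> ?B"
      define y where "y = N * D"
      have "- (y / 2) < X s u" using u by (simp add: y_def D_def)
      moreover have "0 \<le> N * \<delta>" using \<delta> by simp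
      moreover have "N * (\<gamma> 1 s - \<delta>) = - y - N * \<delta>" by (simp add: D_def y_def algebra_simps)
      moreover have "N * (D / 2) = y / 2" by (simp add: y_def)
      ultimately have "N * (D / 2) \<le> ?Z u" by linarith
      then show "N * (D / 2) \<le> max 0 (?Z u)" by (rule max.coboundedI2)
    qed auto
    also have "\<dots> \<le> (\<Sum>u\<in>words N. word_prob p u * max 0 (?Z u))"
      by (intro sum_mono2 finite_words) auto
    \<comment> \<open>The positive part is the value plus the negative part. The first has small
      mean by \<open>G_upper\<close>, the second is controlled by the exponential moment.\<close>
    also have "\<dots> = (\<Sum>u\<in>words N. word_prob p u * ?Z u + word_prob p u * max 0 (- ?Z u))"
      by (intro sum.cong) (auto simp: max_def algebra_simps)
    also have "\<dots> = (\<Sum>u\<in>words N. word_prob p u * ?Z u) + (\<Sum>u\<in>words N. word_prob p u * max 0 (- ?Z u))"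
      by (rule sum.distrib)
    also have "(\<Sum>u\<in>words N. word_prob p u * ?Z u) = G 1 s N - N * (\<gamma> 1 s - \<delta>)"
      by (simp add: right_diff_distrib sum_subtractf sum_distrib_right[symmetric] sum_word_prob G_def gmean_def)
    also have "\<dots> \<le> ln (K s) + N * \<delta>" using G_upper[OF s elim(3), of 1] by (simp add: algebra_simps)
    also have "(\<Sum>u\<in>words N. word_prob p u * max 0 (- ?Z u)) \<le> (\<Sum>u\<in>words N. word_prob p u * (exp (t * (- ?Z u)) / t))"
      by (intro sum_mono mult_left_mono neg_part) auto
    also have "\<dots> = (\<Sum>u\<in>words N. word_prob p u * exp (t * (N * (\<gamma> 1 s - \<delta>) - X s u))) / t"
      by (simp add: sum_divide_distrib)
    also have "\<dots> \<le> 1 / t" using elim(1) t by (intro divide_right_mono) auto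
    finally have 1: "N * (D / 2) * (\<Sum>u\<in>?B. word_prob p u) \<le> ln (K s) + N * \<delta> + 1 / t" by simp
    have "(ln (K s) + 1 / t) * 4 / (\<tau> * D) \<le> N" using N0 elim(2) by linarith
    then have "ln (K s) + 1 / t \<le> N * (\<tau> * D / 4)" using \<tau> D by (simp add: field_simps)
    then have "N * (D / 2) * (\<Sum>u\<in>?B. word_prob p u) \<le> N * (D / 2) * \<tau>"
      using 1 by (simp add: \<delta>_def algebra_simps)
    then show ?case using D elim(3) by simp
  qed
qed

definition good_words :: "real \<Rightarrow> nat \<Rightarrow> real \<Rightarrow> real \<Rightarrow> 'n list set" where
  "good_words s N y z = {w\<in>words N. (\<forall>k<N. X s (take k w) \<le> y \<or> word_prob p w = 0) \<and> (X s w \<le> - z \<or> word_prob p w = 0)}"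

text \<open>X is tested only at L multiples of a step proportional to n. As L does not depend on n,
  a union bound over rare exceptions suffices. At these lengths X is at most 0, between them it can
  rise only by \<epsilon> n, and the last length is long enough for X to fall below -z n.\<close>

lemma good_words_typical:
  fixes s \<epsilon> \<tau> z :: real
  assumes s: "0 \<le> s" and neg: "\<gamma> 1 s < 0" and \<epsilon>: "0 < \<epsilon>" and \<tau>: "0 < \<tau>" and z: "0 < z"
  obtains \<kappa> :: real where
    "\<forall>\<^sub>F n in sequentially. \<exists>N\<le>\<kappa> * n. 1 - \<tau> \<le> (\<Sum>w\<in>good_words s N (\<epsilon> * n) (z * n). word_prob p w)"
proof -
  define D where "D = - \<gamma> 1 s"
  have D: "0 < D" using neg by (simp add: D_def)
  define lb where "lb = s * ln (1 / b)"
  have lb: "0 \<le> lb" using s ln_inverse_b_pos by (simp add: lb_def)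
  \<comment> \<open>The step length \<delta> n is so short that X gains at most about \<epsilon> n /
    2 within one step; the rest of \<epsilon> n absorbs rounding.\<close>
  define \<delta> where "\<delta> = \<epsilon> / (2 * (lb + 1))"
  have \<delta>: "0 < \<delta>" using \<epsilon> lb by (simp add: \<delta>_def)
  \<comment> \<open>Enough steps for half the rate D over the length L \<delta> n to outweigh z
    n.\<close>
  obtain L0 :: nat where L0: "2 * z / (\<delta> * D) < L0" using reals_Archimedean2 by blast
  define L where "L = Suc L0"
  have L: "0 < L" "2 * z \<le> real L * \<delta> * D" using L0 \<delta> D by (auto simp: L_def field_simps) (smt (verit) mult_pos_pos)
  define h where "h n = nat \<lfloor>\<delta> * real n\<rfloor> + 1" for n
  have h_ge: "\<delta> * n \<le> h n" for n unfolding h_def by linarith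
  have h_le: "h n \<le> \<delta> * n + 1" for n
  proof -
    have "0 \<le> \<delta> * n" using \<delta> by simp
    then have "real (nat \<lfloor>\<delta> * real n\<rfloor>) \<le> \<delta> * n" by (simp add: of_nat_floor)
    then show ?thesis by (simp add: h_def)
  qed
  have h_top: "filterlim h at_top sequentially"
  proof -
    have "filterlim (\<lambda>n. \<delta> * real n) at_top sequentially"
      using \<delta> by (intro filterlim_tendsto_pos_mult_at_top[OF tendsto_const] filterlim_real_sequentially)
    then have "filterlim (\<lambda>n. real (h n)) at_top sequentially"
      by (rule filterlim_at_top_mono) (use h_ge in auto)
    then show ?thesis by (simp add: filterlim_sequentially_iff_filterlim_real)
  qed
  have rare: "\<forall>\<^sub>F n in sequentially. \<forall>i\<in>{1..L}.
      (\<Sum>u\<in>{u\<in>words (i * h n). (i * h n) * \<gamma> 1 s / 2 < X s u}. word_prob p u) \<le> \<tau> / L"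
  proof (intro eventually_ball_finite ballI finite_atLeastAtMost)
    fix i assume i: "i \<in> {1..L}"
    have "filterlim (\<lambda>n. i * h n) sequentially sequentially"
      using i by (intro filterlim_at_top_mono[OF h_top]) auto
    moreover have "\<forall>\<^sub>F N in sequentially. (\<Sum>u\<in>{u\<in>words N. N * \<gamma> 1 s / 2 < X s u}. word_prob p u) \<le> \<tau> / L"
      using \<tau> L(1) by (intro rare_large_values[OF s neg]) auto
    ultimately show "\<forall>\<^sub>F n in sequentially.
      (\<Sum>u\<in>{u\<in>words (i * h n). (i * h n) * \<gamma> 1 s / 2 < X s u}. word_prob p u) \<le> \<tau> / L"
      by (rule eventually_compose_filterlim[rotated])
  qed
  obtain n0 :: nat where n0: "(lb + 1) * 2 / \<epsilon> < n0" using reals_Archimedean2 by blast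
  define \<kappa> where "\<kappa> = L * (\<delta> + 1)"
  from rare eventually_ge_at_top[of n0] eventually_gt_at_top[of 0]
  have "\<forall>\<^sub>F n in sequentially. \<exists>N\<le>\<kappa> * n. 1 - \<tau> \<le> (\<Sum>w\<in>good_words s N (\<epsilon> * n) (z * n). word_prob p w)"
  proof eventually_elim
    case (elim n)
    define N where "N = L * h n"
    define Bad where "Bad i = {w\<in>words N. (i * h n) * \<gamma> 1 s / 2 < X s (take (i * h n) w)}" for i
    have h0: "0 < h n" by (simp add: h_def)
    have "real N \<le> \<kappa> * n"
    proof -
      have "real N \<le> real L * (\<delta> * n + 1)" unfolding N_def using h_le[of n] by (simp add: mult_left_mono)
      also have "\<dots> \<le> real L * (\<delta> * n + n)" using elim(3) by (intro mult_left_mono) auto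
      finally show ?thesis by (simp add: \<kappa>_def algebra_simps)
    qed
    have bad: "(\<Sum>w\<in>Bad i. word_prob p w) \<le> \<tau> / L" if i: "i \<in> {1..L}" for i
    proof -
      have le: "i * h n \<le> N" using i by (simp add: N_def)
      have "(\<Sum>w\<in>Bad i. word_prob p w) =
          (\<Sum>w\<in>words (i * h n + (N - i * h n)). if (i * h n) * \<gamma> 1 s / 2 < X s (take (i * h n) w) then word_prob p w else 0)"
        using le by (simp add: Bad_def sum.If_cases finite_words Int_def)
      also have "\<dots> = (\<Sum>u\<in>words (i * h n). if (i * h n) * \<gamma> 1 s / 2 < X s u then word_prob p u else 0)"
        unfolding sum_words_append
        by (intro sum.cong) (auto simp: sum_distrib_left[symmetric] sum_word_prob)
      also have "\<dots> = (\<Sum>u\<in>{u\<in>words (i * h n). (i * h n) * \<gamma> 1 s / 2 < X s u}. word_prob p u)"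
        by (simp add: sum.If_cases finite_words Int_def)
      also have "\<dots> \<le> \<tau> / L" using elim(1) i by blast
      finally show ?thesis .
    qed
    have good: "w \<in> good_words s N (\<epsilon> * n) (z * n)" if w: "w \<in> words N" "w \<notin> (\<Union>i\<in>{1..L}. Bad i)" for w
    proof (cases "word_prob p w = 0")
      case True
      then show ?thesis using w by (simp add: good_words_def)
    next
      case False
      have X_grid: "X s (take (i * h n) w) \<le> (i * h n) * \<gamma> 1 s / 2" if "i \<in> {1..L}" for i
        using w that by (auto simp: Bad_def not_less)
      have pos: "0 < word_prob p (take k w)" for k
      proof -
        have "word_prob p w = word_prob p (take k w) * word_prob p (drop k w)"
          by (metis append_take_drop_id word_prob_append)
        then show ?thesis using False word_prob_pos_iff by auto
      qed
      have "X s (take k w) \<le> \<epsilon> * n" if k: "k < N" for k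
      proof -
        define i where "i = k div h n"
        have ik: "i * h n + k mod h n = k" by (simp add: i_def)
        have r: "k mod h n < h n" using h0 by simp
        have "i < L" using k h0 unfolding i_def N_def by (simp add: less_mult_imp_div_less)
        have X0: "X s (take (i * h n) w) \<le> 0"
        proof (cases "i = 0")
          case True
          then show ?thesis by (simp add: X_Nil[OF s])
        next
          case False
          then have "X s (take (i * h n) w) \<le> (i * h n) * \<gamma> 1 s / 2" using \<open>i < L\<close> by (intro X_grid) auto
          also have "\<dots> \<le> 0" using neg by (simp add: mult_nonneg_nonpos)
          finally show ?thesis .
        qed
        have split: "take k w = take (i * h n) w @ take (k mod h n) (drop (i * h n) w)"
          using ik by (metis take_add)
        have "X s (take k w) \<le> X s (take (i * h n) w) + s * length (take (k mod h n) (drop (i * h n) w)) * ln (1 / b)"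
          using pos[of k] X_append_le[OF s, of "take (i * h n) w" "take (k mod h n) (drop (i * h n) w)"]
          unfolding split by simp
        also have "s * length (take (k mod h n) (drop (i * h n) w)) * ln (1 / b) \<le> s * real (h n) * ln (1 / b)"
          using r s ln_inverse_b_pos by (intro mult_right_mono mult_left_mono) auto
        also have "\<dots> = lb * h n" by (simp add: lb_def)
        also have "\<dots> \<le> lb * (\<delta> * n + 1)" using lb h_le by (intro mult_left_mono) auto
        also have "\<dots> \<le> (lb + 1) * (\<delta> * n + 1)" using \<delta> by (intro mult_right_mono) auto
        also have "\<dots> = \<epsilon> / 2 * n + (lb + 1)" using lb by (simp add: \<delta>_def field_simps)
        also have "lb + 1 \<le> \<epsilon> / 2 * n"
        proof -
          have "(lb + 1) * 2 / \<epsilon> \<le> n" using n0 elim(2) by linarith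
          then show ?thesis using \<epsilon> by (simp add: field_simps)
        qed
        finally show ?thesis using X0 by simp
      qed
      moreover have "X s w \<le> - (z * n)"
      proof -
        have "X s w \<le> (L * h n) * \<gamma> 1 s / 2" using X_grid[of L] L(1) w by (simp add: N_def)
        also have "\<dots> = - (real (h n) * (L * D / 2))" by (simp add: D_def)
        also have "\<dots> \<le> - (\<delta> * n * (L * D / 2))"
          using h_ge[of n] D by (intro le_imp_neg_le mult_right_mono) auto
        also have "\<dots> \<le> - (z * n)"
          using mult_right_mono[OF L(2), of "real n"] by (simp add: mult_ac)
        finally show ?thesis .
      qed
      ultimately show ?thesis using w by (simp add: good_words_def)
    qed
    have "1 = (\<Sum>w\<in>words N. word_prob p w)" by (simp add: sum_word_prob)
    also have "\<dots> \<le> (\<Sum>w\<in>good_words s N (\<epsilon> * n) (z * n) \<union> (\<Union>i\<in>{1..L}. Bad i). word_prob p w)"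
    proof (rule sum_mono2)
      show "finite (good_words s N (\<epsilon> * n) (z * n) \<union> (\<Union>i\<in>{1..L}. Bad i))"
        by (rule finite_subset[OF _ finite_words[of N]]) (auto simp: good_words_def Bad_def)
    qed (use good in auto)
    also have "\<dots> \<le> (\<Sum>w\<in>good_words s N (\<epsilon> * n) (z * n). word_prob p w) + (\<Sum>w\<in>(\<Union>i\<in>{1..L}. Bad i). word_prob p w)"
    proof -
      have "finite (good_words s N (\<epsilon> * n) (z * n))" "finite (\<Union>i\<in>{1..L}. Bad i)"
        by (rule finite_subset[OF _ finite_words[of N]]; auto simp: good_words_def Bad_def)+
      then show ?thesis by (subst sum_Un) (auto intro!: sum_nonneg)
    qed
    also have "(\<Sum>w\<in>(\<Union>i\<in>{1..L}. Bad i). word_prob p w) \<le> (\<Sum>i\<in>{1..L}. \<Sum>w\<in>Bad i. word_prob p w)"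
      by (rule sum_UN_le) (auto intro: finite_subset[OF _ finite_words[of N]] simp: Bad_def)
    also have "\<dots> \<le> (\<Sum>i\<in>{1..L}. \<tau> / L)" by (intro sum_mono bad)
    also have "\<dots> = \<tau>" using L(1) by simp
    finally have "1 - \<tau> \<le> (\<Sum>w\<in>good_words s N (\<epsilon> * n) (z * n). word_prob p w)" by simp
    then show ?case using \<open>real N \<le> \<kappa> * n\<close> by blast
  qed
  then show thesis by (rule that)
qed

end

section \<open>Mesh cubes\<close>

lemma mesh_cube_index:
  fixes x :: "real^'d"
  assumes "0 < r"
  shows "of_int j * r \<le> x $ i \<and> x $ i < (of_int j + 1) * r \<longleftrightarrow> j = \<lfloor>x $ i / r\<rfloor>"
  using assms floor_eq_iff[of "x $ i / r" j] by (auto simp: field_simps)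

lemma mesh_cubes_eq:
  assumes "0 < r"
  shows "mesh_cubes r = range (\<lambda>j :: int^'d. {x. \<forall>i. j $ i = \<lfloor>x $ i / r\<rfloor>})"
  unfolding mesh_cubes_def mesh_cube_index[OF assms] ..

lemma mesh_cube_unique:
  assumes "0 < r" "Q \<in> mesh_cubes r" "Q' \<in> mesh_cubes r" "x \<in> Q" "x \<in> Q'"
  shows "Q = Q'"
proof -
  obtain j j' where "Q = {x. \<forall>i. j $ i = \<lfloor>x $ i / r\<rfloor>}" "Q' = {x. \<forall>i. j' $ i = \<lfloor>x $ i / r\<rfloor>}"
    using assms(2,3) unfolding mesh_cubes_eq[OF assms(1)] by auto
  moreover from this have "j = j'" using assms(4,5) by (simp add: vec_eq_iff)
  ultimately show ?thesis by simp
qed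

lemma mesh_cube_exists:
  fixes x :: "real^'b"
  assumes "0 < r"
  obtains Q where "Q \<in> mesh_cubes r" "x \<in> Q"
proof
  let ?Q = "\<lambda>j :: int^'b. {y :: real^'b. \<forall>i. j $ i = \<lfloor>y $ i / r\<rfloor>}"
  show "?Q (\<chi> i. \<lfloor>x $ i / r\<rfloor>) \<in> mesh_cubes r" unfolding mesh_cubes_eq[OF assms] by (rule rangeI)
  show "x \<in> ?Q (\<chi> i. \<lfloor>x $ i / r\<rfloor>)" by simp
qed

lemma mesh_cube_diameter:
  fixes x y :: "real^'d" and r :: real
  assumes "0 < r" "Q \<in> mesh_cubes r" "x \<in> Q" "y \<in> Q"
  shows "norm (x - y) \<le> CARD('d) * r"
proof -
  have "\<bar>(x - y) $ i\<bar> \<le> r" for i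
  proof -
    obtain j :: "int^'d" where "of_int (j $ i) * r \<le> x $ i" "x $ i < (of_int (j $ i) + 1) * r"
      "of_int (j $ i) * r \<le> y $ i" "y $ i < (of_int (j $ i) + 1) * r"
      using assms(2-) unfolding mesh_cubes_def by blast
    then show ?thesis by (simp add: algebra_simps abs_le_iff)
  qed
  then have "(\<Sum>i\<in>UNIV. \<bar>(x - y) $ i\<bar>) \<le> (\<Sum>i\<in>(UNIV :: 'd set). r)" by (intro sum_mono)
  then show ?thesis using norm_le_l1_cart[of "x - y"] by simp
qed

lemma mesh_cube_borel:
  fixes Q :: "(real^'d) set"
  assumes "Q \<in> mesh_cubes r"
  shows "Q \<in> sets borel"
proof -
  obtain j :: "int^'d" where "Q = {x. \<forall>i. of_int (j $ i) * r \<le> x $ i \<and> x $ i < (of_int (j $ i) + 1) * r}"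
    using assms unfolding mesh_cubes_def by blast
  then have "Q = (\<Inter>i. {x. of_int (j $ i) * r \<le> x $ i} \<inter> {x. x $ i < (of_int (j $ i) + 1) * r})" by auto
  also have "\<dots> \<in> sets borel"
  proof (intro sets.finite_INT sets.Int)
    fix i
    have "closed {x :: real^'d. of_int (j $ i) * r \<le> x $ i}" by (intro closed_Collect_le continuous_intros)
    then show "{x :: real^'d. of_int (j $ i) * r \<le> x $ i} \<in> sets borel" by (rule borel_closed)
    have "open {x :: real^'d. x $ i < (of_int (j $ i) + 1) * r}" by (intro open_Collect_less continuous_intros)
    then show "{x :: real^'d. x $ i < (of_int (j $ i) + 1) * r} \<in> sets borel" by (rule borel_open)
  qed auto
  finally show ?thesis .
qed

lemma mesh_cube_volume:
  fixes Q :: "(real^'d) set"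
  assumes r: "0 < r" and Q: "Q \<in> mesh_cubes r"
  shows "ennreal (r ^ CARD('d)) \<le> emeasure lborel Q"
proof -
  obtain j :: "int^'d" where j: "Q = {x. \<forall>i. of_int (j $ i) * r \<le> x $ i \<and> x $ i < (of_int (j $ i) + 1) * r}"
    using Q unfolding mesh_cubes_def by blast
  define l :: "real^'d" where "l = (\<chi> i. of_int (j $ i) * r)"
  define u :: "real^'d" where "u = (\<chi> i. (of_int (j $ i) + 1) * r)"
  have ul: "(u - l) \<bullet> b = r" if "b \<in> Basis" for b
    using that by (auto simp: Basis_vec_def u_def l_def inner_axis algebra_simps)
  have "emeasure lborel (box l u) = ennreal (\<Prod>b\<in>Basis. (u - l) \<bullet> b)"
  proof (rule emeasure_lborel_box)
    fix b :: "real^'d" assume "b \<in> Basis"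
    from ul[OF this] r show "l \<bullet> b \<le> u \<bullet> b" by (simp add: inner_diff_left)
  qed
  also have "(\<Prod>b\<in>Basis. (u - l) \<bullet> b) = (\<Prod>b\<in>(Basis :: (real^'d) set). r)" by (intro prod.cong ul) auto
  also have "\<dots> = r ^ CARD('d)" by simp
  finally have "ennreal (r ^ CARD('d)) = emeasure lborel (box l u)" by simp
  also have "\<dots> \<le> emeasure lborel Q"
    using mesh_cube_borel[OF Q] by (intro emeasure_mono) (auto simp: j mem_box_cart l_def u_def less_imp_le)
  finally show ?thesis .
qed

text \<open>Disjoint cubes of volume at least r^d inside a set of volume v. Finite subfamilies are
  counted first, and infinitely many cubes would exceed any bound.\<close>

lemma mesh_cubes_count:
  fixes U :: "(real^'d) set" and r v :: real
  assumes r: "0 < r" and \<Q>: "\<Q> \<subseteq> mesh_cubes r" "\<And>Q. Q \<in> \<Q> \<Longrightarrow> Q \<subseteq> U"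
    and U: "U \<in> sets borel" "emeasure lborel U \<le> ennreal v" and v: "0 \<le> v"
  shows "finite \<Q>" and "card \<Q> * r ^ CARD('d) \<le> v"
proof -
  have fin: "card \<F> * r ^ CARD('d) \<le> v" if \<F>: "finite \<F>" "\<F> \<subseteq> \<Q>" for \<F>
  proof -
    have "ennreal (card \<F> * r ^ CARD('d)) = (\<Sum>Q\<in>\<F>. ennreal (r ^ CARD('d)))"
      using r by (simp add: ennreal_mult ennreal_of_nat_eq_real_of_nat)
    also have "\<dots> \<le> (\<Sum>Q\<in>\<F>. emeasure lborel Q)"
      using \<F> \<Q>(1) by (intro sum_mono mesh_cube_volume[OF r]) auto
    also have "\<dots> = emeasure lborel (\<Union>\<F>)"
    proof -
      have "(\<Sum>Q\<in>\<F>. emeasure lborel Q) = emeasure lborel (\<Union>Q\<in>\<F>. Q)"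
      proof (rule sum_emeasure)
        show "(\<lambda>Q. Q) ` \<F> \<subseteq> sets lborel" using \<F> \<Q>(1) mesh_cube_borel by auto
        show "disjoint_family_on (\<lambda>Q. Q) \<F>"
          using \<F> \<Q>(1) mesh_cube_unique[OF r] by (fastforce simp: disjoint_family_on_def)
      qed (rule \<F>)
      then show ?thesis by simp
    qed
    also have "\<dots> \<le> emeasure lborel U" using \<F> \<Q>(2) U(1) by (intro emeasure_mono) auto
    also have "\<dots> \<le> ennreal v" by (rule U)
    finally show ?thesis using v by simp
  qed
  show "finite \<Q>"
  proof (rule ccontr)
    assume inf: "infinite \<Q>"
    obtain n :: nat where n: "v / r ^ CARD('d) < n" using reals_Archimedean2 by blast
    obtain \<F> where "finite \<F>" "\<F> \<subseteq> \<Q>" "card \<F> = n"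
      using infinite_arbitrarily_large[OF inf, of n] by blast
    then have "n * r ^ CARD('d) \<le> v" using fin by blast
    then show False using n r by (simp add: field_simps)
  qed
  then show "card \<Q> * r ^ CARD('d) \<le> v" by (intro fin) auto
qed

text \<open>A cube of the mesh has diameter at most d r, so every cube meeting the ellipsoid lies in
  a box about z along the left singular vectors, with half sides (R + d) times the maximum of the
  singular value and r. Comparing volumes counts them.\<close>

lemma mesh_count_ellipsoid:
  fixes A :: "real^'d^'d" and z :: "real^'d" and r R :: real
  assumes A: "invertible A" and r: "0 < r" and R: "0 \<le> R"
  defines "\<Q> \<equiv> {Q \<in> mesh_cubes r. \<exists>x. norm x \<le> R \<and> z + A *v x \<in> Q}"
  shows "finite \<Q>" and "card \<Q> \<le> (2 * (R + CARD('d))) ^ CARD('d) * (sv_max_prod A r / r ^ CARD('d))"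
proof -
  obtain v where v: "sv_basis A v" using sv_basis_exists by blast
  define e where "e i = (A *v v i) /\<^sub>R sing_val A i" for i
  have on: "orthonormal_family e" unfolding e_def by (rule sv_basis_image_orthonormal[OF v A])
  define l where "l i = (R + CARD('d)) * max (sing_val A i) r" for i
  have l0: "0 < l i" for i using r R by (auto simp: l_def intro!: mult_pos_pos add_nonneg_pos)
  define U where "U = {w. - z + w \<in> obox e l}"
  have "closed U"
  proof -
    have "U = (\<lambda>w. - z + w) -` obox e l" by (auto simp: U_def)
    also have "closed \<dots>" by (intro continuous_closed_vimage closed_obox) (auto intro!: continuous_intros)
    finally show ?thesis .
  qed
  then have U[measurable]: "U \<in> sets borel" by (rule borel_closed)
  have "indicator U w = (indicator (obox e l) (- z + w) :: ennreal)" for w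
    by (simp add: U_def indicator_def)
  then have "emeasure lborel U = (\<integral>\<^sup>+w. indicator (obox e l) (- z + w) \<partial>lborel)"
    using nn_integral_indicator[of U lborel] by simp
  also have "\<dots> = emeasure lborel (obox e l)" by (rule nn_integral_indicator_translate) measurable
  also have "\<dots> = ennreal (\<Prod>i=1..CARD('d). 2 * l i)" using l0 by (intro emeasure_obox on)
  also have "(\<Prod>i=1..CARD('d). 2 * l i) = (2 * (R + CARD('d))) ^ CARD('d) * sv_max_prod A r"
  proof -
    have "(\<Prod>i=1..CARD('d). 2 * l i) = (\<Prod>i=1..CARD('d). (2 * (R + CARD('d))) * max (sing_val A i) r)"
      unfolding l_def by (simp only: mult.assoc)
    then show ?thesis by (simp only: prod.distrib prod_constant sv_max_prod_def card_atLeastAtMost diff_Suc_1 power_mult_distrib)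
  qed
  finally have vol: "emeasure lborel U = ennreal ((2 * (R + CARD('d))) ^ CARD('d) * sv_max_prod A r)" .
  have sub: "Q \<subseteq> U" if Q: "Q \<in> \<Q>" for Q
  proof
    fix y assume y: "y \<in> Q"
    obtain x where x: "norm x \<le> R" "z + A *v x \<in> Q" using Q by (auto simp: \<Q>_def)
    have d: "norm (y - (z + A *v x)) \<le> CARD('d) * r"
      using Q x y by (intro mesh_cube_diameter[OF r, of Q]) (auto simp: \<Q>_def)
    show "y \<in> U"
      unfolding U_def obox_def
    proof (intro CollectI ballI)
      fix i assume i: "i \<in> {1..CARD('d)}"
      have a: "0 \<le> sing_val A i" using sing_val_nonneg i by auto
      have "norm (e i) = 1" using on i by (simp add: orthonormal_family_def norm_eq_1)
      then have "\<bar>(y - (z + A *v x)) \<bullet> e i\<bar> \<le> CARD('d) * r"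
        using Cauchy_Schwarz_ineq2[of "y - (z + A *v x)" "e i"] d by simp
      moreover have "\<bar>(A *v x) \<bullet> e i\<bar> \<le> sing_val A i * norm x"
        unfolding e_def by (rule sv_basis_image_coord[OF v A i])
      moreover have "sing_val A i * norm x \<le> sing_val A i * R" using x a by (intro mult_left_mono)
      moreover have "(- z + y) \<bullet> e i = (y - (z + A *v x)) \<bullet> e i + (A *v x) \<bullet> e i"
        by (simp add: inner_diff_left inner_add_left)
      ultimately have "\<bar>(- z + y) \<bullet> e i\<bar> \<le> CARD('d) * r + sing_val A i * R" by linarith
      also have "\<dots> \<le> CARD('d) * max (sing_val A i) r + max (sing_val A i) r * R"
        using R by (intro add_mono mult_left_mono mult_right_mono) auto
      also have "\<dots> = l i" by (simp add: l_def algebra_simps)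
      finally show "\<bar>(- z + y) \<bullet> e i\<bar> \<le> l i" .
    qed
  qed
  have v0: "0 \<le> (2 * (R + CARD('d))) ^ CARD('d) * sv_max_prod A r"
    using R sv_max_prod_pos[OF r, of A] by simp
  have "\<Q> \<subseteq> mesh_cubes r" by (auto simp: \<Q>_def)
  note count = mesh_cubes_count[OF r this sub U eq_refl[OF vol] v0]
  show "finite \<Q>" by (rule count(1))
  show "card \<Q> \<le> (2 * (R + CARD('d))) ^ CARD('d) * (sv_max_prod A r / r ^ CARD('d))"
    using count(2) r by (simp add: field_simps)
qed

section \<open>Mesh sums of an image measure\<close>

lemma ln_at_right_0_quotient: "((\<lambda>r. C / ln r) \<longlongrightarrow> 0) (at_right (0 :: real))"
  by (intro real_tendsto_divide_at_top filterlim_at_bot_imp_at_infinity tendsto_divide_0[OF tendsto_const] ln_at_0)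

locale bounded_image = prob_space M for M :: "'a measure" +
  fixes f :: "'a \<Rightarrow> real^'d" and R :: real
  assumes f [measurable]: "f \<in> borel_measurable M" and bound: "\<And>x. x \<in> space M \<Longrightarrow> norm (f x) \<le> R"
begin

definition mass :: "(real^'d) set \<Rightarrow> real" where
  "mass Q = measure (distr M borel f) Q"

definition part :: "'a set \<Rightarrow> (real^'d) set \<Rightarrow> real" where
  "part B Q = prob (B \<inter> f -` Q)"

text \<open>The finitely many cubes that can carry mass, as all values of f have norm at most R;
  infinite sums over the mesh reduce to these.\<close>

definition cells :: "real \<Rightarrow> (real^'d) set set" where
  "cells r = {Q \<in> mesh_cubes r. \<exists>x. norm x \<le> R \<and> x \<in> Q}"

lemma R_nonneg: "0 \<le> R"
proof -
  obtain x where "x \<in> space M" using not_empty by blast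
  then show ?thesis using bound[of x] norm_ge_zero[of "f x"] by linarith
qed

lemma finite_cells: "0 < r \<Longrightarrow> finite (cells r)"
proof -
  assume r: "0 < r"
  have "cells r = {Q \<in> mesh_cubes r. \<exists>x. norm x \<le> R \<and> 0 + mat 1 *v x \<in> Q}" by (simp add: cells_def)
  also have "finite \<dots>" using mesh_count_ellipsoid(1)[OF invertible_mat_1 r R_nonneg, of 0] .
  finally show ?thesis .
qed

lemma cells_mesh: "Q \<in> cells r \<Longrightarrow> Q \<in> mesh_cubes r"
  by (simp add: cells_def)

lemma vimage_sets [measurable]:
  assumes "B \<in> events" "Q \<in> mesh_cubes r"
  shows "B \<inter> f -` Q \<in> events"
proof -
  have "f -` Q \<inter> space M \<in> events" using mesh_cube_borel[OF assms(2)] by (rule measurable_sets[OF f])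
  then have "B \<inter> (f -` Q \<inter> space M) \<in> events" using assms(1) by (rule sets.Int[rotated])
  moreover have "B \<inter> (f -` Q \<inter> space M) = B \<inter> f -` Q" using sets.sets_into_space[OF assms(1)] by auto
  ultimately show ?thesis by simp
qed

lemma mass_eq_part: "Q \<in> mesh_cubes r \<Longrightarrow> mass Q = part (space M) Q"
  unfolding mass_def part_def by (subst measure_distr) (auto simp: mesh_cube_borel Int_commute)

lemma part_nonneg: "0 \<le> part B Q"
  by (simp add: part_def)

lemma mass_nonneg: "0 \<le> mass Q"
  by (simp add: mass_def)

lemma part_le_mass: "B \<in> events \<Longrightarrow> Q \<in> mesh_cubes r \<Longrightarrow> part B Q \<le> mass Q"
  unfolding mass_eq_part part_def using sets.sets_into_space[of B M]
  by (intro finite_measure_mono vimage_sets[of "space M"]) auto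

lemma mass_le_1: "Q \<in> mesh_cubes r \<Longrightarrow> mass Q \<le> 1"
  by (simp add: mass_eq_part part_def)

lemma part_outside_cells:
  assumes "B \<in> events" "Q \<in> mesh_cubes r" "Q \<notin> cells r"
  shows "part B Q = 0"
proof -
  have "B \<inter> f -` Q = {}"
    using assms bound sets.sets_into_space[OF assms(1)] by (auto simp: cells_def)
  then show ?thesis by (simp add: part_def)
qed

lemma sum_part:
  assumes r: "0 < r" and B: "B \<in> events"
  shows "(\<Sum>Q\<in>cells r. part B Q) = prob B"
proof -
  have "(\<Sum>Q\<in>cells r. part B Q) = prob (\<Union>Q\<in>cells r. B \<inter> f -` Q)"
    unfolding part_def
  proof (rule finite_measure_finite_Union[symmetric])
    show "disjoint_family_on (\<lambda>Q. B \<inter> f -` Q) (cells r)"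
      using mesh_cube_unique[OF r cells_mesh cells_mesh] by (fastforce simp: disjoint_family_on_def)
  qed (use finite_cells[OF r] vimage_sets[OF B cells_mesh] in auto)
  also have "(\<Union>Q\<in>cells r. B \<inter> f -` Q) = B"
  proof (intro equalityI subsetI)
    fix x assume x: "x \<in> B"
    then have "norm (f x) \<le> R" using bound sets.sets_into_space[OF B] by auto
    moreover obtain Q where "Q \<in> mesh_cubes r" "f x \<in> Q" using mesh_cube_exists[OF r] by blast
    ultimately show "x \<in> (\<Union>Q\<in>cells r. B \<inter> f -` Q)" using x by (auto simp: cells_def)
  qed auto
  finally show ?thesis .
qed

lemma sum_mass: "0 < r \<Longrightarrow> (\<Sum>Q\<in>cells r. mass Q) = 1"
  using sum_part[of r "space M"] mass_eq_part[OF cells_mesh] by (simp add: prob_space)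

text \<open>The dimension quotient multiplied by ln r. With 1 / (q - 1) included, larger values
  always mean smaller dimension, for every q, when r < 1.\<close>

definition entropy_sum :: "real \<Rightarrow> real \<Rightarrow> real" where
  "entropy_sum q r = (if q = 1 then (\<Sum>Q\<in>cells r. mass Q * ln (mass Q))
     else ln (\<Sum>Q\<in>cells r. mass Q powr q) / (q - 1))"

lemma powr_sum_pos:
  assumes r: "0 < r"
  shows "0 < (\<Sum>Q\<in>cells r. mass Q powr q)"
proof -
  have "(\<Sum>Q\<in>cells r. mass Q powr q) \<noteq> 0"
  proof
    assume "(\<Sum>Q\<in>cells r. mass Q powr q) = 0"
    then have "\<forall>Q\<in>cells r. mass Q powr q = 0" using finite_cells[OF r] by (subst (asm) sum_nonneg_eq_0_iff) auto
    then have "(\<Sum>Q\<in>cells r. mass Q) = 0" by simp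
    then show False using sum_mass[OF r] by simp
  qed
  moreover have "0 \<le> (\<Sum>Q\<in>cells r. mass Q powr q)" by (intro sum_nonneg) auto
  ultimately show ?thesis by linarith
qed

lemma infsum_mesh:
  assumes r: "0 < r" and g: "g 0 = 0"
  shows "(\<Sum>\<^sub>\<infinity>Q\<in>mesh_cubes r. ereal (g (measure (distr M borel f) Q))) = ereal (\<Sum>Q\<in>cells r. g (mass Q))"
proof -
  have "(\<Sum>\<^sub>\<infinity>Q\<in>mesh_cubes r. ereal (g (measure (distr M borel f) Q))) = (\<Sum>\<^sub>\<infinity>Q\<in>cells r. ereal (g (mass Q)))"
  proof (rule infsum_cong_neutral)
    fix Q assume "Q \<in> mesh_cubes r - cells r"
    then have "mass Q = 0" using part_outside_cells[of "space M" Q r] mass_eq_part[of Q r] by auto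
    then show "ereal (g (measure (distr M borel f) Q)) = 0" using g by (simp add: mass_def)
  qed (auto simp: mass_def cells_def)
  also have "\<dots> = (\<Sum>Q\<in>cells r. ereal (g (mass Q)))" by (rule infsum_finite[OF finite_cells[OF r]])
  finally show ?thesis by simp
qed

lemma dimension_quotient_eq:
  assumes r: "0 < r" "r < 1"
  shows "dimension_quotient q (distr M borel f) r = ereal (entropy_sum q r / ln r)"
proof -
  have l: "ln r \<noteq> 0" using r by simp
  show ?thesis
  proof (cases "q = 1")
    case True
    then show ?thesis
      using infsum_mesh[OF r(1), of "\<lambda>x. x * ln x"] l by (simp add: dimension_quotient_def entropy_sum_def)
  next
    case False
    have "ln_ereal (\<Sum>\<^sub>\<infinity>Q\<in>mesh_cubes r. ereal (measure (distr M borel f) Q powr q))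
        = ereal (ln (\<Sum>Q\<in>cells r. mass Q powr q))"
      using infsum_mesh[OF r(1), of "\<lambda>x. x powr q"] powr_sum_pos[OF r(1), of q] by (simp add: ln_ereal_def)
    then show ?thesis using False l by (simp add: dimension_quotient_def entropy_sum_def)
  qed
qed

text \<open>The additive constant disappears after division by ln r, which tends to minus infinity;
  as ln r is negative the inequality is reversed. \<open>lower_gen_dim_ge\<close> is the
  counterpart.\<close>

lemma upper_gen_dim_le:
  assumes "\<forall>\<^sub>F r in at_right 0. s * ln r - C \<le> entropy_sum q r"
  shows "upper_gen_dim q (distr M borel f) \<le> ereal s"
proof -
  have "\<forall>\<^sub>F r in at_right 0. dimension_quotient q (distr M borel f) r \<le> ereal (s - C / ln r)"
    using assms eventually_at_right_real[OF zero_less_one]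
  proof eventually_elim
    case (elim r)
    then have l: "ln r < 0" by simp
    then have "entropy_sum q r / ln r \<le> (s * ln r - C) / ln r" using elim(1) by (intro divide_right_mono_neg) auto
    also have "\<dots> = s - C / ln r" using l by (simp add: diff_divide_distrib)
    finally show ?case using elim by (simp add: dimension_quotient_eq)
  qed
  then have "Limsup (at_right 0) (dimension_quotient q (distr M borel f)) \<le> Limsup (at_right 0) (\<lambda>r. ereal (s - C / ln r))"
    by (rule Limsup_mono)
  also have "((\<lambda>r. ereal (s - C / ln r)) \<longlongrightarrow> ereal (s - 0)) (at_right 0)"
    by (intro tendsto_ereal tendsto_diff tendsto_const ln_at_right_0_quotient)
  then have "Limsup (at_right 0) (\<lambda>r. ereal (s - C / ln r)) = ereal s"
    by (intro lim_imp_Limsup) auto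
  finally show ?thesis by (simp add: upper_gen_dim_def)
qed

lemma lower_gen_dim_ge:
  assumes "\<forall>\<^sub>F r in at_right 0. entropy_sum q r \<le> s * ln r + C"
  shows "ereal s \<le> lower_gen_dim q (distr M borel f)"
proof -
  have "\<forall>\<^sub>F r in at_right 0. ereal (s + C / ln r) \<le> dimension_quotient q (distr M borel f) r"
    using assms eventually_at_right_real[OF zero_less_one]
  proof eventually_elim
    case (elim r)
    then have l: "ln r < 0" by simp
    then have "s + C / ln r = (s * ln r + C) / ln r" by (simp add: add_divide_distrib)
    also have "\<dots> \<le> entropy_sum q r / ln r" using elim(1) l by (intro divide_right_mono_neg) auto
    finally show ?case using elim by (simp add: dimension_quotient_eq)
  qed
  then have "Liminf (at_right 0) (\<lambda>r. ereal (s + C / ln r)) \<le> Liminf (at_right 0) (dimension_quotient q (distr M borel f))"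
    by (rule Liminf_mono)
  moreover have "((\<lambda>r. ereal (s + C / ln r)) \<longlongrightarrow> ereal (s + 0)) (at_right 0)"
    by (intro tendsto_ereal tendsto_add tendsto_const ln_at_right_0_quotient)
  then have "Liminf (at_right 0) (\<lambda>r. ereal (s + C / ln r)) = ereal s"
    by (intro lim_imp_Liminf) auto
  ultimately show ?thesis by (simp add: lower_gen_dim_def)
qed

text \<open>The almost sure lower bounds are proved for positive v only; this one covers a critical
  value equal to 0.\<close>

lemma lower_gen_dim_nonneg:
  assumes q: "1 \<le> q"
  shows "0 \<le> lower_gen_dim q (distr M borel f)"
proof -
  have "\<forall>\<^sub>F r in at_right 0. entropy_sum q r \<le> 0 * ln r + 0"
    using eventually_at_right_real[OF zero_less_one]
  proof eventually_elim
    case (elim r)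
    then have r: "0 < r" by simp
    have m1: "mass Q \<le> 1" if "Q \<in> cells r" for Q using mass_le_1[OF cells_mesh[OF that]] .
    show ?case
    proof (cases "q = 1")
      case True
      have "mass Q * ln (mass Q) \<le> 0" if "Q \<in> cells r" for Q
        using m1[OF that] mass_nonneg[of Q] by (cases "mass Q = 0") (auto intro!: mult_nonneg_nonpos simp: ln_le_zero_iff)
      then show ?thesis using True by (auto simp: entropy_sum_def intro!: sum_nonpos)
    next
      case False
      have "mass Q powr q \<le> mass Q" if "Q \<in> cells r" for Q
        using powr_mono'[OF q mass_nonneg m1[OF that]] mass_nonneg[of Q] by simp
      then have "(\<Sum>Q\<in>cells r. mass Q powr q) \<le> (\<Sum>Q\<in>cells r. mass Q)" by (rule sum_mono)
      then have "ln (\<Sum>Q\<in>cells r. mass Q powr q) \<le> 0"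
        using powr_sum_pos[OF r, of q] sum_mass[OF r] by (simp add: ln_le_zero_iff)
      then show ?thesis using False q by (simp add: entropy_sum_def divide_nonpos_pos)
    qed
  qed
  from lower_gen_dim_ge[OF this] show ?thesis by (simp add: zero_ereal_def)
qed

definition proximity :: "real \<Rightarrow> 'a \<Rightarrow> real" where
  "proximity r x = prob {y \<in> space M. norm (f x - f y) \<le> r}"

text \<open>The cube containing f x lies in the ball of radius d r about f x, so its mass is at most
  the proximity there. The sum over cubes is then an integral over x.\<close>

lemma sum_part_mass_powr_le:
  fixes r t :: real
  assumes r: "0 < r" and B: "B \<in> events" and t: "0 < t"
  shows "ennreal (\<Sum>Q\<in>cells r. part B Q * mass Q powr t)
    \<le> (\<integral>\<^sup>+x. indicator B x * ennreal (proximity (CARD('d) * r) x powr t) \<partial>M)"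
proof -
  have B_space: "B \<subseteq> space M" using sets.sets_into_space[OF B] .
  have mass_le: "mass Q \<le> proximity (CARD('d) * r) x" if Q: "Q \<in> cells r" "f x \<in> Q" for Q x
    unfolding mass_eq_part[OF cells_mesh[OF Q(1)]] part_def proximity_def
    by (intro finite_measure_mono) (use mesh_cube_diameter[OF r cells_mesh[OF Q(1)] Q(2)] in auto)
  have "ennreal (\<Sum>Q\<in>cells r. part B Q * mass Q powr t) = (\<Sum>Q\<in>cells r. ennreal (part B Q * mass Q powr t))"
    by (intro sum_ennreal[symmetric]) (auto simp: part_nonneg)
  also have "\<dots> = (\<Sum>Q\<in>cells r. \<integral>\<^sup>+x. ennreal (mass Q powr t) * indicator (B \<inter> f -` Q) x \<partial>M)"
  proof (rule sum.cong)
    fix Q assume "Q \<in> cells r"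
    then have "B \<inter> f -` Q \<in> events" using vimage_sets[OF B cells_mesh] by blast
    then show "ennreal (part B Q * mass Q powr t) = (\<integral>\<^sup>+x. ennreal (mass Q powr t) * indicator (B \<inter> f -` Q) x \<partial>M)"
      by (simp add: nn_integral_cmult_indicator part_def emeasure_eq_measure ennreal_mult mult.commute)
  qed simp
  also have "\<dots> = (\<integral>\<^sup>+x. (\<Sum>Q\<in>cells r. ennreal (mass Q powr t) * indicator (B \<inter> f -` Q) x) \<partial>M)"
    using vimage_sets[OF B cells_mesh] by (intro nn_integral_sum[symmetric]) auto
  also have "\<dots> \<le> (\<integral>\<^sup>+x. indicator B x * ennreal (proximity (CARD('d) * r) x powr t) \<partial>M)"
  proof (rule nn_integral_mono)
    fix x assume "x \<in> space M"
    show "(\<Sum>Q\<in>cells r. ennreal (mass Q powr t) * indicator (B \<inter> f -` Q) x)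
        \<le> indicator B x * ennreal (proximity (CARD('d) * r) x powr t)"
    proof (cases "x \<in> B \<and> (\<exists>Q\<in>cells r. f x \<in> Q)")
      case True
      then obtain Q where Q: "Q \<in> cells r" "f x \<in> Q" by blast
      have "(\<Sum>Q'\<in>cells r. ennreal (mass Q' powr t) * indicator (B \<inter> f -` Q') x)
          = (\<Sum>Q'\<in>cells r. if Q' = Q then ennreal (mass Q powr t) else 0)"
      proof (rule sum.cong)
        fix Q' assume Q': "Q' \<in> cells r"
        show "ennreal (mass Q' powr t) * indicator (B \<inter> f -` Q') x = (if Q' = Q then ennreal (mass Q powr t) else 0)"
        proof (cases "Q' = Q")
          case False
          then have "f x \<notin> Q'"
            using mesh_cube_unique[OF r cells_mesh[OF Q(1)] cells_mesh[OF Q'] Q(2)] by blast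
          then show ?thesis using False by simp
        qed (use Q True in simp)
      qed simp
      also have "\<dots> = ennreal (mass Q powr t)" using Q finite_cells[OF r] by simp
      also have "\<dots> \<le> ennreal (proximity (CARD('d) * r) x powr t)"
        using mass_le[OF Q] mass_nonneg t by (intro ennreal_leI powr_mono2) auto
      finally show ?thesis using True by simp
    next
      case False
      then have "(\<Sum>Q\<in>cells r. ennreal (mass Q powr t) * indicator (B \<inter> f -` Q) x) = (\<Sum>Q\<in>cells r. 0)"
        by (intro sum.cong) (auto simp: indicator_def)
      then show ?thesis by simp
    qed
  qed
  finally show ?thesis .
qed

lemma entropy_sum_le_powr:
  fixes r q y :: real
  assumes r: "0 < r" and q: "1 < q" and y: "0 < y"
    and A: "(\<integral>\<^sup>+x. indicator (space M) x * ennreal (proximity (CARD('d) * r) x powr (q - 1)) \<partial>M) \<le> ennreal y"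
  shows "entropy_sum q r \<le> ln y / (q - 1)"
proof -
  have "mass Q powr q = part (space M) Q * mass Q powr (q - 1)" if "Q \<in> cells r" for Q
    using mass_nonneg[of Q] unfolding mass_eq_part[OF cells_mesh[OF that], symmetric]
    by (cases "mass Q = 0") (auto simp: powr_mult_base)
  then have "ennreal (\<Sum>Q\<in>cells r. mass Q powr q) \<le> ennreal y"
    using sum_part_mass_powr_le[OF r sets.top, of "q - 1"] q A by simp
  then have "(\<Sum>Q\<in>cells r. mass Q powr q) \<le> y" using y by (subst (asm) ennreal_le_iff) auto
  then have "ln (\<Sum>Q\<in>cells r. mass Q powr q) \<le> ln y" using powr_sum_pos[OF r] by (intro ln_mono) auto
  then show ?thesis using q by (simp add: entropy_sum_def divide_right_mono)
qed

text \<open>As ln (mass) \<le> 0, discarding the points outside B only raises the sum. The tangent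
  bound ln m \<le> ln y + m / y reduces the logarithm to the first power of the mass, so the
  integral of the proximity over B suffices.\<close>

lemma entropy_sum_le_ln:
  fixes r y z :: real
  assumes r: "0 < r" and B: "B \<in> events" and y: "0 < y" and z: "0 \<le> z"
    and A: "(\<integral>\<^sup>+x. indicator B x * ennreal (proximity (CARD('d) * r) x powr 1) \<partial>M) \<le> ennreal z"
  shows "entropy_sum 1 r \<le> prob B * ln y + z / y"
proof -
  have piece: "mass Q * ln (mass Q) \<le> part B Q * ln y + part B Q * mass Q powr 1 / y" if Q: "Q \<in> cells r" for Q
  proof (cases "mass Q = 0")
    case True
    then have "part B Q = 0" using part_le_mass[OF B cells_mesh[OF Q]] part_nonneg[of B Q] by simp
    then show ?thesis using True by simp
  next
    case False
    then have m: "0 < mass Q" using mass_nonneg[of Q] by simp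
    have "ln (mass Q) \<le> 0" using m mass_le_1[OF cells_mesh[OF Q]] by (simp add: ln_le_zero_iff)
    then have "mass Q * ln (mass Q) \<le> part B Q * ln (mass Q)"
      using part_le_mass[OF B cells_mesh[OF Q]] by (intro mult_right_mono_neg)
    also have "ln (mass Q) \<le> ln y + mass Q / y"
      using ln_le_minus_one[of "mass Q / y"] m y by (simp add: ln_div)
    then have "part B Q * ln (mass Q) \<le> part B Q * (ln y + mass Q / y)"
      using part_nonneg by (intro mult_left_mono)
    finally show ?thesis using m by (simp add: distrib_left)
  qed
  have "ennreal (\<Sum>Q\<in>cells r. part B Q * mass Q powr 1) \<le> ennreal z"
    using sum_part_mass_powr_le[OF r B zero_less_one] A by (rule order_trans)
  then have "(\<Sum>Q\<in>cells r. part B Q * mass Q powr 1) \<le> z" using z by (subst (asm) ennreal_le_iff) auto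
  have "entropy_sum 1 r \<le> (\<Sum>Q\<in>cells r. part B Q * ln y + part B Q * mass Q powr 1 / y)"
    using piece by (auto simp: entropy_sum_def intro!: sum_mono)
  also have "\<dots> = prob B * ln y + (\<Sum>Q\<in>cells r. part B Q * mass Q powr 1) / y"
    by (simp add: sum.distrib sum_distrib_right[symmetric] sum_part[OF r B] sum_divide_distrib)
  also have "\<dots> \<le> prob B * ln y + z / y"
    using \<open>(\<Sum>Q\<in>cells r. part B Q * mass Q powr 1) \<le> z\<close> y by (simp add: divide_right_mono)
  finally show ?thesis .
qed

text \<open>The mass of each C u is spread over at most N u cubes. A tangent inequality at an even
  share replaces Jensen's inequality, and since x^q and x ln x are superadditive at nonnegative x,
  with q > 1 for the power, the pieces of different u in one cube may be added up.\<close>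

lemma
  fixes r q :: real and N :: "'b \<Rightarrow> real"
  assumes r: "0 < r" and S: "finite S" "\<And>u. u \<in> S \<Longrightarrow> C u \<in> events"
    and disj: "disjoint_family_on C S" and cover: "(\<Union>u\<in>S. C u) = space M"
    and N: "\<And>u. u \<in> S \<Longrightarrow> 0 < N u" "\<And>u. u \<in> S \<Longrightarrow> card {Q \<in> cells r. f ` C u \<inter> Q \<noteq> {}} \<le> N u"
  shows powr_sum_ge: "1 < q \<Longrightarrow> (\<Sum>u\<in>S. N u powr (1 - q) * prob (C u) powr q) / 2 powr q \<le> (\<Sum>Q\<in>cells r. mass Q powr q)"
    and ln_sum_ge: "(\<Sum>u\<in>S. prob (C u) * ln (prob (C u) / N u)) \<le> (\<Sum>Q\<in>cells r. mass Q * ln (mass Q))"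
proof -
  let ?D = "\<lambda>u. {Q \<in> cells r. f ` C u \<inter> Q \<noteq> {}}"
  have finD: "finite (?D u)" for u using finite_cells[OF r] by simp
  have part_0: "part (C u) Q = 0" if "Q \<in> cells r - ?D u" for u Q
  proof -
    have "C u \<inter> f -` Q = {}" using that by auto
    then show ?thesis by (simp add: part_def)
  qed
  have sum_D: "(\<Sum>Q\<in>?D u. part (C u) Q) = prob (C u)" if "u \<in> S" for u
  proof -
    have "(\<Sum>Q\<in>?D u. part (C u) Q) = (\<Sum>Q\<in>cells r. part (C u) Q)"
      using finite_cells[OF r] part_0 by (intro sum.mono_neutral_left) auto
    then show ?thesis using sum_part[OF r S(2)[OF that]] by simp
  qed
  have mass_sum: "mass Q = (\<Sum>u\<in>S. part (C u) Q)" if Q: "Q \<in> cells r" for Q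
  proof -
    have "mass Q = prob (\<Union>u\<in>S. C u \<inter> f -` Q)"
      unfolding mass_eq_part[OF cells_mesh[OF Q]] part_def cover[symmetric] by (simp only: Int_UN_distrib2 UN_simps)
    also have "\<dots> = (\<Sum>u\<in>S. prob (C u \<inter> f -` Q))"
    proof (rule finite_measure_finite_Union)
      show "disjoint_family_on (\<lambda>u. C u \<inter> f -` Q) S" using disj by (auto simp: disjoint_family_on_def)
    qed (use S vimage_sets[OF S(2) cells_mesh[OF Q]] in auto)
    finally show ?thesis by (simp add: part_def)
  qed
  {
    assume q: "1 < q"
    have piece: "N u powr (1 - q) * prob (C u) powr q / 2 powr q \<le> (\<Sum>Q\<in>cells r. part (C u) Q powr q)" if u: "u \<in> S" for u
    proof (cases "prob (C u) = 0")
      case True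
      then show ?thesis by (simp add: sum_nonneg)
    next
      case False
      then have P: "0 < prob (C u)" by (simp add: zero_less_measure_iff)
      \<comment> \<open>Half the even share: subtracting y in each of at most N u cubes still leaves
        half of the mass. This admits a cruder inequality than the true tangent and costs the factor
        2^q.\<close>
      define y where "y = prob (C u) / (2 * N u)"
      have y: "0 < y" using P N(1)[OF u] by (simp add: y_def)
      have tangent: "y powr (q - 1) * (x - y) \<le> x powr q" if x: "0 \<le> x" for x
      proof (cases "x \<le> y")
        case True
        then have "y powr (q - 1) * (x - y) \<le> 0" by (intro mult_nonneg_nonpos) auto
        also have "0 \<le> x powr q" by simp
        finally show ?thesis .
      next
        case False
        then have "y powr (q - 1) * (x - y) \<le> x powr (q - 1) * x"
          using y q by (intro mult_mono powr_mono2) auto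
        also have "\<dots> = x powr q" using False y by (simp add: powr_mult_base mult.commute)
        finally show ?thesis .
      qed
      have "N u powr (1 - q) * prob (C u) powr q / 2 powr q = y powr (q - 1) * (prob (C u) / 2)"
        using P N(1)[OF u] by (simp add: y_def powr_divide powr_mult powr_diff field_simps)
      also have "\<dots> \<le> y powr (q - 1) * (prob (C u) - card (?D u) * y)"
      proof (rule mult_left_mono)
        have "card (?D u) * y \<le> N u * y" using N(2)[OF u] y by (intro mult_right_mono) auto
        also have "\<dots> = prob (C u) / 2" using N(1)[OF u] by (simp add: y_def)
        finally show "prob (C u) / 2 \<le> prob (C u) - card (?D u) * y" by simp
      qed simp
      also have "\<dots> = (\<Sum>Q\<in>?D u. y powr (q - 1) * (part (C u) Q - y))"
        by (simp add: sum_distrib_left[symmetric] sum_subtractf sum_D[OF u])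
      also have "\<dots> \<le> (\<Sum>Q\<in>?D u. part (C u) Q powr q)" by (intro sum_mono tangent part_nonneg)
      also have "\<dots> \<le> (\<Sum>Q\<in>cells r. part (C u) Q powr q)" using finite_cells[OF r] by (intro sum_mono2) auto
      finally show ?thesis .
    qed
    have "(\<Sum>u\<in>S. N u powr (1 - q) * prob (C u) powr q) / 2 powr q
        = (\<Sum>u\<in>S. N u powr (1 - q) * prob (C u) powr q / 2 powr q)" by (rule sum_divide_distrib)
    also have "\<dots> \<le> (\<Sum>u\<in>S. \<Sum>Q\<in>cells r. part (C u) Q powr q)" by (intro sum_mono piece)
    also have "\<dots> = (\<Sum>Q\<in>cells r. \<Sum>u\<in>S. part (C u) Q powr q)" by (rule sum.swap)
    also have "\<dots> \<le> (\<Sum>Q\<in>cells r. mass Q powr q)"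
    proof (rule sum_mono)
      fix Q assume Q: "Q \<in> cells r"
      have "(\<Sum>u\<in>S. part (C u) Q powr q) \<le> (\<Sum>u\<in>S. part (C u) Q * mass Q powr (q - 1))"
      proof (rule sum_mono)
        fix u assume u: "u \<in> S"
        have "part (C u) Q powr q = part (C u) Q * part (C u) Q powr (q - 1)"
          using part_nonneg[of "C u" Q] by (cases "part (C u) Q = 0") (auto simp: powr_mult_base)
        also have "\<dots> \<le> part (C u) Q * mass Q powr (q - 1)"
          using part_le_mass[OF S(2)[OF u] cells_mesh[OF Q]] q part_nonneg by (intro mult_left_mono powr_mono2) auto
        finally show "part (C u) Q powr q \<le> part (C u) Q * mass Q powr (q - 1)" .
      qed
      also have "\<dots> = mass Q * mass Q powr (q - 1)" by (simp add: mass_sum[OF Q] sum_distrib_right)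
      also have "\<dots> = mass Q powr q" using mass_nonneg[of Q] by (cases "mass Q = 0") (auto simp: powr_mult_base)
      finally show "(\<Sum>u\<in>S. part (C u) Q powr q) \<le> mass Q powr q" .
    qed
    finally show "(\<Sum>u\<in>S. N u powr (1 - q) * prob (C u) powr q) / 2 powr q \<le> (\<Sum>Q\<in>cells r. mass Q powr q)" .
  }
  have piece: "prob (C u) * ln (prob (C u) / N u) \<le> (\<Sum>Q\<in>cells r. part (C u) Q * ln (part (C u) Q))" if u: "u \<in> S" for u
  proof (cases "prob (C u) = 0")
    case True
    then have "part (C u) Q = 0" if "Q \<in> cells r" for Q
      using sum_part[OF r S(2)[OF u]] that finite_cells[OF r] part_nonneg sum_nonneg_eq_0_iff[of "cells r" "part (C u)"] by auto
    then show ?thesis using True by simp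
  next
    case False
    then have P: "0 < prob (C u)" by (simp add: zero_less_measure_iff)
    define y where "y = prob (C u) / N u"
    have y: "0 < y" using P N(1)[OF u] by (simp add: y_def)
    \<comment> \<open>The tangent line of x ln x at y; with y the even share the linear terms do not
      sum to a negative number.\<close>
    have tangent: "x * ln y + x - y \<le> x * ln x" if x: "0 \<le> x" for x
    proof (cases "x = 0")
      case False
      then have "0 < x" using x by simp
      then have "x * ln (y / x) \<le> x * (y / x - 1)" using y by (intro mult_left_mono ln_le_minus_one) auto
      then show ?thesis using \<open>0 < x\<close> y by (simp add: ln_div algebra_simps)
    qed (use y in simp)
    have "card (?D u) * y \<le> N u * y" using N(2)[OF u] y by (intro mult_right_mono) auto
    also have "\<dots> = prob (C u)" using N(1)[OF u] by (simp add: y_def)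
    finally have "prob (C u) * ln y \<le> prob (C u) * ln y + prob (C u) - card (?D u) * y" by simp
    also have "\<dots> = (\<Sum>Q\<in>?D u. part (C u) Q * ln y + part (C u) Q - y)"
      by (simp add: sum.distrib sum_subtractf sum_distrib_right[symmetric] sum_D[OF u])
    also have "\<dots> \<le> (\<Sum>Q\<in>?D u. part (C u) Q * ln (part (C u) Q))" by (intro sum_mono tangent part_nonneg)
    also have "\<dots> = (\<Sum>Q\<in>cells r. part (C u) Q * ln (part (C u) Q))"
      using finite_cells[OF r] part_0 by (intro sum.mono_neutral_left) auto
    finally show ?thesis by (simp add: y_def)
  qed
  have "(\<Sum>u\<in>S. prob (C u) * ln (prob (C u) / N u)) \<le> (\<Sum>u\<in>S. \<Sum>Q\<in>cells r. part (C u) Q * ln (part (C u) Q))"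
    by (intro sum_mono piece)
  also have "\<dots> = (\<Sum>Q\<in>cells r. \<Sum>u\<in>S. part (C u) Q * ln (part (C u) Q))" by (rule sum.swap)
  also have "\<dots> \<le> (\<Sum>Q\<in>cells r. mass Q * ln (mass Q))"
  proof (rule sum_mono)
    fix Q assume Q: "Q \<in> cells r"
    have "(\<Sum>u\<in>S. part (C u) Q * ln (part (C u) Q)) \<le> (\<Sum>u\<in>S. part (C u) Q * ln (mass Q))"
    proof (rule sum_mono)
      fix u assume u: "u \<in> S"
      show "part (C u) Q * ln (part (C u) Q) \<le> part (C u) Q * ln (mass Q)"
        using part_le_mass[OF S(2)[OF u] cells_mesh[OF Q]] part_nonneg[of "C u" Q]
        by (cases "part (C u) Q = 0") (auto intro!: mult_left_mono ln_mono)
    qed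
    also have "\<dots> = mass Q * ln (mass Q)" by (simp add: mass_sum[OF Q] sum_distrib_right)
    finally show "(\<Sum>u\<in>S. part (C u) Q * ln (part (C u) Q)) \<le> mass Q * ln (mass Q)" .
  qed
  finally show "(\<Sum>u\<in>S. prob (C u) * ln (prob (C u) / N u)) \<le> (\<Sum>Q\<in>cells r. mass Q * ln (mass Q))" .
qed

end

section \<open>The upper bound\<close>

lemma is_cut_cylinders:
  assumes "is_cut S"
  shows "disjoint_family_on cylinder S" and "(\<Union>u\<in>S. cylinder u) = UNIV"
proof -
  have ex1: "\<exists>!k. prefix_word x k \<in> S" for x using assms by (simp add: is_cut_def)
  show "disjoint_family_on cylinder S"
    unfolding disjoint_family_on_def
  proof (intro ballI impI equals0I)
    fix u v x assume uv: "u \<in> S" "v \<in> S" "u \<noteq> v" and x: "x \<in> cylinder u \<inter> cylinder v"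
    have *: "prefix_word x (length u) = u" "prefix_word x (length v) = v" using x by (auto simp: cylinder_def)
    from ex1[of x] obtain k where k: "\<And>j. prefix_word x j \<in> S \<Longrightarrow> j = k" by (rule ex1E) blast
    have "length u = length v" using k[of "length u"] k[of "length v"] * uv(1,2) by simp
    then show False using uv(3) * by simp
  qed
  show "(\<Union>u\<in>S. cylinder u) = UNIV"
  proof (intro equalityI subsetI)
    fix x :: "nat \<Rightarrow> 'a"
    obtain k where "prefix_word x k \<in> S" using ex1[of x] by blast
    moreover have "x \<in> cylinder (prefix_word x k)" by (simp add: cylinder_def)
    ultimately show "x \<in> (\<Union>u\<in>S. cylinder u)" by blast
  qed simp
qed

lemma is_cut_Nil: "is_cut {[]}"
proof -
  have "prefix_word x k \<in> {[]} \<longleftrightarrow> k = 0" for x :: "nat \<Rightarrow> 'a" and k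
    by (simp add: prefix_word_def)
  then show ?thesis by (simp add: is_cut_def)
qed

text \<open>Words of a cut have an m-th singular value somewhat below r. This moves the radius from
  r to that value, where \<open>sv_max_prod\<close> equals psi^s up to a power.\<close>

lemma sv_max_prod_scale:
  fixes A :: "real^'d^'d" and a r :: real
  assumes "0 < a" "a \<le> r"
  shows "sv_max_prod A r \<le> sv_max_prod A a * (r / a) ^ CARD('d)"
proof -
  have ra: "1 \<le> r / a" using assms by simp
  have le: "max (sing_val A i) r \<le> max (sing_val A i) a * (r / a)" for i
  proof (rule max.boundedI)
    have "sing_val A i \<le> max (sing_val A i) a * 1" by simp
    also have "\<dots> \<le> max (sing_val A i) a * (r / a)"
      using ra assms by (intro mult_left_mono) (simp_all add: le_max_iff_disj)
    finally show "sing_val A i \<le> max (sing_val A i) a * (r / a)" .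
    have "r = a * (r / a)" using assms by simp
    also have "\<dots> \<le> max (sing_val A i) a * (r / a)" using ra by (intro mult_right_mono) simp_all
    finally show "r \<le> max (sing_val A i) a * (r / a)" .
  qed
  have "0 \<le> max (sing_val A i) r" for i using assms by (simp add: le_max_iff_disj)
  with le have "sv_max_prod A r \<le> (\<Prod>i=1..CARD('d). max (sing_val A i) a * (r / a))"
    unfolding sv_max_prod_def by (intro prod_mono) simp
  then show ?thesis unfolding sv_max_prod_def prod.distrib by simp
qed

context affine_system
begin

lemma bounded_image_code_point:
  fixes a :: "(real^'d)^'t::finite"
  shows "bounded_image (bernoulli_measure p) (\<lambda>x. code_point \<omega> x a) (norm a / (1 - c))"
proof -
  interpret prob_space "bernoulli_measure p" by (rule prob_space_bernoulli)
  show ?thesis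
    by standard (auto intro!: norm_tail_point_le Finite_Cartesian_Product.norm_nth_le)
qed

lemma affine_measure_eq:
  fixes a :: "(real^'d)^'t::finite"
  assumes "admissible_seed T (\<lambda>u. a $ \<omega> u) J"
  shows "affine_measure T p (\<lambda>u. a $ \<omega> u) J = distr (bernoulli_measure p) borel (\<lambda>x. code_point \<omega> x a)"
  unfolding affine_measure_def coding_map_eq[OF assms, abs_def] ..

lemma code_point_in_cylinder:
  assumes J: "admissible_seed T (\<lambda>u. a $ \<omega> u) J" and x: "x \<in> cylinder u"
  obtains y where "y \<in> J" "code_point \<omega> x a = word_map T (\<lambda>u. a $ \<omega> u) u 0 + word_matrix T u *v y"
proof -
  have "code_point \<omega> x a \<in> (\<Inter>k. word_set T (\<lambda>u. a $ \<omega> u) J (prefix_word x k))"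
    unfolding coding_map_eq[OF J, symmetric] coding_map_def by (rule theI'[OF coding_map_unique[OF J]])
  then have "code_point \<omega> x a \<in> word_set T (\<lambda>u. a $ \<omega> u) J (prefix_word x (length u))" by blast
  then have "code_point \<omega> x a \<in> word_map T (\<lambda>u. a $ \<omega> u) u ` J"
    using x by (simp add: cylinder_def word_set_def)
  then obtain y where y: "y \<in> J" "code_point \<omega> x a = word_map T (\<lambda>u. a $ \<omega> u) u y" by (rule imageE)
  from y(2) have "code_point \<omega> x a = word_map T (\<lambda>u. a $ \<omega> u) u 0 + word_matrix T u *v y"
    by (subst (asm) word_map_affine)
  with y(1) show thesis by (rule that)
qed

text \<open>Two cuts are used: the trivial one for the bound by the dimension of the space, and
  \<open>cut_set T s r\<close> for s slightly above the critical root. The result holds for every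
  parameter, not only almost every one.\<close>

lemma upper_dimension_bound:
  fixes a :: "(real^'d)^'t::finite"
  assumes J: "admissible_seed T (\<lambda>u. a $ \<omega> u) J" and q: "1 \<le> q"
  shows "upper_gen_dim q (affine_measure T p (\<lambda>u. a $ \<omega> u) J) \<le> min (ereal (crit_root q)) (ereal CARD('d))"
proof -
  interpret bounded_image "bernoulli_measure p" "\<lambda>x. code_point \<omega> x a" "norm a / (1 - c)"
    by (rule bounded_image_code_point)
  obtain R0 where R0: "\<And>y. y \<in> J \<Longrightarrow> norm y \<le> R0"
  proof -
    have "bounded J" using J by (simp add: admissible_seed_def compact_imp_bounded)
    then show thesis using that unfolding bounded_iff by (elim exE) blast
  qed
  define R where "R = max 0 R0"
  have R: "0 \<le> R" "\<And>y. y \<in> J \<Longrightarrow> norm y \<le> R" using R0 by (auto simp: R_def le_max_iff_disj)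
  define C0 where "C0 = (2 * (R + CARD('d))) ^ CARD('d)"
  have C0: "0 < C0" using R(1) by (simp add: C0_def add_nonneg_pos)
  have count: "card {Q \<in> cells r. (\<lambda>x. code_point \<omega> x a) ` cylinder u \<inter> Q \<noteq> {}}
      \<le> C0 * (sv_max_prod (word_matrix T u) r / r ^ CARD('d))" if r: "0 < r" for r u
  proof -
    let ?z = "word_map T (\<lambda>u. a $ \<omega> u) u 0"
    let ?Q = "{Q \<in> mesh_cubes r. \<exists>y. norm y \<le> R \<and> ?z + word_matrix T u *v y \<in> Q}"
    note * = mesh_count_ellipsoid[OF invertible_word_matrix[of u] r R(1), of ?z]
    have "{Q \<in> cells r. (\<lambda>x. code_point \<omega> x a) ` cylinder u \<inter> Q \<noteq> {}} \<subseteq> ?Q"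
    proof
      fix Q assume "Q \<in> {Q \<in> cells r. (\<lambda>x. code_point \<omega> x a) ` cylinder u \<inter> Q \<noteq> {}}"
      then obtain x where x: "Q \<in> cells r" "x \<in> cylinder u" "code_point \<omega> x a \<in> Q" by blast
      obtain y where "y \<in> J" "code_point \<omega> x a = ?z + word_matrix T u *v y"
        using code_point_in_cylinder[OF J x(2)] by blast
      then show "Q \<in> ?Q" using x R(2) cells_mesh by auto
    qed
    then have "card {Q \<in> cells r. (\<lambda>x. code_point \<omega> x a) ` cylinder u \<inter> Q \<noteq> {}} \<le> card ?Q"
      by (intro card_mono *(1))
    then show ?thesis using *(2) unfolding C0_def by linarith
  qed
  \<comment> \<open>Common to both cuts: if a cylinder u of the cut meets at most \<kappa>
    psi^s(T_u) cubes and the cut sum is bounded below, the mesh sum is controlled by \<kappa>. The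
    exponent s is 0 for the trivial cut.\<close>
  have entropy_ge: "- ln \<kappa> - q * ln 2 / (q - 1) \<le> entropy_sum q r"
    if r: "0 < r" and S: "is_cut S" and s: "0 \<le> s" and \<kappa>: "0 < \<kappa>"
      and N: "\<And>u. u \<in> S \<Longrightarrow> C0 * (sv_max_prod (word_matrix T u) r / r ^ CARD('d)) \<le> \<kappa> * sv_fun s (word_matrix T u)"
      and F: "(if q = 1 then 0 else 1) \<le> (\<Sum>u\<in>S. term_sum q s u)" for r s \<kappa> S
  proof -
    let ?N = "\<lambda>u. \<kappa> * sv_fun s (word_matrix T u)"
    have N0: "0 < ?N u" for u using \<kappa> phi_pos[OF s, of u] by simp
    have card: "card {Q \<in> cells r. (\<lambda>x. code_point \<omega> x a) ` cylinder u \<inter> Q \<noteq> {}} \<le> ?N u" if "u \<in> S" for u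
      using count[OF r] N[OF that] by (rule order_trans)
    have fin: "finite S" using S by (simp add: is_cut_def)
    note facts = r fin sets_cylinder is_cut_cylinders(1)[OF S] is_cut_cylinders(2)[OF S, folded space_bernoulli[of p]] N0 card
    show ?thesis
    proof (cases "q = 1")
      case True
      have "(\<Sum>u\<in>S. prob (cylinder u) * ln (prob (cylinder u) / ?N u))
          = (\<Sum>u\<in>S. term_sum 1 s u + word_prob p u * (- ln \<kappa>))"
      proof (rule sum.cong)
        fix u
        show "prob (cylinder u) * ln (prob (cylinder u) / ?N u) = term_sum 1 s u + word_prob p u * (- ln \<kappa>)"
        proof (cases "word_prob p u = 0")
          case False
          then have w: "0 < word_prob p u" using word_prob_pos_iff by blast
          have "ln (word_prob p u / ?N u) = X s u - ln \<kappa>"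
            using w \<kappa> phi_pos[OF s, of u] by (simp add: X_eq[OF s w] ln_div ln_mult)
          then show ?thesis by (simp add: measure_cylinder term_sum_def right_diff_distrib)
        qed (simp add: measure_cylinder term_sum_def)
      qed simp
      also have "\<dots> = (\<Sum>u\<in>S. term_sum 1 s u) - ln \<kappa>"
        by (simp add: sum_subtractf sum_distrib_right[symmetric] cut_sum_word_prob[OF S])
      finally have "(\<Sum>u\<in>S. term_sum 1 s u) - ln \<kappa> \<le> (\<Sum>Q\<in>cells r. mass Q * ln (mass Q))"
        using ln_sum_ge[OF facts] by simp
      then show ?thesis using F True by (simp add: entropy_sum_def)
    next
      case False
      then have q1: "1 < q" using q by simp
      have "(\<Sum>u\<in>S. ?N u powr (1 - q) * prob (cylinder u) powr q) = \<kappa> powr (1 - q) * (\<Sum>u\<in>S. term_sum q s u)"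
        using \<kappa> phi_pos[OF s] False
        by (simp add: sum_distrib_left powr_mult measure_cylinder term_sum_def less_imp_le mult.assoc)
      then have "\<kappa> powr (1 - q) * (\<Sum>u\<in>S. term_sum q s u) / 2 powr q \<le> (\<Sum>Q\<in>cells r. mass Q powr q)"
        using powr_sum_ge[OF facts q1] by simp
      moreover have "\<kappa> powr (1 - q) * 1 / 2 powr q \<le> \<kappa> powr (1 - q) * (\<Sum>u\<in>S. term_sum q s u) / 2 powr q"
        using F False by (intro divide_right_mono mult_left_mono) auto
      ultimately have "\<kappa> powr (1 - q) / 2 powr q \<le> (\<Sum>Q\<in>cells r. mass Q powr q)" by simp
      then have "ln (\<kappa> powr (1 - q) / 2 powr q) \<le> ln (\<Sum>Q\<in>cells r. mass Q powr q)"
        using \<kappa> by (intro ln_mono) auto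
      then have "((1 - q) * ln \<kappa> - q * ln 2) / (q - 1) \<le> entropy_sum q r"
        using \<kappa> q1 by (auto simp: entropy_sum_def ln_div ln_powr intro!: divide_right_mono)
      moreover have "((1 - q) * ln \<kappa> - q * ln 2) / (q - 1) = - ln \<kappa> - q * ln 2 / (q - 1)"
      proof -
        have "((1 - q) * ln \<kappa>) / (q - 1) = - ln \<kappa>" using q1 by (simp add: field_simps)
        then show ?thesis by (simp add: diff_divide_distrib)
      qed
      ultimately show ?thesis by simp
    qed
  qed
  let ?\<nu> = "distr (bernoulli_measure p) borel (\<lambda>x. code_point \<omega> x a)"
  have "upper_gen_dim q ?\<nu> \<le> ereal CARD('d)"
  proof (rule upper_gen_dim_le[where C = "ln C0 + q * ln 2 / (q - 1)"])
    show "\<forall>\<^sub>F r in at_right 0. CARD('d) * ln r - (ln C0 + q * ln 2 / (q - 1)) \<le> entropy_sum q r"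
      using eventually_at_right_real[OF zero_less_one]
    proof eventually_elim
      case (elim r)
      then have r: "0 < r" "r < 1" by auto
      have "sv_max_prod (mat 1 :: real^'d^'d) r = 1"
        using r by (simp add: sv_max_prod_def sing_val_mat_1[where 'd = 'd, simplified] max_def)
      then have "- ln (C0 / r ^ CARD('d)) - q * ln 2 / (q - 1) \<le> entropy_sum q r"
        using r C0 by (intro entropy_ge[OF r(1) is_cut_Nil order_refl]) (auto simp: term_sum_def X_Nil)
      then show ?case using r C0 by (simp add: ln_div ln_realpow)
    qed
  qed
  moreover have "upper_gen_dim q ?\<nu> \<le> ereal (crit_root q)" if less: "crit_root q < CARD('d)"
  proof (rule dense_ge)
    fix y assume "ereal (crit_root q) < y"
    then obtain s where s: "crit_root q < s" "ereal s < y" "s \<le> CARD('d)"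
    proof -
      have "ereal (crit_root q) < min y (ereal CARD('d))" using less \<open>ereal (crit_root q) < y\<close> by simp
      then obtain s where "ereal (crit_root q) < ereal s" "ereal s < min y (ereal CARD('d))"
        using ereal_dense2 by blast
      then show thesis using that[of s] by auto
    qed
    have s0: "0 < s" using s crit_root(1)[of q] by linarith
    have \<gamma>: "0 < \<gamma> q s" using s s0 by (simp add: gamma_pos_iff)
    \<comment> \<open>Above the root the cut sums diverge, so they eventually exceed the bound that
      \<open>entropy_ge\<close> asks for.\<close>
    have "\<forall>\<^sub>F r in at_right 0. 1 \<le> F_sum T p q s r"
      using F_sum_at_top[OF s0, of q] q \<gamma> unfolding filterlim_at_top by blast
    with eventually_is_cut[OF s0] eventually_at_right_real[OF zero_less_one]
    have "\<forall>\<^sub>F r in at_right 0. s * ln r - (ln C0 - s * ln b + q * ln 2 / (q - 1)) \<le> entropy_sum q r"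
    proof eventually_elim
      case (elim r)
      then have r: "0 < r" "r < 1" by auto
      have "- ln (C0 * (b * r) powr (- s)) - q * ln 2 / (q - 1) \<le> entropy_sum q r"
      proof (rule entropy_ge[OF r(1) elim(1) less_imp_le[OF s0]])
        show "0 < C0 * (b * r) powr (- s)" using C0 r bT by simp
        show "(if q = 1 then 0 else 1) \<le> (\<Sum>u\<in>cut_set T s r. term_sum q s u)"
          using elim(3) by (auto simp: F_sum_eq)
        fix u assume u: "u \<in> cut_set T s r"
        define m where "m = nat \<lceil>s\<rceil>"
        have m: "cut_index s = m" using s(3) by (simp add: cut_index_def m_def)
        \<comment> \<open>The m-th singular value at u. It is at most r, and at least b r because
          the parent of u is still above r; this fixes \<kappa> as a multiple of (b r)^(-s).\<close>
        define h where "h = \<alpha> s u"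
        have h: "0 < h" "h \<le> r" using u alpha_pos[OF s0] by (auto simp: cut_set_eq h_def)
        have "u = butlast u @ [last u]" using u by (simp add: cut_set_eq)
        then have "\<alpha> s (butlast u) * b \<le> h" unfolding h_def using alpha_snoc_ge[OF s0] by metis
        moreover have "r * b \<le> \<alpha> s (butlast u) * b" using u bT by (intro mult_right_mono) (auto simp: cut_set_eq)
        ultimately have bh: "b * r \<le> h" by (simp add: mult.commute)
        let ?A = "word_matrix T u"
        have hm: "h = sing_val ?A m" by (simp add: h_def \<alpha>_def m)
        have "sv_max_prod ?A r / r ^ CARD('d) \<le> sv_max_prod ?A h * (r / h) ^ CARD('d) / r ^ CARD('d)"
          using h r by (intro divide_right_mono sv_max_prod_scale) auto
        also have "\<dots> = sv_max_prod ?A h / h ^ CARD('d)" using r by (simp add: power_divide)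
        also have "sv_max_prod ?A h = sv_fun s ?A * h powr (real CARD('d) - s)"
          unfolding hm by (rule sv_max_prod_at_sing_val[OF invertible_word_matrix s0 s(3) m_def])
        also have "\<dots> / h ^ CARD('d) = sv_fun s ?A * h powr (- s)"
          using h(1) by (simp add: powr_diff powr_realpow powr_minus divide_inverse)
        also have "h powr (- s) \<le> (b * r) powr (- s)"
          using bh bT r s0 by (intro powr_mono2') auto
        finally have "sv_max_prod ?A r / r ^ CARD('d) \<le> sv_fun s ?A * (b * r) powr (- s)"
          using phi_pos[OF less_imp_le[OF s0], of u] by (simp add: mult_left_mono)
        from mult_left_mono[OF this less_imp_le[OF C0]]
        show "C0 * (sv_max_prod ?A r / r ^ CARD('d)) \<le> C0 * (b * r) powr (- s) * sv_fun s ?A"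
          by (simp only: mult_ac)
      qed
      then show ?case using C0 bT r by (simp add: ln_mult ln_powr algebra_simps)
    qed
    then have "upper_gen_dim q ?\<nu> \<le> ereal s" by (rule upper_gen_dim_le)
    then show "upper_gen_dim q ?\<nu> \<le> y" using s(2) by (meson less_imp_le order_trans)
  qed
  ultimately show ?thesis
    unfolding affine_measure_eq[OF J] by (cases "crit_root q < CARD('d)") (auto simp: min_def)
qed

end

section \<open>The lower bound\<close>

lemma powr_add_le:
  fixes x y t :: real
  assumes "0 \<le> x" "0 \<le> y" "0 < t" "t \<le> 1"
  shows "(x + y) powr t \<le> x powr t + y powr t"
proof (cases "x + y = 0")
  case False
  then have s: "0 < x + y" using assms by simp
  have "z / (x + y) \<le> (z / (x + y)) powr t" if "0 \<le> z" "z \<le> x + y" for z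
    using powr_mono'[of t 1 "z / (x + y)"] that s assms by simp
  from this[of x] this[of y] have "x / (x + y) + y / (x + y) \<le> (x / (x + y)) powr t + (y / (x + y)) powr t"
    using assms by simp
  moreover have "x / (x + y) + y / (x + y) = 1" using s by (simp add: add_divide_distrib[symmetric])
  moreover have "(x / (x + y)) powr t + (y / (x + y)) powr t = (x powr t + y powr t) / (x + y) powr t"
    using assms s by (simp add: powr_divide add_divide_distrib)
  ultimately have "1 \<le> (x powr t + y powr t) / (x + y) powr t" by simp
  then show ?thesis using s by (simp add: le_divide_eq)
qed (use assms in simp)

lemma powr_sum_le:
  fixes f :: "'b \<Rightarrow> real"
  assumes "finite I" "\<And>i. i \<in> I \<Longrightarrow> 0 \<le> f i" "0 < t" "t \<le> 1"
  shows "(\<Sum>i\<in>I. f i) powr t \<le> (\<Sum>i\<in>I. f i powr t)"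
  using assms
proof (induction I rule: finite_induct)
  case (insert i I)
  have "(\<Sum>i\<in>insert i I. f i) powr t \<le> f i powr t + (\<Sum>i\<in>I. f i) powr t"
    using insert by (simp, intro powr_add_le) (auto intro: sum_nonneg)
  then show ?case using insert by simp
qed simp

text \<open>A linear majorant of the concave power at the scale y. It lets an estimate of an
  integral be passed inside the power without Jensen's inequality.\<close>

lemma powr_le_tangent:
  fixes z y t :: real
  assumes "0 < y" "0 \<le> z" "0 < t" "t \<le> 1"
  shows "z powr t \<le> y powr t + y powr (t - 1) * z"
proof (cases "z \<le> y")
  case True
  then have "z powr t \<le> y powr t" using assms by (intro powr_mono2) auto
  then show ?thesis using assms by (simp add: add_increasing2)
next
  case False
  then have "z powr t = z powr (t - 1) * z" using assms by (simp add: powr_mult_base mult.commute)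
  also have "\<dots> \<le> y powr (t - 1) * z" using False assms by (intro mult_right_mono powr_mono2') auto
  finally show ?thesis by (simp add: add_increasing)
qed

lemma nn_integral_prefix_word:
  fixes g :: "'n::finite list \<Rightarrow> real"
  assumes "\<And>w. 0 \<le> g w"
  shows "(\<integral>\<^sup>+x. ennreal (g (prefix_word x k)) \<partial>bernoulli_measure p) = ennreal (\<Sum>w\<in>words k. word_prob p w * g w)"
proof -
  interpret prob_space "bernoulli_measure p" by (rule prob_space_bernoulli)
  have "ennreal (g (prefix_word x k)) = (\<Sum>w\<in>words k. ennreal (g w) * indicator (cylinder w) x)" for x
  proof -
    have "(\<Sum>w\<in>words k. ennreal (g w) * indicator (cylinder w) x) = (\<Sum>w\<in>words k. if w = prefix_word x k then ennreal (g w) else 0)"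
      by (intro sum.cong) (auto simp: cylinder_def indicator_def)
    then show ?thesis by (simp add: finite_words)
  qed
  then have "(\<integral>\<^sup>+x. ennreal (g (prefix_word x k)) \<partial>bernoulli_measure p)
      = (\<Sum>w\<in>words k. \<integral>\<^sup>+x. ennreal (g w) * indicator (cylinder w) x \<partial>bernoulli_measure p)"
    by (simp add: nn_integral_sum)
  also have "\<dots> = (\<Sum>w\<in>words k. ennreal (word_prob p w * g w))"
    by (simp add: nn_integral_cmult_indicator emeasure_cylinder ennreal_mult assms mult.commute)
  also have "\<dots> = ennreal (\<Sum>w\<in>words k. word_prob p w * g w)"
    by (rule sum_ennreal) (simp add: assms)
  finally show ?thesis .
qed

lemma prob_prefix_in:
  fixes A :: "'n::finite list set"
  assumes "A \<subseteq> words N"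
  shows "{x. prefix_word x N \<in> A} \<in> sets (bernoulli_measure p)"
    and "measure (bernoulli_measure p) {x. prefix_word x N \<in> A} = (\<Sum>w\<in>A. word_prob p w)"
proof -
  interpret prob_space "bernoulli_measure p" by (rule prob_space_bernoulli)
  have "(\<lambda>x. prefix_word x N) -` A \<inter> space (bernoulli_measure p) \<in> sets (bernoulli_measure p)"
    by (rule measurable_sets[OF measurable_prefix_word]) simp
  moreover have "(\<lambda>x. prefix_word x N) -` A \<inter> space (bernoulli_measure p) = {x. prefix_word x N \<in> A}" by auto
  ultimately show S: "{x. prefix_word x N \<in> A} \<in> sets (bernoulli_measure p)" by simp
  have "(\<lambda>x. indicator A (prefix_word x N)) = (indicator {x. prefix_word x N \<in> A} :: _ \<Rightarrow> real)"
    by (auto simp: indicator_def)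
  then have "measure (bernoulli_measure p) {x. prefix_word x N \<in> A} = (\<integral>x. indicator A (prefix_word x N) \<partial>bernoulli_measure p)"
    by simp
  also have "\<dots> = (\<Sum>w\<in>words N. word_prob p w * indicator A w)" by (rule integral_prefix_word)
  also have "\<dots> = (\<Sum>w\<in>words N. if w \<in> A then word_prob p w else 0)" by (intro sum.cong) auto
  also have "\<dots> = (\<Sum>w\<in>words N \<inter> A. word_prob p w)" by (rule sum.inter_restrict[symmetric]) (rule finite_words)
  also have "words N \<inter> A = A" using assms by auto
  finally show "measure (bernoulli_measure p) {x. prefix_word x N \<in> A} = (\<Sum>w\<in>A. word_prob p w)" .
qed

text \<open>Divided by \<theta>'^n, the functions have summable integrals from some index on. Their
  sum is finite almost everywhere, so the terms tend to 0 and are eventually below 1.\<close>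

lemma geometric_borel_cantelli:
  fixes A :: "nat \<Rightarrow> 'a \<Rightarrow> ennreal" and C \<theta> \<theta>' :: real
  assumes A [measurable]: "\<And>n. A n \<in> borel_measurable M"
    and le: "\<forall>\<^sub>F n in sequentially. (\<integral>\<^sup>+a. A n a \<partial>M) \<le> ennreal (C * \<theta> ^ n)"
    and \<theta>: "0 < \<theta>" "\<theta> < \<theta>'" and C: "0 \<le> C"
  shows "AE a in M. \<forall>\<^sub>F n in sequentially. A n a \<le> ennreal (\<theta>' ^ n)"
proof -
  obtain n0 where n0: "\<And>n. n0 \<le> n \<Longrightarrow> (\<integral>\<^sup>+a. A n a \<partial>M) \<le> ennreal (C * \<theta> ^ n)"
    using le by (auto simp: eventually_sequentially)
  define g where "g n a = ennreal (1 / \<theta>' ^ n) * A n a" for n a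
  have [measurable]: "g n \<in> borel_measurable M" for n unfolding g_def by measurable
  have "(\<integral>\<^sup>+a. (\<Sum>n. g (n + n0) a) \<partial>M) = (\<Sum>n. \<integral>\<^sup>+a. g (n + n0) a \<partial>M)"
    by (rule nn_integral_suminf) measurable
  also have "\<dots> \<le> (\<Sum>n. ennreal (C * (\<theta> / \<theta>') ^ (n + n0)))"
  proof (intro suminf_le summableI)
    fix n
    have "(\<integral>\<^sup>+a. g (n + n0) a \<partial>M) = ennreal (1 / \<theta>' ^ (n + n0)) * (\<integral>\<^sup>+a. A (n + n0) a \<partial>M)"
      unfolding g_def by (rule nn_integral_cmult) measurable
    also have "\<dots> \<le> ennreal (1 / \<theta>' ^ (n + n0)) * ennreal (C * \<theta> ^ (n + n0))"
      by (intro mult_left_mono n0) auto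
    also have "\<dots> = ennreal (C * (\<theta> / \<theta>') ^ (n + n0))"
      using \<theta> C by (subst ennreal_mult[symmetric]) (auto simp: power_divide)
    finally show "(\<integral>\<^sup>+a. g (n + n0) a \<partial>M) \<le> ennreal (C * (\<theta> / \<theta>') ^ (n + n0))" .
  qed
  also have "\<dots> < \<infinity>"
  proof -
    have "summable (\<lambda>n. C * (\<theta> / \<theta>') ^ (n + n0))"
      using \<theta> by (intro summable_mult summable_ignore_initial_segment summable_geometric) auto
    then show ?thesis using \<theta> C by (subst suminf_ennreal2) auto
  qed
  finally have "AE a in M. (\<Sum>n. g (n + n0) a) \<noteq> \<infinity>" by (intro nn_integral_PInf_AE) auto
  then show ?thesis
  proof eventually_elim
    case (elim a)
    have fin: "g (n + n0) a < top" for n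
    proof -
      have "g (n + n0) a \<le> (\<Sum>n. g (n + n0) a)"
        using sum_le_suminf[of "\<lambda>n. g (n + n0) a" "{n}"] by simp
      then show ?thesis using elim by (simp add: le_less_trans less_top)
    qed
    define h where "h n = enn2real (g (n + n0) a)" for n
    have h: "ennreal (h n) = g (n + n0) a" for n using fin[of n] by (simp add: h_def)
    have "summable h"
    proof (rule summable_suminf_not_top)
      show "0 \<le> h n" for n by (simp add: h_def)
      show "(\<Sum>n. ennreal (h n)) \<noteq> top" unfolding h using elim by simp
    qed
    then have "h \<longlonglongrightarrow> 0" by (rule summable_LIMSEQ_zero)
    then have "\<forall>\<^sub>F n in sequentially. h n < 1" by (rule order_tendstoD) simp
    then have "\<forall>\<^sub>F n in sequentially. A (n + n0) a \<le> ennreal (\<theta>' ^ (n + n0))"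
    proof eventually_elim
      case (elim n)
      let ?k = "n + n0"
      have "ennreal (\<theta>' ^ ?k) * ennreal (1 / \<theta>' ^ ?k) = 1"
        using \<theta> by (subst ennreal_mult[symmetric]) auto
      then have "A ?k a = ennreal (\<theta>' ^ ?k) * g ?k a" by (simp add: g_def mult.assoc[symmetric])
      also have "g ?k a \<le> 1" using elim h[of n] by (metis ennreal_1 ennreal_leI less_imp_le)
      then have "ennreal (\<theta>' ^ ?k) * g ?k a \<le> ennreal (\<theta>' ^ ?k) * 1" by (intro mult_left_mono) auto
      finally show ?case by simp
    qed
    then show ?case by (rule eventually_sequentially_seg[THEN iffD1])
  qed
qed

section \<open>Masses of balls averaged over the parameters\<close>

context affine_system
begin

definition near :: "('n list \<Rightarrow> 't::finite) \<Rightarrow> real \<Rightarrow> (nat \<Rightarrow> 'n) \<Rightarrow> (real^'d)^'t \<Rightarrow> real" where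
  "near \<omega> r x a = measure (bernoulli_measure p) {y. norm (code_point \<omega> x a - code_point \<omega> y a) \<le> r}"

text \<open>Only words that separate from x exactly after k letters: for these, transversality
  applies with the common prefix of length k.\<close>

definition branch :: "('n list \<Rightarrow> 't::finite) \<Rightarrow> real \<Rightarrow> (nat \<Rightarrow> 'n) \<Rightarrow> nat \<Rightarrow> (real^'d)^'t \<Rightarrow> real" where
  "branch \<omega> r x k a = measure (bernoulli_measure p)
     {y. prefix_word y k = prefix_word x k \<and> y k \<noteq> x k \<and> norm (code_point \<omega> x a - code_point \<omega> y a) \<le> r}"

lemma code_point_borel [measurable]: "(\<lambda>a :: (real^'d)^'t::finite. code_point \<omega> x a) \<in> borel_measurable borel"
  by (intro borel_measurable_continuous_onI linear_continuous_on
    linear_conv_bounded_linear[THEN iffD1] linear_tail_point)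

lemma near_measurable [measurable]:
  fixes \<omega> :: "'n list \<Rightarrow> 't::finite"
  shows "(\<lambda>(a, x). near \<omega> r x a) \<in> borel_measurable (borel \<Otimes>\<^sub>M bernoulli_measure p)"
proof -
  interpret prob_space "bernoulli_measure p" by (rule prob_space_bernoulli)
  let ?N = "borel \<Otimes>\<^sub>M bernoulli_measure p :: (((real^'d)^'t) \<times> (nat \<Rightarrow> 'n)) measure"
  let ?H = "{z \<in> space (?N \<Otimes>\<^sub>M bernoulli_measure p).
      norm (code_point \<omega> (snd (fst z)) (fst (fst z)) - code_point \<omega> (snd z) (fst (fst z))) \<le> r}"
  have 1: "(\<lambda>z. code_point \<omega> (snd (fst z)) (fst (fst z))) \<in> borel_measurable (?N \<Otimes>\<^sub>M bernoulli_measure p)"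
    using measurable_compose[OF measurable_fst code_point_measurable_pair[of \<omega>]] by (simp add: case_prod_beta)
  have "(\<lambda>z. (fst (fst z), snd z)) \<in> ?N \<Otimes>\<^sub>M bernoulli_measure p \<rightarrow>\<^sub>M ?N" by measurable
  from measurable_compose[OF this code_point_measurable_pair[of \<omega>]]
  have 2: "(\<lambda>z. code_point \<omega> (snd z) (fst (fst z))) \<in> borel_measurable (?N \<Otimes>\<^sub>M bernoulli_measure p)"
    by simp
  have "?H \<in> sets (?N \<Otimes>\<^sub>M bernoulli_measure p)" using 1 2 by measurable
  then have "(\<lambda>z. emeasure (bernoulli_measure p) (Pair z -` ?H)) \<in> borel_measurable ?N"
    by (rule measurable_emeasure_Pair)
  then have "(\<lambda>z. enn2real (emeasure (bernoulli_measure p) (Pair z -` ?H))) \<in> borel_measurable ?N" by measurable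
  moreover have "Pair z -` ?H = {y. norm (code_point \<omega> (snd z) (fst z) - code_point \<omega> y (fst z)) \<le> r}" for z
    by (auto simp: space_pair_measure)
  ultimately show ?thesis by (simp add: near_def measure_def case_prod_beta)
qed

lemma near_measurable_fst [measurable]:
  fixes \<omega> :: "'n list \<Rightarrow> 't::finite"
  shows "(\<lambda>a. near \<omega> r x a) \<in> borel_measurable borel"
  using measurable_compose[OF measurable_Pair2'[of x "bernoulli_measure p" borel] near_measurable[of \<omega> r]]
  by simp

lemma branch_set_measurable:
  fixes \<omega> :: "'n list \<Rightarrow> 't::finite"
  shows "{z \<in> space (borel \<Otimes>\<^sub>M bernoulli_measure p). prefix_word (snd z) k = prefix_word x k \<and> snd z k \<noteq> x k \<and>
    norm (code_point \<omega> x (fst z) - code_point \<omega> (snd z) (fst z)) \<le> r} \<in> sets (borel \<Otimes>\<^sub>M bernoulli_measure p)"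
proof -
  let ?N = "borel \<Otimes>\<^sub>M bernoulli_measure p :: (((real^'d)^'t) \<times> (nat \<Rightarrow> 'n)) measure"
  have [measurable]: "(\<lambda>z. code_point \<omega> (snd z) (fst z)) \<in> borel_measurable ?N"
    using code_point_measurable_pair[of \<omega>] by (simp add: case_prod_beta)
  have [measurable]: "(\<lambda>z. code_point \<omega> x (fst z)) \<in> borel_measurable ?N"
    by (rule measurable_compose[OF measurable_fst code_point_borel])
  have [measurable]: "(\<lambda>z. prefix_word (snd z) k) \<in> ?N \<rightarrow>\<^sub>M count_space UNIV"
    by (rule measurable_compose[OF measurable_snd measurable_prefix_word])
  have [measurable]: "(\<lambda>z. snd z k) \<in> ?N \<rightarrow>\<^sub>M count_space UNIV"
    by (rule measurable_compose[OF measurable_snd measurable_coordinate])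
  show ?thesis by measurable
qed

lemma branch_measurable [measurable]:
  fixes \<omega> :: "'n list \<Rightarrow> 't::finite"
  shows "(\<lambda>a. branch \<omega> r x k a) \<in> borel_measurable borel"
proof -
  interpret prob_space "bernoulli_measure p" by (rule prob_space_bernoulli)
  have "(\<lambda>a. enn2real (emeasure (bernoulli_measure p) (Pair a -` {z \<in> space (borel \<Otimes>\<^sub>M bernoulli_measure p).
      prefix_word (snd z) k = prefix_word x k \<and> snd z k \<noteq> x k \<and>
      norm (code_point \<omega> x (fst z) - code_point \<omega> (snd z) (fst z)) \<le> r}))) \<in> borel_measurable borel"
    using measurable_emeasure_Pair[OF branch_set_measurable[of k x \<omega> r]] by measurable
  then show ?thesis by (simp add: branch_def measure_def space_pair_measure vimage_def)
qed

lemma near_sets: "{y. norm (code_point \<omega> x a - code_point \<omega> y a) \<le> r} \<in> sets (bernoulli_measure p)"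
  for \<omega> :: "'n list \<Rightarrow> 't::finite"
proof -
  have "{y \<in> space (bernoulli_measure p). norm (code_point \<omega> x a - code_point \<omega> y a) \<le> r} \<in> sets (bernoulli_measure p)"
    by measurable
  then show ?thesis by simp
qed

lemma branch_sets: "{y. prefix_word y k = prefix_word x k \<and> y k \<noteq> x k \<and> norm (code_point \<omega> x a - code_point \<omega> y a) \<le> r}
    \<in> sets (bernoulli_measure p)"
  for \<omega> :: "'n list \<Rightarrow> 't::finite"
proof -
  have "{y \<in> space (bernoulli_measure p). prefix_word y k = prefix_word x k \<and> y k \<noteq> x k \<and>
      norm (code_point \<omega> x a - code_point \<omega> y a) \<le> r} \<in> sets (bernoulli_measure p)"
    by measurable
  then show ?thesis by simp
qed

text \<open>Sort the nearby words by the first letter in which they differ from x; those agreeing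
  with x in K letters make up a cylinder.\<close>

lemma near_le_branches:
  fixes \<omega> :: "'n list \<Rightarrow> 't::finite"
  shows "near \<omega> r x a \<le> (\<Sum>k<K. branch \<omega> r x k a) + word_prob p (prefix_word x K)"
proof -
  interpret prob_space "bernoulli_measure p" by (rule prob_space_bernoulli)
  let ?B = "\<lambda>k. {y. prefix_word y k = prefix_word x k \<and> y k \<noteq> x k \<and> norm (code_point \<omega> x a - code_point \<omega> y a) \<le> r}"
  have B: "?B k \<in> events" for k by (rule branch_sets)
  have U: "(\<Union>k<K. ?B k) \<in> events" by (intro sets.finite_UN B finite_lessThan)
  have sub: "{y. norm (code_point \<omega> x a - code_point \<omega> y a) \<le> r} \<subseteq> (\<Union>k<K. ?B k) \<union> cylinder (prefix_word x K)"
  proof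
    fix y assume y: "y \<in> {y. norm (code_point \<omega> x a - code_point \<omega> y a) \<le> r}"
    show "y \<in> (\<Union>k<K. ?B k) \<union> cylinder (prefix_word x K)"
    proof (cases "\<exists>k<K. y k \<noteq> x k")
      case True
      then obtain j where j: "j < K" "y j \<noteq> x j" by (elim exE conjE)
      define k where "k = (LEAST k. y k \<noteq> x k)"
      have k: "y k \<noteq> x k" unfolding k_def by (rule LeastI[of _ j]) (rule j(2))
      have "k \<le> j" unfolding k_def by (rule Least_le) (rule j(2))
      have "y i = x i" if "i < k" for i using not_less_Least[of i "\<lambda>k. y k \<noteq> x k"] that by (simp add: k_def)
      then have "prefix_word y k = prefix_word x k" by (simp add: prefix_word_def)
      with k y \<open>k \<le> j\<close> j(1) show ?thesis by (intro UnI1 UN_I[of k]) simp_all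
    next
      case False
      then have "prefix_word y K = prefix_word x K" by (simp add: prefix_word_def)
      then show ?thesis by (simp add: cylinder_def)
    qed
  qed
  have "near \<omega> r x a \<le> prob ((\<Union>k<K. ?B k) \<union> cylinder (prefix_word x K))"
    unfolding near_def by (rule finite_measure_mono[OF sub sets.Un[OF U sets_cylinder]])
  also have "\<dots> \<le> prob (\<Union>k<K. ?B k) + prob (cylinder (prefix_word x K))"
    by (rule measure_Un_le[OF U sets_cylinder])
  also have "prob (\<Union>k<K. ?B k) \<le> (\<Sum>k<K. prob (?B k))"
    by (rule finite_measure_subadditive_finite) (intro finite_lessThan image_subsetI B)+
  finally show ?thesis by (simp add: measure_cylinder branch_def)
qed

lemma branch_le: "branch \<omega> r x k a \<le> word_prob p (prefix_word x k)" for \<omega> :: "'n list \<Rightarrow> 't::finite"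
proof -
  interpret prob_space "bernoulli_measure p" by (rule prob_space_bernoulli)
  have "branch \<omega> r x k a \<le> prob (cylinder (prefix_word x k))"
    unfolding branch_def by (intro finite_measure_mono sets_cylinder) (auto simp: cylinder_def)
  then show ?thesis by (simp add: measure_cylinder)
qed

text \<open>Exchange the integrals, apply transversality for each fixed y and integrate the
  resulting constant over the cylinder of the common prefix.\<close>

lemma branch_integral_le:
  fixes \<omega> :: "'n list \<Rightarrow> 't::finite" and C \<rho> r s :: real
  assumes C: "0 \<le> C" and r: "0 < r" and s: "0 \<le> s"
    and trans: "\<And>y. prefix_word x k = prefix_word y k \<Longrightarrow> x k \<noteq> y k \<Longrightarrow>
      emeasure lborel {a \<in> cball 0 \<rho>. norm (code_point \<omega> x a - code_point \<omega> y a) \<le> r}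
      \<le> ennreal (C * (r powr s / sv_fun s (word_matrix T (prefix_word x k))))"
  shows "(\<integral>\<^sup>+a. indicator (cball 0 \<rho>) a * ennreal (branch \<omega> r x k a) \<partial>lborel)
    \<le> ennreal (C * (word_prob p (prefix_word x k) * (r powr s / sv_fun s (word_matrix T (prefix_word x k)))))"
proof -
  interpret prob_space "bernoulli_measure p" by (rule prob_space_bernoulli)
  interpret pair_sigma_finite "lborel :: ((real^'d)^'t) measure" "bernoulli_measure p" ..
  let ?B = "\<lambda>a. {y. prefix_word y k = prefix_word x k \<and> y k \<noteq> x k \<and> norm (code_point \<omega> x a - code_point \<omega> y a) \<le> r}"
  let ?z = "C * (r powr s / sv_fun s (word_matrix T (prefix_word x k)))"
  have z: "0 \<le> ?z" using C phi_pos[OF s, of "prefix_word x k"] by simp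
  have ball: "cball 0 \<rho> \<in> sets (borel :: ((real^'d)^'t) measure)" by (rule borel_closed) simp
  have "(\<lambda>q. indicator (cball 0 \<rho>) (fst q) * indicator (?B (fst q)) (snd q) :: ennreal)
      \<in> borel_measurable (borel \<Otimes>\<^sub>M bernoulli_measure p)"
  proof (rule borel_measurable_times_ennreal)
    show "(\<lambda>q. indicator (cball 0 \<rho> :: ((real^'d)^'t) set) (fst q) :: ennreal) \<in> borel_measurable (borel \<Otimes>\<^sub>M bernoulli_measure p)"
      by (rule measurable_compose[OF measurable_fst borel_measurable_indicator[OF ball]])
    have "(\<lambda>q. indicator (?B (fst q)) (snd q) :: ennreal) = indicator {z \<in> space (borel \<Otimes>\<^sub>M bernoulli_measure p).
        prefix_word (snd z) k = prefix_word x k \<and> snd z k \<noteq> x k \<and>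
        norm (code_point \<omega> x (fst z) - code_point \<omega> (snd z) (fst z)) \<le> r}"
      by (auto simp: indicator_def space_pair_measure)
    then show "(\<lambda>q. indicator (?B (fst q)) (snd q) :: ennreal) \<in> borel_measurable (borel \<Otimes>\<^sub>M bernoulli_measure p)"
      using borel_measurable_indicator[OF branch_set_measurable[of k x \<omega> r]] by simp
  qed
  then have meas: "(\<lambda>(a, y). indicator (cball 0 \<rho>) a * indicator (?B a) y :: ennreal)
      \<in> borel_measurable (lborel \<Otimes>\<^sub>M bernoulli_measure p)"
    by (simp add: case_prod_beta cong: measurable_cong_sets sets_pair_measure_cong)
  have "(\<integral>\<^sup>+a. indicator (cball 0 \<rho>) a * ennreal (branch \<omega> r x k a) \<partial>lborel)
      = (\<integral>\<^sup>+a. \<integral>\<^sup>+y. indicator (cball 0 \<rho>) a * indicator (?B a) y \<partial>bernoulli_measure p \<partial>lborel)"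
  proof (rule nn_integral_cong)
    fix a
    show "indicator (cball 0 \<rho>) a * ennreal (branch \<omega> r x k a)
        = (\<integral>\<^sup>+y. indicator (cball 0 \<rho>) a * indicator (?B a) y \<partial>bernoulli_measure p)"
      using branch_sets[of k x \<omega> a r]
      by (simp add: nn_integral_cmult_indicator branch_def emeasure_eq_measure)
  qed
  also have "\<dots> = (\<integral>\<^sup>+y. \<integral>\<^sup>+a. indicator (cball 0 \<rho>) a * indicator (?B a) y \<partial>lborel \<partial>bernoulli_measure p)"
    by (rule Fubini'[OF meas, symmetric])
  also have "\<dots> \<le> (\<integral>\<^sup>+y. ennreal ?z * indicator (cylinder (prefix_word x k)) y \<partial>bernoulli_measure p)"
  proof (rule nn_integral_mono)
    fix y
    show "(\<integral>\<^sup>+a. indicator (cball 0 \<rho>) a * indicator (?B a) y \<partial>lborel) \<le> ennreal ?z * indicator (cylinder (prefix_word x k)) y"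
    proof (cases "prefix_word y k = prefix_word x k \<and> y k \<noteq> x k")
      case True
      let ?S = "{a \<in> cball 0 \<rho>. norm (code_point \<omega> x a - code_point \<omega> y a) \<le> r}"
      have "?S \<in> sets lborel"
      proof -
        have "?S = cball 0 \<rho> \<inter> {a \<in> space borel. norm (code_point \<omega> x a - code_point \<omega> y a) \<le> r}" by auto
        also have "\<dots> \<in> sets borel" by (intro sets.Int ball) measurable
        finally show ?thesis by simp
      qed
      have "(\<integral>\<^sup>+a. indicator (cball 0 \<rho>) a * indicator (?B a) y \<partial>lborel) = (\<integral>\<^sup>+a. indicator ?S a \<partial>lborel)"
        using True by (intro nn_integral_cong) (auto simp: indicator_def)
      also have "\<dots> = emeasure lborel ?S" using \<open>?S \<in> sets lborel\<close> by (rule nn_integral_indicator)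
      also have "\<dots> \<le> ennreal ?z" using True by (intro trans) auto
      finally show ?thesis using True by (simp add: cylinder_def)
    next
      case False
      then have "(\<integral>\<^sup>+a. indicator (cball 0 \<rho>) a * indicator (?B a) y \<partial>lborel) = (\<integral>\<^sup>+a. 0 \<partial>(lborel :: ((real^'d)^'t) measure))"
        by (intro nn_integral_cong) (auto simp: indicator_def)
      then show ?thesis by simp
    qed
  qed
  also have "\<dots> = ennreal ?z * ennreal (word_prob p (prefix_word x k))"
    by (simp add: nn_integral_cmult_indicator emeasure_cylinder)
  also have "\<dots> = ennreal (?z * word_prob p (prefix_word x k))" by (rule ennreal_mult[symmetric]; use z in simp)
  finally show ?thesis by (simp add: mult_ac)
qed

text \<open>As t \<le> 1, the power of the sum over branches is at most the sum of powers. Each is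
  linearized at the size that transversality predicts for the mean of that branch, so the constant
  and the linear part are of the same order.\<close>

lemma near_powr_integral:
  fixes \<omega> :: "'n list \<Rightarrow> 't::finite" and s t \<rho> :: real
  assumes \<omega>: "distinct_siblings \<omega>" and s: "0 \<le> s" "s \<le> CARD('d)" and t: "0 < t" "t \<le> 1"
  shows "\<exists>C\<ge>0. \<forall>x r K. 0 < r \<longrightarrow> (\<integral>\<^sup>+a. indicator (cball 0 \<rho>) a * ennreal (near \<omega> r x a powr t) \<partial>lborel) \<le>
    ennreal (C * ((\<Sum>k<K. (word_prob p (prefix_word x k) * (r powr s / sv_fun s (word_matrix T (prefix_word x k)))) powr t)
      + word_prob p (prefix_word x K) powr t))"
proof -
  obtain C0 where C0: "0 \<le> C0" and trans: "\<And>x y k r. prefix_word x k = prefix_word y k \<Longrightarrow> x k \<noteq> y k \<Longrightarrow> 0 < r \<Longrightarrow>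
    emeasure lborel {a \<in> cball 0 \<rho>. norm (code_point \<omega> x a - code_point \<omega> y a) \<le> r}
      \<le> ennreal (C0 * (r powr s / sv_fun s (word_matrix T (prefix_word x k))))"
    using transversality[OF \<omega> s, of \<rho>] by blast
  let ?P = "cball 0 \<rho> :: ((real^'d)^'t) set"
  define V where "V = measure lborel ?P"
  have V: "emeasure lborel ?P = ennreal V" unfolding V_def
    by (rule emeasure_eq_ennreal_measure) (use emeasure_lborel_cball_finite in \<open>simp add: less_top\<close>)
  have P_sets[measurable]: "?P \<in> sets borel" by (rule borel_closed) simp
  have V0: "0 \<le> V" by (simp add: V_def)
  \<comment> \<open>V, the volume of the parameter ball, bounds the constant parts and the cylinder
    term; C0 comes from the linear parts.\<close>
  define C where "C = V + C0"
  have "(\<integral>\<^sup>+a. indicator ?P a * ennreal (near \<omega> r x a powr t) \<partial>lborel) \<le>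
    ennreal (C * ((\<Sum>k<K. (word_prob p (prefix_word x k) * (r powr s / sv_fun s (word_matrix T (prefix_word x k)))) powr t)
      + word_prob p (prefix_word x K) powr t))" if r: "0 < r" for x r K
  proof -
    define y where "y k = word_prob p (prefix_word x k) * (r powr s / sv_fun s (word_matrix T (prefix_word x k)))" for k
    have y0: "0 \<le> y k" for k using phi_pos[OF s(1), of "prefix_word x k"] by (simp add: y_def)
    have b0: "0 \<le> branch \<omega> r x k a" for k a by (simp add: branch_def)
    have piece: "(\<integral>\<^sup>+a. indicator ?P a * ennreal (branch \<omega> r x k a powr t) \<partial>lborel) \<le> ennreal (C * y k powr t)" for k
    proof (cases "y k = 0")
      case True
      then have "word_prob p (prefix_word x k) = 0"
        using r phi_pos[OF s(1), of "prefix_word x k"] by (simp add: y_def)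
      then have "branch \<omega> r x k a = 0" for a using branch_le[of \<omega> r x k a] b0[of k a] by simp
      then show ?thesis by simp
    next
      case False
      then have y: "0 < y k" using y0[of k] by simp
      have "indicator ?P a * ennreal (branch \<omega> r x k a powr t)
          \<le> ennreal (y k powr t) * indicator ?P a + ennreal (y k powr (t - 1)) * (indicator ?P a * ennreal (branch \<omega> r x k a))" for a
      proof (cases "a \<in> ?P")
        case True
        have "ennreal (branch \<omega> r x k a powr t) \<le> ennreal (y k powr t + y k powr (t - 1) * branch \<omega> r x k a)"
          by (intro ennreal_leI powr_le_tangent y b0 t)
        also have "\<dots> = ennreal (y k powr t) + ennreal (y k powr (t - 1)) * ennreal (branch \<omega> r x k a)"
          by (simp add: ennreal_mult b0)
        finally show ?thesis using True by simp
      qed simp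
      then have "(\<integral>\<^sup>+a. indicator ?P a * ennreal (branch \<omega> r x k a powr t) \<partial>lborel) \<le>
          (\<integral>\<^sup>+a. ennreal (y k powr t) * indicator ?P a + ennreal (y k powr (t - 1)) * (indicator ?P a * ennreal (branch \<omega> r x k a)) \<partial>lborel)"
        by (intro nn_integral_mono)
      also have "\<dots> = ennreal (y k powr t) * ennreal V
          + ennreal (y k powr (t - 1)) * (\<integral>\<^sup>+a. indicator ?P a * ennreal (branch \<omega> r x k a) \<partial>lborel)"
        by (subst nn_integral_add) (simp_all add: nn_integral_cmult nn_integral_cmult_indicator V)
      also have "\<dots> \<le> ennreal (y k powr t) * ennreal V + ennreal (y k powr (t - 1)) * ennreal (C0 * y k)"
        unfolding y_def by (intro add_left_mono mult_left_mono branch_integral_le[OF C0 r s(1)] trans r) auto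
      also have "\<dots> = ennreal (y k powr t * V + y k powr (t - 1) * (C0 * y k))"
        using V0 C0 y by (simp add: ennreal_mult ennreal_plus)
      also have "y k powr t * V + y k powr (t - 1) * (C0 * y k) = C * y k powr t"
        using y by (simp add: C_def powr_diff field_simps)
      finally show ?thesis .
    qed
    have "near \<omega> r x a powr t \<le> (\<Sum>k<K. branch \<omega> r x k a powr t) + word_prob p (prefix_word x K) powr t" for a
    proof -
      have "near \<omega> r x a powr t \<le> ((\<Sum>k<K. branch \<omega> r x k a) + word_prob p (prefix_word x K)) powr t"
        using t by (intro powr_mono2 near_le_branches) (auto simp: near_def)
      also have "\<dots> \<le> (\<Sum>k<K. branch \<omega> r x k a) powr t + word_prob p (prefix_word x K) powr t"
        using b0 t by (intro powr_add_le sum_nonneg) auto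
      also have "(\<Sum>k<K. branch \<omega> r x k a) powr t \<le> (\<Sum>k<K. branch \<omega> r x k a powr t)"
        using b0 t by (intro powr_sum_le) auto
      finally show ?thesis by simp
    qed
    then have "ennreal (near \<omega> r x a powr t) \<le> (\<Sum>k<K. ennreal (branch \<omega> r x k a powr t)) + ennreal (word_prob p (prefix_word x K) powr t)" for a
      by (simp add: sum_ennreal ennreal_plus[symmetric] sum_nonneg del: ennreal_plus)
    then have "(\<integral>\<^sup>+a. indicator ?P a * ennreal (near \<omega> r x a powr t) \<partial>lborel) \<le>
        (\<integral>\<^sup>+a. indicator ?P a * ((\<Sum>k<K. ennreal (branch \<omega> r x k a powr t)) + ennreal (word_prob p (prefix_word x K) powr t)) \<partial>lborel)"
      by (intro nn_integral_mono mult_left_mono) auto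
    also have "\<dots> = (\<integral>\<^sup>+a. (\<Sum>k<K. indicator ?P a * ennreal (branch \<omega> r x k a powr t))
        + ennreal (word_prob p (prefix_word x K) powr t) * indicator ?P a \<partial>lborel)"
      by (intro nn_integral_cong) (simp add: distrib_left sum_distrib_left mult.commute del: sum_ennreal)
    also have "\<dots> = (\<Sum>k<K. \<integral>\<^sup>+a. indicator ?P a * ennreal (branch \<omega> r x k a powr t) \<partial>lborel)
        + ennreal (word_prob p (prefix_word x K) powr t) * ennreal V"
    proof -
      have m: "(\<lambda>a. indicator ?P a * ennreal (branch \<omega> r x k a powr t)) \<in> borel_measurable lborel" for k
        by measurable
      have "(\<integral>\<^sup>+a. (\<Sum>k<K. indicator ?P a * ennreal (branch \<omega> r x k a powr t)) \<partial>lborel)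
          = (\<Sum>k<K. \<integral>\<^sup>+a. indicator ?P a * ennreal (branch \<omega> r x k a powr t) \<partial>lborel)"
        by (rule nn_integral_sum) (rule m)
      moreover have "(\<integral>\<^sup>+a. ennreal (word_prob p (prefix_word x K) powr t) * indicator ?P a \<partial>lborel)
          = ennreal (word_prob p (prefix_word x K) powr t) * ennreal V"
        by (simp add: nn_integral_cmult_indicator V)
      ultimately show ?thesis
        by (subst nn_integral_add) (auto intro!: borel_measurable_sum m)
    qed
    also have "\<dots> \<le> (\<Sum>k<K. ennreal (C * y k powr t)) + ennreal (word_prob p (prefix_word x K) powr t) * ennreal C"
      using C0 by (intro add_mono sum_mono piece mult_left_mono ennreal_leI) (auto simp: C_def)
    also have "\<dots> = ennreal (C * ((\<Sum>k<K. y k powr t) + word_prob p (prefix_word x K) powr t))"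
      using C0 V0 by (simp add: sum_ennreal ennreal_mult[symmetric] ennreal_plus[symmetric] sum_nonneg C_def
        sum_distrib_left distrib_left mult.commute del: ennreal_plus)
    finally show ?thesis by (simp add: y_def)
  qed
  moreover have "0 \<le> C" using C0 V0 by (simp add: C_def)
  ultimately show ?thesis by blast
qed

text \<open>By \<open>sum_part_mass_powr_le\<close> this integral controls the mesh sums. U is
  everything for q > 1 and a set of typical words for q = 1.\<close>

definition energy :: "('n list \<Rightarrow> 't::finite) \<Rightarrow> (nat \<Rightarrow> 'n) set \<Rightarrow> real \<Rightarrow> real \<Rightarrow> (real^'d)^'t \<Rightarrow> ennreal" where
  "energy \<omega> U t r a = (\<integral>\<^sup>+x. indicator U x * ennreal (near \<omega> r x a powr t) \<partial>bernoulli_measure p)"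

lemma energy_integrand_measurable:
  fixes \<omega> :: "'n list \<Rightarrow> 't::finite"
  assumes U: "U \<in> sets (bernoulli_measure p)"
  shows "(\<lambda>(a, x). indicator U x * ennreal (near \<omega> r x a powr t)) \<in> borel_measurable (borel \<Otimes>\<^sub>M bernoulli_measure p)"
proof -
  have [measurable]: "(\<lambda>z. near \<omega> r (snd z) (fst z)) \<in> borel_measurable (borel \<Otimes>\<^sub>M bernoulli_measure p)"
    using near_measurable[of \<omega> r] by (simp add: case_prod_beta)
  have [measurable]: "(\<lambda>z. indicator U (snd z) :: ennreal) \<in> borel_measurable (borel \<Otimes>\<^sub>M bernoulli_measure p)"
    by (rule measurable_compose[OF measurable_snd borel_measurable_indicator[OF U]])
  show ?thesis unfolding case_prod_beta by measurable
qed

lemma energy_measurable: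
  fixes \<omega> :: "'n list \<Rightarrow> 't::finite"
  assumes U: "U \<in> sets (bernoulli_measure p)"
  shows "energy \<omega> U t r \<in> borel_measurable borel"
proof -
  interpret prob_space "bernoulli_measure p" by (rule prob_space_bernoulli)
  show ?thesis
    unfolding energy_def[abs_def] using energy_integrand_measurable[OF U, of \<omega> r t]
    by (rule borel_measurable_nn_integral)
qed

lemma energy_mono:
  fixes \<omega> :: "'n list \<Rightarrow> 't::finite"
  assumes "r \<le> r'" "0 \<le> t"
  shows "energy \<omega> U t r a \<le> energy \<omega> U t r' a"
proof -
  interpret prob_space "bernoulli_measure p" by (rule prob_space_bernoulli)
  have "near \<omega> r x a \<le> near \<omega> r' x a" for x
    unfolding near_def using assms(1) near_sets by (intro finite_measure_mono) auto
  then show ?thesis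
    unfolding energy_def using assms(2)
    by (intro nn_integral_mono mult_left_mono ennreal_leI powr_mono2) (auto simp: near_def)
qed

lemma energy_integral_le:
  fixes \<omega> :: "'n list \<Rightarrow> 't::finite" and s t \<rho> :: real
  assumes \<omega>: "distinct_siblings \<omega>" and s: "0 \<le> s" "s \<le> CARD('d)" and t: "0 < t" "t \<le> 1"
  shows "\<exists>C\<ge>0. \<forall>r K U. 0 < r \<longrightarrow> U \<in> sets (bernoulli_measure p) \<longrightarrow>
    (\<integral>\<^sup>+a. indicator (cball 0 \<rho>) a * energy \<omega> U t r a \<partial>lborel) \<le>
    (\<integral>\<^sup>+x. indicator U x * ennreal (C * ((\<Sum>k<K. (word_prob p (prefix_word x k) *
      (r powr s / sv_fun s (word_matrix T (prefix_word x k)))) powr t) + word_prob p (prefix_word x K) powr t)) \<partial>bernoulli_measure p)"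
proof -
  interpret prob_space "bernoulli_measure p" by (rule prob_space_bernoulli)
  interpret pair_sigma_finite "lborel :: ((real^'d)^'t) measure" "bernoulli_measure p" ..
  obtain C where C: "0 \<le> C" and le: "\<And>x r K. 0 < r \<Longrightarrow> (\<integral>\<^sup>+a. indicator (cball 0 \<rho>) a * ennreal (near \<omega> r x a powr t) \<partial>lborel) \<le>
    ennreal (C * ((\<Sum>k<K. (word_prob p (prefix_word x k) * (r powr s / sv_fun s (word_matrix T (prefix_word x k)))) powr t)
      + word_prob p (prefix_word x K) powr t))"
    using near_powr_integral[OF \<omega> s t, of \<rho>] by blast
  have ball: "cball 0 \<rho> \<in> sets (borel :: ((real^'d)^'t) measure)" by (rule borel_closed) simp
  have "(\<integral>\<^sup>+a. indicator (cball 0 \<rho>) a * energy \<omega> U t r a \<partial>lborel) \<le>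
      (\<integral>\<^sup>+x. indicator U x * ennreal (C * ((\<Sum>k<K. (word_prob p (prefix_word x k) *
        (r powr s / sv_fun s (word_matrix T (prefix_word x k)))) powr t) + word_prob p (prefix_word x K) powr t)) \<partial>bernoulli_measure p)"
    if r: "0 < r" and U: "U \<in> sets (bernoulli_measure p)" for r K U
  proof -
    let ?f = "\<lambda>x. ennreal (C * ((\<Sum>k<K. (word_prob p (prefix_word x k) *
      (r powr s / sv_fun s (word_matrix T (prefix_word x k)))) powr t) + word_prob p (prefix_word x K) powr t))"
    have sec: "(\<lambda>x. indicator U x * ennreal (near \<omega> r x a powr t)) \<in> borel_measurable (bernoulli_measure p)" for a
      using measurable_compose[OF measurable_Pair1'[of a borel "bernoulli_measure p"] energy_integrand_measurable[OF U, of \<omega> r t]]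
      by simp
    have "(\<lambda>q. indicator (cball 0 \<rho>) (fst q) * (indicator U (snd q) * ennreal (near \<omega> r (snd q) (fst q) powr t)) :: ennreal)
        \<in> borel_measurable (borel \<Otimes>\<^sub>M bernoulli_measure p)"
      using energy_integrand_measurable[OF U, of \<omega> r t, unfolded case_prod_beta]
      by (rule borel_measurable_times_ennreal[OF measurable_compose[OF measurable_fst borel_measurable_indicator[OF ball]]])
    then have meas: "(\<lambda>(a, x). indicator (cball 0 \<rho>) a * (indicator U x * ennreal (near \<omega> r x a powr t)) :: ennreal)
        \<in> borel_measurable (lborel \<Otimes>\<^sub>M bernoulli_measure p)"
      by (simp add: case_prod_beta cong: measurable_cong_sets sets_pair_measure_cong)
    have "(\<integral>\<^sup>+a. indicator (cball 0 \<rho>) a * energy \<omega> U t r a \<partial>lborel)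
        = (\<integral>\<^sup>+a. \<integral>\<^sup>+x. indicator (cball 0 \<rho>) a * (indicator U x * ennreal (near \<omega> r x a powr t)) \<partial>bernoulli_measure p \<partial>lborel)"
      unfolding energy_def by (intro nn_integral_cong nn_integral_cmult[symmetric] sec)
    also have "\<dots> = (\<integral>\<^sup>+x. \<integral>\<^sup>+a. indicator (cball 0 \<rho>) a * (indicator U x * ennreal (near \<omega> r x a powr t)) \<partial>lborel \<partial>bernoulli_measure p)"
      by (rule Fubini'[OF meas, symmetric])
    also have "\<dots> = (\<integral>\<^sup>+x. indicator U x * (\<integral>\<^sup>+a. indicator (cball 0 \<rho>) a * ennreal (near \<omega> r x a powr t) \<partial>lborel) \<partial>bernoulli_measure p)"
    proof (rule nn_integral_cong)
      fix x
      have "(\<lambda>a. indicator (cball 0 \<rho>) a * ennreal (near \<omega> r x a powr t)) \<in> borel_measurable lborel"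
        using borel_measurable_indicator[OF ball] by measurable
      from nn_integral_cmult[OF this, of "indicator U x"]
      show "(\<integral>\<^sup>+a. indicator (cball 0 \<rho>) a * (indicator U x * ennreal (near \<omega> r x a powr t)) \<partial>lborel)
          = indicator U x * (\<integral>\<^sup>+a. indicator (cball 0 \<rho>) a * ennreal (near \<omega> r x a powr t) \<partial>lborel)"
        by (simp add: mult.left_commute)
    qed
    also have "\<dots> \<le> (\<integral>\<^sup>+x. indicator U x * ?f x \<partial>bernoulli_measure p)"
      by (intro nn_integral_mono mult_left_mono le r) auto
    finally show ?thesis .
  qed
  with C show ?thesis by blast
qed

end

section \<open>From energies to lower bounds of the dimensions\<close>

text \<open>For given r take the largest n with r \<le> 2^(-n). Replacing n by the logarithm of 1 /
  r costs only the constant s ln 2.\<close>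

lemma (in bounded_image) lower_gen_dim_ge_dyadic:
  fixes s C q :: real
  assumes s: "0 \<le> s"
    and le: "\<forall>\<^sub>F n in sequentially. \<forall>r. 0 < r \<longrightarrow> r \<le> (1 / 2) ^ n \<longrightarrow> entropy_sum q r \<le> C - s * ln 2 * n"
  shows "ereal s \<le> lower_gen_dim q (distr M borel f)"
proof -
  obtain n0 where n0: "\<And>n r. n0 \<le> n \<Longrightarrow> 0 < r \<Longrightarrow> r \<le> (1 / 2) ^ n \<Longrightarrow> entropy_sum q r \<le> C - s * ln 2 * n"
    using le unfolding eventually_sequentially by (elim exE) blast
  have "0 < (1 / 2 :: real) ^ n0" by simp
  from eventually_at_right_real[OF this]
  have "\<forall>\<^sub>F r in at_right 0. entropy_sum q r \<le> s * ln r + (C + s * ln 2)"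
  proof eventually_elim
    case (elim r)
    then have r: "0 < r" "r < (1 / 2) ^ n0" by simp_all
    define v where "v = - ln r / ln 2"
    have "ln r < ln ((1 / 2) ^ n0)" using r by (subst ln_less_cancel_iff) simp_all
    then have "n0 * ln 2 < - ln r" by (simp add: ln_realpow ln_div)
    then have v: "n0 < v" unfolding v_def by (subst pos_less_divide_eq) simp_all
    define n where "n = nat \<lfloor>v\<rfloor>"
    have n: "real n \<le> v" "v < real n + 1" using v unfolding n_def by linarith+
    have ln_r: "ln r = - (v * ln 2)" by (simp add: v_def)
    have "ln r \<le> - (real n * ln 2)" unfolding ln_r using n by (simp add: mult_right_mono)
    also have "\<dots> = ln ((1 / 2) ^ n)" by (simp add: ln_realpow ln_div)
    finally have "r \<le> (1 / 2) ^ n" using r by (subst (asm) ln_le_cancel_iff) simp_all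
    moreover have "n0 \<le> n" using v n by linarith
    ultimately have "entropy_sum q r \<le> C - s * ln 2 * n" using r by (intro n0)
    moreover have "v * (s * ln 2) \<le> (real n + 1) * (s * ln 2)" using n s by (intro mult_right_mono) auto
    ultimately show ?case by (simp add: ln_r algebra_simps)
  qed
  then show ?thesis by (rule lower_gen_dim_ge)
qed

context affine_system
begin

lemma lower_dim_of_energy_powr:
  fixes a :: "(real^'d)^'t::finite" and s q :: real
  assumes q: "1 < q" and s: "0 \<le> s"
    and E: "\<forall>\<^sub>F n in sequentially. energy \<omega> UNIV (q - 1) (CARD('d) * (1 / 2) ^ n) a \<le> ennreal (((1 / 2) powr (s * (q - 1))) ^ n)"
  shows "ereal s \<le> lower_gen_dim q (distr (bernoulli_measure p) borel (\<lambda>x. code_point \<omega> x a))"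
proof -
  interpret bounded_image "bernoulli_measure p" "\<lambda>x. code_point \<omega> x a" "norm a / (1 - c)"
    by (rule bounded_image_code_point)
  have prox: "proximity r x = near \<omega> r x a" for r x by (simp add: proximity_def near_def)
  show ?thesis
  proof (rule lower_gen_dim_ge_dyadic[OF s, where C = 0])
    show "\<forall>\<^sub>F n in sequentially. \<forall>r. 0 < r \<longrightarrow> r \<le> (1 / 2) ^ n \<longrightarrow> entropy_sum q r \<le> 0 - s * ln 2 * n"
      using E
    proof eventually_elim
      case (elim n)
      show ?case
      proof (intro allI impI)
        fix r :: real assume r: "0 < r" "r \<le> (1 / 2) ^ n"
        let ?y = "((1 / 2) powr (s * (q - 1))) ^ n"
        have "energy \<omega> UNIV (q - 1) (CARD('d) * r) a \<le> energy \<omega> UNIV (q - 1) (CARD('d) * (1 / 2) ^ n) a"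
          using r q by (intro energy_mono mult_left_mono) auto
        also note elim
        finally have "entropy_sum q r \<le> ln ?y / (q - 1)"
          using r q by (intro entropy_sum_le_powr) (simp_all add: prox energy_def)
        also have "\<dots> = 0 - s * ln 2 * n" using q by (simp add: ln_realpow ln_powr ln_div field_simps)
        finally show "entropy_sum q r \<le> 0 - s * ln 2 * n" .
      qed
    qed
  qed
qed

text \<open>With y the energy bound itself in \<open>entropy_sum_le_ln\<close>, the energy
  contributes only the constant 1. The main term is ln y times the probability of
  \<open>U n\<close>; a deficit in that probability therefore reduces the dimension by the factor
  z.\<close>

lemma lower_dim_of_energy_ln:
  fixes a :: "(real^'d)^'t::finite" and s z :: real
  assumes s: "0 \<le> s" and z: "0 \<le> z"
    and U: "\<And>n. U n \<in> sets (bernoulli_measure p)" "\<forall>\<^sub>F n in sequentially. z \<le> measure (bernoulli_measure p) (U n)"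
    and E: "\<forall>\<^sub>F n in sequentially. energy \<omega> (U n) 1 (CARD('d) * (1 / 2) ^ n) a \<le> ennreal (((1 / 2) powr s) ^ n)"
  shows "ereal (z * s) \<le> lower_gen_dim 1 (distr (bernoulli_measure p) borel (\<lambda>x. code_point \<omega> x a))"
proof -
  interpret bounded_image "bernoulli_measure p" "\<lambda>x. code_point \<omega> x a" "norm a / (1 - c)"
    by (rule bounded_image_code_point)
  have prox: "proximity r x = near \<omega> r x a" for r x by (simp add: proximity_def near_def)
  show ?thesis
  proof (rule lower_gen_dim_ge_dyadic[where C = 1])
    show "0 \<le> z * s" using s z by simp
    show "\<forall>\<^sub>F n in sequentially. \<forall>r. 0 < r \<longrightarrow> r \<le> (1 / 2) ^ n \<longrightarrow> entropy_sum 1 r \<le> 1 - z * s * ln 2 * n"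
      using E U(2)
    proof eventually_elim
      case (elim n)
      show ?case
      proof (intro allI impI)
        fix r :: real assume r: "0 < r" "r \<le> (1 / 2) ^ n"
        let ?y = "((1 / 2) powr s) ^ n"
        have "energy \<omega> (U n) 1 (CARD('d) * r) a \<le> energy \<omega> (U n) 1 (CARD('d) * (1 / 2) ^ n) a"
          using r by (intro energy_mono mult_left_mono) auto
        also note elim(1)
        finally have "entropy_sum 1 r \<le> prob (U n) * ln ?y + ?y / ?y"
          unfolding energy_def using r U(1) by (intro entropy_sum_le_ln) (simp_all only: prox, simp_all)
        also have "ln ?y = - (s * ln 2 * n)" by (simp add: ln_realpow ln_powr ln_div)
        also have "prob (U n) * - (s * ln 2 * n) \<le> z * - (s * ln 2 * n)"
          using elim(2) s by (intro mult_right_mono_neg) auto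
        finally show "entropy_sum 1 r \<le> 1 - z * s * ln 2 * n" by (simp add: mult_ac)
      qed
    qed
  qed
qed

text \<open>The integral estimates hold on bounded sets of parameters; countably many balls exhaust
  the parameter space.\<close>

lemma almost_every_energy:
  fixes \<omega> :: "'n list \<Rightarrow> 't::finite" and \<theta> \<theta>' t :: real
  assumes U: "\<And>n. U n \<in> sets (bernoulli_measure p)"
    and le: "\<And>\<rho>. \<exists>C\<ge>0. \<forall>\<^sub>F n in sequentially.
      (\<integral>\<^sup>+a. indicator (cball 0 \<rho>) a * energy \<omega> (U n) t (R n) a \<partial>lborel) \<le> ennreal (C * \<theta> ^ n)"
    and \<theta>: "0 < \<theta>" "\<theta> < \<theta>'"
  shows "AE a in lborel. \<forall>\<^sub>F n in sequentially. energy \<omega> (U n) t (R n) a \<le> ennreal (\<theta>' ^ n)"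
proof -
  let ?A = "\<lambda>\<rho> n a. indicator (cball 0 \<rho>) a * energy \<omega> (U n) t (R n) a"
  have "AE a in lborel. \<forall>\<^sub>F n in sequentially. ?A (real m) n a \<le> ennreal (\<theta>' ^ n)" for m :: nat
  proof -
    obtain C where C: "0 \<le> C" "\<forall>\<^sub>F n in sequentially. (\<integral>\<^sup>+a. ?A (real m) n a \<partial>lborel) \<le> ennreal (C * \<theta> ^ n)"
      using le[of "real m"] by (elim exE conjE)
    have ball: "cball 0 (real m) \<in> sets (borel :: ((real^'d)^'t) measure)" by (rule borel_closed) simp
    show ?thesis
    proof (rule geometric_borel_cantelli[OF _ C(2) \<theta> C(1)])
      show "?A (real m) n \<in> borel_measurable lborel" for n
        using borel_measurable_times_ennreal[OF borel_measurable_indicator[OF ball] energy_measurable[OF U]] by simp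
    qed
  qed
  then have "AE a in lborel. \<forall>m :: nat. \<forall>\<^sub>F n in sequentially. ?A (real m) n a \<le> ennreal (\<theta>' ^ n)"
    by (simp add: AE_all_countable)
  then show ?thesis
  proof eventually_elim
    case (elim a)
    obtain m :: nat where "norm a \<le> real m" using real_arch_simple by blast
    then have "a \<in> cball 0 (real m)" by simp
    with elim[rule_format, of m] show ?case by simp
  qed
qed

lemma phi_le_1: "0 \<le> s \<Longrightarrow> sv_fun s (word_matrix T u) \<le> 1"
proof -
  assume s: "0 \<le> s"
  have "sv_fun (0 + s) (word_matrix T u) \<le> sv_fun 0 (word_matrix T u) * c powr (s * length u)"
    using s by (intro phi_add_le) auto
  also have "\<dots> = c powr (s * length u)" by (simp add: phi_zero)
  also have "\<dots> \<le> 1" using s c_pos cT by (intro powr_le1) auto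
  finally show ?thesis by simp
qed

text \<open>Averaged over x, the k-th branch term with t = q - 1 becomes r^(s t) times the sum over
  words of length k. The rate is negative, so these sums converge.\<close>

lemma energy_bound_powr:
  fixes \<omega> :: "'n list \<Rightarrow> 't::finite" and s q \<rho> :: real
  assumes \<omega>: "distinct_siblings \<omega>" and s: "0 \<le> s" "s \<le> CARD('d)" and q: "1 < q" "q \<le> 2" and \<gamma>: "\<gamma> q s < 0"
  shows "\<exists>C\<ge>0. \<forall>r>0. (\<integral>\<^sup>+a. indicator (cball 0 \<rho>) a * energy \<omega> UNIV (q - 1) r a \<partial>lborel) \<le> ennreal (C * r powr (s * (q - 1)))"
proof -
  interpret prob_space "bernoulli_measure p" by (rule prob_space_bernoulli)
  define t where "t = q - 1"
  have t: "0 < t" "t \<le> 1" "1 + t = q" using q by (auto simp: t_def)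
  obtain C where C: "0 \<le> C" and le: "\<And>r K U. 0 < r \<Longrightarrow> U \<in> sets (bernoulli_measure p) \<Longrightarrow>
    (\<integral>\<^sup>+a. indicator (cball 0 \<rho>) a * energy \<omega> U t r a \<partial>lborel) \<le>
    (\<integral>\<^sup>+x. indicator U x * ennreal (C * ((\<Sum>k<K. (word_prob p (prefix_word x k) *
      (r powr s / sv_fun s (word_matrix T (prefix_word x k)))) powr t) + word_prob p (prefix_word x K) powr t)) \<partial>bernoulli_measure p)"
    using energy_integral_le[OF \<omega> s t(1,2), of \<rho>] by blast
  define S where "S k = (\<Sum>u\<in>words k. term_sum q s u)" for k
  have S0: "0 \<le> S k" for k unfolding S_def using q by (intro sum_nonneg term_sum_nonneg) simp
  have sum: "summable S" unfolding S_def using s q \<gamma> by (intro term_sum_summable) (auto simp: mult_less_0_iff)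
  have "(\<integral>\<^sup>+a. indicator (cball 0 \<rho>) a * energy \<omega> UNIV t r a \<partial>lborel) \<le> ennreal (C * (suminf S + 1) * r powr (s * t))"
    if r: "0 < r" for r
  proof -
    have "\<forall>\<^sub>F K in sequentially. S K < r powr (s * t)"
      using summable_LIMSEQ_zero[OF sum] r by (intro order_tendstoD) auto
    \<comment> \<open>The number of branches may depend on r: K is so large that the remaining
      cylinder term is of the order of the bound. That term is dominated by S K because psi^s \<le>
      1.\<close>
    then obtain K where K: "S K < r powr (s * t)" by (auto dest: eventually_happens)
    let ?g = "\<lambda>u. (word_prob p u * (r powr s / sv_fun s (word_matrix T u))) powr t"
    let ?h = "\<lambda>u. word_prob p u powr t"
    have g: "word_prob p u * ?g u = r powr (s * t) * term_sum q s u" for u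
    proof -
      have "?g u = word_prob p u powr t * r powr (s * t) * sv_fun s (word_matrix T u) powr (- t)"
        using r phi_pos[OF s(1), of u] by (simp add: powr_mult powr_divide powr_powr powr_minus_divide)
      then have "word_prob p u * ?g u = (word_prob p u * word_prob p u powr t) * r powr (s * t) * sv_fun s (word_matrix T u) powr (- t)"
        by (simp only: mult_ac)
      also have "word_prob p u * word_prob p u powr t = word_prob p u powr q" by (simp add: powr_mult_base t(3))
      finally show ?thesis using q by (simp add: term_sum_def t_def mult_ac)
    qed
    have h: "word_prob p u * ?h u \<le> term_sum q s u" for u
    proof -
      have "word_prob p u * ?h u = 1 * word_prob p u powr q" by (simp add: powr_mult_base t(3))
      also have "1 \<le> sv_fun s (word_matrix T u) powr (1 - q)"
        using phi_le_1[OF s(1), of u] phi_pos[OF s(1), of u] q powr_mono2'[of "1 - q" "sv_fun s (word_matrix T u)" 1] by simp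
      then have "1 * word_prob p u powr q \<le> sv_fun s (word_matrix T u) powr (1 - q) * word_prob p u powr q"
        by (intro mult_right_mono) auto
      finally show ?thesis using q by (simp add: term_sum_def)
    qed
    have U: "UNIV \<in> sets (bernoulli_measure p)" using sets.top[of "bernoulli_measure p"] by simp
    have m: "(\<lambda>x. ennreal (f (prefix_word x k))) \<in> borel_measurable (bernoulli_measure p)" for f :: "'n list \<Rightarrow> real" and k
      by (rule measurable_compose[OF measurable_prefix_word]) simp
    let ?f = "\<lambda>x. C * ((\<Sum>k<K. ?g (prefix_word x k)) + ?h (prefix_word x K))"
    have "(\<integral>\<^sup>+x. indicator UNIV x * ennreal (?f x) \<partial>bernoulli_measure p)
        = (\<integral>\<^sup>+x. ennreal C * ((\<Sum>k<K. ennreal (?g (prefix_word x k))) + ennreal (?h (prefix_word x K))) \<partial>bernoulli_measure p)"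
      using C by (intro nn_integral_cong) (simp add: ennreal_mult ennreal_plus sum_ennreal sum_nonneg)
    also have "\<dots> = ennreal C * ((\<Sum>k<K. \<integral>\<^sup>+x. ennreal (?g (prefix_word x k)) \<partial>bernoulli_measure p)
        + (\<integral>\<^sup>+x. ennreal (?h (prefix_word x K)) \<partial>bernoulli_measure p))"
      by (subst nn_integral_cmult, intro borel_measurable_add borel_measurable_sum m,
        subst nn_integral_add, intro borel_measurable_sum m, rule m, subst nn_integral_sum, rule m, rule refl)
    also have "\<dots> = ennreal C * ((\<Sum>k<K. ennreal (\<Sum>u\<in>words k. word_prob p u * ?g u)) + ennreal (\<Sum>u\<in>words K. word_prob p u * ?h u))"
      by (subst (1 2) nn_integral_prefix_word) simp_all
    also have "\<dots> \<le> ennreal C * ((\<Sum>k<K. ennreal (r powr (s * t) * S k)) + ennreal (S K))"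
      unfolding g S_def sum_distrib_left by (intro mult_left_mono add_left_mono ennreal_leI sum_mono h) simp
    also have "\<dots> = ennreal (C * (r powr (s * t) * (\<Sum>k<K. S k) + S K))"
      using C S0 by (simp add: sum_ennreal ennreal_mult sum_distrib_left[symmetric] ennreal_plus sum_nonneg)
    also have "\<dots> \<le> ennreal (C * (suminf S + 1) * r powr (s * t))"
    proof (rule ennreal_leI)
      have "(\<Sum>k<K. S k) \<le> suminf S" using sum S0 by (intro sum_le_suminf) auto
      then have "r powr (s * t) * (\<Sum>k<K. S k) + S K \<le> r powr (s * t) * suminf S + r powr (s * t)"
        using K by (intro add_mono mult_left_mono) auto
      from mult_left_mono[OF this C] show "C * (r powr (s * t) * (\<Sum>k<K. S k) + S K) \<le> C * (suminf S + 1) * r powr (s * t)"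
        by (simp add: algebra_simps)
    qed
    finally show ?thesis using le[OF r U, of K] by (rule order_trans[rotated])
  qed
  moreover have "0 \<le> C * (suminf S + 1)" using C suminf_nonneg[OF sum S0] by simp
  ultimately show ?thesis unfolding t_def by blast
qed

lemma lower_dim_gt1:
  fixes \<omega> :: "'n list \<Rightarrow> 't::finite" and v q :: real
  assumes \<omega>: "distinct_siblings \<omega>" and q: "1 < q" "q \<le> 2" and v: "0 < v" "v < crit_root q" "v < CARD('d)"
  shows "AE a in lborel. ereal v \<le> lower_gen_dim q (distr (bernoulli_measure p) borel (\<lambda>x. code_point \<omega> x (a :: (real^'d)^'t)))"
proof -
  obtain s where s: "v < s" "s < min (crit_root q) CARD('d)" using dense[of v "min (crit_root q) CARD('d)"] v by auto
  have s0: "0 \<le> s" "s \<le> CARD('d)" using s v by auto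
  have \<gamma>: "\<gamma> q s < 0" using s s0 by (simp add: gamma_neg_iff)
  define t where "t = q - 1"
  have t: "0 < t" using q by (simp add: t_def)
  define \<theta> \<theta>' :: real where "\<theta> = (1 / 2) powr (s * t)" and "\<theta>' = (1 / 2) powr (v * t)"
  have \<theta>: "0 < \<theta>" "\<theta> < \<theta>'" using s t by (simp_all add: \<theta>_def \<theta>'_def powr_less_mono')
  have "AE a :: (real^'d)^'t in lborel. \<forall>\<^sub>F n in sequentially. energy \<omega> UNIV t (CARD('d) * (1 / 2) ^ n) a \<le> ennreal (\<theta>' ^ n)"
  proof (rule almost_every_energy[OF _ _ \<theta>])
    show "UNIV \<in> sets (bernoulli_measure p)" using sets.top[of "bernoulli_measure p"] by simp
    fix \<rho> :: real
    obtain C where C: "0 \<le> C" and le: "\<And>r. 0 < r \<Longrightarrow>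
        (\<integral>\<^sup>+a. indicator (cball 0 \<rho>) a * energy \<omega> UNIV t r a \<partial>lborel) \<le> ennreal (C * r powr (s * t))"
      using energy_bound_powr[OF \<omega> s0 q \<gamma>, of \<rho>] unfolding t_def by blast
    have "(\<integral>\<^sup>+a. indicator (cball 0 \<rho>) a * energy \<omega> UNIV t (CARD('d) * (1 / 2) ^ n) a \<partial>lborel)
        \<le> ennreal (C * CARD('d) powr (s * t) * \<theta> ^ n)" for n
    proof -
      have "(CARD('d) * (1 / 2) ^ n) powr (s * t) = CARD('d) powr (s * t) * \<theta> ^ n"
        by (simp add: powr_mult \<theta>_def powr_powr powr_realpow[symmetric] mult_ac)
      then show ?thesis using le[of "CARD('d) * (1 / 2) ^ n"] by (simp add: mult_ac)
    qed
    then show "\<exists>C\<ge>0. \<forall>\<^sub>F n in sequentially.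
        (\<integral>\<^sup>+a. indicator (cball 0 \<rho>) a * energy \<omega> UNIV t (CARD('d) * (1 / 2) ^ n) a \<partial>lborel) \<le> ennreal (C * \<theta> ^ n)"
      using C by (intro exI[of _ "C * CARD('d) powr (s * t)"]) simp
  qed
  then show ?thesis
  proof eventually_elim
    case (elim a)
    then show ?case using q v unfolding \<theta>'_def t_def by (intro lower_dim_of_energy_powr) auto
  qed
qed

text \<open>The quotient p / psi^s is e^X, so on the chosen words each of the N branch terms is at
  most r^s e^y and the remainder at most e^(-z). The bound is pointwise in x and survives
  integration against a probability.\<close>

lemma energy_bound_good_words:
  fixes \<omega> :: "'n list \<Rightarrow> 't::finite" and s \<rho> :: real
  assumes \<omega>: "distinct_siblings \<omega>" and s: "0 \<le> s" "s \<le> CARD('d)"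
  shows "\<exists>C\<ge>0. \<forall>r>0. \<forall>N y z. (\<integral>\<^sup>+a. indicator (cball 0 \<rho>) a *
      energy \<omega> {x. prefix_word x N \<in> {w \<in> good_words s N y z. word_prob p w \<noteq> 0}} 1 r a \<partial>lborel)
    \<le> ennreal (C * (N * (r powr s * exp y) + exp (- z)))"
proof -
  interpret prob_space "bernoulli_measure p" by (rule prob_space_bernoulli)
  obtain C where C: "0 \<le> C" and le: "\<And>r K U. 0 < r \<Longrightarrow> U \<in> sets (bernoulli_measure p) \<Longrightarrow>
    (\<integral>\<^sup>+a. indicator (cball 0 \<rho>) a * energy \<omega> U 1 r a \<partial>lborel) \<le>
    (\<integral>\<^sup>+x. indicator U x * ennreal (C * ((\<Sum>k<K. (word_prob p (prefix_word x k) *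
      (r powr s / sv_fun s (word_matrix T (prefix_word x k)))) powr 1) + word_prob p (prefix_word x K) powr 1)) \<partial>bernoulli_measure p)"
    using energy_integral_le[OF \<omega> s zero_less_one order_refl, of \<rho>] by blast
  have "(\<integral>\<^sup>+a. indicator (cball 0 \<rho>) a *
      energy \<omega> {x. prefix_word x N \<in> {w \<in> good_words s N y z. word_prob p w \<noteq> 0}} 1 r a \<partial>lborel)
    \<le> ennreal (C * (N * (r powr s * exp y) + exp (- z)))" if r: "0 < r" for r y z :: real and N
  proof -
    let ?A = "{w \<in> good_words s N y z. word_prob p w \<noteq> 0}"
    let ?U = "{x. prefix_word x N \<in> ?A}"
    have U: "?U \<in> sets (bernoulli_measure p)" by (rule prob_prefix_in) (auto simp: good_words_def)
    have quot: "word_prob p u / sv_fun s (word_matrix T u) \<le> exp v" if "X s u \<le> v" "0 < word_prob p u" for u v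
    proof -
      have "X s u = ln (word_prob p u / sv_fun s (word_matrix T u))"
        using that(2) phi_pos[OF s(1), of u] by (simp add: X_eq[OF s(1)] ln_div)
      then have "exp (X s u) = word_prob p u / sv_fun s (word_matrix T u)" using that(2) phi_pos[OF s(1), of u] by simp
      then show ?thesis using that(1) by (metis exp_le_cancel_iff)
    qed
    let ?f = "\<lambda>x. C * ((\<Sum>k<N. (word_prob p (prefix_word x k) *
      (r powr s / sv_fun s (word_matrix T (prefix_word x k)))) powr 1) + word_prob p (prefix_word x N) powr 1)"
    have "indicator ?U x * ennreal (?f x) \<le> ennreal (C * (N * (r powr s * exp y) + exp (- z)))" for x
    proof (cases "x \<in> ?U")
      case True
      let ?w = "prefix_word x N"
      have w: "?w \<in> good_words s N y z" "word_prob p ?w \<noteq> 0" using True by auto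
      have wk: "take k ?w = prefix_word x k" "0 < word_prob p (prefix_word x k)" if "k \<le> N" for k
      proof -
        show *: "take k ?w = prefix_word x k" using that by (simp add: prefix_word_def take_map)
        have "0 < word_prob p (take k ?w @ drop k ?w)" using w(2) by (simp only: append_take_drop_id word_prob_pos_iff not_False_eq_True)
        then show "0 < word_prob p (prefix_word x k)" unfolding word_prob_append_pos * ..
      qed
      have "(word_prob p (prefix_word x k) * (r powr s / sv_fun s (word_matrix T (prefix_word x k)))) powr 1 \<le> r powr s * exp y"
        if k: "k < N" for k
      proof -
        have pos: "0 < sv_fun s (word_matrix T (prefix_word x k))" by (rule phi_pos[OF s(1)])
        have "X s (prefix_word x k) \<le> y" using w k wk(1)[of k] unfolding good_words_def by auto
        from quot[OF this wk(2)] k have "r powr s * (word_prob p (prefix_word x k) / sv_fun s (word_matrix T (prefix_word x k))) \<le> r powr s * exp y"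
          by (intro mult_left_mono) auto
        moreover have "0 \<le> word_prob p (prefix_word x k) * (r powr s / sv_fun s (word_matrix T (prefix_word x k)))"
          using pos by simp
        ultimately show ?thesis by (simp add: mult.commute)
      qed
      then have "(\<Sum>k<N. (word_prob p (prefix_word x k) * (r powr s / sv_fun s (word_matrix T (prefix_word x k)))) powr 1)
          \<le> (\<Sum>k<N. r powr s * exp y)" by (intro sum_mono) simp
      moreover have "word_prob p ?w powr 1 \<le> exp (- z)"
      proof -
        have "X s ?w \<le> - z" using w unfolding good_words_def by auto
        from quot[OF this wk(2)[OF order_refl]] have "word_prob p ?w \<le> exp (- z) * sv_fun s (word_matrix T ?w)"
          using phi_pos[OF s(1), of ?w] by (simp add: divide_le_eq)
        also have "\<dots> \<le> exp (- z) * 1" by (intro mult_left_mono phi_le_1 s) simp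
        finally show ?thesis by simp
      qed
      ultimately have "?f x \<le> C * (N * (r powr s * exp y) + exp (- z))" using C by (intro mult_left_mono) simp_all
      then show ?thesis using True by (simp add: ennreal_leI)
    qed simp
    then have "(\<integral>\<^sup>+x. indicator ?U x * ennreal (?f x) \<partial>bernoulli_measure p)
        \<le> (\<integral>\<^sup>+x. ennreal (C * (N * (r powr s * exp y) + exp (- z))) \<partial>bernoulli_measure p)"
      by (intro nn_integral_mono)
    also have "\<dots> = ennreal (C * (N * (r powr s * exp y) + exp (- z)))"
      by (simp only: nn_integral_const emeasure_space_1 mult_1_right)
    finally show ?thesis by (rule order_trans[OF le[OF r U, of N]])
  qed
  with C show ?thesis by blast
qed

lemma lower_dim_1:
  fixes \<omega> :: "'n list \<Rightarrow> 't::finite" and v :: real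
  assumes \<omega>: "distinct_siblings \<omega>" and v: "0 < v" "v < crit_root 1" "v < CARD('d)"
  shows "AE a in lborel. ereal v \<le> lower_gen_dim 1 (distr (bernoulli_measure p) borel (\<lambda>x. code_point \<omega> x (a :: (real^'d)^'t)))"
proof -
  obtain s where s: "v < s" "s < min (crit_root 1) CARD('d)" using dense[of v "min (crit_root 1) CARD('d)"] v by auto
  have s0: "0 \<le> s" "s \<le> CARD('d)" "0 < s" using s v by auto
  have \<gamma>: "\<gamma> 1 s < 0" using s s0 by (simp add: gamma_neg_iff)
  \<comment> \<open>Three of these quarters are spent: one on the growth e^y along prefixes, one on
    the linear factor N, one on the gap for Borel-Cantelli. The fourth keeps s - 3 \<eta> above
    v.\<close>
  define \<eta> where "\<eta> = (s - v) / 4"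
  have \<eta>: "0 < \<eta>" "v < s - 3 * \<eta>" using s by (auto simp: \<eta>_def field_simps)
  \<comment> \<open>The probability of atypical words, chosen so that the loss by the factor 1 -
    \<tau> brings s - 3 \<eta> down to exactly v.\<close>
  define \<tau> where "\<tau> = 1 - v / (s - 3 * \<eta>)"
  have \<tau>: "0 < \<tau>" "0 \<le> 1 - \<tau>" "(1 - \<tau>) * (s - 3 * \<eta>) = v" using \<eta> v by (auto simp: \<tau>_def)
  have "0 < \<eta> * ln 2" "0 < s * ln 2" using \<eta> s0 by auto
  from good_words_typical[OF s0(1) \<gamma> this(1) \<tau>(1) this(2)] obtain \<kappa> :: real where
    \<kappa>: "\<forall>\<^sub>F n in sequentially. \<exists>N\<le>\<kappa> * n. 1 - \<tau> \<le> (\<Sum>w\<in>good_words s N (\<eta> * ln 2 * n) (s * ln 2 * n). word_prob p w)" .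
  define N where "N n = (SOME N. real N \<le> \<kappa> * real n \<and>
    1 - \<tau> \<le> (\<Sum>w\<in>good_words s N (\<eta> * ln 2 * n) (s * ln 2 * n). word_prob p w))" for n :: nat
  have N: "\<forall>\<^sub>F n in sequentially. real (N n) \<le> \<kappa> * n \<and>
      1 - \<tau> \<le> (\<Sum>w\<in>good_words s (N n) (\<eta> * ln 2 * n) (s * ln 2 * n). word_prob p w)"
    using \<kappa> unfolding N_def by eventually_elim (rule someI_ex, simp)
  \<comment> \<open>Removing the words of probability 0, which \<open>good_words\<close> admits
    without any growth condition, leaves the total probability unchanged and makes the estimates
    valid on all of A.\<close>
  define A where "A n = {w \<in> good_words s (N n) (\<eta> * ln 2 * n) (s * ln 2 * n). word_prob p w \<noteq> 0}" for n :: nat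
  define U where "U n = {x. prefix_word x (N n) \<in> A n}" for n
  have A: "A n \<subseteq> words (N n)" for n by (auto simp: A_def good_words_def)
  have U: "U n \<in> sets (bernoulli_measure p)" for n unfolding U_def by (rule prob_prefix_in(1)[OF A])
  have U_prob: "\<forall>\<^sub>F n in sequentially. 1 - \<tau> \<le> measure (bernoulli_measure p) (U n)"
    using N
  proof eventually_elim
    case (elim n)
    have "finite (good_words s (N n) (\<eta> * ln 2 * n) (s * ln 2 * n))"
      by (rule finite_subset[OF _ finite_words[of "N n"]]) (auto simp: good_words_def)
    then have "(\<Sum>w\<in>A n. word_prob p w) = (\<Sum>w\<in>good_words s (N n) (\<eta> * ln 2 * n) (s * ln 2 * n). word_prob p w)"
      unfolding A_def by (intro sum.mono_neutral_left) auto
    then show ?case using elim unfolding U_def prob_prefix_in(2)[OF A] by simp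
  qed
  define h :: real where "h = 1 / 2"
  define \<theta> \<theta>' :: real where "\<theta> = h powr (s - 2 * \<eta>)" and "\<theta>' = h powr (s - 3 * \<eta>)"
  have \<theta>: "0 < \<theta>" "\<theta> < \<theta>'" using \<eta> by (simp_all add: \<theta>_def \<theta>'_def h_def powr_less_mono')
  have hexp: "exp (- (z * ln 2 * n)) = (h powr z) ^ n" for z and n :: nat
    by (simp add: h_def powr_def ln_div exp_of_nat_mult[symmetric] mult_ac)
  have "AE a :: (real^'d)^'t in lborel. \<forall>\<^sub>F n in sequentially. energy \<omega> (U n) 1 (CARD('d) * (1 / 2) ^ n) a \<le> ennreal (\<theta>' ^ n)"
  proof (rule almost_every_energy[OF U _ \<theta>])
    fix \<rho> :: real
    obtain C where C: "0 \<le> C" and le: "\<And>r N y z. 0 < r \<Longrightarrow> (\<integral>\<^sup>+a. indicator (cball 0 \<rho>) a *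
        energy \<omega> {x. prefix_word x N \<in> {w \<in> good_words s N y z. word_prob p w \<noteq> 0}} 1 r a \<partial>lborel)
      \<le> ennreal (C * (N * (r powr s * exp y) + exp (- z)))"
      using energy_bound_good_words[OF \<omega> s0(1,2), of \<rho>] by blast
    define C' where "C' = C * (\<bar>\<kappa>\<bar> * CARD('d) powr s + 1)"
    have "h powr \<eta> < 1" using powr_less_mono2[of \<eta> h 1] \<eta> by (simp add: h_def)
    then have "(\<lambda>n. real n * (h powr \<eta>) ^ n) \<longlonglongrightarrow> 0" by (intro powser_times_n_limit_0) simp
    then have "\<forall>\<^sub>F n in sequentially. real n * (h powr \<eta>) ^ n < 1" by (rule order_tendstoD) simp
    with N have "\<forall>\<^sub>F n in sequentially.
        (\<integral>\<^sup>+a. indicator (cball 0 \<rho>) a * energy \<omega> (U n) 1 (CARD('d) * (1 / 2) ^ n) a \<partial>lborel) \<le> ennreal (C' * \<theta> ^ n)"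
    proof eventually_elim
      case (elim n)
      let ?r = "CARD('d) * (1 / 2) ^ n :: real"
      have r_s: "?r powr s = CARD('d) powr s * (h powr s) ^ n"
        by (simp add: h_def powr_mult powr_realpow[symmetric] powr_powr mult_ac)
      have e: "exp (\<eta> * ln 2 * n) = (h powr (- \<eta>)) ^ n" using hexp[of "- \<eta>" n] by simp
      have "(h powr s) ^ n * (h powr (- \<eta>)) ^ n = (h powr \<eta>) ^ n * \<theta> ^ n"
        by (simp add: \<theta>_def power_mult_distrib[symmetric] powr_add[symmetric] h_def)
      then have "N n * (?r powr s * exp (\<eta> * ln 2 * n)) = N n * (CARD('d) powr s * ((h powr \<eta>) ^ n * \<theta> ^ n))"
        unfolding r_s e by (simp add: mult.assoc)
      also have "\<dots> \<le> (\<bar>\<kappa>\<bar> * n) * (CARD('d) powr s * ((h powr \<eta>) ^ n * \<theta> ^ n))"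
      proof (rule mult_right_mono)
        have "\<kappa> * n \<le> \<bar>\<kappa>\<bar> * n" by (intro mult_right_mono) auto
        then show "real (N n) \<le> \<bar>\<kappa>\<bar> * n" using elim(1) by linarith
      qed (use \<theta> in simp)
      also have "\<dots> = (\<bar>\<kappa>\<bar> * CARD('d) powr s * \<theta> ^ n) * (n * (h powr \<eta>) ^ n)" by (simp only: mult_ac)
      also have "\<dots> \<le> (\<bar>\<kappa>\<bar> * CARD('d) powr s * \<theta> ^ n) * 1"
        using elim(2) \<theta> by (intro mult_left_mono) auto
      finally have 1: "N n * (?r powr s * exp (\<eta> * ln 2 * n)) \<le> \<bar>\<kappa>\<bar> * CARD('d) powr s * \<theta> ^ n" by simp
      have "h powr s \<le> \<theta>" using \<eta> by (simp add: \<theta>_def h_def powr_mono')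
      then have 2: "exp (- (s * ln 2 * n)) \<le> \<theta> ^ n" unfolding hexp by (intro power_mono) auto
      have "C * (N n * (?r powr s * exp (\<eta> * ln 2 * n)) + exp (- (s * ln 2 * n))) \<le> C * (\<bar>\<kappa>\<bar> * CARD('d) powr s * \<theta> ^ n + \<theta> ^ n)"
        using 1 2 C by (intro mult_left_mono add_mono)
      also have "\<dots> = C' * \<theta> ^ n" by (simp add: C'_def algebra_simps)
      finally have 3: "C * (N n * (?r powr s * exp (\<eta> * ln 2 * n)) + exp (- (s * ln 2 * n))) \<le> C' * \<theta> ^ n" .
      have "0 < ?r" by simp
      from le[OF this, of "N n" "\<eta> * ln 2 * n" "s * ln 2 * n", folded A_def U_def] ennreal_leI[OF 3]
      show ?case by (rule order_trans)
    qed
    moreover have "0 \<le> C'" using C by (simp add: C'_def)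
    ultimately show "\<exists>C\<ge>0. \<forall>\<^sub>F n in sequentially.
        (\<integral>\<^sup>+a. indicator (cball 0 \<rho>) a * energy \<omega> (U n) 1 (CARD('d) * (1 / 2) ^ n) a \<partial>lborel) \<le> ennreal (C * \<theta> ^ n)"
      by (intro exI[of _ C'] conjI)
  qed
  then show ?thesis
  proof eventually_elim
    case (elim a)
    have "ereal ((1 - \<tau>) * (s - 3 * \<eta>)) \<le> lower_gen_dim 1 (distr (bernoulli_measure p) borel (\<lambda>x. code_point \<omega> x a))"
      by (rule lower_dim_of_energy_ln[OF _ \<tau>(2) U U_prob elim[unfolded \<theta>'_def h_def]]) (use \<eta> v in simp)
    then show ?case unfolding \<tau>(3) .
  qed
qed

lemma almost_every_gen_dim:
  fixes \<omega> :: "'n list \<Rightarrow> 't::finite" and J :: "(real^'d)^'t \<Rightarrow> (real^'d) set"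
  assumes \<omega>: "distinct_siblings \<omega>" and J: "\<And>a. admissible_seed T (\<lambda>u. a $ \<omega> u) (J a)" and q: "1 \<le> q" "q \<le> 2"
  shows "AE a in lborel. gen_dim_exists q (affine_measure T p (\<lambda>u. a $ \<omega> u) (J a)) \<and>
    gen_dim q (affine_measure T p (\<lambda>u. a $ \<omega> u) (J a)) = min (ereal (crit_root q)) (ereal CARD('d))"
proof -
  let ?m = "min (crit_root q) CARD('d)"
  let ?L = "\<lambda>a. lower_gen_dim q (affine_measure T p (\<lambda>u. a $ \<omega> u) (J a))"
  have "AE a in lborel. 0 < v \<longrightarrow> v < ?m \<longrightarrow> ereal v \<le> ?L a" for v :: real
  proof (cases "0 < v \<and> v < ?m")
    case True
    then have v: "0 < v" "v < crit_root q" "v < CARD('d)" by auto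
    have "AE a in lborel. ereal v \<le> ?L a"
    proof (cases "q = 1")
      case True
      show ?thesis using lower_dim_1[OF \<omega>, of v] v unfolding True affine_measure_eq[OF J] by simp
    next
      case False
      show ?thesis using lower_dim_gt1[OF \<omega> _ q(2) v] False q(1) unfolding affine_measure_eq[OF J] by simp
    qed
    then show ?thesis by eventually_elim simp
  qed auto
  \<comment> \<open>Rational v suffice, which makes the exceptional sets countably many.\<close>
  then have "AE a in lborel. \<forall>v :: rat. 0 < real_of_rat v \<longrightarrow> real_of_rat v < ?m \<longrightarrow> ereal (real_of_rat v) \<le> ?L a"
    by (simp only: AE_all_countable) simp
  then show ?thesis
  proof eventually_elim
    case (elim a)
    interpret bounded_image "bernoulli_measure p" "\<lambda>x. code_point \<omega> x a" "norm a / (1 - c)"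
      by (rule bounded_image_code_point)
    have low0: "0 \<le> ?L a" unfolding affine_measure_eq[OF J] using q(1) by (rule lower_gen_dim_nonneg)
    have low: "ereal ?m \<le> ?L a"
    proof (rule ccontr)
      assume "\<not> ereal ?m \<le> ?L a"
      then obtain l where l: "?L a = ereal l" "l < ?m" "0 \<le> l" using low0
        by (cases "?L a") (auto simp: min_def not_le split: if_splits)
      obtain v where v: "l < real_of_rat v" "real_of_rat v < ?m" using of_rat_dense[OF l(2)] by blast
      from l(3) v(1) have "0 < real_of_rat v" by (rule le_less_trans)
      from elim[rule_format, OF this v(2)] show False using l(1) v(1) by simp
    qed
    have up: "upper_gen_dim q (affine_measure T p (\<lambda>u. a $ \<omega> u) (J a)) \<le> min (ereal (crit_root q)) (ereal CARD('d))"
      by (rule upper_dimension_bound[OF J q(1)])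
    have le: "?L a \<le> upper_gen_dim q (affine_measure T p (\<lambda>u. a $ \<omega> u) (J a))"
      unfolding lower_gen_dim_def upper_gen_dim_def by (rule Liminf_le_Limsup) simp
    have "min (ereal (crit_root q)) (ereal CARD('d)) \<le> ?L a" using low by simp
    with up le show ?case unfolding gen_dim_exists_def gen_dim_def by (meson order_antisym order_trans)
  qed
qed

end

theorem corollary2p13:
  fixes T :: "'n::finite \<Rightarrow> real^'d^'d"
    and p :: "'n pmf"
    and \<omega> :: "'n list \<Rightarrow> 't::finite"
    and J :: "(real^'d)^'t \<Rightarrow> (real^'d) set"
  assumes "CARD('n) \<ge> 2"
    and "\<And>j. invertible (T j)"
    and "(SUP j. onorm ((*v) (T j))) < 1 / 2"
    and "distinct_siblings \<omega>"
    and "\<And>a. admissible_seed T (\<lambda>u. a $ \<omega> u) (J a)"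
  shows "(\<forall>q\<ge>1. \<exists>!s. crit_equation T p q s) \<and>
    (\<forall>q>0. crit_lower T p q = crit_dim T p q \<and> crit_upper T p q = crit_dim T p q) \<and>
    (\<forall>q. 1 \<le> q \<and> q \<le> 2 \<longrightarrow>
      (AE a in lebesgue.
        gen_dim_exists q (affine_measure T p (\<lambda>u. a $ \<omega> u) (J a)) \<and>
        gen_dim q (affine_measure T p (\<lambda>u. a $ \<omega> u) (J a))
          = min (crit_dim T p q) (ereal (CARD('d)))))"
proof -
  define c where "c = (SUP j. onorm ((*v) (T j)))"
  have c: "norm (T j *v x) \<le> c * norm x" for j x
  proof -
    have "onorm ((*v) (T j)) \<le> c" unfolding c_def by (intro cSUP_upper bdd_above_finite) simp_all
    then have "onorm ((*v) (T j)) * norm x \<le> c * norm x" by (rule mult_right_mono) simp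
    then show ?thesis using onorm[OF matrix_vector_mul_bounded_linear, of "T j" x] by linarith
  qed
  have "\<exists>b>0. \<forall>x. b * norm x \<le> norm (T j *v x)" for j
    using invertible_lower_bound[OF assms(2)] by metis
  then obtain B where B: "\<And>j. 0 < B j" "\<And>j x. B j * norm x \<le> norm (T j *v x)" by metis
  \<comment> \<open>The alphabet is finite, so the least of the lower stretching constants of the
    letters is positive and serves all of them.\<close>
  define b where "b = Min (range B)"
  have b: "0 < b" "b \<le> B j" for j using B(1) by (auto simp: b_def)
  have bT: "b * norm x \<le> norm (T j *v x)" for j x
    using mult_right_mono[OF b(2)[of j] norm_ge_zero[of x]] B(2)[of j x] by linarith
  interpret affine_system T p b c
    using assms(2,3) b(1) bT c by unfold_locales (auto simp: c_def)
  show ?thesis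
  proof (intro conjI allI impI)
    fix q :: real assume "1 \<le> q"
    then show "\<exists>!s. crit_equation T p q s" by (simp add: crit_equation_iff)
  next
    fix q :: real assume q: "0 < q"
    show "crit_lower T p q = crit_dim T p q" "crit_upper T p q = crit_dim T p q"
      using q by (simp_all add: crit_values_eq crit_dim_eq)
  next
    fix q :: real assume q: "1 \<le> q \<and> q \<le> 2"
    have "AE a in lborel. gen_dim_exists q (affine_measure T p (\<lambda>u. a $ \<omega> u) (J a)) \<and>
        gen_dim q (affine_measure T p (\<lambda>u. a $ \<omega> u) (J a)) = min (crit_dim T p q) (ereal CARD('d))"
      unfolding crit_dim_eq using q by (intro almost_every_gen_dim assms) auto
    \<comment> \<open>Null sets of Borel measure remain null in its completion.\<close>
    then show "AE a in lebesgue. gen_dim_exists q (affine_measure T p (\<lambda>u. a $ \<omega> u) (J a)) \<and>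
        gen_dim q (affine_measure T p (\<lambda>u. a $ \<omega> u) (J a)) = min (crit_dim T p q) (ereal CARD('d))"
      by (rule AE_completion)
  qed
qed

end
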